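(* Let $d=2$. Then $$\|H^{-1}-H_\varepsilon^{-1}\|_{L^2\to\mathscr H^\gamma}\to0\qquad\text{as }\varepsilon\to0 .$$ In particular $H_\varepsilon$ converges to $H$ in the norm resolvent sense.
   Context: Function spaces. $\mathbb T^2=\mathbb R^2/\mathbb Z^2$; $L^2=L^2(\mathbb T^2)$; $\mathscr H^s$ is the $L^2$-based Sobolev space. $\Delta$ without index is the Laplacian. $\Delta_j$, $j\ge -1$, are Littlewood–Paley blocks: Fourier multipliers with symbols $\chi$ ($j=-1$) and $\rho(2^{-j}\cdot)$ ($j\ge0$), where $\chi,\rho\ge 0$ are smooth radial, $\chi$ supported in a ball, $\rho$ in an annulus, $\chi+\sum_{j\ge0}\rho(2^{-j}\cdot)=1$, $\chi\rho(2^{-j}\cdot)=0$ for $j\ge1$, $\rho(2^{-i}\cdot)\rho(2^{-j}\cdot)=0$ for $|i-j|>1$. $\mathscr C^a=B^a_{\infty,\infty}$ with norm $\sup_j2^{ja}\|\Delta_jf\|_{L^\infty}$. Paraproducts: $f\prec g=\sum_{j}\sum_{i\le j-2}\Delta_if\,\Delta_jg$, $f\succ g=g\prec f$; resonant product: $f\circ g=\sum_{|i-j|\le1}\Delta_if\,\Delta_jg$ (products of gradients are contracted). For $a\in(0,1)$, $b+c<0$, $a+b+c>0$, $C:\mathscr H^a\times\mathscr C^b\times\mathscr C^c\to\mathscr H^{a+b+c}$ is the bounded trilinear operator which on smooth functions is $C(f,g,h)=(f\prec g)\circ h-f(g\circ h)$. Noise. $\xi=\sum_{k\in\mathbb Z^2}\hat\xi(k)e^{2\pi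 ik\cdot x}$ is (real) Gaussian white noise on $\mathbb T^2$, i.e. $\hat\xi(k)$ are centred complex Gaussians, independent up to $\hat\xi(-k)=\overline{\hat\xi(k)}$, with $\mathbb E[\hat\xi(k)\overline{\hat\xi(l)}]=\delta_{kl}$. $\xi_\varepsilon=\sum_{k\in\mathbb Z^2}m(\varepsilon k)\hat\xi(k)e^{2\pi ik\cdot x}$, with $m$ radial, smooth away from $0$, compactly supported, $\lim_{x\to0}m(x)=1$, and $c_\varepsilon=\sum_{k\in\mathbb Z^2}|m(\varepsilon k)|^2/(1+4\pi^2|k|^2)$. Almost surely $\Xi^\varepsilon=(\xi_\varepsilon,\ \xi_\varepsilon\circ(1-\Delta)^{-1}\xi_\varepsilon-c_\varepsilon)$ converges as $\varepsilon\to0$ in $\mathscr C^{\alpha}\times\mathscr C^{2\alpha+2}$, for every $\alpha<-1$, to a limit $\Xi=(\xi,\Xi_2)$ (the enhanced noise). Everything is pathwise: a realization for which this holds is fixed. The operator. Fix $-4/3<\alpha<-1$, $2/3<\gamma\le\alpha+2$; this is the $\gamma$ of the claim. Put $X=(1-\Delta)^{-1}\xi$, $B_\Xi(u)=(1-\Delta)^{-1}(\Delta u\prec X+2\nabla u\prec\nabla X+\xi\prec u+u\prec\Xi_2)$, and $\mathscr D(A)=\{u\in\mathscr H^\gamma:\ R(u):=u-u\prec X-B_\Xi(u)\in\mathscr H^2\}$ (independent of $\gamma$). For $u\in\mathscr D(A)$, $Au:=\Delta u+u\prec\xi+\xi\prec u+u\circ\xi\in L^2$, with $u\circ\xi:=C(u,X,\xi)+u\,\Xi_2+B_\Xi(u)\circ\xi+R(u)\circ\xi$.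 Further $A_\varepsilon=\Delta+\xi_\varepsilon-c_\varepsilon$ on $\mathscr D(A_\varepsilon)=\mathscr H^2$. Finally $H=A-K_\Xi$, $\mathscr D(H)=\mathscr D(A)$, and $H_\varepsilon=A_\varepsilon-K_\Xi$, $\mathscr D(H_\varepsilon)=\mathscr H^2$, where $K_\Xi>0$ is a sufficiently large constant depending only on $\Xi$ and not on $\varepsilon$; in particular $\langle -Hu,u\rangle\ge\|u\|_{L^2}^2$ and $\langle-H_\varepsilon v,v\rangle\ge\|v\|_{L^2}^2$ on the respective domains (claims are meant for all $K_\Xi$ above some threshold depending only on $\Xi$). $H$ and $H_\varepsilon$ are self-adjoint, and $H^{-1},H_\varepsilon^{-1}$ are bounded on $L^2$. *)

theory Defs
  imports "HOL-Probability.Probability" "HOL-Library.Function_Algebras"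
begin

section \<open>Distributions on the two-dimensional torus\<close>

text \<open>
  A distribution on \<open>\<real>\<^sup>2/\<int>\<^sup>2\<close> is represented by its family of Fourier coefficients with respect to
  \<open>exp (2 \<pi> \<i> k \<bullet> x)\<close>, \<open>k \<in> \<int>\<^sup>2\<close>.  Distributions are complex valued.  The function spaces below only
  contain families of at most polynomial growth, i.e. genuine distributions.  Pointwise addition
  and subtraction come from \<open>Function_Algebras\<close>.
\<close>

type_synonym tdist = "int \<times> int \<Rightarrow> complex"

definition freq :: "int \<times> int \<Rightarrow> real \<times> real" where
  "freq k = (real_of_int (fst k), real_of_int (snd k))"

definition scale :: "complex \<Rightarrow> tdist \<Rightarrow> tdist" where
  "scale z f = (\<lambda>k. z * f k)"

definition trig_series :: "tdist \<Rightarrow> real \<times> real \<Rightarrow> complex" where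
  "trig_series f x = (\<Sum>\<^sub>\<infinity>k. f k * cis (2 * pi * (freq k \<bullet> x)))"

text \<open>The ordinary product, as a convolution of Fourier coefficients.  The convolution converges
  absolutely for \<open>f \<in> \<H>\<^sup>s\<close>, \<open>g \<in> \<H>\<^sup>-\<^sup>s\<close>, and there it is the sum of the two paraproducts and the
  resonant product.\<close>

definition tprod :: "tdist \<Rightarrow> tdist \<Rightarrow> tdist" where
  "tprod f g = (\<lambda>k. \<Sum>\<^sub>\<infinity>l. f l * g (k - l))"

lemma trig_series_tprod:
  assumes "finite {k. f k \<noteq> 0}" and "finite {k. g k \<noteq> 0}"
  shows "trig_series (tprod f g) x = trig_series f x * trig_series g x"
proof -
  define A where "A = {k. f k \<noteq> 0}"
  define B where "B = {k. g k \<noteq> 0}"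
  define e where "e = (\<lambda>k. cis (2 * pi * (freq k \<bullet> x)))"
  have fin: "finite A" "finite B" using assms by (auto simp: A_def B_def)
  have e_add: "e (k + l) = e k * e l" for k l
    by (simp add: e_def cis_mult freq_def inner_prod_def algebra_simps)
  have prod: "tprod f g k = (\<Sum>l\<in>A. f l * g (k - l))" for k
  proof -
    have "(\<Sum>\<^sub>\<infinity>l. f l * g (k - l)) = (\<Sum>\<^sub>\<infinity>l\<in>A. f l * g (k - l))"
      by (rule infsum_cong_neutral) (auto simp: A_def)
    then show ?thesis using fin by (simp add: tprod_def)
  qed
  define S where "S = (\<lambda>(l, n). l + n) ` (A \<times> B)"
  have finS: "finite S" using fin by (simp add: S_def)
  have zero: "f l * g (k - l) = 0" if "k \<notin> S" for k l
  proof (rule ccontr)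
    assume "f l * g (k - l) \<noteq> 0"
    then have "(l, k - l) \<in> A \<times> B" by (auto simp: A_def B_def)
    then have "k \<in> S" unfolding S_def by force
    with that show False ..
  qed
  have "trig_series (tprod f g) x = (\<Sum>\<^sub>\<infinity>k\<in>S. tprod f g k * e k)"
    unfolding trig_series_def e_def
    by (rule infsum_cong_neutral) (auto simp: prod zero)
  also have "\<dots> = (\<Sum>k\<in>S. \<Sum>l\<in>A. f l * g (k - l) * e k)"
    using finS by (simp add: prod sum_distrib_right)
  also have "\<dots> = (\<Sum>l\<in>A. \<Sum>k\<in>S. f l * g (k - l) * e k)"
    by (rule sum.swap)
  also have "\<dots> = (\<Sum>l\<in>A. \<Sum>n\<in>B. f l * g n * e (l + n))"
  proof (rule sum.cong)
    fix l assume l: "l \<in> A"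
    have "(\<Sum>n\<in>B. f l * g n * e (l + n)) = (\<Sum>k\<in>(\<lambda>n. l + n) ` B. f l * g (k - l) * e k)"
      by (subst sum.reindex) (auto simp: inj_on_def)
    also have "\<dots> = (\<Sum>k\<in>S. f l * g (k - l) * e k)"
    proof (rule sum.mono_neutral_left)
      show "(\<lambda>n. l + n) ` B \<subseteq> S" using l by (auto simp: S_def)
      show "\<forall>k\<in>S - (\<lambda>n. l + n) ` B. f l * g (k - l) * e k = 0"
      proof
        fix k assume k: "k \<in> S - (\<lambda>n. l + n) ` B"
        have "k - l \<notin> B"
        proof
          assume "k - l \<in> B"
          then have "l + (k - l) \<in> (\<lambda>n. l + n) ` B" by (rule imageI)
          with k show False by simp
        qed
        then show "f l * g (k - l) * e k = 0" by (simp add: B_def)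
      qed
    qed (rule finS)
    finally show "(\<Sum>k\<in>S. f l * g (k - l) * e k) = (\<Sum>n\<in>B. f l * g n * e (l + n))" ..
  qed simp
  also have "\<dots> = (\<Sum>l\<in>A. f l * e l) * (\<Sum>n\<in>B. g n * e n)"
    by (simp add: e_add sum_product algebra_simps)
  also have "(\<Sum>l\<in>A. f l * e l) = trig_series f x"
  proof -
    have "trig_series f x = (\<Sum>\<^sub>\<infinity>k\<in>A. f k * e k)"
      unfolding trig_series_def e_def by (rule infsum_cong_neutral) (auto simp: A_def)
    then show ?thesis using fin by simp
  qed
  also have "(\<Sum>l\<in>B. g l * e l) = trig_series g x"
  proof -
    have "trig_series g x = (\<Sum>\<^sub>\<infinity>k\<in>B. g k * e k)"
      unfolding trig_series_def e_def by (rule infsum_cong_neutral) (auto simp: B_def)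
    then show ?thesis using fin by simp
  qed
  finally show ?thesis .
qed

definition laplacian :: "tdist \<Rightarrow> tdist" where
  "laplacian f = (\<lambda>k. - of_real (4 * pi\<^sup>2 * (norm (freq k))\<^sup>2) * f k)"

definition partial1 :: "tdist \<Rightarrow> tdist" where
  "partial1 f = (\<lambda>k. 2 * of_real pi * \<i> * of_int (fst k) * f k)"

definition partial2 :: "tdist \<Rightarrow> tdist" where
  "partial2 f = (\<lambda>k. 2 * of_real pi * \<i> * of_int (snd k) * f k)"

text \<open>The operator \<open>(1 - \<Delta>)\<^sup>-\<^sup>1\<close>.\<close>

definition inv_one_minus_lap :: "tdist \<Rightarrow> tdist" where
  "inv_one_minus_lap f = (\<lambda>k. f k / of_real (1 + 4 * pi\<^sup>2 * (norm (freq k))\<^sup>2))"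

text \<open>Smooth functions: rapidly decreasing Fourier coefficients.\<close>

definition smooth_fun :: "tdist \<Rightarrow> bool" where
  "smooth_fun f \<longleftrightarrow> (\<forall>n::nat. \<exists>B. \<forall>k. (1 + norm (freq k)) ^ n * norm (f k) \<le> B)"

subsection \<open>Sobolev spaces\<close>

definition sobolev :: "real \<Rightarrow> tdist set" where
  "sobolev s = {f. (\<lambda>k. (1 + 4 * pi\<^sup>2 * (norm (freq k))\<^sup>2) powr s * (norm (f k))\<^sup>2) summable_on UNIV}"

text \<open>The norm is infinite outside the space.\<close>

definition sobolev_norm :: "real \<Rightarrow> tdist \<Rightarrow> ennreal" where
  "sobolev_norm s f =
     (if f \<in> sobolev s
      then ennreal (sqrt (\<Sum>\<^sub>\<infinity>k. (1 + 4 * pi\<^sup>2 * (norm (freq k))\<^sup>2) powr s * (norm (f k))\<^sup>2))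
      else \<infinity>)"

text \<open>By Plancherel, the following are the space, the inner product and the norm of \<open>L\<^sup>2\<close>.\<close>

definition L2 :: "tdist set" where
  "L2 = {f. (\<lambda>k. (norm (f k))\<^sup>2) summable_on UNIV}"

definition L2_inner :: "tdist \<Rightarrow> tdist \<Rightarrow> complex" where
  "L2_inner f g = (\<Sum>\<^sub>\<infinity>k. f k * cnj (g k))"

definition L2_norm :: "tdist \<Rightarrow> real" where
  "L2_norm f = sqrt (\<Sum>\<^sub>\<infinity>k. (norm (f k))\<^sup>2)"

lemma L2_eq_sobolev: "L2 = sobolev 0"
proof -
  have *: "(1 + 4 * pi\<^sup>2 * (norm (freq k))\<^sup>2) powr 0 = 1" for k
    by (metis add_pos_nonneg less_numeral_extra(3) mult_nonneg_nonneg powr_zero_eq_one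
        zero_le_numeral zero_le_power2 zero_less_one)
  show ?thesis unfolding L2_def sobolev_def * by simp
qed

subsection \<open>Littlewood--Paley theory\<close>

primrec continuously_diff :: "nat \<Rightarrow> (real \<times> real) set \<Rightarrow> (real \<times> real \<Rightarrow> real) \<Rightarrow> bool" where
  "continuously_diff 0 U f \<longleftrightarrow> continuous_on U f"
| "continuously_diff (Suc n) U f \<longleftrightarrow>
     (\<exists>g h. (\<forall>x\<in>U. (f has_derivative (\<lambda>v. fst v * g x + snd v * h x)) (at x)) \<and>
            continuously_diff n U g \<and> continuously_diff n U h)"

definition smooth_on :: "(real \<times> real) set \<Rightarrow> (real \<times> real \<Rightarrow> real) \<Rightarrow> bool" where
  "smooth_on U f \<longleftrightarrow> (\<forall>n. continuously_diff n U f)"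

definition radial :: "(real \<times> real \<Rightarrow> real) \<Rightarrow> bool" where
  "radial f \<longleftrightarrow> (\<forall>x y. norm x = norm y \<longrightarrow> f x = f y)"

definition littlewood_paley :: "(real \<times> real \<Rightarrow> real) \<Rightarrow> (real \<times> real \<Rightarrow> real) \<Rightarrow> bool" where
  "littlewood_paley chi \<rho> \<longleftrightarrow>
     smooth_on UNIV chi \<and> smooth_on UNIV \<rho> \<and> radial chi \<and> radial \<rho> \<and>
     (\<forall>x. 0 \<le> chi x) \<and> (\<forall>x. 0 \<le> \<rho> x) \<and>
     (\<exists>b. \<forall>x. chi x \<noteq> 0 \<longrightarrow> norm x \<le> b) \<and>
     (\<exists>a b. 0 < a \<and> (\<forall>x. \<rho> x \<noteq> 0 \<longrightarrow> a \<le> norm x \<and> norm x \<le> b)) \<and>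
     (\<forall>x. (\<lambda>j::nat. \<rho> ((1 / 2 ^ j) *\<^sub>R x)) sums (1 - chi x)) \<and>
     (\<forall>(j::nat) x. 1 \<le> j \<longrightarrow> chi x * \<rho> ((1 / 2 ^ j) *\<^sub>R x) = 0) \<and>
     (\<forall>(i::nat) (j::nat) x. 1 < \<bar>int i - int j\<bar> \<longrightarrow>
        \<rho> ((1 / 2 ^ i) *\<^sub>R x) * \<rho> ((1 / 2 ^ j) *\<^sub>R x) = 0)"

text \<open>The block of index \<open>j \<ge> -1\<close>.  The symbols are evaluated at \<open>k\<close>, not
  \<open>2 \<pi> k\<close>.  For a Littlewood--Paley pair the Fourier coefficients have finite support.\<close>

definition lp_block ::
  "(real \<times> real \<Rightarrow> real) \<Rightarrow> (real \<times> real \<Rightarrow> real) \<Rightarrow> int \<Rightarrow> tdist \<Rightarrow> tdist" where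
  "lp_block chi \<rho> j f =
     (\<lambda>k. of_real (if j = -1 then chi (freq k) else \<rho> ((1 / 2 ^ nat j) *\<^sub>R freq k)) * f k)"

definition Linf_norm :: "tdist \<Rightarrow> real" where
  "Linf_norm f = (SUP x. norm (trig_series f x))"

text \<open>The Besov space \<open>\<C>\<^sup>a = B\<^sup>a\<^sub>\<infinity>\<^sub>,\<^sub>\<infinity>\<close>.\<close>

definition besov_norm ::
  "(real \<times> real \<Rightarrow> real) \<Rightarrow> (real \<times> real \<Rightarrow> real) \<Rightarrow> real \<Rightarrow> tdist \<Rightarrow> ennreal" where
  "besov_norm chi \<rho> a f =
     (SUP j\<in>{-1..}. ennreal (2 powr (real_of_int j * a) * Linf_norm (lp_block chi \<rho> j f)))"

definition besov ::
  "(real \<times> real \<Rightarrow> real) \<Rightarrow> (real \<times> real \<Rightarrow> real) \<Rightarrow> real \<Rightarrow> tdist set" where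
  "besov chi \<rho> a = {f. besov_norm chi \<rho> a f < \<infinity>}"

text \<open>\<open>para chi \<rho> f g\<close> is \<open>f \<prec> g\<close>, with the low frequencies of \<open>f\<close> and the high ones of \<open>g\<close>.\<close>

definition para ::
  "(real \<times> real \<Rightarrow> real) \<Rightarrow> (real \<times> real \<Rightarrow> real) \<Rightarrow> tdist \<Rightarrow> tdist \<Rightarrow> tdist" where
  "para chi \<rho> f g =
     (\<lambda>k. \<Sum>\<^sub>\<infinity>j\<in>{-1..}. \<Sum>i\<in>{-1..j - 2}. tprod (lp_block chi \<rho> i f) (lp_block chi \<rho> j g) k)"

definition para_grad ::
  "(real \<times> real \<Rightarrow> real) \<Rightarrow> (real \<times> real \<Rightarrow> real) \<Rightarrow> tdist \<Rightarrow> tdist \<Rightarrow> tdist" where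
  "para_grad chi \<rho> f g = para chi \<rho> (partial1 f) (partial1 g) + para chi \<rho> (partial2 f) (partial2 g)"

definition resonant ::
  "(real \<times> real \<Rightarrow> real) \<Rightarrow> (real \<times> real \<Rightarrow> real) \<Rightarrow> tdist \<Rightarrow> tdist \<Rightarrow> tdist" where
  "resonant chi \<rho> f g =
     (\<lambda>k. \<Sum>\<^sub>\<infinity>(i, j)\<in>{(i, j). -1 \<le> i \<and> -1 \<le> j \<and> \<bar>i - j\<bar> \<le> 1}.
            tprod (lp_block chi \<rho> i f) (lp_block chi \<rho> j g) k)"

definition bounded_trilinear_on ::
  "(tdist \<Rightarrow> tdist \<Rightarrow> tdist \<Rightarrow> tdist) \<Rightarrow>
   tdist set \<Rightarrow> (tdist \<Rightarrow> ennreal) \<Rightarrow> tdist set \<Rightarrow> (tdist \<Rightarrow> ennreal) \<Rightarrow>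
   tdist set \<Rightarrow> (tdist \<Rightarrow> ennreal) \<Rightarrow> tdist set \<Rightarrow> (tdist \<Rightarrow> ennreal) \<Rightarrow> bool" where
  "bounded_trilinear_on T E nE F nF G nG V nV \<longleftrightarrow>
     (\<forall>f\<in>E. \<forall>g\<in>F. \<forall>h\<in>G. T f g h \<in> V) \<and>
     (\<forall>z. \<forall>f\<in>E. \<forall>f'\<in>E. \<forall>g\<in>F. \<forall>h\<in>G. T (scale z f + f') g h = scale z (T f g h) + T f' g h) \<and>
     (\<forall>z. \<forall>f\<in>E. \<forall>g\<in>F. \<forall>g'\<in>F. \<forall>h\<in>G. T f (scale z g + g') h = scale z (T f g h) + T f g' h) \<and>
     (\<forall>z. \<forall>f\<in>E. \<forall>g\<in>F. \<forall>h\<in>G. \<forall>h'\<in>G. T f g (scale z h + h') = scale z (T f g h) + T f g h') \<and>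
     (\<exists>B::real. \<forall>f\<in>E. \<forall>g\<in>F. \<forall>h\<in>G. nV (T f g h) \<le> ennreal B * nE f * nF g * nG h)"

text \<open>
  Smooth functions are not dense in \<open>\<C>\<^sup>b\<close>.  The commutator is nevertheless determined on
  \<open>\<H>\<^sup>a \<times> \<C>\<^sup>b \<times> \<C>\<^sup>c\<close>, because boundedness is required of one and the same operator for all
  admissible exponents, in particular for slightly smaller ones.
\<close>

definition is_commutator ::
  "(real \<times> real \<Rightarrow> real) \<Rightarrow> (real \<times> real \<Rightarrow> real) \<Rightarrow>
   (tdist \<Rightarrow> tdist \<Rightarrow> tdist \<Rightarrow> tdist) \<Rightarrow> bool" where
  "is_commutator chi \<rho> T \<longleftrightarrow>
     (\<forall>f g h. smooth_fun f \<longrightarrow> smooth_fun g \<longrightarrow> smooth_fun h \<longrightarrow>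
        T f g h = resonant chi \<rho> (para chi \<rho> f g) h - tprod f (resonant chi \<rho> g h)) \<and>
     (\<forall>a b c. 0 < a \<longrightarrow> a < 1 \<longrightarrow> b + c < 0 \<longrightarrow> 0 < a + b + c \<longrightarrow>
        bounded_trilinear_on T (sobolev a) (sobolev_norm a)
          (besov chi \<rho> b) (besov_norm chi \<rho> b) (besov chi \<rho> c) (besov_norm chi \<rho> c)
          (sobolev (a + b + c)) (sobolev_norm (a + b + c)))"

definition commutator ::
  "(real \<times> real \<Rightarrow> real) \<Rightarrow> (real \<times> real \<Rightarrow> real) \<Rightarrow> tdist \<Rightarrow> tdist \<Rightarrow> tdist \<Rightarrow> tdist" where
  "commutator chi \<rho> = (SOME T. is_commutator chi \<rho> T)"

section \<open>White noise and its enhancement\<close>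

definition centred_gaussian :: "'w measure \<Rightarrow> ('w \<Rightarrow> real) \<Rightarrow> bool" where
  "centred_gaussian M Y \<longleftrightarrow>
     Y \<in> borel_measurable M \<and>
     ((AE w in M. Y w = 0) \<or> (\<exists>\<sigma>>0. distributed M lborel Y (\<lambda>x. ennreal (normal_density 0 \<sigma> x))))"

definition centred_complex_gaussian :: "'w measure \<Rightarrow> ('w \<Rightarrow> complex) \<Rightarrow> bool" where
  "centred_complex_gaussian M Z \<longleftrightarrow>
     (\<forall>a b. centred_gaussian M (\<lambda>w. a * Re (Z w) + b * Im (Z w)))"

definition white_noise :: "'w measure \<Rightarrow> ('w \<Rightarrow> tdist) \<Rightarrow> bool" where
  "white_noise M \<xi> \<longleftrightarrow>
     prob_space M \<and>
     (\<forall>k. centred_complex_gaussian M (\<lambda>w. \<xi> w k)) \<and>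
     (\<forall>w\<in>space M. \<forall>k. \<xi> w (- k) = cnj (\<xi> w k)) \<and>
     (\<forall>J. (\<forall>k\<in>J. - k \<in> J \<longrightarrow> k = 0) \<longrightarrow>
        prob_space.indep_vars M (\<lambda>_. borel) (\<lambda>k w. \<xi> w k) J) \<and>
     (\<forall>k l. (\<integral>w. \<xi> w k * cnj (\<xi> w l) \<partial>M) = (if k = l then 1 else 0))"

definition mollifier :: "(real \<times> real \<Rightarrow> real) \<Rightarrow> bool" where
  "mollifier m \<longleftrightarrow>
     radial m \<and> smooth_on (- {0}) m \<and> (\<exists>b. \<forall>x. m x \<noteq> 0 \<longrightarrow> norm x \<le> b) \<and> (m \<longlongrightarrow> 1) (at 0)"

definition mollify :: "(real \<times> real \<Rightarrow> real) \<Rightarrow> real \<Rightarrow> tdist \<Rightarrow> tdist" where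
  "mollify m \<epsilon> f = (\<lambda>k. of_real (m (\<epsilon> *\<^sub>R freq k)) * f k)"

definition renorm_const :: "(real \<times> real \<Rightarrow> real) \<Rightarrow> real \<Rightarrow> real" where
  "renorm_const m \<epsilon> =
     (\<Sum>\<^sub>\<infinity>k. \<bar>m (\<epsilon> *\<^sub>R freq k)\<bar>\<^sup>2 / (1 + 4 * pi\<^sup>2 * (norm (freq k))\<^sup>2))"

definition const_fun :: "complex \<Rightarrow> tdist" where
  "const_fun z = (\<lambda>k. if k = 0 then z else 0)"

definition enhanced_noise ::
  "(real \<times> real \<Rightarrow> real) \<Rightarrow> (real \<times> real \<Rightarrow> real) \<Rightarrow> (real \<times> real \<Rightarrow> real) \<Rightarrow>
   tdist \<Rightarrow> tdist \<Rightarrow> bool" where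
  "enhanced_noise chi \<rho> m \<xi> \<Xi>2 \<longleftrightarrow>
     (\<forall>\<alpha>. \<alpha> < -1 \<longrightarrow>
        ((\<lambda>\<epsilon>. besov_norm chi \<rho> \<alpha> (mollify m \<epsilon> \<xi> - \<xi>)) \<longlongrightarrow> 0) (at_right 0) \<and>
        ((\<lambda>\<epsilon>. besov_norm chi \<rho> (2 * \<alpha> + 2)
           (resonant chi \<rho> (mollify m \<epsilon> \<xi>) (inv_one_minus_lap (mollify m \<epsilon> \<xi>))
              - const_fun (of_real (renorm_const m \<epsilon>)) - \<Xi>2)) \<longlongrightarrow> 0) (at_right 0))"

section \<open>Unbounded operators on \<open>L\<^sup>2\<close>\<close>

text \<open>An operator is given by its domain and its action on the domain.\<close>

type_synonym L2_op = "tdist set \<times> (tdist \<Rightarrow> tdist)"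

definition shift_op :: "L2_op \<Rightarrow> complex \<Rightarrow> L2_op" where
  "shift_op T z = (fst T, \<lambda>u. snd T u - scale z u)"

definition op_inverse :: "L2_op \<Rightarrow> tdist \<Rightarrow> tdist" where
  "op_inverse T = inv_into (fst T) (snd T)"

text \<open>The norm of a map from \<open>L\<^sup>2\<close> to \<open>\<H>\<^sup>s\<close>.\<close>

definition op_norm :: "real \<Rightarrow> (tdist \<Rightarrow> tdist) \<Rightarrow> ennreal" where
  "op_norm s T = (SUP f\<in>{f\<in>L2. L2_norm f \<le> 1}. sobolev_norm s (T f))"

definition boundedly_invertible :: "L2_op \<Rightarrow> bool" where
  "boundedly_invertible T \<longleftrightarrow>
     bij_betw (snd T) (fst T) L2 \<and> op_norm 0 (op_inverse T) < \<infinity>"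

text \<open>The last clause says that the graphs of the operator and of its adjoint coincide.\<close>

definition self_adjoint :: "L2_op \<Rightarrow> bool" where
  "self_adjoint T \<longleftrightarrow>
     fst T \<subseteq> L2 \<and> snd T ` fst T \<subseteq> L2 \<and>
     (\<forall>z. \<forall>u\<in>fst T. \<forall>v\<in>fst T. scale z u + v \<in> fst T \<and>
        snd T (scale z u + v) = scale z (snd T u) + snd T v) \<and>
     (\<forall>f\<in>L2. \<forall>e>0. \<exists>u\<in>fst T. L2_norm (f - u) < e) \<and>
     (\<forall>v\<in>L2. \<forall>w\<in>L2.
        (\<forall>u\<in>fst T. L2_inner (snd T u) v = L2_inner u w) \<longleftrightarrow> v \<in> fst T \<and> snd T v = w)"

definition neg_coercive :: "L2_op \<Rightarrow> bool" where
  "neg_coercive T \<longleftrightarrow> (\<forall>u\<in>fst T. (L2_norm u)\<^sup>2 \<le> Re (L2_inner (- snd T u) u))"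

definition norm_resolvent_tendsto :: "(real \<Rightarrow> L2_op) \<Rightarrow> L2_op \<Rightarrow> real filter \<Rightarrow> bool" where
  "norm_resolvent_tendsto S T F \<longleftrightarrow>
     self_adjoint T \<and> (\<forall>\<^sub>F \<epsilon> in F. self_adjoint (S \<epsilon>)) \<and>
     (\<forall>z. Im z \<noteq> 0 \<longrightarrow>
        ((\<lambda>\<epsilon>. op_norm 0 (\<lambda>f. op_inverse (shift_op (S \<epsilon>) z) f - op_inverse (shift_op T z) f))
           \<longlongrightarrow> 0) F)"

section \<open>The Anderson Hamiltonian\<close>

definition ansatz_B ::
  "(real \<times> real \<Rightarrow> real) \<Rightarrow> (real \<times> real \<Rightarrow> real) \<Rightarrow> tdist \<Rightarrow> tdist \<Rightarrow> tdist \<Rightarrow> tdist" where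
  "ansatz_B chi \<rho> \<xi> \<Xi>2 u =
     (let X = inv_one_minus_lap \<xi> in
      inv_one_minus_lap
        (para chi \<rho> (laplacian u) X + scale 2 (para_grad chi \<rho> u X) + para chi \<rho> \<xi> u + para chi \<rho> u \<Xi>2))"

definition ansatz_R ::
  "(real \<times> real \<Rightarrow> real) \<Rightarrow> (real \<times> real \<Rightarrow> real) \<Rightarrow> tdist \<Rightarrow> tdist \<Rightarrow> tdist \<Rightarrow> tdist" where
  "ansatz_R chi \<rho> \<xi> \<Xi>2 u = u - para chi \<rho> u (inv_one_minus_lap \<xi>) - ansatz_B chi \<rho> \<xi> \<Xi>2 u"

definition anderson_domain ::
  "(real \<times> real \<Rightarrow> real) \<Rightarrow> (real \<times> real \<Rightarrow> real) \<Rightarrow> tdist \<Rightarrow> tdist \<Rightarrow> real \<Rightarrow> tdist set" where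
  "anderson_domain chi \<rho> \<xi> \<Xi>2 \<gamma> = {u \<in> sobolev \<gamma>. ansatz_R chi \<rho> \<xi> \<Xi>2 u \<in> sobolev 2}"

text \<open>The renormalised resonant product \<open>u \<circ> \<xi>\<close> on the domain.\<close>

definition resonant_noise ::
  "(real \<times> real \<Rightarrow> real) \<Rightarrow> (real \<times> real \<Rightarrow> real) \<Rightarrow> tdist \<Rightarrow> tdist \<Rightarrow> tdist \<Rightarrow> tdist" where
  "resonant_noise chi \<rho> \<xi> \<Xi>2 u =
     commutator chi \<rho> u (inv_one_minus_lap \<xi>) \<xi> + tprod u \<Xi>2
       + resonant chi \<rho> (ansatz_B chi \<rho> \<xi> \<Xi>2 u) \<xi> + resonant chi \<rho> (ansatz_R chi \<rho> \<xi> \<Xi>2 u) \<xi>"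

definition anderson ::
  "(real \<times> real \<Rightarrow> real) \<Rightarrow> (real \<times> real \<Rightarrow> real) \<Rightarrow> tdist \<Rightarrow> tdist \<Rightarrow> real \<Rightarrow> L2_op" where
  "anderson chi \<rho> \<xi> \<Xi>2 \<gamma> =
     (anderson_domain chi \<rho> \<xi> \<Xi>2 \<gamma>,
      \<lambda>u. laplacian u + para chi \<rho> u \<xi> + para chi \<rho> \<xi> u + resonant_noise chi \<rho> \<xi> \<Xi>2 u)"

definition anderson_approx :: "(real \<times> real \<Rightarrow> real) \<Rightarrow> tdist \<Rightarrow> real \<Rightarrow> L2_op" where
  "anderson_approx m \<xi> \<epsilon> =
     (sobolev 2,
      \<lambda>u. laplacian u + tprod (mollify m \<epsilon> \<xi>) u - scale (of_real (renorm_const m \<epsilon>)) u)"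

end

theory Submission
 imports Defs "HOL-Complex_Analysis.Great_Picard"
begin

text \<open>
 With \<open>X = (1 - \<Delta>)\<^sup>-\<^sup>1 \<xi>\<close>, the equation \<open>(\<mu> - A) u = f\<close> is solved as a fixed-point problem for the pair
 \<open>(u, v)\<close>, \<open>v = u - u \<prec> X\<close>, in \<open>\<H>\<^sup>3\<^sup>/\<^sup>4 \<times> \<H>\<^sup>1\<^sup>7\<^sup>/\<^sup>1\<^sup>6\<close>. By the paraproduct, resonant and commutator
 estimates the map is a contraction for large \<open>\<mu>\<close>, with a rate depending only on the Besov norms of the
 noise. These are bounded uniformly in \<open>\<epsilon>\<close>, so one \<open>\<mu>\<close> serves \<open>A\<close> and all \<open>A\<^sub>\<epsilon>\<close>, the solution operator
 depends Lipschitz continuously on the enhanced noise, and the inverses converge in norm; the bound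
 in \<open>\<H>\<^sup>\<gamma>\<close> comes from \<open>u = u \<prec> X + v\<close>. For \<open>\<epsilon> > 0\<close> the potential is a trigonometric polynomial, so
 \<open>A\<^sub>\<epsilon>\<close> is symmetric and bounded above; solvability for all larger \<open>\<mu>\<close> lets its form bound descend in
 unit steps to a \<open>\<mu>\<close> independent of \<open>\<epsilon>\<close>. Symmetry and coercivity of the inverse pass to the limit and
 give the self-adjointness of \<open>H\<close>.
\<close>

text \<open>All objects are families of Fourier coefficients, so sup norm bounds for multipliers are
  not taken from convolution kernels. A symbol is expanded in an absolutely convergent Fourier
  series on a box: the multiplier becomes a superposition of translations, which respect products
  and every norm involved. Two obstacles shape the rest. The supports of non-neighbouring symbols
  may touch, so paraproduct pieces need not live in annuli; vanishing to infinite order replaces the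
  missing gap. And the commutator enters the operator through a choice: one witness must be built
  that serves all exponents at once, and afterwards only the bounds and the values on smooth triples
  are known. The noise is measured at the fixed exponents \<open>-33/32\<close> and
  \<open>2 * (-33/32) + 2 = -1/16\<close>, whatever \<alpha> and \<gamma> are, and the exponents of
  the fixed-point spaces fit these with a little room. Hence the threshold for K depends on neither
  \<alpha> nor \<gamma>; \<gamma> matters only in the description of the domain and in the last
  estimate of u \<prec> X.\<close>

abbreviation cor :: "real => complex" where "cor \<equiv> complex_of_real"

abbreviation nf :: "int \<times> int => real" where "nf k \<equiv> norm (freq k)"

abbreviation dyad :: "nat => real => real" where "dyad n s \<equiv> 2 powr (real n * s)"

section \<open>Sobolev bounds\<close>

text \<open>The square of \<open>jap\<close> is the symbol of 1 - \<Delta> on the torus of period 1,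
  so \<open>jap k powr (2 * s)\<close> is exactly the weight in the Sobolev norm.\<close>

definition jap :: "int \<times> int => real" where
 "jap k = sqrt (1 + 4 * pi^2 * (nf k)^2)"

lemma jap_ge_1: "1 \<le> jap k" by (simp add: jap_def)

lemma jap_pos [simp]: "0 < jap k" using jap_ge_1[of k] by linarith

lemma jap_nonneg [simp]: "0 \<le> jap k" and jap_nonzero [simp]: "jap k \<noteq> 0"
 using jap_pos[of k] by linarith+

lemma jap_sq: "(jap k)^2 = 1 + 4 * pi^2 * (nf k)^2" by (simp add: jap_def)

lemma jap_powr_sq: "(1 + 4 * pi^2 * (nf k)^2) powr s = (jap k powr s)^2"
proof -
 have "(jap k powr s)^2 = (jap k powr s) powr 2" by simp
 also have "\<dots> = (jap k powr 2) powr s" by (simp only: powr_powr mult.commute)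
 finally show ?thesis by (simp add: jap_sq)
qed

lemma norm_freq_le_jap: "2 * pi * nf k \<le> jap k"
 unfolding jap_def by (rule real_le_rsqrt) (simp add: power_mult_distrib)

lemma jap_le: "jap k \<le> 1 + 2 * pi * nf k" unfolding jap_def
 by (rule real_le_lsqrt) (auto simp: power2_sum power_mult_distrib)

lemma norm_freq_le_jap': "nf k \<le> jap k"
proof -
 have "1 * nf k \<le> (2 * pi) * nf k" using pi_gt3 by (intro mult_right_mono) auto
 then show ?thesis using norm_freq_le_jap[of k] by simp
qed

lemma freq_add: "freq (k + l) = freq k + freq l" and freq_diff: "freq (k - l) = freq k - freq l"
 and freq_uminus: "freq (- k) = - freq k" and freq_zero [simp]: "freq 0 = 0"
 by (simp_all add: freq_def zero_prod_def)

lemma summable_le: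
 fixes f :: "'a => 'b::banach"
 assumes "g summable_on I" "\<And>z. z \<in> I ==> norm (f z) \<le> g z" shows "f summable_on I"
 by (rule abs_summable_summable, rule Infinite_Sum.abs_summable_on_comparison_test'[OF assms])

lemma scale_apply: "scale z f k = z * f k" by (simp add: scale_def)

text \<open>\<open>hb s f C\<close> says that the \<open>\<H>\<^sup>s\<close> norm of \<open>f\<close> is at most \<open>C\<close>; bounding finite sections keeps
 every argument free of convergence questions.\<close>

definition hb :: "real => tdist => real => bool" where
 "hb s f C \<longleftrightarrow> (\<forall>A. finite A --> L2_set (\<lambda>k. jap k powr s * cmod (f k)) A \<le> C)"

lemma hbD: "hb s f C ==> finite A ==> L2_set (\<lambda>k. jap k powr s * cmod (f k)) A \<le> C"
 by (simp add: hb_def)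

lemma hb_nonneg: "hb s f C ==> 0 \<le> C" using hbD[of s f C "{}"] by simp

lemma hb_mono: "hb s f C ==> C \<le> D ==> hb s f D" by (force simp: hb_def)

lemma hb_coeff: "hb s f C ==> jap k powr s * cmod (f k) \<le> C"
 using hbD[of s f C "{k}"] by (simp add: L2_set_def abs_mult)

lemma hb0_coeff: "hb 0 f C ==> cmod (f k) \<le> C" using hb_coeff[of 0 f C k] by simp

lemma L2_set_cmult: "0 \<le> c ==> L2_set (\<lambda>k. c * f k) A = c * L2_set f A"
 by (simp add: L2_set_right_distrib)

lemma hb_le: assumes "hb t g C" and "0 \<le> c"
  and "\<And>k. jap k powr s * cmod (f k) \<le> c * (jap k powr t * cmod (g k))"
 shows "hb s f (c * C)" unfolding hb_def
proof (intro allI impI)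
 fix A :: "(int \<times> int) set" assume A: "finite A"
 have "L2_set (\<lambda>k. jap k powr s * cmod (f k)) A \<le> L2_set (\<lambda>k. c * (jap k powr t * cmod (g k))) A"
  by (rule L2_set_mono) (use assms(3) in auto)
 also have "\<dots> = c * L2_set (\<lambda>k. jap k powr t * cmod (g k)) A"
  using assms(2) by (rule L2_set_cmult)
 also have "\<dots> \<le> c * C" using hbD[OF assms(1) A] assms(2) by (rule mult_left_mono)
 finally show "L2_set (\<lambda>k. jap k powr s * cmod (f k)) A \<le> c * C" .
qed

lemma hb_le1:
 assumes "hb t g C" "\<And>k. jap k powr s * cmod (f k) \<le> jap k powr t * cmod (g k)"
 shows "hb s f C" using hb_le[OF assms(1), of 1 s f] assms(2) by simp

lemma hb_weaken: "hb t f C ==> s \<le> t ==> hb s f C"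
 by (erule hb_le1) (auto intro!: mult_right_mono powr_mono jap_ge_1)

lemma hb_zero: "hb s (\<lambda>_. 0) 0" by (simp add: hb_def L2_set_def)

lemma hb_add: assumes "hb s f C" "hb s g D" shows "hb s (\<lambda>k. f k + g k) (C + D)"
 unfolding hb_def
proof (intro allI impI)
 fix A :: "(int \<times> int) set" assume A: "finite A"
 have "L2_set (\<lambda>k. jap k powr s * cmod (f k + g k)) A
   \<le> L2_set (\<lambda>k. jap k powr s * cmod (f k) + jap k powr s * cmod (g k)) A"
  by (rule L2_set_mono) (auto simp flip: distrib_left intro!: mult_left_mono norm_triangle_ineq)
 also have "\<dots> \<le> L2_set (\<lambda>k. jap k powr s * cmod (f k)) A + L2_set (\<lambda>k. jap k powr s * cmod (g k)) A"
  by (rule L2_set_triangle_ineq)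
 also have "\<dots> \<le> C + D" using hbD[OF assms(1) A] hbD[OF assms(2) A] by simp
 finally show "L2_set (\<lambda>k. jap k powr s * cmod (f k + g k)) A \<le> C + D" .
qed

lemma hb_add': "hb s f C ==> hb s g D ==> hb s (f + g) (C + D)"
 using hb_add[of s f C g D] by (simp add: plus_fun_def)

lemma hb_minus: "hb s f C ==> hb s (\<lambda>k. - f k) C" by (simp add: hb_def)

lemma hb_diff: "hb s f C ==> hb s g D ==> hb s (\<lambda>k. f k - g k) (C + D)"
 using hb_add[of s f C "\<lambda>k. - g k" D] hb_minus[of s g D] by simp

lemma hb_diff': "hb s f C ==> hb s g D ==> hb s (f - g) (C + D)"
 using hb_diff[of s f C g D] by (simp add: fun_diff_def)

lemma hb_cmult: "hb s f C ==> hb s (\<lambda>k. z * f k) (cmod z * C)"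
 by (erule hb_le) (auto simp: norm_mult)

lemma hb_scale: "hb s f C ==> hb s (scale z f) (cmod z * C)" unfolding scale_def by (rule hb_cmult)

lemma hb_sum: assumes "finite I" "\<And>i. i \<in> I ==> hb s (f i) (C i)"
 shows "hb s (\<lambda>k. \<Sum>i\<in>I. f i k) (\<Sum>i\<in>I. C i)"
 using assms by (induction I rule: finite_induct) (auto simp: hb_zero intro: hb_add)

text \<open>Fatou's lemma in this setting: a finite section involves finitely many coefficients, so
  convergence of each coefficient is enough to pass to the limit.\<close>

lemma hb_tendsto:
 assumes "\<And>k. ((\<lambda>i. f i k) \<longlongrightarrow> g k) F" "F \<noteq> bot" "eventually (\<lambda>i. hb s (f i) C) F"
 shows "hb s g C" unfolding hb_def
proof (intro allI impI)
 fix A :: "(int \<times> int) set" assume A: "finite A"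
 have "((\<lambda>i. L2_set (\<lambda>k. jap k powr s * cmod (f i k)) A) \<longlongrightarrow> L2_set (\<lambda>k. jap k powr s * cmod (g k)) A) F"
  unfolding L2_set_def by (intro tendsto_intros assms)
 moreover have "eventually (\<lambda>i. L2_set (\<lambda>k. jap k powr s * cmod (f i k)) A \<le> C) F"
  using assms(3) by eventually_elim (rule hbD[OF _ A])
 ultimately show "L2_set (\<lambda>k. jap k powr s * cmod (g k)) A \<le> C"
  by (rule tendsto_upperbound) fact
qed

text \<open>A single coefficient is at most the norm divided by its weight, which gives absolute
  convergence at every frequency. The bound holds for finite partial sums and survives the limit by
  \<open>hb_tendsto\<close>.\<close>

lemma hb_infsum: assumes b: "\<And>i. i \<in> I ==> hb s (f i) (C i)" and C: "C summable_on I"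
 shows "(\<lambda>i. norm (f i k)) summable_on I" "hb s (\<lambda>k. INFSUM i:I. f i k) (INFSUM i:I. C i)"
proof -
 show abs: "(\<lambda>i. norm (f i k)) summable_on I" for k
 proof (rule Infinite_Sum.abs_summable_on_comparison_test')
  show "(\<lambda>i. C i / jap k powr s) summable_on I"
   unfolding divide_inverse using C by (rule summable_on_cmult_left)
  show "norm (f i k) \<le> C i / jap k powr s" if "i \<in> I" for i
   using hb_coeff[OF b[OF that], of k] by (simp add: field_simps)
 qed
 show "hb s (\<lambda>k. INFSUM i:I. f i k) (INFSUM i:I. C i)"
 proof (rule hb_tendsto[where F = "finite_subsets_at_top I"])
  show "((\<lambda>J. \<Sum>i\<in>J. f i k) \<longlongrightarrow> (INFSUM i:I. f i k)) (finite_subsets_at_top I)" for k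
   by (rule infsum_tendsto) (rule abs_summable_summable[OF abs])
  show "\<forall>\<^sub>F J in finite_subsets_at_top I. hb s (\<lambda>k. \<Sum>i\<in>J. f i k) (INFSUM i:I. C i)"
   unfolding eventually_finite_subsets_at_top
  proof (rule exI[of _ "{}"], intro conjI allI impI)
   fix J assume J: "finite J \<and> {} \<subseteq> J \<and> J \<subseteq> I"
   have "hb s (\<lambda>k. \<Sum>i\<in>J. f i k) (\<Sum>i\<in>J. C i)"
    by (rule hb_sum) (use J b in auto)
   moreover have "(\<Sum>i\<in>J. C i) \<le> (INFSUM i:I. C i)"
    by (rule finite_sum_le_infsum) (use J C hb_nonneg[OF b] in auto)
   ultimately show "hb s (\<lambda>k. \<Sum>i\<in>J. f i k) (INFSUM i:I. C i)" by (rule hb_mono)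
  qed auto
 qed simp
qed

lemma hb_L2_set_sq:
 "hb s f C \<longleftrightarrow> 0 \<le> C \<and> (\<forall>A. finite A --> (\<Sum>k\<in>A. (jap k powr s * cmod (f k))^2) \<le> C^2)"
 (is "?l \<longleftrightarrow> ?r")
proof
 assume l: ?l
 then have C: "0 \<le> C" by (rule hb_nonneg)
 moreover have "(\<Sum>k\<in>A. (jap k powr s * cmod (f k))^2) \<le> C^2" if "finite A" for A
  using hbD[OF l that] C unfolding L2_set_def by (simp add: real_sqrt_le_iff' sqrt_le_D)
 ultimately show ?r by blast
next
 assume ?r then show ?l unfolding hb_def L2_set_def by (auto intro!: real_le_lsqrt sum_nonneg)
qed

lemma hb_summable: "hb s f C ==> (\<lambda>k. (jap k powr s * cmod (f k))^2) summable_on UNIV"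
 by (rule nonneg_bdd_above_summable_on) (auto simp: hb_L2_set_sq intro!: bdd_aboveI)

lemma hb_infsum_le: assumes "hb s f C" shows "(INFSUM k. (jap k powr s * cmod (f k))^2) \<le> C^2"
 by (rule infsum_le_finite_sums[OF hb_summable[OF assms]])
   (use assms in \<open>auto simp: hb_L2_set_sq\<close>)

lemma hb_summableI: assumes "(\<lambda>k. (jap k powr s * cmod (f k))^2) summable_on UNIV"
 shows "hb s f (sqrt (INFSUM k. (jap k powr s * cmod (f k))^2))"
 using assms finite_sum_le_infsum[OF assms] by (auto simp: hb_L2_set_sq infsum_nonneg)

lemma sobolev_iff: "f \<in> sobolev s \<longleftrightarrow> (\<exists>C. hb s f C)"
 unfolding sobolev_def jap_powr_sq power_mult_distrib[symmetric]
 using hb_summable hb_summableI by blast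

lemma L2_iff: "f \<in> L2 \<longleftrightarrow> (\<exists>C. hb 0 f C)"
 unfolding L2_eq_sobolev by (rule sobolev_iff)

lemma sobolev_norm_eq:
 "f \<in> sobolev s ==> sobolev_norm s f = ennreal (sqrt (INFSUM k. (jap k powr s * cmod (f k))^2))"
 unfolding sobolev_norm_def jap_powr_sq power_mult_distrib by simp

lemma sobolev_norm_le_iff:
 assumes "0 \<le> C" shows "sobolev_norm s f \<le> ennreal C \<longleftrightarrow> hb s f C"
proof
 assume l: "sobolev_norm s f \<le> ennreal C"
 then have f: "f \<in> sobolev s" by (auto simp: sobolev_norm_def top_unique split: if_splits)
 then obtain D where "hb s f D" by (auto simp: sobolev_iff)
 from hb_summableI[OF hb_summable[OF this]] show "hb s f C"
  using l unfolding sobolev_norm_eq[OF f] using assms by (auto intro: hb_mono)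
next
 assume h: "hb s f C"
 then have f: "f \<in> sobolev s" by (auto simp: sobolev_iff)
 show "sobolev_norm s f \<le> ennreal C" unfolding sobolev_norm_eq[OF f]
  by (intro ennreal_leI real_le_lsqrt infsum_nonneg assms hb_infsum_le h)
qed

lemma L2_norm_hb: "f \<in> L2 ==> hb 0 f (L2_norm f)"
proof -
 assume "f \<in> L2"
 then obtain C where "hb 0 f C" by (auto simp: L2_iff)
 from hb_summableI[OF hb_summable[OF this]] show ?thesis by (simp add: L2_norm_def)
qed

lemma L2_norm_le: "hb 0 f C ==> L2_norm f \<le> C"
 using hb_infsum_le[of 0 f C] hb_nonneg[of 0 f C] unfolding L2_norm_def
 by (intro real_le_lsqrt) (auto intro: infsum_nonneg)

lemma L2_norm_nonneg: "0 \<le> L2_norm f" unfolding L2_norm_def by (auto intro: infsum_nonneg)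

section \<open>Trigonometric polynomials\<close>

abbreviation fs :: "tdist => bool" where "fs F \<equiv> finite {k. F k \<noteq> 0}"

text \<open>The sup norm counterpart of \<open>hb\<close>. It is applied to functions with finite
  Fourier support, where the trigonometric series is a finite sum.\<close>

definition ub :: "tdist => real => bool" where
 "ub F C \<longleftrightarrow> (\<forall>x. cmod (trig_series F x) \<le> C)"

lemma trig_series_finite: assumes "finite A" "{k. F k \<noteq> 0} \<subseteq> A"
 shows "trig_series F x = (\<Sum>k\<in>A. F k * cis (2 * pi * (freq k \<bullet> x)))"
proof -
 have "trig_series F x = (INFSUM k:A. F k * cis (2 * pi * (freq k \<bullet> x)))"
  unfolding trig_series_def by (rule infsum_cong_neutral) (use assms in auto)
 then show ?thesis using assms by simp
qed

lemma tprod_finite: assumes "finite A" "{k. F k \<noteq> 0} \<subseteq> A"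
 shows "tprod F G k = (\<Sum>l\<in>A. F l * G (k - l))"
proof -
 have "tprod F G k = (INFSUM l:A. F l * G (k - l))"
  unfolding tprod_def by (rule infsum_cong_neutral) (use assms in auto)
 then show ?thesis using assms by simp
qed

lemma fs_mono: "fs G ==> (\<And>k. G k = 0 ==> F k = 0) ==> fs F" by (erule rev_finite_subset) auto

lemma fs_add: "fs F ==> fs G ==> fs (\<lambda>k. F k + G k)"
 by (rule finite_subset[where B = "{k. F k \<noteq> 0} \<union> {k. G k \<noteq> 0}"]) auto

lemma fs_diff: "fs F ==> fs G ==> fs (\<lambda>k. F k - G k)"
 by (rule finite_subset[where B = "{k. F k \<noteq> 0} \<union> {k. G k \<noteq> 0}"]) auto

lemma fs_sum: "finite I ==> (\<And>i. i \<in> I ==> fs (F i)) ==> fs (\<lambda>k. \<Sum>i\<in>I. F i k)"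
 by (induction I rule: finite_induct) (auto intro!: fs_add)

lemma tprod_nonzeroE:
 assumes "tprod F G k \<noteq> 0" obtains l where "F l \<noteq> 0" "G (k - l) \<noteq> 0"
proof -
 have "\<not> (\<forall>l. F l * G (k - l) = 0)"
 proof
  assume "\<forall>l. F l * G (k - l) = 0"
  then have "tprod F G k = 0" by (simp only: tprod_def infsum_0_simp)
  with assms show False ..
 qed
 then obtain l where "F l * G (k - l) \<noteq> 0" by blast
 then show thesis using that[of l] by simp
qed

lemma fs_tprod: assumes "fs F" "fs G" shows "fs (tprod F G)"
proof (rule finite_subset)
 show "{k. tprod F G k \<noteq> 0} \<subseteq> (\<lambda>(a, b). a + b) ` ({k. F k \<noteq> 0} \<times> {k. G k \<noteq> 0})"
 proof
  fix k assume "k \<in> {k. tprod F G k \<noteq> 0}"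
  then obtain l where "F l \<noteq> 0" "G (k - l) \<noteq> 0" by (auto elim: tprod_nonzeroE)
  then show "k \<in> (\<lambda>(a, b). a + b) ` ({k. F k \<noteq> 0} \<times> {k. G k \<noteq> 0})"
   by (intro image_eqI[of _ _ "(l, k - l)"]) auto
 qed
qed (use assms in auto)

lemma ub_nonneg: "ub F C ==> 0 \<le> C" unfolding ub_def by (meson norm_ge_zero order_trans)

lemma ub_mono: "ub F C ==> C \<le> D ==> ub F D" unfolding ub_def by (meson order_trans)

lemma ub_sum:
 assumes "finite I" "\<And>i. i \<in> I ==> fs (F i)" "\<And>i. i \<in> I ==> ub (F i) (C i)"
 shows "ub (\<lambda>k. \<Sum>i\<in>I. F i k) (\<Sum>i\<in>I. C i)"
proof -
 define A where "A = (\<Union>i\<in>I. {k. F i k \<noteq> 0})"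
 have A: "finite A" using assms by (auto simp: A_def)
 have "trig_series (\<lambda>k. \<Sum>i\<in>I. F i k) x = (\<Sum>i\<in>I. trig_series (F i) x)" for x
 proof -
  have "trig_series (\<lambda>k. \<Sum>i\<in>I. F i k) x
    = (\<Sum>k\<in>A. (\<Sum>i\<in>I. F i k) * cis (2 * pi * (freq k \<bullet> x)))"
  proof (rule trig_series_finite[OF A], rule subsetI, rule ccontr)
   fix k assume "k \<in> {k. (\<Sum>i\<in>I. F i k) \<noteq> 0}" "k \<notin> A"
   then show False by (auto simp: A_def)
  qed
  also have "\<dots> = (\<Sum>i\<in>I. \<Sum>k\<in>A. F i k * cis (2 * pi * (freq k \<bullet> x)))"
   unfolding sum_distrib_right by (rule sum.swap)
  also have "\<dots> = (\<Sum>i\<in>I. trig_series (F i) x)"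
   by (intro sum.cong refl trig_series_finite[symmetric] A) (auto simp: A_def)
  finally show ?thesis .
 qed
 then show ?thesis using assms(3) unfolding ub_def
  by (auto intro!: order_trans[OF norm_sum] sum_mono)
qed

lemma ub_tprod: assumes "fs F" "fs G" "ub F C" "ub G D" shows "ub (tprod F G) (C * D)"
 using assms ub_nonneg[OF assms(3)] unfolding ub_def
 by (auto simp: trig_series_tprod norm_mult intro!: mult_mono)

lemma ub_cmult: "ub F C ==> ub (\<lambda>k. z * F k) (cmod z * C)" unfolding ub_def trig_series_def
 by (auto simp: mult.assoc infsum_cmult_right' norm_mult intro!: mult_left_mono)

lemma ub_coeff_sum:
 assumes "finite A" "{k. F k \<noteq> 0} \<subseteq> A" shows "ub F (\<Sum>k\<in>A. cmod (F k))"
 unfolding ub_def trig_series_finite[OF assms]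
 by (auto intro!: order_trans[OF norm_sum] simp: norm_mult)

text \<open>Translation of the function by \<open>y\<close>. It preserves sup norm and Sobolev
  bounds, so superpositions of translations with summable weights are bounded in both.\<close>

definition tr :: "real \<times> real => tdist => tdist" where
 "tr y F = (\<lambda>k. cis (2 * pi * (freq k \<bullet> y)) * F k)"

lemma tr_supp: "{k. tr y F k \<noteq> 0} = {k. F k \<noteq> 0}" by (simp add: tr_def)

lemma trig_series_tr: "trig_series (tr y F) x = trig_series F (x + y)"
proof -
 have "cis (2 * pi * (freq k \<bullet> (x + y))) = cis (2 * pi * (freq k \<bullet> x)) * cis (2 * pi * (freq k \<bullet> y))" for k
  by (simp add: inner_add_right distrib_left cis_mult)
 then show ?thesis by (simp add: trig_series_def tr_def mult_ac)
qed

lemma ub_tr: "ub F C ==> ub (tr y F) C" unfolding ub_def trig_series_tr by blast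

lemma hb_tr: "hb s F C ==> hb s (tr y F) C" by (simp add: hb_def tr_def norm_mult)

section \<open>Orthogonality of characters on a finite grid\<close>

lemma sum_cis_roots:
 fixes d :: int and N :: nat assumes "0 < N"
 shows "(\<Sum>z<N. cis (2 * pi * (d * z / N))) = (if int N dvd d then of_nat N else 0)"
proof (cases "int N dvd d")
 case True
 then obtain e where e: "d = int N * e" by auto
 have "cis (2 * pi * (d * z / N)) = 1" for z :: nat
 proof -
  have "2 * pi * (d * z / N) = 2 * pi * of_int (e * int z)" using e assms by simp
  then show ?thesis by (simp only: cis_multiple_2pi Ints_of_int)
 qed
 then show ?thesis using True by simp
next
 case False
 define w where "w = cis (2 * pi * (d / N))"
 have w: "cis (2 * pi * (d * z / N)) = w ^ z" for z :: nat
  by (simp add: w_def Complex.DeMoivre mult_ac)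
 have wN: "w ^ N = 1"
 proof -
  have "w ^ N = cis (2 * pi * of_int d)" using assms by (simp add: w_def Complex.DeMoivre)
  then show ?thesis by (simp only: cis_multiple_2pi Ints_of_int)
 qed
 have "w \<noteq> 1"
 proof
  assume "w = 1"
  then have "cos (2 * pi * (d / N)) = 1" by (simp add: w_def complex_eq_iff)
  then obtain x :: int where "2 * pi * (d / N) = x * 2 * pi" using cos_one_2pi_int by auto
  then have "2 * pi * (d / N) = 2 * pi * x" by (simp only: mult_ac)
  then have "d / N = x" by (simp only: mult_cancel_left) simp
  then have "real_of_int d = real_of_int (x * int N)" using assms by (simp add: field_simps)
  then have "d = x * int N" by linarith
  with False show False by simp
 qed
 then show ?thesis using False wN unfolding w by (simp add: geometric_sum)
qed

definition gridpt :: "nat => nat \<times> nat => real \<times> real" where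
 "gridpt N z = (real (fst z) / N, real (snd z) / N)"

lemma sum_cis_grid:
 fixes d :: "int \<times> int" assumes "0 < N"
 shows "(\<Sum>z\<in>{..<N} \<times> {..<N}. cis (2 * pi * (freq d \<bullet> gridpt N z)))
    = (if int N dvd fst d \<and> int N dvd snd d then (of_nat N)^2 else 0)"
proof -
 have "(\<Sum>z\<in>{..<N} \<times> {..<N}. cis (2 * pi * (freq d \<bullet> gridpt N z)))
   = (\<Sum>z1<N. \<Sum>z2<N. cis (2 * pi * (fst d * z1 / N)) * cis (2 * pi * (snd d * z2 / N)))"
  unfolding sum.cartesian_product by (intro sum.cong refl)
    (auto simp: freq_def gridpt_def inner_prod_def cis_mult algebra_simps)
 also have "\<dots> = (\<Sum>z<N. cis (2 * pi * (fst d * z / N))) * (\<Sum>z<N. cis (2 * pi * (snd d * z / N)))"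
  by (simp add: sum_product)
 also have "\<dots> = (if int N dvd fst d \<and> int N dvd snd d then (of_nat N)^2 else 0)"
  unfolding sum_cis_roots[OF assms] by (auto simp: power2_eq_square)
 finally show ?thesis .
qed

text \<open>A grid finer than twice the support keeps distinct frequencies distinct modulo
  \<open>N\<close>, so the exponentials stay orthogonal on it. A finite sum thus plays the role of
  the integral in Plancherel's identity.\<close>

lemma parseval_grid:
 assumes S: "finite S" "\<And>k. k \<in> S ==> 2 * \<bar>fst k\<bar> < int N \<and> 2 * \<bar>snd k\<bar> < int N"
  and N: "0 < N" and F: "{k. F k \<noteq> 0} \<subseteq> S"
 shows "(\<Sum>z\<in>{..<N} \<times> {..<N}. (cmod (trig_series F (gridpt N z)))^2) = (real N)^2 * (\<Sum>k\<in>S. (cmod (F k))^2)"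
proof -
 let ?Z = "{..<N} \<times> {..<N}"
 let ?e = "\<lambda>d z. cis (2 * pi * (freq d \<bullet> gridpt N z))"
 have dvd: "int N dvd fst (k - l) \<and> int N dvd snd (k - l) \<longleftrightarrow> k = l" if "k \<in> S" "l \<in> S" for k l
 proof
  assume d: "int N dvd fst (k - l) \<and> int N dvd snd (k - l)"
  have "\<bar>fst (k - l)\<bar> < int N" "\<bar>snd (k - l)\<bar> < int N"
   using S(2)[OF that(1)] S(2)[OF that(2)] by auto
  with d have "fst (k - l) = 0" "snd (k - l) = 0" by (metis abs_of_nat dvd_imp_le_int not_less)+
  then show "k = l" by (simp add: prod_eq_iff)
 qed auto
 have e: "?e (k - l) z = ?e k z * cnj (?e l z)" for k l z
  by (simp add: freq_diff inner_diff_left right_diff_distrib cis_cnj cis_mult)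
 have "cor (\<Sum>z\<in>?Z. (cmod (trig_series F (gridpt N z)))^2)
   = (\<Sum>z\<in>?Z. \<Sum>k\<in>S. \<Sum>l\<in>S. F k * cnj (F l) * ?e (k - l) z)"
  unfolding of_real_sum complex_norm_square trig_series_finite[OF S(1) F] cnj_sum sum_product
  by (intro sum.cong refl) (simp only: e complex_cnj_mult, simp only: mult_ac)
 also have "\<dots> = (\<Sum>k\<in>S. \<Sum>l\<in>S. F k * cnj (F l) * (\<Sum>z\<in>?Z. ?e (k - l) z))"
  by (simp add: sum_distrib_left) (subst sum.swap, intro sum.cong refl, rule sum.swap)
 also have "\<dots> = (\<Sum>k\<in>S. \<Sum>l\<in>S. F k * cnj (F l) * (if k = l then (of_nat N)^2 else 0))"
  unfolding sum_cis_grid[OF N] by (intro sum.cong refl) (simp only: dvd)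
 also have "\<dots> = (\<Sum>k\<in>S. \<Sum>l\<in>S. (if k = l then F k * cnj (F l) * (of_nat N)^2 else 0))"
  by (intro sum.cong refl) auto
 also have "\<dots> = (\<Sum>k\<in>S. F k * cnj (F k) * (of_nat N)^2)" using S(1) by simp
 also have "\<dots> = cor ((real N)^2 * (\<Sum>k\<in>S. (cmod (F k))^2))"
  unfolding of_real_mult of_real_sum sum_distrib_left complex_norm_square
  by (intro sum.cong refl) simp
 finally show ?thesis by (simp only: of_real_eq_iff)
qed

text \<open>An L2 factor times an L-infinity factor: on grid points the product is pointwise, and
  discrete Parseval is applied once to the product and once to \<open>F\<close>.\<close>

lemma hb_tprod: assumes F: "fs F" "fs G" and b: "hb 0 F C" "ub G D" shows "hb 0 (tprod F G) (C * D)"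
proof -
 have CD: "0 \<le> C" "0 \<le> D" using hb_nonneg[OF b(1)] ub_nonneg[OF b(2)] .
 define S where "S = {k. F k \<noteq> 0} \<union> {k. tprod F G k \<noteq> 0}"
 have S: "finite S" using F fs_tprod[OF F] by (simp add: S_def)
 \<comment> \<open>Large enough that the grid resolves every frequency of \<open>F\<close> and of
   the product.\<close>
 define N where "N = nat (1 + 2 * (\<Sum>k\<in>S. \<bar>fst k\<bar> + \<bar>snd k\<bar>))"
 have N0: "0 < N" by (simp add: N_def sum_nonneg add_pos_nonneg)
 have SN: "2 * \<bar>fst k\<bar> < int N \<and> 2 * \<bar>snd k\<bar> < int N" if "k \<in> S" for k
 proof -
  have "\<bar>fst k\<bar> + \<bar>snd k\<bar> \<le> (\<Sum>k\<in>S. \<bar>fst k\<bar> + \<bar>snd k\<bar>)"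
   by (rule member_le_sum[OF that _ S]) auto
  then show ?thesis unfolding N_def by auto
 qed
 have "(real N)^2 * (\<Sum>k\<in>S. (cmod (tprod F G k))^2)
   = (\<Sum>z\<in>{..<N} \<times> {..<N}. (cmod (trig_series F (gridpt N z)) * cmod (trig_series G (gridpt N z)))^2)"
  by (subst parseval_grid[OF S SN N0, symmetric])
    (auto simp: S_def trig_series_tprod[OF F] norm_mult)
 also have "\<dots> \<le> (\<Sum>z\<in>{..<N} \<times> {..<N}. D^2 * (cmod (trig_series F (gridpt N z)))^2)"
  unfolding power_mult_distrib
  by (intro sum_mono, subst mult.commute, intro mult_right_mono power_mono)
    (use b(2) in \<open>simp_all only: ub_def norm_ge_zero zero_le_power2\<close>)
 also have "\<dots> = D^2 * ((real N)^2 * (\<Sum>k\<in>S. (cmod (F k))^2))"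
  unfolding sum_distrib_left[symmetric] by (subst parseval_grid[OF S SN N0]) (auto simp: S_def)
 finally have "(\<Sum>k\<in>S. (cmod (tprod F G k))^2) \<le> D^2 * (\<Sum>k\<in>S. (cmod (F k))^2)"
  using N0 by (simp add: mult.left_commute[of "D^2"])
 also have "\<dots> \<le> D^2 * C^2"
  using b(1) S by (intro mult_left_mono) (auto simp: hb_L2_set_sq)
 finally have *: "(\<Sum>k\<in>S. (cmod (tprod F G k))^2) \<le> (C * D)^2" by (simp add: power_mult_distrib mult.commute)
 have "(\<Sum>k\<in>A. (cmod (tprod F G k))^2) \<le> (C * D)^2" if "finite A" for A
 proof -
  have "(\<Sum>k\<in>A. (cmod (tprod F G k))^2) = (\<Sum>k\<in>A \<inter> S. (cmod (tprod F G k))^2)"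
   using that by (intro sum.mono_neutral_right) (auto simp: S_def)
  also have "\<dots> \<le> (\<Sum>k\<in>S. (cmod (tprod F G k))^2)"
   using S by (intro sum_mono2) auto
  finally show ?thesis using * by linarith
 qed
 then show ?thesis using CD by (simp add: hb_L2_set_sq)
qed

lemma tprod_commute: "tprod F G = tprod G F"
proof
 fix k :: "int \<times> int"
 have "bij_betw (\<lambda>l. k - l) UNIV UNIV"
  by (rule bij_betwI[where g = "\<lambda>l. k - l"]) auto
 from infsum_reindex_bij_betw[OF this, of "\<lambda>l. G l * F (k - l)"]
 show "tprod F G k = tprod G F k" by (simp add: tprod_def mult.commute)
qed

declare split_paired_All [simp del] split_paired_Ex [simp del]

section \<open>Smooth functions on the plane\<close>

abbreviation cd :: "nat => (real \<times> real => real) => bool" where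
 "cd n f \<equiv> continuously_diff n UNIV f"

abbreviation pd :: "(real \<times> real => real) => (real \<times> real => real) => (real \<times> real => real) => bool" where
 "pd f g h \<equiv> (\<forall>x. (f has_derivative (\<lambda>v. fst v * g x + snd v * h x)) (at x))"

lemma cd_Suc_I: "pd f g h ==> cd n g ==> cd n h ==> cd (Suc n) f" by auto

lemma cd_Suc_E: assumes "cd (Suc n) f" obtains g h where "pd f g h" "cd n g" "cd n h"
 using assms by auto

lemma cd_Suc_D: "cd (Suc n) f ==> cd n f"
proof (induction n arbitrary: f)
 case 0
 then obtain g h where "pd f g h" by (rule cd_Suc_E)
 then have "continuous_on UNIV f" by (meson continuous_at_imp_continuous_on has_derivative_continuous)
 then show ?case by simp
next
 case (Suc n)
 from Suc.prems obtain g h where gh: "pd f g h" "cd (Suc n) g" "cd (Suc n) h" by (rule cd_Suc_E)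
 then show ?case by (intro cd_Suc_I[OF gh(1)] Suc.IH)
qed

lemma cd_const: "cd n (\<lambda>_. c)"
proof (induction n arbitrary: c)
 case (Suc n)
 show ?case by (rule cd_Suc_I[of _ "\<lambda>_. 0" "\<lambda>_. 0"]) (use Suc in auto)
qed simp

lemma cd_fst: "cd n fst" and cd_snd: "cd n snd"
proof -
 have "pd fst (\<lambda>_. 1) (\<lambda>_. 0)" "pd snd (\<lambda>_. 0) (\<lambda>_. 1)"
  by (auto intro!: has_derivative_eq_rhs[OF has_derivative_fst[OF has_derivative_ident]]
   has_derivative_eq_rhs[OF has_derivative_snd[OF has_derivative_ident]])
 note this[THEN cd_Suc_I, OF cd_const cd_const]
 from this[THEN cd_Suc_D] show "cd n fst" "cd n snd" .
qed

lemma cd_add: "cd n f ==> cd n g ==> cd n (\<lambda>x. f x + g x)"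
proof (induction n arbitrary: f g)
 case 0 then show ?case by (simp add: continuous_on_add)
next
 case (Suc n)
 from Suc.prems(1) obtain f1 f2 where f: "pd f f1 f2" "cd n f1" "cd n f2" by (rule cd_Suc_E)
 from Suc.prems(2) obtain g1 g2 where g: "pd g g1 g2" "cd n g1" "cd n g2" by (rule cd_Suc_E)
 have "pd (\<lambda>x. f x + g x) (\<lambda>x. f1 x + g1 x) (\<lambda>x. f2 x + g2 x)"
  by (intro allI has_derivative_eq_rhs[OF has_derivative_add[OF f(1)[rule_format] g(1)[rule_format]]]) (auto simp: algebra_simps)
 then show ?case by (rule cd_Suc_I) (use f g Suc.IH in auto)
qed

lemma cd_mult: "cd n f ==> cd n g ==> cd n (\<lambda>x. f x * g x)"
proof (induction n arbitrary: f g)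
 case 0 then show ?case by (simp add: continuous_on_mult)
next
 case (Suc n)
 from Suc.prems(1) obtain f1 f2 where f: "pd f f1 f2" "cd n f1" "cd n f2" by (rule cd_Suc_E)
 from Suc.prems(2) obtain g1 g2 where g: "pd g g1 g2" "cd n g1" "cd n g2" by (rule cd_Suc_E)
 have "pd (\<lambda>x. f x * g x) (\<lambda>x. f x * g1 x + f1 x * g x) (\<lambda>x. f x * g2 x + f2 x * g x)"
  by (intro allI has_derivative_eq_rhs[OF has_derivative_mult[OF f(1)[rule_format] g(1)[rule_format]]]) (auto simp: algebra_simps)
 then show ?case by (rule cd_Suc_I) (use f g Suc.IH Suc.prems[THEN cd_Suc_D] in \<open>auto intro!: cd_add\<close>)
qed

lemma cd_inverse: "cd n f ==> (\<And>x. f x \<noteq> 0) ==> cd n (\<lambda>x. inverse (f x))"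
proof (induction n arbitrary: f)
 case 0 then show ?case by (simp add: continuous_on_inverse)
next
 case (Suc n)
 from Suc.prems(1) obtain f1 f2 where f: "pd f f1 f2" "cd n f1" "cd n f2" by (rule cd_Suc_E)
 have i: "cd n (\<lambda>x. inverse (f x))" by (rule Suc.IH[OF cd_Suc_D[OF Suc.prems(1)] Suc.prems(2)])
 let ?d = "\<lambda>g x. (- 1) * (g x * (inverse (f x) * inverse (f x)))"
 have "pd (\<lambda>x. inverse (f x)) (?d f1) (?d f2)"
  by (intro allI has_derivative_eq_rhs[OF Deriv.has_derivative_inverse[OF Suc.prems(2) f(1)[rule_format]]]) (auto simp: algebra_simps)
 then show ?case by (rule cd_Suc_I) (intro cd_mult cd_const f i)+
qed

lemma cd_scaleR: "cd n f ==> cd n (\<lambda>x. f (c *\<^sub>R x))"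
proof (induction n arbitrary: f)
 case 0 then show ?case
  by (auto intro!: continuous_on_compose2[OF _ continuous_on_scaleR[OF continuous_on_const continuous_on_id]])
next
 case (Suc n)
 from Suc.prems(1) obtain f1 f2 where f: "pd f f1 f2" "cd n f1" "cd n f2" by (rule cd_Suc_E)
 have "pd (\<lambda>x. f (c *\<^sub>R x)) (\<lambda>x. c * f1 (c *\<^sub>R x)) (\<lambda>x. c * f2 (c *\<^sub>R x))"
  by (intro allI has_derivative_eq_rhs[OF has_derivative_compose[of "\<lambda>x. c *\<^sub>R x" "\<lambda>x. c *\<^sub>R x", OF _ f(1)[rule_format]]])
    (auto simp: algebra_simps intro!: derivative_eq_intros)
 then show ?case by (rule cd_Suc_I) (use f Suc.IH in \<open>auto intro!: cd_mult cd_const\<close>)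
qed

lemma pd_unique:
 fixes f :: "real \<times> real => real"
 assumes "(f has_derivative (\<lambda>v. fst v * a + snd v * b)) (at x)" "(f has_derivative (\<lambda>v. fst v * a' + snd v * b')) (at x)"
 shows "a = a' \<and> b = b'"
 using has_derivative_unique[OF assms, THEN fun_cong, of "(1, 0)"] has_derivative_unique[OF assms, THEN fun_cong, of "(0, 1)"] by simp

definition bump :: "real => (real \<times> real => real) => bool" where
 "bump b f \<longleftrightarrow> smooth_on UNIV f \<and> (\<forall>x. f x \<noteq> 0 --> norm x \<le> b)"

lemma bump_continuous: "bump b f ==> continuous_on S f"
 unfolding bump_def smooth_on_def by (metis continuously_diff.simps(1) continuous_on_subset subset_UNIV)

text \<open>Smoothness only provides, for each order separately, some partial derivatives;
  uniqueness of the derivative makes the witnesses of different orders agree. Outside the closed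
  ball the function vanishes on an open set, hence so do its derivatives.\<close>

lemma bump_pd: assumes "bump b f"
 obtains g h where "pd f g h" "bump b g" "bump b h"
proof -
 have f: "cd n f" for n using assms by (auto simp: bump_def smooth_on_def)
 from f[of "Suc 0"] obtain g h where gh: "pd f g h" by (rule cd_Suc_E)
 have "cd n g \<and> cd n h" for n
 proof -
  from f[of "Suc n"] obtain g' h' where gh': "pd f g' h'" "cd n g'" "cd n h'" by (rule cd_Suc_E)
  have "g = g'" "h = h'" using pd_unique gh gh'(1) by blast+
  with gh' show ?thesis by simp
 qed
 then have s: "smooth_on UNIV g" "smooth_on UNIV h" by (auto simp: smooth_on_def)
 have z: "g x = 0 \<and> h x = 0" if x: "\<not> norm x \<le> b" for x
 proof -
  have o: "open {y::real \<times> real. b < norm y}" by (intro open_Collect_less continuous_intros)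
  have "((\<lambda>_. 0) has_derivative (\<lambda>v. fst v * g x + snd v * h x)) (at x)"
   by (rule has_derivative_transform_within_open[OF gh[rule_format] o])
     (use x assms in \<open>(simp_all add: bump_def)[1], fastforce simp: bump_def not_le\<close>)
  from pd_unique[OF this, of 0 0] show ?thesis by simp
 qed
 show thesis by (rule that[OF gh]) (use s z in \<open>auto simp: bump_def\<close>)
qed

lemma bump_bounded: assumes "bump b f" shows "\<exists>C\<ge>0. \<forall>x. \<bar>f x\<bar> \<le> C"
proof -
 have "bounded (f ` cball 0 b)" by (intro compact_imp_bounded compact_continuous_image bump_continuous[OF assms] compact_cball)
 then obtain B where B: "\<forall>y\<in>f ` cball 0 b. norm y \<le> B" by (auto simp: bounded_iff)
 have "\<bar>f x\<bar> \<le> max B 0" for x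
  using B assms by (cases "f x = 0") (force simp: bump_def le_max_iff_disj)+
 then show ?thesis by (intro exI[of _ "max B 0"]) auto
qed

definition fd :: "real \<times> real => real => (real \<times> real => real) => real \<times> real => real" where
 "fd e h f = (\<lambda>x. f (x + h *\<^sub>R e) - f x)"

lemma pd_fd_pow: "pd f g k ==> pd ((fd e h ^^ p) f) ((fd e h ^^ p) g) ((fd e h ^^ p) k)"
proof (induction p)
 case (Suc p)
 let ?F = "(fd e h ^^ p) f" and ?G = "(fd e h ^^ p) g" and ?K = "(fd e h ^^ p) k"
 have *: "pd ?F ?G ?K" using Suc by blast
 show ?case
 proof
  fix x
  have "((\<lambda>x. ?F (x + h *\<^sub>R e) - ?F x) has_derivative
    (\<lambda>v. (fst v * ?G (x + h *\<^sub>R e) + snd v * ?K (x + h *\<^sub>R e)) - (fst v * ?G x + snd v * ?K x))) (at x)"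
   by (intro has_derivative_diff *[rule_format]
     has_derivative_compose[of "\<lambda>x. x + h *\<^sub>R e" "\<lambda>x. x", OF _ *[rule_format]])
     (auto intro!: derivative_eq_intros)
  then show "((fd e h ^^ Suc p) f has_derivative
    (\<lambda>v. fst v * (fd e h ^^ Suc p) g x + snd v * (fd e h ^^ Suc p) k x)) (at x)"
   by (simp add: fd_def algebra_simps)
 qed
qed simp

text \<open>By the mean value theorem one difference in a coordinate direction costs a factor
  \<open>h\<close> and one partial derivative. Differences commute with differentiation, so the
  induction applies to the partial derivative, which is again a bump.\<close>

lemma fd_pow_bound: assumes "bump b f" "e = (1, 0) \<or> e = (0, 1)"
 shows "\<exists>C\<ge>0. \<forall>h>0. \<forall>x. \<bar>(fd e h ^^ p) f x\<bar> \<le> C * h ^ p"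
 using assms(1)
proof (induction p arbitrary: f)
 case 0
 from bump_bounded[OF this] show ?case by auto
next
 case (Suc p)
 from bump_pd[OF Suc.prems] obtain g k where gk: "pd f g k" "bump b g" "bump b k" .
 define d where "d = (if e = (1, 0) then g else k)"
 have "bump b d" using gk by (simp add: d_def)
 from Suc.IH[OF this] obtain C where C: "0 \<le> C" "\<And>h x. 0 < h ==> \<bar>(fd e h ^^ p) d x\<bar> \<le> C * h ^ p" by blast
 have "\<bar>(fd e h ^^ Suc p) f x\<bar> \<le> C * h ^ Suc p" if h: "0 < h" for h x
 proof -
  let ?w = "\<lambda>t. (fd e h ^^ p) f (x + t *\<^sub>R e)"
  have "(?w has_derivative (\<lambda>s. fst (s *\<^sub>R e) * (fd e h ^^ p) g (x + t *\<^sub>R e)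
     + snd (s *\<^sub>R e) * (fd e h ^^ p) k (x + t *\<^sub>R e))) (at t)" for t
   by (rule has_derivative_compose[of "\<lambda>t. x + t *\<^sub>R e" "\<lambda>s. s *\<^sub>R e", OF _ pd_fd_pow[OF gk(1), rule_format]])
     (auto intro!: derivative_eq_intros)
  moreover have "(\<lambda>s. fst (s *\<^sub>R e) * (fd e h ^^ p) g y + snd (s *\<^sub>R e) * (fd e h ^^ p) k y) = (*) ((fd e h ^^ p) d y)" for y
   using assms(2) by (auto simp: d_def fun_eq_iff)
  ultimately have "(?w has_real_derivative (fd e h ^^ p) d (x + t *\<^sub>R e)) (at t)" for t
   by (simp add: has_field_derivative_def)
  from MVT2[OF h this] obtain z where z: "?w h - ?w 0 = (h - 0) * (fd e h ^^ p) d (x + z *\<^sub>R e)" by blast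
  have "\<bar>(fd e h ^^ Suc p) f x\<bar> = h * \<bar>(fd e h ^^ p) d (x + z *\<^sub>R e)\<bar>"
   using z h by (simp add: fd_def abs_mult)
  also have "\<dots> \<le> h * (C * h ^ p)" using h by (intro mult_left_mono C) auto
  finally show ?thesis by (simp add: mult_ac)
 qed
 then show ?case using C(1) by blast
qed

lemma fd_pow_supp: assumes "\<And>x. f x \<noteq> 0 ==> norm x \<le> b" "norm e = 1" "0 \<le> h"
 shows "(fd e h ^^ p) f x \<noteq> 0 ==> norm x \<le> b + p * h"
proof (induction p arbitrary: x)
 case (Suc p)
 have "norm x \<le> norm (x + h *\<^sub>R e) + h"
  using norm_triangle_ineq4[of "x + h *\<^sub>R e" "h *\<^sub>R e"] assms by simp
 moreover have "(fd e h ^^ p) f (x + h *\<^sub>R e) \<noteq> 0 \<or> (fd e h ^^ p) f x \<noteq> 0"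
  using Suc.prems unfolding funpow.simps o_def fd_def[of e h "(fd e h ^^ p) f"] by auto
 then have "norm (x + h *\<^sub>R e) \<le> b + p * h \<or> norm x \<le> b + p * h" using Suc.IH by blast
 moreover have "b + real p * h + h = b + real (Suc p) * h" by (simp add: algebra_simps)
 ultimately show ?case using assms(3) by linarith
qed (use assms in auto)

lemma norm_cis_diff_1: "cmod (cis t - 1) = 2 * \<bar>sin (t / 2)\<bar>"
 using dist_exp_i_1[of t] by (simp add: cis_conv_exp)

lemma norm_cis_diff_1_le: "cmod (cis t - 1) \<le> \<bar>t\<bar>"
 using abs_sin_x_le_abs_x[of "t / 2"] by (simp add: norm_cis_diff_1)

lemma norm_cis_diff_1_ge:
 assumes "\<bar>t\<bar> \<le> pi" shows "\<bar>t\<bar> / 2 \<le> cmod (cis t - 1)"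
proof -
 define x where "x = \<bar>t\<bar> / 2"
 \<comment> \<open>\<open>8 / 5\<close> exceeds half of pi, and its square 2.56 is below 3, so the
   cubic bound \<open>x - x ^ 3 / 6\<close> stays above \<open>x / 2\<close>.\<close>
 have x: "0 \<le> x" "x \<le> 8 / 5" using assms pi_approx by (simp_all add: x_def)
 then have "x ^ 3 \<le> x * ((8 / 5) * (8 / 5))" unfolding power3_eq_cube mult.assoc by (intro mult_left_mono mult_mono) auto
 moreover have "\<bar>sin x - x\<bar> \<le> x ^ 3 / 6"
  using Maclaurin_sin_bound[of x 3] x by (simp add: sin_coeff_def numeral_3_eq_3)
 moreover have "\<bar>sin (t / 2)\<bar> = \<bar>sin x\<bar>" by (simp add: abs_if x_def)
 ultimately have "x \<le> 2 * \<bar>sin (t / 2)\<bar>" using x by linarith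
 then show ?thesis by (simp add: norm_cis_diff_1 x_def)
qed

section \<open>Fourier expansion of bump functions\<close>

text \<open>A product weight, so that summability of \<open>1 / (wt z)^2\<close> over the lattice
  factors into two one-dimensional series.\<close>

definition wt :: "int \<times> int => real" where
 "wt z = (1 + \<bar>real_of_int (fst z)\<bar>) * (1 + \<bar>real_of_int (snd z)\<bar>)"

lemma wt_ge_1: "1 \<le> wt z"
proof -
 have "1 * 1 \<le> wt z" unfolding wt_def by (intro mult_mono) auto
 then show ?thesis by simp
qed

lemma wt_pos [simp]: "0 < wt z" using wt_ge_1[of z] by linarith

lemma norm_freq_le_wt: "nf z \<le> wt z"
proof -
 have "nf z \<le> \<bar>real_of_int (fst z)\<bar> + \<bar>real_of_int (snd z)\<bar>"
  using norm_Pair_le[of "real_of_int (fst z)" "real_of_int (snd z)"] by (simp add: freq_def)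
 also have "\<dots> \<le> wt z" by (simp add: wt_def algebra_simps)
 finally show ?thesis .
qed

lemma summable_on_int_inverse_square: "(\<lambda>i::int. 1 / (1 + \<bar>real_of_int i\<bar>)^2) summable_on UNIV"
proof -
 have s: "summable (\<lambda>n. 1 / (1 + real n)^2)"
 proof -
  have "summable (\<lambda>n. inverse (real n ^ 2))" by (rule inverse_power_summable) simp
  then have "summable (\<lambda>n. inverse (real (Suc n) ^ 2))" by (subst summable_Suc_iff)
  then show ?thesis by (simp add: inverse_eq_divide)
 qed
 have n: "(\<lambda>n. 1 / (1 + real n)^2) summable_on UNIV"
  using s by (subst summable_on_UNIV_nonneg_real_iff) auto
 have "(\<lambda>i. 1 / (1 + \<bar>real_of_int i\<bar>)^2) summable_on range int"
  by (subst summable_on_reindex) (use n in \<open>auto simp: o_def\<close>)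
 moreover have "(\<lambda>i. 1 / (1 + \<bar>real_of_int i\<bar>)^2) summable_on range (\<lambda>n. - int n)"
  by (subst summable_on_reindex) (use n in \<open>auto simp: o_def inj_on_def\<close>)
 ultimately have "(\<lambda>i. 1 / (1 + \<bar>real_of_int i\<bar>)^2) summable_on (range int \<union> range (\<lambda>n. - int n))"
  by (rule summable_on_union)
 moreover have "range int \<union> range (\<lambda>n. - int n) = UNIV"
 proof -
  have "i \<in> range int \<union> range (\<lambda>n. - int n)" for i :: int
   by (cases i rule: int_cases2) auto
  then show ?thesis by blast
 qed
 ultimately show ?thesis by simp
qed

lemma summable_wt: "(\<lambda>z. 1 / (wt z)^2) summable_on UNIV"
proof -
 let ?u = "\<lambda>i::int. 1 / (1 + \<bar>real_of_int i\<bar>)^2"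
 note s = summable_on_int_inverse_square
 have "(\<lambda>z. ?u (fst z) * ?u (snd z)) summable_on UNIV \<times> UNIV"
  by (rule summable_on_SigmaI[where g = "\<lambda>i. ?u i * infsum ?u UNIV"])
    (simp_all only: fst_conv snd_conv has_sum_cmult_right[OF has_sum_infsum[OF s]] summable_on_cmult_left[OF s], simp)
 then show ?thesis by (simp add: wt_def power_mult_distrib)
qed

lemma
 fixes f g :: "'a => complex" assumes "f summable_on A" "g summable_on A"
 shows infsum_minus: "(INFSUM z:A. f z - g z) = (INFSUM z:A. f z) - (INFSUM z:A. g z)"
  and summable_on_minus: "(\<lambda>z. f z - g z) summable_on A"
proof -
 have g: "(\<lambda>z. - g z) summable_on A" using assms(2) by (simp add: summable_on_uminus)
 show "(INFSUM z:A. f z - g z) = (INFSUM z:A. f z) - (INFSUM z:A. g z)"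
  using infsum_add[OF assms(1) g] by (simp add: infsum_uminus)
 show "(\<lambda>z. f z - g z) summable_on A" using summable_on_add[OF assms(1) g] by simp
qed

lemma tannery_infsum:
 fixes f :: "nat => 'a => complex"
 assumes b: "\<And>j z. cmod (f j z) \<le> h z" and h: "h summable_on UNIV"
  and lim: "\<And>z. (\<lambda>j. f j z) \<longlonglongrightarrow> g z"
 shows "(\<lambda>j. INFSUM z. f j z) \<longlonglongrightarrow> (INFSUM z. g z)"
proof -
 have gb: "cmod (g z) \<le> h z" for z
  by (rule tendsto_upperbound[OF tendsto_norm[OF lim]]) (auto simp: b)
 have e: "infsum u UNIV = integral\<^sup>L (count_space UNIV) u" if "\<And>z. cmod (u z) \<le> h z" for u
  using infsetsum_infsum[of u UNIV] Infinite_Sum.abs_summable_on_comparison_test'[OF h that]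
   abs_summable_equivalent[of u UNIV] that by (simp add: infsetsum_def)
 have "(\<lambda>z. norm (h z)) summable_on UNIV" using h order_trans[OF norm_ge_zero b[of 0]] by simp
 then have "integrable (count_space UNIV) h" using abs_summable_equivalent[of h UNIV] by (simp add: abs_summable_on_def)
 then show ?thesis unfolding e[OF b] e[OF gb]
  by (intro integral_dominated_convergence[where w = h]) (use b lim in auto)
qed

lemma finite_freq_ball: "finite {k. nf k \<le> R}"
 and card_freq_ball: "0 \<le> R ==> real (card {k. nf k \<le> R}) \<le> (2 * R + 1)^2"
proof -
 let ?I = "{-\<lfloor>R\<rfloor>..\<lfloor>R\<rfloor>}"
 have sub: "{k. nf k \<le> R} \<subseteq> ?I \<times> ?I"
 proof
  fix k assume k: "k \<in> {k. nf k \<le> R}"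
  have "norm (fst (freq k)) \<le> R" "norm (snd (freq k)) \<le> R"
   using k norm_fst_le[of "fst (freq k)" "snd (freq k)"] norm_snd_le[of "snd (freq k)" "fst (freq k)"]
   by simp_all
  then have "\<bar>fst k\<bar> \<le> \<lfloor>R\<rfloor>" "\<bar>snd k\<bar> \<le> \<lfloor>R\<rfloor>" by (simp_all add: freq_def le_floor_iff)
  then show "k \<in> ?I \<times> ?I" by (auto simp: mem_Times_iff)
 qed
 then show "finite {k. nf k \<le> R}" by (rule finite_subset) auto
 assume R: "0 \<le> R"
 have "card {k. nf k \<le> R} \<le> card (?I \<times> ?I)" using sub by (intro card_mono) auto
 also have "\<dots> = (nat (2 * \<lfloor>R\<rfloor> + 1))^2" by (simp add: card_cartesian_product power2_eq_square algebra_simps)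
 finally have "real (card {k. nf k \<le> R}) \<le> real ((nat (2 * \<lfloor>R\<rfloor> + 1))^2)" by simp
 also have "\<dots> = (real_of_int (2 * \<lfloor>R\<rfloor> + 1))^2" using R by simp
 also have "\<dots> \<le> (2 * R + 1)^2" using R by (intro power_mono) auto
 finally show "real (card {k. nf k \<le> R}) \<le> (2 * R + 1)^2" .
qed

text \<open>Samples of \<open>f\<close> at spacing \<open>1 / M\<close>, read as Fourier
  coefficients: the values of the resulting trigonometric polynomial are Riemann sums for the
  Fourier transform of \<open>f\<close>, up to scaling.\<close>

definition samp :: "real => (real \<times> real => real) => tdist" where
 "samp M f = (\<lambda>k. cor (f ((1 / M) *\<^sub>R freq k)))"

lemma samp_supp: assumes "\<And>x. f x \<noteq> 0 ==> norm x \<le> b" "0 < M"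
 shows "{k. samp M f k \<noteq> 0} \<subseteq> {k. nf k \<le> b * M}"
proof
 fix k assume "k \<in> {k. samp M f k \<noteq> 0}"
 then have "norm ((1 / M) *\<^sub>R freq k) \<le> b" by (intro assms) (auto simp: samp_def)
 then show "k \<in> {k. nf k \<le> b * M}" using assms(2) by (simp add: field_simps)
qed

lemma trig_series_diff: assumes "fs F" "fs G"
 shows "trig_series (\<lambda>k. F k - G k) x = trig_series F x - trig_series G x"
proof -
 let ?A = "{k. F k \<noteq> 0} \<union> {k. G k \<noteq> 0}"
 have A: "finite ?A" using assms by simp
 show ?thesis
  by (subst (1 2 3) trig_series_finite[OF A]) (auto simp: left_diff_distrib sum_subtractf)
qed

lemma trig_series_shift:
 "trig_series (\<lambda>k. F (k + u)) x = cis (- 2 * pi * (freq u \<bullet> x)) * trig_series F x"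
proof -
 have "bij_betw (\<lambda>k. k + u) UNIV UNIV" by (rule bij_betwI[where g = "\<lambda>k. k - u"]) auto
 from infsum_reindex_bij_betw[OF this, of "\<lambda>k. F k * cis (2 * pi * (freq (k - u) \<bullet> x))"]
 have "trig_series (\<lambda>k. F (k + u)) x = (INFSUM k. F k * cis (2 * pi * (freq (k - u) \<bullet> x)))"
  by (simp add: trig_series_def)
 also have "cis (2 * pi * (freq (k - u) \<bullet> x)) = cis (- 2 * pi * (freq u \<bullet> x)) * cis (2 * pi * (freq k \<bullet> x))" for k
  by (simp add: freq_diff inner_diff_left right_diff_distrib cis_mult)
 then have "(\<lambda>k. F k * cis (2 * pi * (freq (k - u) \<bullet> x)))
   = (\<lambda>k. cis (- 2 * pi * (freq u \<bullet> x)) * (F k * cis (2 * pi * (freq k \<bullet> x))))"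
  by (simp only: mult.left_commute)
 finally show ?thesis by (simp only: trig_series_def infsum_cmult_right')
qed

lemma fs_shift: assumes "fs F" shows "fs (\<lambda>k. F (k + u))"
proof (rule finite_subset)
 show "{k. F (k + u) \<noteq> 0} \<subseteq> (\<lambda>k. k - u) ` {k. F k \<noteq> 0}"
 proof
  fix k assume "k \<in> {k. F (k + u) \<noteq> 0}"
  then show "k \<in> (\<lambda>k. k - u) ` {k. F k \<noteq> 0}" by (intro image_eqI[where x = "k + u"]) auto
 qed
qed (use assms in simp)

text \<open>Summation by parts: shifting the coefficients multiplies the function by a character, so
  each difference brings one factor of the form \<open>cis t - 1\<close>.\<close>

lemma trig_series_fd_pow:
 assumes f: "\<And>x. f x \<noteq> 0 ==> norm x \<le> b" and M: "0 < M" and e: "nf u = 1"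
 shows "trig_series (samp M ((fd (freq u) (1 / M) ^^ p) f)) x
    = (cis (- 2 * pi * (freq u \<bullet> x)) - 1) ^ p * trig_series (samp M f) x"
proof (induction p)
 case (Suc p)
 let ?g = "(fd (freq u) (1 / M) ^^ p) f"
 have fsg: "fs (samp M ?g)"
 proof (rule finite_subset[OF samp_supp[OF _ M] finite_freq_ball])
  show "\<And>x. ?g x \<noteq> 0 ==> norm x \<le> b + p * (1 / M)"
   by (rule fd_pow_supp[OF f e]) (use M in auto)
 qed
 have "samp M ((fd (freq u) (1 / M) ^^ Suc p) f) = (\<lambda>k. samp M ?g (k + u) - samp M ?g k)"
  by (simp add: samp_def fd_def freq_add scaleR_right_distrib fun_eq_iff)
 then show ?case
  by (simp add: trig_series_diff[OF fs_shift[OF fsg] fsg] trig_series_shift Suc.IH algebra_simps)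
qed simp

lemma trig_series_bound:
 assumes "finite A" "{k. F k \<noteq> 0} \<subseteq> A" "\<And>k. cmod (F k) \<le> B"
 shows "cmod (trig_series F x) \<le> real (card A) * B" unfolding trig_series_finite[OF assms(1,2)]
 by (rule order_trans[OF norm_sum], rule sum_bounded_above) (use assms(3) in \<open>simp add: norm_mult\<close>)

text \<open>The factor \<open>M^2\<close> counts the lattice points in the dilated support, and
  \<open>M ^ p\<close> comes from \<open>p\<close> differences of step \<open>1 / M\<close> of a
  smooth function.\<close>

lemma trig_samp_decay: assumes f: "bump b f" and u: "u = (1, 0) \<or> u = (0, 1)"
 shows "\<exists>C\<ge>0. \<forall>M\<ge>1. \<forall>x. cmod (cis (- 2 * pi * (freq u \<bullet> x)) - 1) ^ p * cmod (trig_series (samp M f) x)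
   \<le> C * M^2 / M ^ p"
proof -
 have e: "freq u = (1, 0) \<or> freq u = (0, 1)" using u by (auto simp: freq_def)
 then have e1: "nf u = 1" by (auto simp: norm_prod_def)
 from fd_pow_bound[OF f e, of p] obtain C
  where C: "0 \<le> C" "\<And>h x. 0 < h ==> \<bar>(fd (freq u) h ^^ p) f x\<bar> \<le> C * h ^ p" by blast
 define c where "c = \<bar>b\<bar> + p"
 have fb: "norm x \<le> \<bar>b\<bar>" if "f x \<noteq> 0" for x using f that unfolding bump_def by (meson abs_ge_self order_trans)
 have "cmod (cis (- 2 * pi * (freq u \<bullet> x)) - 1) ^ p * cmod (trig_series (samp M f) x)
   \<le> ((2 * c + 1)^2 * C) * M^2 / M ^ p" if M: "1 \<le> M" for M x
 proof -
  let ?g = "(fd (freq u) (1 / M) ^^ p) f"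
  have M0: "0 < M" using M by simp
  have g: "norm x \<le> c" if "?g x \<noteq> 0" for x
  proof -
   have "norm x \<le> \<bar>b\<bar> + p * (1 / M)" by (rule fd_pow_supp[OF fb e1 _ that]) (use M in auto)
   also have "\<dots> \<le> c" unfolding c_def using M mult_left_mono[of 1 M "real p"] by (simp add: divide_le_eq)
   finally show ?thesis .
  qed
  have c0: "0 \<le> c" by (simp add: c_def)
  have "cmod (cis (- 2 * pi * (freq u \<bullet> x)) - 1) ^ p * cmod (trig_series (samp M f) x)
    = cmod (trig_series (samp M ?g) x)"
   by (simp add: trig_series_fd_pow[OF fb M0 e1] norm_mult norm_power)
  also have "\<dots> \<le> real (card {k. nf k \<le> c * M}) * (C * (1 / M) ^ p)"
   by (rule trig_series_bound[OF finite_freq_ball samp_supp[OF g M0]])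
     (use C M in \<open>auto simp: samp_def\<close>)
  also have "\<dots> \<le> (2 * (c * M) + 1)^2 * (C * (1 / M) ^ p)"
   using C M c0 by (intro mult_right_mono card_freq_ball) auto
  also have "\<dots> \<le> ((2 * c + 1) * M)^2 * (C * (1 / M) ^ p)"
   using C M c0 by (intro mult_right_mono power_mono) (auto simp: algebra_simps)
  also have "\<dots> = ((2 * c + 1)^2 * C) * M^2 / M ^ p"
   by (simp add: power_mult_distrib power_divide)
  finally show ?thesis .
 qed
 moreover have "0 \<le> (2 * c + 1)^2 * C" using C by simp
 ultimately show ?thesis by blast
qed

text \<open>Discrete Fourier coefficients of \<open>f\<close> for the period \<open>2 * L\<close>,
  from \<open>2 * L * M\<close> samples in each direction.\<close>

definition dft :: "nat => nat => (real \<times> real => real) => tdist" where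
 "dft L M f = (\<lambda>z. trig_series (samp M f) ((- 1 / real (2 * L * M)) *\<^sub>R freq z) / (real (2 * L * M))^2)"

text \<open>Inside the fundamental box the phase is at most pi in modulus, where
  \<open>cis t - 1\<close> is comparable to \<open>t\<close>. The decay in the phase therefore
  becomes decay in the index, and the powers of \<open>M\<close> cancel, so the bound is uniform in
  \<open>M\<close>.\<close>

lemma dft_decay1: assumes f: "bump b f" and u: "u = (1, 0) \<or> u = (0, 1)" and L: "0 < L"
 shows "\<exists>C\<ge>0. \<forall>M\<ge>1. \<forall>z. \<bar>freq u \<bullet> freq z\<bar> \<le> real (L * M) -->
   \<bar>freq u \<bullet> freq z\<bar> ^ p * cmod (dft L M f z) \<le> C"
proof -
 from trig_samp_decay[OF f u, of p] obtain C where C: "0 \<le> C"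
  "\<And>M x. 1 \<le> M ==> cmod (cis (- 2 * pi * (freq u \<bullet> x)) - 1) ^ p * cmod (trig_series (samp M f) x) \<le> C * M^2 / M ^ p"
  by blast
 have "\<bar>freq u \<bullet> freq z\<bar> ^ p * cmod (dft L M f z) \<le> C * (2 * L) ^ p" if M: "1 \<le> M" and z: "\<bar>freq u \<bullet> freq z\<bar> \<le> real (L * M)" for M z
 proof -
  define N where "N = real (2 * L * M)"
  define y where "y = freq u \<bullet> freq z"
  have N0: "0 < N" using L M by (simp add: N_def)
  let ?x = "(- 1 / N) *\<^sub>R freq z"
  define t where "t = - 2 * pi * (freq u \<bullet> ?x)"
  have t: "t = 2 * pi * y / N" by (simp add: t_def y_def)
  have "\<bar>y\<bar> \<le> N / 2" using z by (simp add: y_def N_def)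
  then have "\<bar>t\<bar> \<le> pi" using N0 by (simp add: t abs_mult field_simps)
  then have "\<bar>t\<bar> / 2 \<le> cmod (cis t - 1)" by (rule norm_cis_diff_1_ge)
  moreover have "\<bar>y\<bar> / N \<le> \<bar>t\<bar> / 2"
  proof -
   have "1 * \<bar>y\<bar> \<le> pi * \<bar>y\<bar>" using pi_gt3 by (intro mult_right_mono) auto
   then show ?thesis using N0 by (simp add: t abs_mult divide_right_mono)
  qed
  ultimately have y: "\<bar>y\<bar> / N \<le> cmod (cis t - 1)" by (rule order_trans[rotated])
  have "(\<bar>y\<bar> / N) ^ p * cmod (trig_series (samp M f) ?x) \<le> cmod (cis t - 1) ^ p * cmod (trig_series (samp M f) ?x)"
   using y N0 by (intro mult_right_mono power_mono) auto
  also have "\<dots> \<le> C * (real M)^2 / real M ^ p" unfolding t_def using C(2)[of "real M" ?x] M by simp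
  finally have "\<bar>y\<bar> ^ p * cmod (trig_series (samp M f) ?x) \<le> C * (real M)^2 / real M ^ p * N ^ p"
   using N0 by (simp add: power_divide divide_le_eq)
  also have "\<dots> = C * (real M)^2 * (2 * L) ^ p"
   using M by (simp add: N_def power_mult_distrib field_simps)
  finally have "\<bar>y\<bar> ^ p * cmod (trig_series (samp M f) ?x) / N^2 \<le> C * (real M)^2 * (2 * L) ^ p / N^2"
   using N0 by (intro divide_right_mono) auto
  also have "\<dots> = C * (2 * L) ^ p * ((real M)^2 / N^2)" by simp
  also have "\<dots> \<le> C * (2 * L) ^ p * 1"
  proof (intro mult_left_mono)
   have "real M \<le> N" using L by (simp add: N_def mult_le_cancel_right1)
   then show "(real M)^2 / N^2 \<le> 1" using N0 by (simp add: power_mono)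
  qed (use C in simp)
  finally show ?thesis by (simp add: dft_def y_def N_def norm_divide norm_power norm_mult)
 qed
 then show ?thesis using C(1) by (intro exI[of _ "C * (2 * L) ^ p"]) auto
qed

definition ibox :: "int => (int \<times> int) set" where "ibox R = {- R..<R} \<times> {- R..<R}"

lemma finite_ibox [simp]: "finite (ibox R)" by (simp add: ibox_def)

lemma dft_decay: assumes f: "bump b f" and L: "0 < L"
 shows "\<exists>C\<ge>0. \<forall>M\<ge>1. \<forall>z\<in>ibox (int (L * M)). cmod (dft L M f z) * wt z ^ q \<le> C"
proof -
 have u: "freq (1, 0) \<bullet> freq z = fst z" "freq (0, 1) \<bullet> freq z = snd z" for z
  by (auto simp: freq_def)
 from dft_decay1[OF f disjI1[OF refl] L, of 0] dft_decay1[OF f disjI1[OF refl] L, of "2 * q"]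
  dft_decay1[OF f disjI2[OF refl] L, of "2 * q"]
 obtain C0 C1 C2 where C: "0 \<le> C0" "0 \<le> C1" "0 \<le> C2"
  "\<And>M z. 1 \<le> M ==> \<bar>real_of_int (fst z)\<bar> \<le> real (L * M) ==> cmod (dft L M f z) \<le> C0"
  "\<And>M z. 1 \<le> M ==> \<bar>real_of_int (fst z)\<bar> \<le> real (L * M) ==> \<bar>real_of_int (fst z)\<bar> ^ (2 * q) * cmod (dft L M f z) \<le> C1"
  "\<And>M z. 1 \<le> M ==> \<bar>real_of_int (snd z)\<bar> \<le> real (L * M) ==> \<bar>real_of_int (snd z)\<bar> ^ (2 * q) * cmod (dft L M f z) \<le> C2"
  unfolding u power_0 mult_1 by (elim exE conjE) (rule that; blast)
 have "cmod (dft L M f z) * wt z ^ q \<le> 4 ^ q * (C0 + C1 + C2)" if M: "1 \<le> M" and z: "z \<in> ibox (int (L * M))" for M z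
 proof -
  have b: "\<bar>real_of_int (fst z)\<bar> \<le> real (L * M)" "\<bar>real_of_int (snd z)\<bar> \<le> real (L * M)"
   using z unfolding ibox_def by (auto simp: mem_Times_iff abs_le_iff simp del: of_nat_mult)
  \<comment> \<open>Whichever of 1 and the two coordinates realises the maximum, the matching one of
    the three bounds applies; \<open>wt z\<close> is at most \<open>4 * m^2\<close>, which explains
    the power \<open>2 * q\<close>.\<close>
  define m where "m = max 1 (max \<bar>real_of_int (fst z)\<bar> \<bar>real_of_int (snd z)\<bar>)"
  have "wt z \<le> (2 * m) * (2 * m)" unfolding wt_def by (intro mult_mono) (auto simp: m_def)
  then have "wt z ^ q \<le> 4 ^ q * m ^ (2 * q)"
   using power_mono[of "wt z" "4 * m^2" q] less_imp_le[OF wt_pos[of z]]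
   by (simp add: power_mult_distrib power_mult power2_eq_square)
  then have "cmod (dft L M f z) * wt z ^ q \<le> cmod (dft L M f z) * (4 ^ q * m ^ (2 * q))" by (intro mult_left_mono) auto
  also have "\<dots> = 4 ^ q * (m ^ (2 * q) * cmod (dft L M f z))" by simp
  also have "m ^ (2 * q) * cmod (dft L M f z) \<le> C0 + C1 + C2"
   using C(1-3) C(4)[OF M b(1)] C(5)[OF M b(1)] C(6)[OF M b(2)] by (auto simp: m_def max_def)
  finally show ?thesis by simp
 qed
 then show ?thesis using C(1-3) by (intro exI[of _ "4 ^ q * (C0 + C1 + C2)"]) auto
qed

lemma sum_cis_ibox:
 assumes R: "0 < R" and d: "\<bar>fst d\<bar> < 2 * int R" "\<bar>snd d\<bar> < 2 * int R"
 shows "(\<Sum>z\<in>ibox (int R). cis (2 * pi * (freq d \<bullet> freq z) / real (2 * R))) = (if d = 0 then (of_nat (2 * R))^2 else 0)"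
proof -
 let ?h = "\<lambda>w. (int (fst w) - int R, int (snd w) - int R)"
 have bij: "bij_betw ?h ({..<2 * R} \<times> {..<2 * R}) (ibox (int R))"
  by (rule bij_betwI[where g = "\<lambda>z. (nat (fst z + int R), nat (snd z + int R))"])
    (auto simp: ibox_def)
 \<comment> \<open>Centring the box only brings in a factor independent of \<open>w\<close>, which
   equals 1 in the one case, \<open>d = 0\<close>, where the sum does not vanish.\<close>
 have *: "cis (2 * pi * (freq d \<bullet> freq (?h w)) / real (2 * R))
   = cis (2 * pi * (freq d \<bullet> gridpt (2 * R) w)) * cis (- pi * (fst d + snd d))" for w
  unfolding cis_mult
  by (rule arg_cong[where f = cis]) (use R in \<open>simp add: freq_def gridpt_def field_simps\<close>)
 have "(\<Sum>z\<in>ibox (int R). cis (2 * pi * (freq d \<bullet> freq z) / real (2 * R)))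
   = (\<Sum>w\<in>{..<2 * R} \<times> {..<2 * R}. cis (2 * pi * (freq d \<bullet> freq (?h w)) / real (2 * R)))"
  by (rule sum.reindex_bij_betw[OF bij, symmetric])
 also have "\<dots> = (\<Sum>w\<in>{..<2 * R} \<times> {..<2 * R}. cis (2 * pi * (freq d \<bullet> gridpt (2 * R) w))) * cis (- pi * (fst d + snd d))"
  unfolding * sum_distrib_right ..
 also have "(\<Sum>w\<in>{..<2 * R} \<times> {..<2 * R}. cis (2 * pi * (freq d \<bullet> gridpt (2 * R) w)))
   = (if int (2 * R) dvd fst d \<and> int (2 * R) dvd snd d then (of_nat (2 * R))^2 else 0)"
  by (rule sum_cis_grid) (use R in simp)
 also have "int (2 * R) dvd fst d \<and> int (2 * R) dvd snd d \<longleftrightarrow> d = 0"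
 proof
  assume dv: "int (2 * R) dvd fst d \<and> int (2 * R) dvd snd d"
  have "fst d = 0" using dv d(1) zdvd_not_zless[of "\<bar>fst d\<bar>" "int (2 * R)"] by fastforce
  moreover have "snd d = 0" using dv d(2) zdvd_not_zless[of "\<bar>snd d\<bar>" "int (2 * R)"] by fastforce
  ultimately show "d = 0" by (simp add: prod_eq_iff)
 qed simp
 finally show ?thesis by simp
qed

lemma dft_inversion:
 assumes f: "\<And>x. f x \<noteq> 0 ==> norm x \<le> b" and L: "b < L" "0 < L" "1 \<le> M" and k: "k \<in> ibox (int (L * M))"
 shows "samp M f k = (\<Sum>z\<in>ibox (int (L * M)). dft L M f z * cis (2 * pi * (freq k \<bullet> freq z) / real (2 * L * M)))"
proof -
 let ?K = "ibox (int (L * M))"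
 let ?N = "real (2 * L * M)"
 have M0: "0 < real M" using L by simp
 have supp: "{k. samp M f k \<noteq> 0} \<subseteq> ?K"
 proof
  fix l assume "l \<in> {k. samp M f k \<noteq> 0}"
  then have "nf l \<le> b * M" using samp_supp[OF f M0] by auto
  also have "\<dots> < L * M" using L M0 by simp
  finally have n: "nf l < real (L * M)" by simp
  have "\<bar>real_of_int (fst l)\<bar> < real (L * M)" "\<bar>real_of_int (snd l)\<bar> < real (L * M)"
   using n norm_fst_le[of "fst (freq l)" "snd (freq l)"] norm_snd_le[of "snd (freq l)" "fst (freq l)"]
   by (simp_all add: freq_def)
  then have "\<bar>fst l\<bar> < int (L * M)" "\<bar>snd l\<bar> < int (L * M)" by linarith+
  then show "l \<in> ?K" by (auto simp: ibox_def mem_Times_iff)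
 qed
 have dft: "dft L M f z = (\<Sum>l\<in>?K. samp M f l * cis (- 2 * pi * (freq l \<bullet> freq z) / ?N)) / ?N^2" for z
  unfolding dft_def by (subst trig_series_finite[OF finite_ibox supp]) simp
 have "(\<Sum>z\<in>?K. dft L M f z * cis (2 * pi * (freq k \<bullet> freq z) / ?N))
   = (\<Sum>z\<in>?K. \<Sum>l\<in>?K. samp M f l * cis (2 * pi * (freq (k - l) \<bullet> freq z) / ?N) / ?N^2)"
 proof (rule sum.cong[OF refl])
  fix z
  have e: "cis (2 * pi * (freq (k - l) \<bullet> freq z) / ?N)
    = cis (- 2 * pi * (freq l \<bullet> freq z) / ?N) * cis (2 * pi * (freq k \<bullet> freq z) / ?N)" for l
   unfolding cis_mult
   by (rule arg_cong[where f = cis]) (simp add: freq_diff inner_diff_left right_diff_distrib diff_divide_distrib)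
  show "dft L M f z * cis (2 * pi * (freq k \<bullet> freq z) / ?N)
   = (\<Sum>l\<in>?K. samp M f l * cis (2 * pi * (freq (k - l) \<bullet> freq z) / ?N) / ?N^2)"
   unfolding dft e sum_divide_distrib sum_distrib_right by (intro sum.cong refl) simp
 qed
 also have "\<dots> = (\<Sum>l\<in>?K. samp M f l * (\<Sum>z\<in>?K. cis (2 * pi * (freq (k - l) \<bullet> freq z) / ?N)) / ?N^2)"
  by (subst sum.swap) (simp add: sum_distrib_left sum_divide_distrib)
 also have "\<dots> = (\<Sum>l\<in>?K. if l = k then samp M f k else 0)"
 proof (rule sum.cong[OF refl])
  fix l assume l: "l \<in> ?K"
  have d: "\<bar>fst (k - l)\<bar> < 2 * int (L * M)" "\<bar>snd (k - l)\<bar> < 2 * int (L * M)"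
   using l k by (auto simp: ibox_def mem_Times_iff)
  have LM: "0 < L * M" using L by simp
  have s: "(\<Sum>z\<in>?K. cis (2 * pi * (freq (k - l) \<bullet> freq z) / ?N)) = (if k - l = 0 then (of_nat (2 * L * M))^2 else 0)"
   using sum_cis_ibox[OF LM d] by (simp only: mult.assoc)
  have "cor ?N \<noteq> 0" using L by simp
  then show "samp M f l * (\<Sum>z\<in>?K. cis (2 * pi * (freq (k - l) \<bullet> freq z) / ?N)) / ?N^2 = (if l = k then samp M f k else 0)"
   unfolding s by auto
 qed
 also have "\<dots> = samp M f k" using k by simp
 finally show ?thesis ..
qed

text \<open>A Fourier series of period \<open>P\<close> in each coordinate with rapidly decreasing
  coefficients. It agrees with \<open>f\<close> on the ball of radius \<open>B\<close> only, since
  the series is periodic and \<open>f\<close> is not.\<close>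

definition rep :: "(real \<times> real => real) => real => real => tdist => bool" where
 "rep f B P c \<longleftrightarrow> 0 < P \<and> (\<forall>q. (\<lambda>z. cmod (c z) * wt z ^ q) summable_on UNIV) \<and>
  (\<forall>x. norm x \<le> B --> cor (f x) = (INFSUM z. c z * cis (2 * pi * (freq z \<bullet> x) / P)))"

text \<open>The coefficients are a subsequential limit of discrete ones at spacing
  \<open>2 ^ (-j)\<close>. Their decay, uniform in \<open>j\<close>, gives both compactness at each
  index and the domination needed to pass to the limit in the inversion formula.\<close>

theorem rep_exists: assumes f: "bump b f" shows "\<exists>P c. rep f B P c"
proof -
 \<comment> \<open>The box of half-width \<open>L\<close> contains the support of \<open>f\<close>
   and the ball of radius \<open>B\<close>, so periodisation does not wrap around.\<close>
 define L where "L = nat (\<lceil>max \<bar>b\<bar> \<bar>B\<bar>\<rceil> + 2)"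
 have Lr: "max \<bar>b\<bar> \<bar>B\<bar> + 2 \<le> L" unfolding L_def by linarith
 have L0: "0 < L" and bL: "b < L" using Lr by linarith+
 have fb: "\<And>x. f x \<noteq> 0 ==> norm x \<le> b" using f by (auto simp: bump_def)
 define A where "A j z = (if z \<in> ibox (int (L * 2 ^ j)) then dft L (2 ^ j) f z else 0)" for j z
 have dec: "\<exists>C\<ge>0. \<forall>j z. cmod (A j z) * wt z ^ q \<le> C" for q
 proof -
  from dft_decay[OF f L0, of q] obtain C where "0 \<le> C"
   "\<And>M z. 1 \<le> M ==> z \<in> ibox (int (L * M)) ==> cmod (dft L M f z) * wt z ^ q \<le> C" by blast
  then show ?thesis by (intro exI[of _ C]) (auto simp: A_def)
 qed
 have dec2: "\<exists>C. \<forall>j z. cmod (A j z) * wt z ^ q \<le> C * (1 / (wt z)^2)" for q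
 proof -
  from dec[of "q + 2"] obtain C where "\<And>j z. cmod (A j z) * wt z ^ (q + 2) \<le> C" by blast
  then show ?thesis by (intro exI[of _ C]) (simp add: power_add power2_eq_square field_simps)
 qed
 obtain C0 where C0: "\<And>j z. cmod (A j z) \<le> C0" using dec[of 0] by auto
 obtain r where r: "strict_mono (r::nat\<Rightarrow>nat)" "\<And>z. \<exists>l. (\<lambda>n. A (r n) z) \<longlonglongrightarrow> l"
  using function_convergent_subsequence[of UNIV A C0] C0 by auto
 from r(2) obtain c where c: "\<And>z. (\<lambda>n. A (r n) z) \<longlonglongrightarrow> c z" by metis
 have sm: "(\<lambda>z. cmod (c z) * wt z ^ q) summable_on UNIV" for q
 proof -
  from dec2[of q] obtain C where C: "\<And>j z. cmod (A j z) * wt z ^ q \<le> C * (1 / (wt z)^2)" by blast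
  have "cmod (c z) * wt z ^ q \<le> C * (1 / (wt z)^2)" for z
   by (rule tendsto_upperbound[OF tendsto_mult[OF tendsto_norm[OF c] tendsto_const]]) (use C in auto)
  then show ?thesis
   by (intro summable_le[OF summable_on_cmult_right[OF summable_wt]]) (simp add: abs_mult less_imp_le)
 qed
 define P where "P = 2 * real L"
 have P0: "0 < P" using L0 by (simp add: P_def)
 have "cor (f x) = (INFSUM z. c z * cis (2 * pi * (freq z \<bullet> x) / P))" if x: "norm x \<le> B" for x
 proof -
  \<comment> \<open>Discrete inversion is exact at points of the dyadic lattice; rounding down
    approximates \<open>x\<close> by such points.\<close>
  define kk where "kk j = (\<lfloor>2 ^ j * fst x\<rfloor>, \<lfloor>2 ^ j * snd x\<rfloor>)" for j :: nat
  define y where "y j = (1 / 2 ^ j) *\<^sub>R freq (kk j)" for j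
  have fl: "(\<lambda>j. real_of_int \<lfloor>2 ^ j * t\<rfloor> / 2 ^ j) \<longlonglongrightarrow> t" for t :: real
  proof (rule LIM_zero_cancel, rule Lim_null_comparison)
   have "norm (real_of_int \<lfloor>2 ^ j * t\<rfloor> / 2 ^ j - t) \<le> (1 / 2) ^ j" for j
   proof -
    have "real_of_int \<lfloor>2 ^ j * t\<rfloor> / 2 ^ j - t = (real_of_int \<lfloor>2 ^ j * t\<rfloor> - 2 ^ j * t) / 2 ^ j" by (simp add: field_simps)
    moreover have "\<bar>real_of_int \<lfloor>2 ^ j * t\<rfloor> - 2 ^ j * t\<bar> \<le> 1" by linarith
    ultimately show ?thesis by (simp add: power_divide divide_right_mono)
   qed
   then show "\<forall>\<^sub>F j in sequentially. norm (real_of_int \<lfloor>2 ^ j * t\<rfloor> / 2 ^ j - t) \<le> (1 / 2) ^ j" by simp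
  qed (rule LIMSEQ_realpow_zero, auto)
  have ylim: "y \<longlonglongrightarrow> x"
   using tendsto_Pair[OF fl[of "fst x"] fl[of "snd x"]] by (simp add: y_def[abs_def] kk_def freq_def)
  have kbox: "kk j \<in> ibox (int (L * 2 ^ j))" for j
  proof -
   have c1: "- int (L * 2 ^ j) \<le> \<lfloor>2 ^ j * t\<rfloor> \<and> \<lfloor>2 ^ j * t\<rfloor> < int (L * 2 ^ j)" if t: "\<bar>t\<bar> \<le> B" for t
   proof -
    have "\<bar>t\<bar> < real L" using t Lr by linarith
    then have "\<bar>2 ^ j * t\<bar> < real (L * 2 ^ j)" by (simp add: abs_mult mult.commute)
    then show ?thesis by linarith
   qed
   have "\<bar>fst x\<bar> \<le> B" "\<bar>snd x\<bar> \<le> B"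
    using x norm_fst_le[of "fst x" "snd x"] norm_snd_le[of "snd x" "fst x"] by simp_all
   then show ?thesis using c1 by (auto simp: ibox_def kk_def)
  qed
  have e: "cor (f (y j)) = (INFSUM z. A j z * cis (2 * pi * (freq z \<bullet> y j) / P))" for j
  proof -
   have "cor (f (y j)) = samp (2 ^ j) f (kk j)" by (simp add: samp_def y_def)
   also have "\<dots> = (\<Sum>z\<in>ibox (int (L * 2 ^ j)). dft L (2 ^ j) f z * cis (2 * pi * (freq (kk j) \<bullet> freq z) / real (2 * L * 2 ^ j)))"
    using dft_inversion[OF fb bL L0 _ kbox] by simp
   also have "\<dots> = (INFSUM z:ibox (int (L * 2 ^ j)). A j z * cis (2 * pi * (freq z \<bullet> y j) / P))"
    unfolding infsum_finite[OF finite_ibox]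
    by (intro sum.cong refl) (simp add: A_def y_def P_def inner_commute mult_ac)
   also have "\<dots> = (INFSUM z. A j z * cis (2 * pi * (freq z \<bullet> y j) / P))"
    by (rule infsum_cong_neutral) (auto simp: A_def)
   finally show ?thesis .
  qed
  have yr: "(\<lambda>n. y (r n)) \<longlonglongrightarrow> x" using LIMSEQ_subseq_LIMSEQ[OF ylim r(1)] by (simp add: o_def)
  have "isCont f x" using bump_continuous[OF f, of UNIV] by (simp add: continuous_on_eq_continuous_at)
  then have l1: "(\<lambda>n. cor (f (y (r n)))) \<longlonglongrightarrow> cor (f x)"
   by (intro tendsto_of_real isCont_tendsto_compose[OF _ yr])
  from dec2[of 0] obtain C where C: "\<And>j z. cmod (A j z) \<le> C * (1 / (wt z)^2)" by auto
  have "(\<lambda>n. cor (f (y (r n)))) \<longlonglongrightarrow> (INFSUM z. c z * cis (2 * pi * (freq z \<bullet> x) / P))"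
   unfolding e
  proof (rule tannery_infsum)
   show "cmod (A (r n) z * cis (2 * pi * (freq z \<bullet> y (r n)) / P)) \<le> C * (1 / (wt z)^2)" for n z
    using C by (simp add: norm_mult)
   show "(\<lambda>n. A (r n) z * cis (2 * pi * (freq z \<bullet> y (r n)) / P)) \<longlonglongrightarrow> c z * cis (2 * pi * (freq z \<bullet> x) / P)" for z
    unfolding cis_conv_exp by (intro tendsto_intros c yr) (use P0 in auto)
  qed (intro summable_on_cmult_right summable_wt)
  with l1 show ?thesis by (rule LIMSEQ_unique)
 qed
 with P0 sm show ?thesis unfolding rep_def by blast
qed

section \<open>Fourier multipliers at dyadic scales\<close>

definition dil :: "(real \<times> real => real) => nat => tdist => tdist" where
 "dil f n F = (\<lambda>k. cor (f ((1 / 2 ^ n) *\<^sub>R freq k)) * F k)"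

lemma rep_summable: "rep f B P c ==> (\<lambda>z. cmod (c z) * wt z ^ q) summable_on UNIV"
 by (simp add: rep_def)

lemma rep_summable0: "rep f B P c ==> (\<lambda>z. cmod (c z)) summable_on UNIV"
 using rep_summable[of f B P c 0] by simp

lemma rep_freq: assumes "rep f B P c" "nf k \<le> B * 2 ^ n"
 shows "cor (f ((1 / 2 ^ n) *\<^sub>R freq k))
  = (INFSUM z. c z * cis (2 * pi * (freq k \<bullet> ((1 / (P * 2 ^ n)) *\<^sub>R freq z))))"
proof -
 have "norm ((1 / 2 ^ n) *\<^sub>R freq k) \<le> B" using assms(2) by (simp add: field_simps)
 then have "cor (f ((1 / 2 ^ n) *\<^sub>R freq k)) = (INFSUM z. c z * cis (2 * pi * (freq z \<bullet> ((1 / 2 ^ n) *\<^sub>R freq k)) / P))"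
  using assms(1) by (simp add: rep_def)
 moreover have "2 * pi * (freq z \<bullet> ((1 / 2 ^ n) *\<^sub>R freq k)) / P = 2 * pi * (freq k \<bullet> ((1 / (P * 2 ^ n)) *\<^sub>R freq z))" for z
  by (simp add: inner_commute mult_ac)
 ultimately show ?thesis by (simp only:)
qed

lemma infsum_finite_sum:
 fixes f :: "'a => 'b => complex" assumes "finite A" "\<And>k. k \<in> A ==> f k summable_on I"
 shows "(\<lambda>z. \<Sum>k\<in>A. f k z) summable_on I" "(INFSUM z:I. \<Sum>k\<in>A. f k z) = (\<Sum>k\<in>A. INFSUM z:I. f k z)"
proof -
 have "(\<lambda>z. \<Sum>k\<in>A. f k z) summable_on I \<and> (INFSUM z:I. \<Sum>k\<in>A. f k z) = (\<Sum>k\<in>A. INFSUM z:I. f k z)"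
  using assms
 proof (induction A rule: finite_induct)
  case (insert a A)
  then have s: "f a summable_on I" "(\<lambda>z. \<Sum>k\<in>A. f k z) summable_on I" by auto
  show ?case using insert summable_on_add[OF s] infsum_add[OF s] by simp
 qed simp
 then show "(\<lambda>z. \<Sum>k\<in>A. f k z) summable_on I" "(INFSUM z:I. \<Sum>k\<in>A. f k z) = (\<Sum>k\<in>A. INFSUM z:I. f k z)" by auto
qed

lemma summable_bounded_factor:
 fixes c g :: "'a => complex"
 assumes "(\<lambda>z. cmod (c z)) summable_on I" "\<And>z. z \<in> I ==> cmod (g z) \<le> B"
 shows "(\<lambda>z. c z * g z) summable_on I"
proof (rule summable_le)
 show "(\<lambda>z. cmod (c z) * B) summable_on I" by (intro summable_on_cmult_left assms)
qed (auto simp: norm_mult intro!: mult_left_mono assms)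

lemma phase_le:
 assumes "0 \<le> s" shows "\<bar>2 * pi * (freq k \<bullet> (s *\<^sub>R freq z))\<bar> \<le> 2 * pi * s * nf k * wt z"
proof -
 have "\<bar>freq k \<bullet> freq z\<bar> \<le> nf k * nf z" by (rule Cauchy_Schwarz_ineq2)
 also have "\<dots> \<le> nf k * wt z" by (intro mult_left_mono norm_freq_le_wt) auto
 finally show ?thesis using assms by (simp add: abs_mult mult.assoc mult_left_mono)
qed

lemma ub_infsum: assumes A: "finite A" and supp: "\<And>z. {k. G z k \<noteq> 0} \<subseteq> A"
  and s: "\<And>k. (\<lambda>z. G z k) summable_on UNIV"
  and b: "\<And>z. ub (G z) (C z)" and C: "C summable_on UNIV"
 shows "ub (\<lambda>k. INFSUM z. G z k) (INFSUM z. C z)" unfolding ub_def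
proof
 fix x
 have "{k. (INFSUM z. G z k) \<noteq> 0} \<subseteq> A"
 proof
  fix k assume k: "k \<in> {k. (INFSUM z. G z k) \<noteq> 0}"
  show "k \<in> A"
  proof (rule ccontr)
   assume "k \<notin> A"
   then have "\<And>z. G z k = 0" using supp by blast
   then show False using k by simp
  qed
 qed
 then have "trig_series (\<lambda>k. INFSUM z. G z k) x = (\<Sum>k\<in>A. (INFSUM z. G z k) * cis (2 * pi * (freq k \<bullet> x)))"
  by (rule trig_series_finite[OF A])
 also have "\<dots> = (\<Sum>k\<in>A. INFSUM z. G z k * cis (2 * pi * (freq k \<bullet> x)))"
  by (simp only: infsum_cmult_left')
 also have "\<dots> = (INFSUM z. \<Sum>k\<in>A. G z k * cis (2 * pi * (freq k \<bullet> x)))"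
  by (rule infsum_finite_sum(2)[OF A, symmetric]) (intro summable_on_cmult_left s)
 also have "\<dots> = (INFSUM z. trig_series (G z) x)" by (simp only: trig_series_finite[OF A supp])
 finally have e: "trig_series (\<lambda>k. INFSUM z. G z k) x = (INFSUM z. trig_series (G z) x)" .
 show "cmod (trig_series (\<lambda>k. INFSUM z. G z k) x) \<le> (INFSUM z. C z)"
  unfolding e by (rule norm_infsum_le[OF has_sum_infsum has_sum_infsum])
   (use b C in \<open>auto simp: ub_def intro!: summable_le[OF C]\<close>)
qed

text \<open>On the ball where the expansion holds, the multiplier is a superposition of translations
  with weights \<open>c z\<close>. The scale only changes the translation vectors, so the absolute
  sum of the weights is a bound uniform in \<open>n\<close>, like the L1 norm of a rescaled
  kernel.\<close>

lemma ub_dil: assumes "bump b f"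
 shows "\<exists>C\<ge>0. \<forall>n F D. (\<forall>k. F k \<noteq> 0 --> nf k \<le> B * 2 ^ n) --> ub F D --> ub (dil f n F) (C * D)"
proof -
 from rep_exists[OF assms] obtain P c where rep: "rep f B P c" by blast
 note sc = rep_summable0[OF rep]
 define C where "C = (INFSUM z. cmod (c z))"
 have "ub (dil f n F) (C * D)" if F: "\<And>k. F k \<noteq> 0 ==> nf k \<le> B * 2 ^ n" and D: "ub F D" for n F D
 proof -
  let ?s = "1 / (P * 2 ^ n)"
  let ?G = "\<lambda>z k. c z * tr (?s *\<^sub>R freq z) F k"
  have "dil f n F = (\<lambda>k. INFSUM z. ?G z k)"
  proof
   fix k
   show "dil f n F k = (INFSUM z. ?G z k)"
   proof (cases "F k = 0")
    case False
    show ?thesis unfolding dil_def rep_freq[OF rep F[OF False]]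
     by (simp add: tr_def infsum_cmult_left' flip: mult.assoc)
   qed (simp add: dil_def tr_def)
  qed
  moreover have "ub (\<lambda>k. INFSUM z. ?G z k) (INFSUM z. cmod (c z) * D)"
  proof (rule ub_infsum[OF finite_freq_ball[of "B * 2 ^ n"]])
   show "{k. ?G z k \<noteq> 0} \<subseteq> {k. nf k \<le> B * 2 ^ n}" for z using F by (auto simp: tr_def)
   show "(\<lambda>z. ?G z k) summable_on UNIV" for k
    by (rule summable_bounded_factor[OF sc, of _ "cmod (F k)"]) (simp add: tr_def norm_mult)
   show "ub (?G z) (cmod (c z) * D)" for z by (intro ub_cmult ub_tr D)
  qed (intro summable_on_cmult_left sc)
  ultimately show ?thesis by (simp add: C_def infsum_cmult_left')
 qed
 moreover have "0 \<le> C" unfolding C_def by (rule infsum_nonneg) simp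
 ultimately show ?thesis by blast
qed

text \<open>A translation is multiplicative, so commuting it with multiplication by \<open>F\<close>
  leaves the difference of \<open>F\<close> and a translate of \<open>F\<close>. That difference
  costs a gradient and gains the length of the translation, which is of order
  \<open>wt z / 2 ^ n\<close>.\<close>

lemma hb_commutator: assumes "bump b f"
 shows "\<exists>C\<ge>0. \<forall>n F G Y D. (\<forall>k. F k \<noteq> 0 --> nf k \<le> B * 2 ^ n) -->
   (\<forall>k. G k \<noteq> 0 --> nf k \<le> B * 2 ^ n) --> hb 0 (\<lambda>k. cor (nf k) * F k) Y --> ub G D -->
   hb 0 (\<lambda>k. dil f n (tprod F G) k - tprod F (dil f n G) k) (C * Y * D / 2 ^ n)"
proof -
 \<comment> \<open>The radius is doubled because a frequency of the product is a sum of one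
   frequency from each factor.\<close>
 from rep_exists[OF assms] obtain P c where rep: "rep f (2 * B) P c" by blast
 have P: "0 < P" using rep by (simp add: rep_def)
 note sc = rep_summable0[OF rep]
 note sc1 = rep_summable[OF rep, of 1, simplified]
 define C where "C = (INFSUM z. cmod (c z) * wt z) * (2 * pi / P)"
 have "hb 0 (\<lambda>k. dil f n (tprod F G) k - tprod F (dil f n G) k) (C * Y * D / 2 ^ n)"
  if F: "\<And>k. F k \<noteq> 0 ==> nf k \<le> B * 2 ^ n" and G: "\<And>k. G k \<noteq> 0 ==> nf k \<le> B * 2 ^ n"
   and Y: "hb 0 (\<lambda>k. cor (nf k) * F k) Y" and D: "ub G D" for n F G Y D
 proof -
  define s where "s = 1 / (P * 2 ^ n)"
  have s0: "0 < s" using P by (simp add: s_def)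
  have Y0: "0 \<le> Y" by (rule hb_nonneg[OF Y])
  have D0: "0 \<le> D" by (rule ub_nonneg[OF D])
  define A where "A = {k. nf k \<le> B * 2 ^ n}"
  have fA: "finite A" by (simp add: A_def finite_freq_ball)
  have FA: "{k. F k \<noteq> 0} \<subseteq> A" using F by (auto simp: A_def)
  have fsF: "fs F" by (rule finite_subset[OF FA fA])
  have fsG: "fs G" by (rule finite_subset[of _ A]) (use G fA in \<open>auto simp: A_def\<close>)
  define F' where "F' z = (\<lambda>l. F l - tr (- (s *\<^sub>R freq z)) F l)" for z
  have F'A: "{k. F' z k \<noteq> 0} \<subseteq> A" for z using FA by (auto simp: F'_def tr_def)
  let ?H = "\<lambda>z k. c z * tr (s *\<^sub>R freq z) (tprod (F' z) G) k"
  have e: "(\<lambda>k. dil f n (tprod F G) k - tprod F (dil f n G) k) = (\<lambda>k. INFSUM z. ?H z k)"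
  proof
   fix k
   let ?e = "\<lambda>z l. cis (2 * pi * (freq l \<bullet> (s *\<^sub>R freq z)))"
   let ?t = "\<lambda>l z. c z * (?e z k * ((F l - cis (- (2 * pi * (freq l \<bullet> (s *\<^sub>R freq z)))) * F l) * G (k - l)))"
   have trm: "cor (f ((1 / 2 ^ n) *\<^sub>R freq k)) * (F l * G (k - l)) - F l * dil f n G (k - l)
     = (INFSUM z. ?t l z)" for l
   proof (cases "F l = 0 \<or> G (k - l) = 0")
    case False
    then have nl: "nf l \<le> B * 2 ^ n" and nkl: "nf (k - l) \<le> B * 2 ^ n" using F G by auto
    have B0: "0 \<le> B * 2 ^ n" using nl norm_ge_zero order_trans by blast
    have "nf k \<le> nf (k - l) + nf l"
     using norm_triangle_ineq[of "freq (k - l)" "freq l"] by (simp flip: freq_add)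
    then have nk: "nf k \<le> 2 * B * 2 ^ n" using nl nkl by simp
    have nkl': "nf (k - l) \<le> 2 * B * 2 ^ n" using nkl B0 by simp
    have "cor (f ((1 / 2 ^ n) *\<^sub>R freq k)) * (F l * G (k - l)) - F l * dil f n G (k - l)
      = (cor (f ((1 / 2 ^ n) *\<^sub>R freq k)) - cor (f ((1 / 2 ^ n) *\<^sub>R freq (k - l)))) * (F l * G (k - l))"
     by (simp add: dil_def algebra_simps)
    also have "\<dots> = (INFSUM z. (c z * ?e z k - c z * ?e z (k - l)) * (F l * G (k - l)))"
     unfolding rep_freq[OF rep nk] rep_freq[OF rep nkl'] s_def[symmetric]
     by (subst infsum_minus[symmetric]) (auto intro!: summable_bounded_factor[OF sc, of _ 1] simp: infsum_cmult_left')
    also have "\<dots> = (INFSUM z. ?t l z)"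
    proof (rule infsum_cong)
     fix z
     have "?e z (k - l) = ?e z k * cis (- (2 * pi * (freq l \<bullet> (s *\<^sub>R freq z))))"
      by (simp add: cis_mult freq_diff inner_diff_left algebra_simps)
     then show "(c z * ?e z k - c z * ?e z (k - l)) * (F l * G (k - l)) = ?t l z" by (simp add: algebra_simps)
    qed
    finally show ?thesis .
   qed (auto simp: dil_def)
   have st: "?t l summable_on UNIV" for l
   proof (rule summable_bounded_factor[OF sc, of _ "(cmod (F l) + cmod (F l)) * cmod (G (k - l))"])
    fix z
    show "cmod (?e z k * ((F l - cis (- (2 * pi * (freq l \<bullet> (s *\<^sub>R freq z)))) * F l) * G (k - l)))
     \<le> (cmod (F l) + cmod (F l)) * cmod (G (k - l))"
     using norm_triangle_ineq4[of "F l" "cis (- (2 * pi * (freq l \<bullet> (s *\<^sub>R freq z)))) * F l"]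
     by (simp only: norm_mult norm_cis mult_1_left mult_right_mono norm_ge_zero)
   qed
   have "dil f n (tprod F G) k - tprod F (dil f n G) k
     = (\<Sum>l\<in>A. cor (f ((1 / 2 ^ n) *\<^sub>R freq k)) * (F l * G (k - l)) - F l * dil f n G (k - l))"
    unfolding dil_def[of f n "tprod F G"] tprod_finite[OF fA FA] by (simp add: sum_distrib_left sum_subtractf)
   also have "\<dots> = (\<Sum>l\<in>A. INFSUM z. ?t l z)" by (simp only: trm)
   also have "\<dots> = (INFSUM z. \<Sum>l\<in>A. ?t l z)" by (rule infsum_finite_sum(2)[OF fA st, symmetric])
   also have "\<dots> = (INFSUM z. ?H z k)"
    unfolding tr_def[of "s *\<^sub>R freq _"] tprod_finite[OF fA F'A]
    by (simp add: F'_def tr_def sum_distrib_left)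
   finally show "dil f n (tprod F G) k - tprod F (dil f n G) k = (INFSUM z. ?H z k)" .
  qed
  have bnd: "hb 0 (?H z) (cmod (c z) * (((2 * pi * s * wt z) * Y) * D))" for z
  proof (intro hb_cmult hb_tr hb_tprod D fsG)
   show "fs (F' z)" by (rule finite_subset[OF F'A fA])
   show "hb 0 (F' z) (2 * pi * s * wt z * Y)"
   proof (rule hb_le[OF Y])
    show "0 \<le> 2 * pi * s * wt z" using s0 less_imp_le[OF wt_pos[of z]] by simp
    fix l
    have "F' z l = - ((cis (- (2 * pi * (freq l \<bullet> (s *\<^sub>R freq z)))) - 1) * F l)"
     by (simp add: F'_def tr_def algebra_simps)
    then have "cmod (F' z l) = cmod (cis (- (2 * pi * (freq l \<bullet> (s *\<^sub>R freq z)))) - 1) * cmod (F l)"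
     by (simp add: norm_mult)
    also have "\<dots> \<le> (2 * pi * s * nf l * wt z) * cmod (F l)"
     using norm_cis_diff_1_le[of "- (2 * pi * (freq l \<bullet> (s *\<^sub>R freq z)))"] phase_le[of s l z] s0
     by (intro mult_right_mono) (auto intro: order_trans)
    finally show "jap l powr 0 * cmod (F' z l) \<le> 2 * pi * s * wt z * (jap l powr 0 * cmod (cor (nf l) * F l))"
     by (simp add: norm_mult mult_ac mult_right_mono)
   qed
  qed
  have "hb 0 (\<lambda>k. INFSUM z. ?H z k) (INFSUM z. cmod (c z) * (((2 * pi * s * wt z) * Y) * D))"
  proof (rule hb_infsum(2)[OF bnd])
   have "(\<lambda>z. (2 * pi * s * Y * D) * (cmod (c z) * wt z)) summable_on UNIV"
    by (intro summable_on_cmult_right sc1)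
   then show "(\<lambda>z. cmod (c z) * (((2 * pi * s * wt z) * Y) * D)) summable_on UNIV"
    by (simp add: mult_ac)
  qed
  also have "(INFSUM z. cmod (c z) * (((2 * pi * s * wt z) * Y) * D)) = (INFSUM z. (2 * pi * s * Y * D) * (cmod (c z) * wt z))"
   by (simp add: mult_ac)
  also have "\<dots> = C * Y * D / 2 ^ n"
   by (simp only: infsum_cmult_right') (simp add: C_def s_def)
  finally show ?thesis unfolding e .
 qed
 moreover have "0 \<le> C" unfolding C_def using P by (intro mult_nonneg_nonneg infsum_nonneg) (auto simp: less_imp_le)
 ultimately show ?thesis by blast
qed

text \<open>Differentiation of the vanishing sum under the summation sign, one order at a time:
  difference quotients along a sequence \<open>h n\<close> that keeps \<open>t + h n\<close> in the
  interval, with domination from the moments of all orders.\<close>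

lemma trig_moments_zero:
 fixes a :: "int \<times> int => complex" and w :: "int \<times> int => real"
 assumes a: "\<And>q. (\<lambda>z. cmod (a z) * wt z ^ q) summable_on UNIV"
  and w: "\<And>z. \<bar>w z\<bar> \<le> W * wt z" and d: "0 < \<delta>"
  and zero: "\<And>t. \<bar>t\<bar> < \<delta> ==> (INFSUM z. a z * cis (t * w z)) = 0"
 shows "\<bar>t\<bar> < \<delta> ==> (INFSUM z. a z * (\<i> * w z) ^ m * cis (t * w z)) = 0"
proof (induction m arbitrary: t)
 case 0 then show ?case using zero by simp
next
 case (Suc m)
 have s: "(\<lambda>z. cmod (a z) * \<bar>w z\<bar> ^ q) summable_on UNIV" for q
 proof (rule summable_le[OF summable_on_cmult_right[OF a[of q], of "W ^ q"]])
  show "norm (cmod (a z) * \<bar>w z\<bar> ^ q) \<le> W ^ q * (cmod (a z) * wt z ^ q)" for z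
   using mult_left_mono[OF power_mono[OF w[of z], of q], of "cmod (a z)"] by (simp add: power_mult_distrib mult_ac)
 qed
 have sc: "(\<lambda>z. a z * (\<i> * w z) ^ q * cis (x z)) summable_on UNIV" for q x
  by (rule summable_le[OF s[of q]]) (simp add: norm_mult norm_power)
 define h where "h n = (\<delta> - \<bar>t\<bar>) / 2 * inverse (real (Suc n))" for n
 have h: "0 < h n" "\<bar>t + h n\<bar> < \<delta>" for n
 proof -
  show h0: "0 < h n" using Suc.prems by (simp add: h_def)
  have "h n \<le> (\<delta> - \<bar>t\<bar>) / 2" unfolding h_def using Suc.prems by (intro mult_left_le) (auto simp: field_simps)
  then show "\<bar>t + h n\<bar> < \<delta>" using abs_triangle_ineq[of t "h n"] h0 Suc.prems by (simp add: field_simps)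
 qed
 have h_lim: "h \<longlonglongrightarrow> 0" unfolding h_def by (intro tendsto_mult_right_zero LIMSEQ_inverse_real_of_nat)
 let ?b = "\<lambda>z. a z * (\<i> * w z) ^ m" and ?d = "\<lambda>n z. (cis ((t + h n) * w z) - cis (t * w z)) / h n"
 have "(\<lambda>n. INFSUM z. ?b z * ?d n z) \<longlonglongrightarrow> (INFSUM z. ?b z * (\<i> * w z * cis (t * w z)))"
 proof (rule tannery_infsum[OF _ s[of "Suc m"]])
  fix n z
  have "cis ((t + h n) * w z) - cis (t * w z) = cis (t * w z) * (cis (h n * w z) - 1)"
   by (simp add: cis_mult distrib_right right_diff_distrib)
  then have "cmod (?d n z) \<le> \<bar>w z\<bar>"
   using norm_cis_diff_1_le[of "h n * w z"] h(1)[of n] by (simp add: norm_mult norm_divide divide_le_eq abs_mult mult.commute)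
  from mult_left_mono[OF this, of "cmod (?b z)"]
  show "cmod (?b z * ?d n z) \<le> cmod (a z) * \<bar>w z\<bar> ^ Suc m" by (simp add: norm_mult norm_power norm_divide mult_ac)
 next
  fix z
  have "((\<lambda>u::complex. exp (\<i> * ((t + u) * w z))) has_field_derivative \<i> * w z * exp (\<i> * (t * w z))) (at 0)"
   by (auto intro!: derivative_eq_intros)
  then have "(\<lambda>u::complex. (exp (\<i> * ((t + u) * w z)) - exp (\<i> * (t * w z))) / u) \<midarrow>0\<rightarrow> \<i> * w z * exp (\<i> * (t * w z))"
   by (simp add: has_field_derivative_iff)
  moreover have "filterlim (\<lambda>n. cor (h n)) (at 0) sequentially"
   using tendsto_of_real[OF h_lim, where 'a = complex] h(1) by (auto simp: filterlim_at less_imp_neq[THEN not_sym])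
  ultimately have "(\<lambda>n. ?d n z) \<longlonglongrightarrow> \<i> * w z * cis (t * w z)"
   by (auto dest: filterlim_compose simp: cis_conv_exp)
  then show "(\<lambda>n. ?b z * ?d n z) \<longlonglongrightarrow> ?b z * (\<i> * w z * cis (t * w z))" by (intro tendsto_mult tendsto_const)
 qed
 moreover have "(INFSUM z. ?b z * ?d n z) = 0" for n
 proof -
  have "(INFSUM z. ?b z * ?d n z) = (INFSUM z. ?b z * cis ((t + h n) * w z) - ?b z * cis (t * w z)) * inverse (h n)"
   unfolding infsum_cmult_left'[symmetric] by (simp add: field_simps)
  then show ?thesis unfolding infsum_minus[OF sc sc] using Suc.IH[OF h(2)] Suc.IH[OF Suc.prems] by simp
 qed
 ultimately show ?case by (simp add: LIMSEQ_const_iff mult_ac)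
qed

text \<open>If the symbol \<open>f\<close> vanishes to infinite order at the frequencies of \<open>F\<close>, then the low
 frequencies of \<open>F \<cdot> (f(2\<^sup>-\<^sup>n D) G)\<close> are small: subtract from each exponential of the Fourier expansion
 of \<open>f\<close> its Taylor polynomial in the output frequency, whose contribution is zero.\<close>

lemma hb_low_output: assumes "bump b f" and even: "\<And>x. f (- x) = f x"
 shows "\<exists>C\<ge>0. \<forall>n F G K. (\<forall>k. F k \<noteq> 0 --> nf k \<le> B * 2 ^ n) -->
   (\<forall>k. G k \<noteq> 0 --> nf k \<le> B * 2 ^ n) -->
   (\<forall>k. F k \<noteq> 0 --> (\<exists>e>0. \<forall>x. norm (x - (1 / 2 ^ n) *\<^sub>R freq k) < e --> f x = 0)) -->
   (\<forall>y. hb 0 (tprod (tr y F) G) K) --> hb (- real M) (tprod F (dil f n G)) (C * K / 2 ^ (n * M))"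
proof -
 from rep_exists[OF assms(1)] obtain P c where rep: "rep f (\<bar>B\<bar> + 1) P c" by blast
 have P: "0 < P" using rep by (simp add: rep_def)
 note sc = rep_summable0[OF rep]
 note scM = rep_summable[OF rep, of M]
 define C where "C = (INFSUM z. cmod (c z) * wt z ^ M) * (2 * pi / P) ^ M"
 \<comment> \<open>The Taylor remainder of order \<open>M\<close>. Each of its \<open>M\<close>
   powers of the phase contributes one factor \<open>2 ^ (-n)\<close> and one power of the output
   frequency, which the index \<open>- real M\<close> absorbs.\<close>
 define r where "r t = cis t - (\<Sum>m<M. (\<i> * cor t) ^ m / fact m)" for t :: real
 have r: "cmod (r t) \<le> \<bar>t\<bar> ^ M" for t
 proof (cases M)
  case (Suc m)
  have "cmod (r t) \<le> \<bar>t\<bar> ^ Suc m / fact (Suc m)"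
   using iexp_approx1[of t m] unfolding r_def Suc cis_conv_exp lessThan_Suc_atMost by simp
  also have "\<dots> \<le> \<bar>t\<bar> ^ Suc m / 1"
   by (intro divide_left_mono) (auto simp: fact_ge_1 simp del: fact_Suc)
  finally show ?thesis using Suc by simp
 qed (simp add: r_def)
 have "hb (- real M) (tprod F (dil f n G)) (C * K / 2 ^ (n * M))"
  if F: "\<And>k. F k \<noteq> 0 ==> nf k \<le> B * 2 ^ n" and G: "\<And>k. G k \<noteq> 0 ==> nf k \<le> B * 2 ^ n"
   and van: "\<And>k. F k \<noteq> 0 ==> \<exists>e>0. \<forall>x. norm (x - (1 / 2 ^ n) *\<^sub>R freq k) < e --> f x = 0"
   and K: "\<And>y. hb 0 (tprod (tr y F) G) K" for n F G K
 proof -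
  define s where "s = 1 / (P * 2 ^ n)"
  have s0: "0 < s" using P by (simp add: s_def)
  have K0: "0 \<le> K" by (rule hb_nonneg[OF K])
  define A where "A = {k. nf k \<le> B * 2 ^ n}"
  have fA: "finite A" by (simp add: A_def finite_freq_ball)
  have FA: "{k. F k \<noteq> 0} \<subseteq> A" using F by (auto simp: A_def)
  define th where "th z k = 2 * pi * (freq k \<bullet> (s *\<^sub>R freq z))" for z k
  have th: "\<bar>th z k\<bar> \<le> 2 * pi * s * nf k * wt z" for z k
   unfolding th_def using s0 by (intro phase_le) simp
  let ?H = "\<lambda>z k. c z * (r (th z k) * tprod (tr (- (s *\<^sub>R freq z)) F) G k)"
  have e: "tprod F (dil f n G) = (\<lambda>k. INFSUM z. ?H z k)"
  proof
   fix k
   let ?t = "\<lambda>l z. c z * (r (th z k) * (cis (- th z l) * F l * G (k - l)))"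
   have sq: "(\<lambda>z. c z * cis (- th z l) * (\<i> * th z k) ^ q * x) summable_on UNIV" for q l x
   proof -
    have "(\<lambda>z. c z * cis (- th z l) * (\<i> * th z k) ^ q) summable_on UNIV"
    proof (rule summable_le[OF summable_on_cmult_right[OF rep_summable[OF rep, of q]]])
     show "norm (c z * cis (- th z l) * (\<i> * th z k) ^ q) \<le> (2 * pi * s * nf k) ^ q * (cmod (c z) * wt z ^ q)" for z
      using mult_left_mono[OF power_mono[OF th[of z k], of q], of "cmod (c z)"]
      by (simp add: norm_mult norm_power power_mult_distrib mult_ac)
    qed
    then show ?thesis by (rule summable_on_cmult_left)
   qed
   have rexp: "c z * (r (th z k) * (cis (- th z l) * x)) = c z * cis (th z k - th z l) * x
     - (\<Sum>m<M. c z * cis (- th z l) * (\<i> * th z k) ^ m * (x / fact m))" for z l x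
   proof -
    have "cis (th z k - th z l) = cis (th z k) * cis (- th z l)" by (simp add: cis_mult)
    then show ?thesis by (simp add: r_def algebra_simps sum_distrib_left)
   qed
   have sc': "(\<lambda>z. c z * cis (th z k - th z l) * x) summable_on UNIV" for l x
    by (intro summable_on_cmult_left summable_bounded_factor[OF sc, of _ 1]) simp
   have ssum: "(\<lambda>z. \<Sum>m<M. c z * cis (- th z l) * (\<i> * th z k) ^ m * (x / fact m)) summable_on UNIV" for l x
    by (rule infsum_finite_sum(1)[OF finite_lessThan sq])
   have st: "?t l summable_on UNIV" for l
    unfolding mult.assoc[of _ "F l"] rexp by (rule summable_on_minus[OF sc' ssum])
   have trm: "F l * dil f n G (k - l) = (INFSUM z. ?t l z)" for l
   proof (cases "F l = 0 \<or> G (k - l) = 0")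
    case False
    then have nl: "nf l \<le> B * 2 ^ n" and nkl: "nf (k - l) \<le> B * 2 ^ n" using F G by auto
    have nkl': "nf (k - l) \<le> (\<bar>B\<bar> + 1) * 2 ^ n"
     using nkl by (rule order_trans) (intro mult_right_mono, auto)
    from van[of l] False obtain e where e: "0 < e" "\<And>x. norm (x - (1 / 2 ^ n) *\<^sub>R freq l) < e ==> f x = 0" by auto
    \<comment> \<open>Small enough that the argument of \<open>f\<close> stays in the ball of radius
      \<open>\<bar>B\<bar> + 1\<close>, where the expansion is valid, and, after a reflection that
      the even \<open>f\<close> does not notice, within \<open>e\<close> of the rescaled frequency
      \<open>l\<close>, where \<open>f\<close> vanishes.\<close>
    define \<delta> where "\<delta> = min 1 (e * 2 ^ n) / (nf k + 1)"
    have kp: "0 < nf k + 1" using norm_ge_zero[of "freq k"] by linarith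
    have d0: "0 < \<delta>" using e kp by (simp add: \<delta>_def)
    have zero: "(INFSUM z. c z * cis (- th z l) * cis (t * th z k)) = 0" if t: "\<bar>t\<bar> < \<delta>" for t
    proof -
     define x where "x = (1 / 2 ^ n) *\<^sub>R (t *\<^sub>R freq k - freq l)"
     have "\<bar>t\<bar> * (nf k + 1) < min 1 (e * 2 ^ n)" using t kp by (simp add: \<delta>_def pos_less_divide_eq)
     then have t1: "\<bar>t\<bar> * nf k < 1" and t2: "\<bar>t\<bar> * nf k < e * 2 ^ n"
      by (simp_all add: distrib_left) (use abs_ge_zero[of t] in linarith)+
     have "(1::real) \<le> 2 ^ n" "B * 2 ^ n \<le> \<bar>B\<bar> * 2 ^ n" by (auto intro: mult_right_mono)
     then have "norm (t *\<^sub>R freq k - freq l) \<le> (\<bar>B\<bar> + 1) * 2 ^ n"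
      using norm_triangle_ineq4[of "t *\<^sub>R freq k" "freq l", unfolded norm_scaleR] t1 nl unfolding distrib_right by linarith
     then have nx: "norm x \<le> \<bar>B\<bar> + 1" unfolding x_def norm_scaleR by (simp add: field_simps)
     have "norm (- x - (1 / 2 ^ n) *\<^sub>R freq l) < e"
     proof -
      have e1: "- x - (1 / 2 ^ n) *\<^sub>R freq l = (- t / 2 ^ n) *\<^sub>R freq k" by (simp add: x_def scaleR_diff_right)
      show ?thesis unfolding e1 using t2 by (simp add: field_simps)
     qed
     then have "f x = 0" using e(2)[of "- x"] even[of x] by simp
     moreover have "cor (f x) = (INFSUM z. c z * cis (2 * pi * (freq z \<bullet> x) / P))"
      using rep nx by (simp add: rep_def)
     moreover have "cis (2 * pi * (freq z \<bullet> x) / P) = cis (- th z l) * cis (t * th z k)" for z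
      unfolding cis_mult using P
      by (intro arg_cong[where f = cis]) (simp add: x_def th_def s_def inner_commute[of _ "freq z"] inner_diff_right field_simps)
     ultimately show ?thesis by (simp add: mult.assoc)
    qed
    \<comment> \<open>As a function of \<open>t\<close>, \<open>f\<close> at the rescaled point
      \<open>t * k - l\<close> vanishes near 0, and so do all its derivatives; these are the
      subtracted Taylor terms.\<close>
    have mom: "(INFSUM z. c z * cis (- th z l) * (\<i> * th z k) ^ m * x) = 0" for m x
    proof -
     have "(INFSUM z. c z * cis (- th z l) * (\<i> * th z k) ^ m * cis (0 * th z k)) = 0"
     proof (rule trig_moments_zero[OF _ _ d0 zero])
      show "(\<lambda>z. cmod (c z * cis (- th z l)) * wt z ^ q) summable_on UNIV" for q
       using rep_summable[OF rep, of q] by (simp add: norm_mult)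
      show "\<bar>th z k\<bar> \<le> 2 * pi * s * nf k * wt z" for z by (rule th)
     qed (use d0 in auto)
     then show ?thesis by (simp add: infsum_cmult_left')
    qed
    have "F l * dil f n G (k - l) = (INFSUM z. c z * cis (th z (k - l))) * (F l * G (k - l))"
     unfolding dil_def rep_freq[OF rep nkl'] by (simp add: th_def s_def)
    also have "\<dots> = (INFSUM z. c z * cis (th z k - th z l) * (F l * G (k - l)))"
     unfolding infsum_cmult_left' by (simp add: th_def freq_diff inner_diff_left right_diff_distrib)
    also have "\<dots> = (INFSUM z. c z * cis (th z k - th z l) * (F l * G (k - l)))
      - (INFSUM z. \<Sum>m<M. c z * cis (- th z l) * (\<i> * th z k) ^ m * ((F l * G (k - l)) / fact m))"
     unfolding infsum_finite_sum(2)[OF finite_lessThan sq] mom by simp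
    also have "\<dots> = (INFSUM z. c z * cis (th z k - th z l) * (F l * G (k - l))
      - (\<Sum>m<M. c z * cis (- th z l) * (\<i> * th z k) ^ m * ((F l * G (k - l)) / fact m)))"
     by (rule infsum_minus[OF sc' ssum, symmetric])
    also have "\<dots> = (INFSUM z. ?t l z)"
     by (rule infsum_cong) (subst rexp[symmetric], simp only: mult.assoc)
    finally show ?thesis .
   qed (auto simp: dil_def)
   have "tprod F (dil f n G) k = (\<Sum>l\<in>A. INFSUM z. ?t l z)"
    unfolding tprod_finite[OF fA FA] by (simp only: trm)
   also have "\<dots> = (INFSUM z. \<Sum>l\<in>A. ?t l z)" by (rule infsum_finite_sum(2)[OF fA st, symmetric])
   also have "\<dots> = (INFSUM z. ?H z k)"
   proof (rule infsum_cong)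
    fix z
    have "{l. tr (- (s *\<^sub>R freq z)) F l \<noteq> 0} \<subseteq> A" using FA by (simp add: tr_supp)
    from tprod_finite[OF fA this] show "(\<Sum>l\<in>A. ?t l z) = ?H z k" by (simp add: tr_def th_def sum_distrib_left mult_ac)
   qed
   finally show "tprod F (dil f n G) k = (INFSUM z. ?H z k)" .
  qed
  have bnd: "hb (- real M) (?H z) (cmod (c z) * ((2 * pi * s * wt z) ^ M * K))" for z
  proof (intro hb_cmult hb_le[OF K])
   show "0 \<le> (2 * pi * s * wt z) ^ M" using s0 less_imp_le[OF wt_pos[of z]] by (intro zero_le_power) simp
   fix k
   have jm: "jap k powr - real M = inverse (jap k ^ M)" by (simp add: powr_minus powr_realpow)
   have "cmod (r (th z k)) \<le> (2 * pi * s * nf k * wt z) ^ M"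
    by (rule order_trans[OF r power_mono[OF th]]) simp
   also have "\<dots> \<le> (2 * pi * s * jap k * wt z) ^ M"
    using s0 less_imp_le[OF wt_pos[of z]] norm_freq_le_jap'[of k] by (intro power_mono mult_right_mono mult_left_mono) auto
   finally have "jap k powr - real M * cmod (r (th z k)) \<le> jap k powr - real M * (2 * pi * s * jap k * wt z) ^ M"
    by (intro mult_left_mono) auto
   also have "\<dots> = (2 * pi * s * wt z) ^ M" by (simp add: jm power_mult_distrib field_simps)
   finally have "jap k powr - real M * cmod (r (th z k)) * cmod (tprod (tr (- (s *\<^sub>R freq z)) F) G k)
     \<le> (2 * pi * s * wt z) ^ M * cmod (tprod (tr (- (s *\<^sub>R freq z)) F) G k)" by (rule mult_right_mono) simp
   then show "jap k powr - real M * cmod (r (th z k) * tprod (tr (- (s *\<^sub>R freq z)) F) G k)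
     \<le> (2 * pi * s * wt z) ^ M * (jap k powr 0 * cmod (tprod (tr (- (s *\<^sub>R freq z)) F) G k))"
    by (simp add: norm_mult mult.assoc)
  qed
  have eq: "cmod (c z) * ((2 * pi * s * wt z) ^ M * K) = ((2 * pi * s) ^ M * K) * (cmod (c z) * wt z ^ M)" for z
   by (simp add: power_mult_distrib mult_ac)
  have "hb (- real M) (\<lambda>k. INFSUM z. ?H z k) (INFSUM z. cmod (c z) * ((2 * pi * s * wt z) ^ M * K))"
   by (rule hb_infsum(2)[OF bnd]) (unfold eq, intro summable_on_cmult_right scM)
  also have "(INFSUM z. cmod (c z) * ((2 * pi * s * wt z) ^ M * K)) = C * K / 2 ^ (n * M)"
   unfolding eq infsum_cmult_right' by (simp add: C_def s_def power_mult_distrib power_divide power_mult)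
  finally show ?thesis unfolding e .
 qed
 moreover have "0 \<le> C" unfolding C_def using P by (intro mult_nonneg_nonneg infsum_nonneg) (auto simp: less_imp_le)
 ultimately show ?thesis by blast
qed

section \<open>Littlewood--Paley blocks\<close>

lemma hb_mult_le_1:
 assumes "hb s f C" "\<And>k. cmod (m k) \<le> 1" shows "hb s (\<lambda>k. m k * f k) C"
 by (rule hb_le1[OF assms(1)])
   (use assms(2) in \<open>auto simp: norm_mult intro!: mult_left_mono mult_left_le_one_le\<close>)

lemma jap_powr_le: assumes "0 < l" "l * 2 ^ n \<le> jap k" "jap k \<le> u * 2 ^ n"
 shows "jap k powr r \<le> (l powr r + u powr r) * dyad n r"
proof -
 have u: "0 < u"
 proof (rule ccontr)
  assume "\<not> 0 < u"
  then have "u * 2 ^ n \<le> 0" by (simp add: mult_nonpos_nonneg)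
  then show False using assms(3) jap_pos[of k] by linarith
 qed
 have p: "dyad n r = (2 ^ n) powr r" by (simp add: powr_powr flip: powr_realpow)
 show ?thesis
 proof (cases "0 \<le> r")
  case True
  have "jap k powr r \<le> (u * 2 ^ n) powr r" using assms True by (intro powr_mono2) auto
  also have "\<dots> = u powr r * dyad n r" using u by (simp add: powr_mult p)
  finally show ?thesis by (simp add: distrib_right add_increasing)
 next
  case False
  have "jap k powr r \<le> (l * 2 ^ n) powr r" using assms False by (intro powr_mono2') auto
  also have "\<dots> = l powr r * dyad n r" using assms by (simp add: powr_mult p)
  finally show ?thesis by (simp add: distrib_right add_increasing2)
 qed
qed

lemma hb_annulus:
 assumes f: "hb s f C" and l: "0 < l" and supp: "\<And>k. f k \<noteq> 0 ==> l * 2 ^ n \<le> jap k \<and> jap k \<le> u * 2 ^ n"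
 shows "hb t f ((l powr (t - s) + u powr (t - s)) * dyad n (t - s) * C)"
proof (rule hb_le[OF f])
 fix k
 show "jap k powr t * cmod (f k) \<le> (l powr (t - s) + u powr (t - s)) * dyad n (t - s) * (jap k powr s * cmod (f k))"
 proof (cases "f k = 0")
  case False
  have "jap k powr t = jap k powr (t - s) * jap k powr s" by (simp flip: powr_add)
  also have "\<dots> \<le> (l powr (t - s) + u powr (t - s)) * dyad n (t - s) * jap k powr s"
   using supp[OF False] l by (intro mult_right_mono jap_powr_le) auto
  finally show ?thesis by (simp add: mult_right_mono mult.assoc[symmetric])
 qed simp
qed auto

lemma hb_ball:
 assumes f: "hb s f C" and supp: "\<And>k. f k \<noteq> 0 ==> jap k \<le> u * 2 ^ n" and st: "s \<le> t" and u: "0 \<le> u"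
 shows "hb t f (u powr (t - s) * dyad n (t - s) * C)"
proof (rule hb_le[OF f])
 fix k
 show "jap k powr t * cmod (f k) \<le> u powr (t - s) * dyad n (t - s) * (jap k powr s * cmod (f k))"
 proof (cases "f k = 0")
  case False
  have "jap k powr t = jap k powr (t - s) * jap k powr s" by (simp flip: powr_add)
  also have "jap k powr (t - s) \<le> (u * 2 ^ n) powr (t - s)"
   using supp[OF False] st by (intro powr_mono2) auto
  also have "(u * 2 ^ n) powr (t - s) = u powr (t - s) * dyad n (t - s)"
   using u by (simp add: powr_mult powr_powr flip: powr_realpow)
  finally show ?thesis by (simp add: mult_right_mono mult.assoc[symmetric])
 qed simp
qed auto

definition geo :: "real => real" where "geo r = (\<Sum>\<^sub>\<infinity>n::nat. dyad n r)"

lemma geo_summable: "r < 0 ==> (\<lambda>n::nat. dyad n r) summable_on UNIV"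
proof -
 assume r: "r < 0"
 have "summable (\<lambda>n::nat. (2 powr r) ^ n)"
  by (rule summable_geometric) (use r powr_less_mono[of r 0 2] in simp)
 moreover have "(2 powr r) ^ n = dyad n r" for n :: nat
  by (simp add: powr_powr mult.commute flip: powr_realpow)
 ultimately show ?thesis by (subst summable_on_UNIV_nonneg_real_iff) auto
qed

lemma geo_nonneg: "0 \<le> geo r" unfolding geo_def by (rule infsum_nonneg) simp

lemma sum_powr_le: assumes "0 < r" shows "(\<Sum>i<n. dyad i r) \<le> geo (- r) * dyad n r"
proof -
 have "(\<Sum>i<n. dyad i r) = (\<Sum>i<n. dyad (n - i) (- r) * dyad n r)"
  by (intro sum.cong refl) (simp add: of_nat_diff algebra_simps flip: powr_add)
 also have "\<dots> = (\<Sum>i<n. dyad (n - i) (- r)) * dyad n r" by (simp add: sum_distrib_right)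
 also have "(\<Sum>i<n. dyad (n - i) (- r)) = (\<Sum>j\<in>(\<lambda>i. n - i) ` {..<n}. dyad j (- r))"
  by (subst sum.reindex) (auto simp: inj_on_def)
 also have "\<dots> \<le> geo (- r)" unfolding geo_def
  by (rule finite_sum_le_infsum) (use assms geo_summable[of "- r"] in auto)
 finally show ?thesis by (simp add: mult_right_mono)
qed

text \<open>Truncated subtraction makes this \<open>{0, 1}\<close> for \<open>n = 0\<close>.\<close>

definition nbh :: "nat => nat set" where "nbh n = {n - 1..n + 1}"

lemma finite_nbh [simp]: "finite (nbh n)" by (simp add: nbh_def)

lemma nbh_iff: "i \<in> nbh n \<longleftrightarrow> n \<le> i + 1 \<and> i \<le> n + 1" by (auto simp: nbh_def)

lemma card_nbh_le: "card (nbh n) \<le> 3" by (simp add: nbh_def)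

lemma sum_nbh_le: "0 \<le> E ==> (\<Sum>i\<in>nbh n. E) \<le> 3 * (E::real)"
 using card_nbh_le[of n] by (simp add: mult_right_mono)

text \<open>The factors 2 in \<open>rho_supp\<close> absorb the index shift: block
  \<open>n > 0\<close> then lives in frequencies between \<open>la * 2 ^ n\<close> and
  \<open>lb * 2 ^ n\<close>. With \<open>la \<le> 1 \<le> lb\<close> the lowest block obeys the same
  bounds in terms of \<open>jap\<close>, which is at least 1.\<close>

locale lp =
 fixes chi rho :: "real \<times> real => real" and la lb :: real
 assumes LP: "littlewood_paley chi rho" and la: "0 < la" "la \<le> 1" and lb: "1 \<le> lb"
  and chi_supp: "chi x \<noteq> 0 ==> norm x \<le> lb"
  and rho_supp: "rho x \<noteq> 0 ==> 2 * la \<le> norm x \<and> norm x \<le> 2 * lb"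
begin

abbreviation "par \<equiv> para chi rho"
abbreviation "reso \<equiv> resonant chi rho"

definition lpf :: "nat => real \<times> real => real" where
 "lpf n x = (if n = 0 then chi x else rho ((1 / 2 ^ (n - 1)) *\<^sub>R x))"

definition rho1 :: "real \<times> real => real" where "rho1 x = rho (2 *\<^sub>R x)"

lemma lpf_rho1: "0 < n ==> lpf n x = rho1 ((1 / 2 ^ n) *\<^sub>R x)"
 by (cases n) (auto simp: lpf_def rho1_def)

lemma lpf_nonneg: "0 \<le> lpf n x" using LP by (auto simp: littlewood_paley_def lpf_def)

lemma lpf_sums: "(\<lambda>n. lpf n x) sums 1"
proof -
 have "(\<lambda>j::nat. rho ((1 / 2 ^ j) *\<^sub>R x)) sums (1 - chi x)" using LP by (auto simp: littlewood_paley_def)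
 then have "(\<lambda>j. lpf (Suc j) x) sums (1 - chi x)" by (simp add: lpf_def)
 from sums_Suc[OF this] show ?thesis by (simp add: lpf_def)
qed

lemma lpf_has_sum: "((\<lambda>n. lpf n x) has_sum 1) UNIV"
 by (rule sums_nonneg_imp_has_sum[OF lpf_sums]) (rule lpf_nonneg)

lemma sum_lpf_le_1: "finite I ==> (\<Sum>i\<in>I. lpf i x) \<le> 1"
 by (rule finite_sum_le_has_sum[OF lpf_has_sum]) (auto simp: lpf_nonneg)

lemma lpf_le_1: "lpf n x \<le> 1" using sum_lpf_le_1[of "{n}"] by simp

lemma lpf_disjoint: "i + 1 < j ==> lpf i x * lpf j x = 0"
proof -
 assume ij: "i + 1 < j"
 have 1: "1 \<le> j ==> chi x * rho ((1 / 2 ^ j) *\<^sub>R x) = 0" for j :: nat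
  using LP by (auto simp: littlewood_paley_def)
 have 2: "1 < \<bar>int i - int j\<bar> ==> rho ((1 / 2 ^ i) *\<^sub>R x) * rho ((1 / 2 ^ j) *\<^sub>R x) = 0" for i j :: nat
  using LP by (auto simp: littlewood_paley_def)
 show ?thesis
 proof (cases "i = 0")
  case True then show ?thesis using 1[of "j - 1"] ij by (simp add: lpf_def)
 next
  case False then show ?thesis using 2[of "i - 1" "j - 1"] ij by (simp add: lpf_def)
 qed
qed

lemma lpf_upper: "lpf n x \<noteq> 0 ==> norm x \<le> lb * 2 ^ n"
proof (cases n)
 case (Suc m)
 assume "lpf n x \<noteq> 0"
 then have "norm ((1 / 2 ^ m) *\<^sub>R x) \<le> 2 * lb" using rho_supp[of "(1 / 2 ^ m) *\<^sub>R x"] by (simp add: lpf_def Suc)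
 then show ?thesis by (simp add: Suc field_simps)
qed (use chi_supp in \<open>simp add: lpf_def\<close>)

lemma lpf_lower: "lpf n x \<noteq> 0 ==> 0 < n ==> la * 2 ^ n \<le> norm x"
proof (cases n)
 case (Suc m)
 assume "lpf n x \<noteq> 0"
 then have "2 * la \<le> norm ((1 / 2 ^ m) *\<^sub>R x)" using rho_supp[of "(1 / 2 ^ m) *\<^sub>R x"] by (simp add: lpf_def Suc)
 then show ?thesis by (simp add: Suc field_simps)
qed simp

definition cj :: real where "cj = 1 + 2 * pi * lb"

lemma cj_ge_1: "1 \<le> cj" using lb by (simp add: cj_def)

lemma jap_le_cj_mult:
 assumes "nf k \<le> x * lb * 2 ^ n" "1 \<le> x" shows "jap k \<le> x * cj * 2 ^ n"
proof -
 have "jap k \<le> 1 * 1 + 2 * pi * (x * lb * 2 ^ n)"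
  by (rule order_trans[OF jap_le]) (use assms in \<open>auto intro!: mult_left_mono\<close>)
 also have "\<dots> \<le> x * 2 ^ n + 2 * pi * (x * lb * 2 ^ n)" using assms by (intro add_right_mono mult_mono) auto
 finally show ?thesis by (simp add: cj_def algebra_simps)
qed

lemma jap_le_cj: "nf k \<le> lb * 2 ^ n ==> jap k \<le> cj * 2 ^ n"
 using jap_le_cj_mult[of k 1 n] by simp

lemma lpf_jap: "lpf n (freq k) \<noteq> 0 ==> la * 2 ^ n \<le> jap k \<and> jap k \<le> cj * 2 ^ n"
proof (intro conjI)
 assume l: "lpf n (freq k) \<noteq> 0"
 show "jap k \<le> cj * 2 ^ n" by (rule jap_le_cj[OF lpf_upper[OF l]])
 show "la * 2 ^ n \<le> jap k"
 proof (cases n)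
  case 0 then show ?thesis using la jap_ge_1[of k] by simp
 next
  case (Suc m) then show ?thesis using lpf_lower[OF l] norm_freq_le_jap'[of k] by simp
 qed
qed

text \<open>Indices are shifted by one: \<open>blk n\<close> is \<open>\<Delta>\<^sub>j\<close> with \<open>j = n - 1\<close>, and \<open>low n\<close> is the sum of the
 \<open>\<Delta>\<^sub>i\<close> with \<open>i \<le> j - 2\<close>.\<close>

definition blk :: "nat => tdist => tdist" where
 "blk n f = (\<lambda>k. cor (lpf n (freq k)) * f k)"

definition low :: "nat => tdist => tdist" where
 "low n f = (\<lambda>k. cor (\<Sum>i<n - 1. lpf i (freq k)) * f k)"

text \<open>The symbol equals 1 on the support of block \<open>n\<close>, so
  \<open>blk n (fat n f) = blk n f\<close>: within any estimate of a block, \<open>f\<close> may be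
  replaced by this band-limited function.\<close>

definition fat :: "nat => tdist => tdist" where
 "fat n f = (\<lambda>k. cor (\<Sum>i\<in>nbh n. lpf i (freq k)) * f k)"

lemma lp_block_blk: "lp_block chi rho (int n - 1) f = blk n f"
 by (cases n) (auto simp: lp_block_def blk_def lpf_def fun_eq_iff)

lemma low_sum: "low n f = (\<lambda>k. \<Sum>i<n - 1. blk i f k)"
 by (simp add: low_def blk_def sum_distrib_right)

lemma fat_sum: "fat n f = (\<lambda>k. \<Sum>i\<in>nbh n. blk i f k)"
 by (simp add: fat_def blk_def sum_distrib_right)

lemma blk_nonzero: "blk n f k \<noteq> 0 ==> lpf n (freq k) \<noteq> 0" by (auto simp: blk_def)

lemma low_nonzero: "low n f k \<noteq> 0 ==> \<exists>i<n - 1. lpf i (freq k) \<noteq> 0"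
 by (rule ccontr) (auto simp: low_def)

lemma fat_nonzero: "fat n f k \<noteq> 0 ==> \<exists>i\<in>nbh n. lpf i (freq k) \<noteq> 0"
 by (rule ccontr) (auto simp: fat_def)

lemma blk_freq: "blk n f k \<noteq> 0 ==> nf k \<le> lb * 2 ^ n"
 using blk_nonzero lpf_upper by blast

lemma low_freq: "low n f k \<noteq> 0 ==> nf k \<le> lb * 2 ^ n"
proof -
 assume "low n f k \<noteq> 0"
 then obtain i where i: "i < n - 1" "lpf i (freq k) \<noteq> 0" using low_nonzero by blast
 have "nf k \<le> lb * 2 ^ i" by (rule lpf_upper[OF i(2)])
 also have "\<dots> \<le> lb * 2 ^ n" using i lb by (intro mult_left_mono power_increasing) auto
 finally show ?thesis .
qed

lemma fat_freq: "fat n f k \<noteq> 0 ==> nf k \<le> 2 * lb * 2 ^ n"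
proof -
 assume "fat n f k \<noteq> 0"
 then obtain i where i: "i \<in> nbh n" "lpf i (freq k) \<noteq> 0" using fat_nonzero by blast
 have "nf k \<le> lb * 2 ^ i" by (rule lpf_upper[OF i(2)])
 also have "\<dots> \<le> lb * 2 ^ (n + 1)" using i lb by (intro mult_left_mono power_increasing) (auto simp: nbh_iff)
 finally show ?thesis by simp
qed

lemma lpf_nbh_jap: assumes "i \<in> nbh n" "lpf i (freq k) \<noteq> 0"
 shows "la / 2 * 2 ^ n \<le> jap k \<and> jap k \<le> 2 * cj * 2 ^ n"
proof -
 have "jap k \<le> cj * 2 ^ i" using lpf_jap[OF assms(2)] by simp
 also have "\<dots> \<le> cj * 2 ^ (n + 1)" using assms cj_ge_1 by (intro mult_left_mono power_increasing) (auto simp: nbh_iff)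
 finally have 1: "jap k \<le> 2 * cj * 2 ^ n" by simp
 have "la / 2 * 2 ^ n \<le> la * 2 ^ (n - 1)" using la by (cases n) auto
 also have "\<dots> \<le> la * 2 ^ i" using assms la by (intro mult_left_mono power_increasing) (auto simp: nbh_iff)
 also have "\<dots> \<le> jap k" using lpf_jap[OF assms(2)] by simp
 finally show ?thesis using 1 by simp
qed

lemma fat_jap: "fat n f k \<noteq> 0 ==> la / 2 * 2 ^ n \<le> jap k \<and> jap k \<le> 2 * cj * 2 ^ n"
 using fat_nonzero lpf_nbh_jap by blast

lemma fs_freq: "(\<And>k. F k \<noteq> 0 ==> nf k \<le> R) ==> fs F"
 by (rule finite_subset[OF _ finite_freq_ball[of R]]) auto

lemma fs_blk: "fs (blk n f)" by (rule fs_freq[OF blk_freq])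
lemma fs_low: "fs (low n f)" by (rule fs_freq[OF low_freq])
lemma fs_fat: "fs (fat n f)" by (rule fs_freq[OF fat_freq])

lemma norm_lpf_le_1: "cmod (cor (lpf n x)) \<le> 1"
 using lpf_nonneg[of n x] lpf_le_1[of n x] by simp

lemma norm_sum_lpf_le_1: "finite I ==> cmod (cor (\<Sum>i\<in>I. lpf i x)) \<le> 1"
 using sum_nonneg[of I "\<lambda>i. lpf i x"] sum_lpf_le_1[of I x] lpf_nonneg by (simp del: of_real_sum)

lemma hb_blk: "hb s f C ==> hb s (blk n f) C"
 unfolding blk_def by (erule hb_mult_le_1) (rule norm_lpf_le_1)

lemma hb_low: "hb s f C ==> hb s (low n f) C"
 unfolding low_def by (erule hb_mult_le_1) (rule norm_sum_lpf_le_1, simp)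

lemma hb_fat: "hb s f C ==> hb s (fat n f) C"
 unfolding fat_def by (erule hb_mult_le_1) (rule norm_sum_lpf_le_1, simp)

lemma lpf_times_fat: "lpf n x * (\<Sum>i\<in>nbh n. lpf i x) = lpf n x"
proof -
 have "(\<lambda>i. lpf n x * lpf i x) sums (lpf n x * 1)" by (rule sums_mult[OF lpf_sums])
 moreover have "(\<lambda>i. lpf n x * lpf i x) sums (\<Sum>i\<in>nbh n. lpf n x * lpf i x)"
 proof (rule sums_finite)
  fix i assume "i \<notin> nbh n"
  then have "i + 1 < n \<or> n + 1 < i" by (auto simp: nbh_iff)
  then show "lpf n x * lpf i x = 0" using lpf_disjoint[of i n x] lpf_disjoint[of n i x] by (auto simp: mult.commute)
 qed simp
 ultimately show ?thesis by (simp add: sums_unique2 sum_distrib_left)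
qed

lemma blk_fat: "blk n (fat n f) = blk n f"
proof -
 have "cor (lpf n x) * cor (\<Sum>i\<in>nbh n. lpf i x) = cor (lpf n x)" for x
  by (simp only: lpf_times_fat flip: of_real_mult)
 then show ?thesis by (simp add: blk_def fat_def fun_eq_iff flip: mult.assoc del: of_real_sum)
qed

lemma blk_has_sum: "((\<lambda>n. blk n f k) has_sum f k) UNIV"
 unfolding blk_def using has_sum_cmult_left[OF has_sum_of_real[OF lpf_has_sum[of "freq k"]], of "f k"] by simp

lemma bump_rho1: "bump lb rho1" unfolding bump_def
proof (intro conjI allI impI)
 have "smooth_on UNIV rho" using LP by (simp add: littlewood_paley_def)
 then show "smooth_on UNIV rho1" unfolding rho1_def[abs_def] smooth_on_def by (auto intro: cd_scaleR)
 show "norm x \<le> lb" if "rho1 x \<noteq> 0" for x using rho_supp[of "2 *\<^sub>R x"] that by (simp add: rho1_def)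
qed

lemma bump_chi: "bump lb chi" using LP chi_supp by (auto simp: bump_def littlewood_paley_def)

lemma rho1_even: "rho1 (- x) = rho1 x"
proof -
 have "radial rho" using LP by (simp add: littlewood_paley_def)
 then show ?thesis unfolding radial_def rho1_def by (metis norm_minus_cancel scaleR_minus_right)
qed

lemma blk_dil: "0 < n ==> blk n f = dil rho1 n f" by (simp add: blk_def dil_def lpf_rho1)

lemma isCont_lpf: "isCont (lpf n) x"
proof -
 have "continuous_on UNIV (lpf n)"
 proof (cases "n = 0")
  case True
  then show ?thesis using bump_continuous[OF bump_chi] by (simp add: lpf_def[abs_def])
 next
  case False
  then have "lpf n = (\<lambda>x. rho1 ((1 / 2 ^ n) *\<^sub>R x))" using lpf_rho1 by auto
  then show ?thesis
   by (auto intro!: continuous_on_compose2[OF bump_continuous[OF bump_rho1, of UNIV]] continuous_intros)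
 qed
 then show ?thesis by (simp add: continuous_on_eq_continuous_at)
qed

text \<open>Only two bump functions occur among the blocks, \<open>chi\<close> for the lowest and
  \<open>rho1\<close> for all others; a bound uniform over the scales of each bump is therefore
  uniform over the blocks.\<close>

lemma blk_uniform:
 assumes ex: "\<And>f. bump lb f ==> \<exists>C\<ge>0. \<forall>n. Q n (dil f n) C"
  and mono: "\<And>n T C D. Q n T C ==> C \<le> D ==> Q n T D"
 shows "\<exists>C\<ge>0::real. \<forall>n. Q n (blk n) C"
proof -
 from ex[OF bump_rho1] ex[OF bump_chi] obtain C1 C2
  where C: "0 \<le> C1" "\<And>n. Q n (dil rho1 n) C1" "\<And>n. Q n (dil chi n) C2" by blast
 have "blk n = dil (if n = 0 then chi else rho1) n" for n
  by (simp add: fun_eq_iff blk_def dil_def lpf_def lpf_rho1[unfolded lpf_def, symmetric])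
 then have "Q n (blk n) (max C1 C2)" for n using mono[OF C(2) max.cobounded1[of C1 C2]] mono[OF C(3) max.cobounded2[of C2 C1]] by simp
 then show ?thesis using C(1) by (intro exI[of _ "max C1 C2"]) auto
qed

lemma ub_blk:
 "\<exists>C\<ge>0. \<forall>n F D. (\<forall>k. F k \<noteq> 0 --> nf k \<le> B * 2 ^ n) --> ub F D --> ub (blk n F) (C * D)"
 by (rule blk_uniform[where Q = "\<lambda>n T C. \<forall>F D. (\<forall>k. F k \<noteq> 0 --> nf k \<le> B * 2 ^ n) --> ub F D --> ub (T F) (C * D)"])
   (rule ub_dil, assumption, blast intro: ub_mono mult_right_mono ub_nonneg)

lemma hb_blk_commutator:
 "\<exists>C\<ge>0. \<forall>n F G Y D. (\<forall>k. F k \<noteq> 0 --> nf k \<le> B * 2 ^ n) -->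
   (\<forall>k. G k \<noteq> 0 --> nf k \<le> B * 2 ^ n) --> hb 0 (\<lambda>k. cor (nf k) * F k) Y --> ub G D -->
   hb 0 (\<lambda>k. blk n (tprod F G) k - tprod F (blk n G) k) (C * Y * D / 2 ^ n)"
 by (rule blk_uniform[where Q = "\<lambda>n T C. \<forall>F G Y D. (\<forall>k. F k \<noteq> 0 --> nf k \<le> B * 2 ^ n) -->
   (\<forall>k. G k \<noteq> 0 --> nf k \<le> B * 2 ^ n) --> hb 0 (\<lambda>k. cor (nf k) * F k) Y --> ub G D -->
   hb 0 (\<lambda>k. T (tprod F G) k - tprod F (T G) k) (C * Y * D / 2 ^ n)"])
   (rule hb_commutator, assumption, blast intro: hb_mono divide_right_mono mult_right_mono ub_nonneg hb_nonneg zero_le_power zero_le_numeral)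

text \<open>The Littlewood--Paley hypotheses do not separate the supports of the low part of \<open>f\<close> and of the
 block of \<open>g\<close> by an annulus, so the output of a paraproduct need not lie in an annulus. It does so up to
 arbitrarily small errors, because the symbol of block \<open>n\<close> vanishes near every frequency of the
 low part.\<close>

lemma hb_high_block:
 "\<exists>B\<ge>0. \<forall>n F g K. (\<forall>k. F k \<noteq> 0 --> (\<exists>i<n - 1. lpf i (freq k) \<noteq> 0)) -->
   (\<forall>y. hb 0 (tprod (tr y F) (fat n g)) K) --> hb (- real M) (tprod F (blk n g)) (B * K / 2 ^ (n * M))"
proof -
 from hb_low_output[OF bump_rho1 rho1_even, of "2 * lb" M] obtain C where C: "0 \<le> C"
  "\<And>n F G K. [|\<forall>k. F k \<noteq> 0 --> nf k \<le> 2 * lb * 2 ^ n; \<forall>k. G k \<noteq> 0 --> nf k \<le> 2 * lb * 2 ^ n;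
   \<forall>k. F k \<noteq> 0 --> (\<exists>e>0. \<forall>x. norm (x - (1 / 2 ^ n) *\<^sub>R freq k) < e --> rho1 x = 0);
   \<forall>y. hb 0 (tprod (tr y F) G) K|] ==> hb (- real M) (tprod F (dil rho1 n G)) (C * K / 2 ^ (n * M))" by blast
 have "hb (- real M) (tprod F (blk n g)) (C * K / 2 ^ (n * M))"
  if F: "\<And>k. F k \<noteq> 0 ==> \<exists>i<n - 1. lpf i (freq k) \<noteq> 0" and K: "\<And>y. hb 0 (tprod (tr y F) (fat n g)) K" for n F g K
 proof (cases "n = 0")
  case True
  then have "F = (\<lambda>_. 0)" using F by fastforce
  then show ?thesis using hb_nonneg[OF K] C(1) by (simp add: tprod_def hb_mono[OF hb_zero])
 next
  case False
  have "hb (- real M) (tprod F (dil rho1 n (fat n g))) (C * K / 2 ^ (n * M))"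
  proof (rule C(2); intro allI impI)
   fix k assume Fk: "F k \<noteq> 0"
   then obtain i where i: "i < n - 1" "lpf i (freq k) \<noteq> 0" using F by blast
   have "nf k \<le> lb * 2 ^ i" by (rule lpf_upper[OF i(2)])
   also have "\<dots> \<le> (2 * lb) * 2 ^ n" using i lb by (intro mult_mono power_increasing) auto
   finally show "nf k \<le> 2 * lb * 2 ^ n" .
   \<comment> \<open>The symbol of block \<open>i\<close> is nonzero at this frequency, hence, by
     continuity, in a neighbourhood; disjointness of blocks \<open>i\<close> and \<open>n\<close>
     then forces the symbol of block \<open>n\<close> to vanish on the whole neighbourhood.\<close>
   have "0 < lpf i (freq k)" using i lpf_nonneg[of i "freq k"] by simp
   then have "\<forall>\<^sub>F x in at (freq k). 0 < lpf i x"
    using isCont_lpf[where n = i and x = "freq k"] unfolding isCont_def by (rule order_tendstoD(1)[rotated])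
   then obtain d where d: "0 < d" "\<And>x. x \<noteq> freq k ==> dist x (freq k) < d ==> 0 < lpf i x"
    unfolding eventually_at by auto
   have pos: "lpf i x \<noteq> 0" if "dist x (freq k) < d" for x
    using d(2)[OF _ that] i(2) by (cases "x = freq k") auto
   show "\<exists>e>0. \<forall>x. norm (x - (1 / 2 ^ n) *\<^sub>R freq k) < e --> rho1 x = 0"
   proof (intro exI[of _ "d / 2 ^ n"] conjI allI impI)
    fix x assume x: "norm (x - (1 / 2 ^ n) *\<^sub>R freq k) < d / 2 ^ n"
    have "dist (2 ^ n *\<^sub>R x) (freq k) = norm (2 ^ n *\<^sub>R (x - (1 / 2 ^ n) *\<^sub>R freq k))"
     by (simp add: dist_norm scaleR_diff_right)
    also have "\<dots> = 2 ^ n * norm (x - (1 / 2 ^ n) *\<^sub>R freq k)" by simp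
    also have "\<dots> < d" using x by (simp add: field_simps)
    finally have "lpf i (2 ^ n *\<^sub>R x) \<noteq> 0" by (rule pos)
    then have "lpf n (2 ^ n *\<^sub>R x) = 0" using lpf_disjoint[of i n "2 ^ n *\<^sub>R x"] i by simp
    then show "rho1 x = 0" using False by (simp add: lpf_rho1)
   qed (use d in simp)
  qed (use fat_freq K in auto)
  then show ?thesis using False by (simp flip: blk_dil add: blk_fat)
 qed
 then show ?thesis using C(1) by blast
qed

lemma tprod_supp_jap:
 assumes "\<And>k. F k \<noteq> 0 ==> nf k \<le> R" "\<And>k. G k \<noteq> 0 ==> nf k \<le> S" "tprod F G k \<noteq> 0"
 shows "nf k \<le> R + S"
proof -
 from assms(3) obtain l where l: "F l \<noteq> 0" "G (k - l) \<noteq> 0" by (rule tprod_nonzeroE)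
 have "nf k \<le> nf l + nf (k - l)"
  using norm_triangle_ineq[of "freq l" "freq (k - l)"] by (simp flip: freq_add)
 also have "\<dots> \<le> R + S" by (intro add_mono assms(1)[OF l(1)] assms(2)[OF l(2)])
 finally show ?thesis .
qed

lemma low_blk_jap: "tprod (low n f) (blk n g) k \<noteq> 0 ==> jap k \<le> 2 * cj * 2 ^ n"
proof -
 assume "tprod (low n f) (blk n g) k \<noteq> 0"
 then have "nf k \<le> lb * 2 ^ n + lb * 2 ^ n"
  by (intro tprod_supp_jap[OF low_freq[of n f] blk_freq[of n g]])
 then have "nf k \<le> lb * 2 ^ (Suc n)" by simp
 from jap_le_cj[OF this] show ?thesis by simp
qed

text \<open>The bound at the very negative index \<open>- real M\<close> is strong, with
  \<open>2 ^ (n * M)\<close> in the denominator. Since the output lies in a ball of radius of order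
  \<open>2 ^ n\<close>, raising the index from \<open>- real M\<close> to \<open>t\<close> costs
  \<open>dyad n (t + real M)\<close>, and the powers of \<open>M\<close> cancel. This gives what an
  annulus would give.\<close>

lemma hb_para_term:
 "\<exists>B\<ge>0. \<forall>n f g K. (\<forall>y. hb 0 (tprod (tr y (low n f)) (fat n g)) K) -->
   hb t (tprod (low n f) (blk n g)) (B * dyad n t * K)"
proof -
 define M where "M = nat \<lceil>\<bar>t\<bar>\<rceil>"
 have M: "\<bar>t\<bar> \<le> real M" unfolding M_def by linarith
 from hb_high_block[of M] obtain B where B: "0 \<le> B"
  "\<And>n F g K. [|\<forall>k. F k \<noteq> 0 --> (\<exists>i<n - 1. lpf i (freq k) \<noteq> 0); \<forall>y. hb 0 (tprod (tr y F) (fat n g)) K|]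
   ==> hb (- real M) (tprod F (blk n g)) (B * K / 2 ^ (n * M))" by blast
 have cj: "0 \<le> 2 * cj" using cj_ge_1 by simp
 have "hb t (tprod (low n f) (blk n g)) ((2 * cj) powr (t + real M) * B * dyad n t * K)"
  if K: "\<forall>y. hb 0 (tprod (tr y (low n f)) (fat n g)) K" for n f g K
 proof -
  have "hb (- real M) (tprod (low n f) (blk n g)) (B * K / 2 ^ (n * M))"
   by (rule B(2)[OF _ K]) (use low_nonzero in blast)
  from hb_ball[OF this low_blk_jap _ cj, where t = t]
  have h: "hb t (tprod (low n f) (blk n g)) ((2 * cj) powr (t - - real M) * dyad n (t - - real M) * (B * K / 2 ^ (n * M)))"
   using M by simp
  have "dyad n (t - - real M) = dyad n t * 2 ^ (n * M)"
   by (simp add: distrib_left powr_add flip: powr_realpow)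
  then have "(2 * cj) powr (t - - real M) * dyad n (t - - real M) * (B * K / 2 ^ (n * M))
    = (2 * cj) powr (t + real M) * B * dyad n t * K" by simp
  with h show ?thesis by simp
 qed
 moreover have "0 \<le> (2 * cj) powr (t + real M) * B" using B by simp
 ultimately show ?thesis by blast
qed

text \<open>The Besov analogue of \<open>hb\<close>. Because the block index is shifted by one, it
  differs from the Besov norm by a factor \<open>2 powr a\<close>.\<close>

definition bb :: "real => tdist => real => bool" where
 "bb a g C \<longleftrightarrow> (\<forall>n. ub (blk n g) (C * dyad n (- a)))"

lemma bbD: "bb a g C ==> ub (blk n g) (C * dyad n (- a))" by (simp add: bb_def)

lemma bb_nonneg: "bb a g C ==> 0 \<le> C" using ub_nonneg[OF bbD[of a g C 0]] by simp

lemma bb_mono: "bb a g C ==> C \<le> D ==> bb a g D"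
 unfolding bb_def by (meson ub_mono mult_right_mono powr_ge_zero)

lemma ub_fat: assumes "bb a g C" shows "ub (fat n g) (3 * 2 powr \<bar>a\<bar> * C * dyad n (- a))"
proof -
 have C: "0 \<le> C" by (rule bb_nonneg[OF assms])
 have "ub (\<lambda>k. \<Sum>i\<in>nbh n. blk i g k) (\<Sum>i\<in>nbh n. C * dyad i (- a))"
  by (rule ub_sum[OF _ fs_blk bbD[OF assms]]) simp
 moreover have "(\<Sum>i\<in>nbh n. C * dyad i (- a)) \<le> (\<Sum>i\<in>nbh n. 2 powr \<bar>a\<bar> * C * dyad n (- a))"
 proof (rule sum_mono)
  fix i assume i: "i \<in> nbh n"
  have "\<bar>(real i - real n) * - a\<bar> \<le> 1 * \<bar>a\<bar>"
   unfolding abs_mult abs_minus_cancel using i by (intro mult_right_mono) (auto simp: nbh_iff)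
  then have "real i * - a \<le> \<bar>a\<bar> + real n * - a" by (simp add: algebra_simps)
  then have "dyad i (- a) \<le> 2 powr \<bar>a\<bar> * dyad n (- a)" by (simp flip: powr_add)
  from mult_left_mono[OF this C] show "C * dyad i (- a) \<le> 2 powr \<bar>a\<bar> * C * dyad n (- a)" by (simp add: mult_ac)
 qed
 moreover have "\<dots> \<le> 3 * (2 powr \<bar>a\<bar> * C * dyad n (- a))" using C by (intro sum_nbh_le) auto
 ultimately show ?thesis unfolding fat_sum by (auto simp: mult_ac intro: ub_mono)
qed

lemma ub_low: assumes "bb a g C" "a < 0" shows "ub (low n g) (geo a * C * dyad n (- a))"
proof -
 have C: "0 \<le> C" by (rule bb_nonneg[OF assms(1)])
 have "ub (\<lambda>k. \<Sum>i<n - 1. blk i g k) (\<Sum>i<n - 1. C * dyad i (- a))"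
  by (rule ub_sum[OF _ fs_blk bbD[OF assms(1)]]) simp
 moreover have "(\<Sum>i<n - 1. C * dyad i (- a)) \<le> geo a * C * dyad n (- a)"
 proof -
  have "(\<Sum>i<n - 1. C * dyad i (- a)) = C * (\<Sum>i<n - 1. dyad i (- a))" by (simp only: sum_distrib_left)
  also have "\<dots> \<le> C * (\<Sum>i<n. dyad i (- a))"
   using C by (intro mult_left_mono sum_mono2) auto
  also have "\<dots> \<le> C * (geo (- (- a)) * dyad n (- a))"
   using C assms by (intro mult_left_mono sum_powr_le) auto
  finally show ?thesis by (simp add: mult_ac)
 qed
 ultimately show ?thesis unfolding low_sum by (rule ub_mono)
qed

lemma Linf_norm_upper: "fs F ==> cmod (trig_series F x) \<le> Linf_norm F" unfolding Linf_norm_def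
proof (rule cSUP_upper)
 assume "fs F"
 from ub_coeff_sum[OF this subset_refl] show "bdd_above (range (\<lambda>x. cmod (trig_series F x)))"
  by (auto simp: ub_def intro!: bdd_aboveI)
qed simp

lemma Linf_norm_le: "ub F C ==> Linf_norm F \<le> C"
 unfolding Linf_norm_def ub_def by (rule cSUP_least) auto

lemma bij_int_index: "bij_betw (\<lambda>n. int n - 1) UNIV {-1..}"
 by (rule bij_betwI[where g = "\<lambda>j. nat (j + 1)"]) auto

lemma besov_normD:
 assumes "besov_norm chi rho a f \<le> ennreal C" "0 \<le> C" shows "bb a f (2 powr a * C)"
 unfolding bb_def
proof
 fix n
 have "int n - 1 \<in> {-1..}" by simp
 then have "ennreal (2 powr (real_of_int (int n - 1) * a) * Linf_norm (blk n f)) \<le> besov_norm chi rho a f"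
  unfolding besov_norm_def lp_block_blk[symmetric] by (rule SUP_upper)
 also note assms(1)
 finally have "2 powr (real_of_int (int n - 1) * a) * Linf_norm (blk n f) \<le> C" using assms(2) by simp
 then have "dyad n a * Linf_norm (blk n f) \<le> 2 powr a * C"
  by (simp add: left_diff_distrib powr_diff field_simps)
 then have "Linf_norm (blk n f) \<le> 2 powr a * C * dyad n (- a)"
  by (simp add: powr_minus field_simps)
 then show "ub (blk n f) (2 powr a * C * dyad n (- a))"
  using Linf_norm_upper[OF fs_blk[of n f]] unfolding ub_def by (meson order_trans)
qed

lemma besov_normI: assumes "bb a f C" shows "besov_norm chi rho a f \<le> ennreal (2 powr - a * C)"
 unfolding besov_norm_def
proof (rule SUP_least)
 fix j :: int assume j: "j \<in> {-1..}"
 define n where "n = nat (j + 1)"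
 have jn: "j = int n - 1" using j by (simp add: n_def)
 have "2 powr (real_of_int j * a) * Linf_norm (lp_block chi rho j f) \<le> 2 powr (real_of_int j * a) * (C * dyad n (- a))"
  unfolding jn lp_block_blk by (intro mult_left_mono Linf_norm_le bbD assms) auto
 also have "\<dots> = 2 powr - a * C"
  by (simp add: jn left_diff_distrib powr_diff powr_minus field_simps)
 finally show "ennreal (2 powr (real_of_int j * a) * Linf_norm (lp_block chi rho j f)) \<le> ennreal (2 powr - a * C)"
  by (rule ennreal_leI)
qed

lemma besov_iff: "f \<in> besov chi rho a \<longleftrightarrow> (\<exists>C. bb a f C)"
proof
 assume "f \<in> besov chi rho a"
 then have "besov_norm chi rho a f < \<infinity>" by (simp add: besov_def)
 then obtain C where "0 \<le> C" "besov_norm chi rho a f = ennreal C"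
  by (metis ennreal_cases infinity_ennreal_def less_irrefl)
 then show "\<exists>C. bb a f C" using besov_normD[of a f C] by auto
next
 assume "\<exists>C. bb a f C"
 then obtain C where "bb a f C" by blast
 from besov_normI[OF this] show "f \<in> besov chi rho a"
  by (auto simp: besov_def intro: order.strict_trans1)
qed

lemma blk_linear: "blk n (scale z f + g) = scale z (blk n f) + blk n g"
 by (simp add: blk_def scale_def fun_eq_iff algebra_simps)

lemma low_linear: "low n (scale z f + g) = scale z (low n f) + low n g"
 by (simp add: low_def scale_def fun_eq_iff algebra_simps)

lemma fat_linear: "fat n (scale z f + g) = scale z (fat n f) + fat n g"
 by (simp add: fat_def scale_def fun_eq_iff algebra_simps)

lemma bb_add: assumes "bb a f C" "bb a g D" shows "bb a (f + g) (C + D)" unfolding bb_def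
proof
 fix n
 have "ub (\<lambda>k. \<Sum>i\<in>{0::nat, 1}. (if i = 0 then blk n f else blk n g) k)
   (\<Sum>i\<in>{0::nat, 1}. (if i = 0 then C else D) * dyad n (- a))"
  by (rule ub_sum) (use bbD[OF assms(1), of n] bbD[OF assms(2), of n] fs_blk in auto)
 moreover have "blk n (f + g) = (\<lambda>k. blk n f k + blk n g k)" by (simp add: blk_def fun_eq_iff algebra_simps)
 ultimately show "ub (blk n (f + g)) ((C + D) * dyad n (- a))" by (simp add: distrib_right)
qed

lemma bb_scale: "bb a f C ==> bb a (scale z f) (cmod z * C)" unfolding bb_def
proof
 fix n assume "\<forall>n. ub (blk n f) (C * dyad n (- a))"
 then have "ub (\<lambda>k. z * blk n f k) (cmod z * (C * dyad n (- a)))" by (intro ub_cmult) auto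
 then show "ub (blk n (scale z f)) (cmod z * C * dyad n (- a))"
  by (simp add: blk_def scale_def mult_ac)
qed

lemma bb_diff: "bb a f C ==> bb a g D ==> bb a (f - g) (C + D)"
 using bb_add[of a f C "scale (-1) g" D] bb_scale[of a g D "-1"]
 by (simp add: scale_def fun_diff_def plus_fun_def)

end

section \<open>Bilinear estimates\<close>

lemma tprod_sum_left: assumes "finite I" "\<And>i. i \<in> I ==> fs (F i)"
 shows "tprod (\<lambda>k. \<Sum>i\<in>I. F i k) G k = (\<Sum>i\<in>I. tprod (F i) G k)"
proof -
 define A where "A = (\<Union>i\<in>I. {k. F i k \<noteq> 0})"
 have A: "finite A" using assms by (auto simp: A_def)
 have "tprod (\<lambda>k. \<Sum>i\<in>I. F i k) G k = (\<Sum>l\<in>A. (\<Sum>i\<in>I. F i l) * G (k - l))"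
 proof (rule tprod_finite[OF A], rule subsetI, rule ccontr)
  fix k assume "k \<in> {k. (\<Sum>i\<in>I. F i k) \<noteq> 0}" "k \<notin> A"
  then show False by (auto simp: A_def)
 qed
 also have "\<dots> = (\<Sum>i\<in>I. \<Sum>l\<in>A. F i l * G (k - l))"
  unfolding sum_distrib_right by (rule sum.swap)
 also have "\<dots> = (\<Sum>i\<in>I. tprod (F i) G k)"
  by (intro sum.cong refl tprod_finite[symmetric] A) (auto simp: A_def)
 finally show ?thesis .
qed

lemma tprod_linear_left:
 assumes "fs f" "fs f'" shows "tprod (scale z f + f') g k = z * tprod f g k + tprod f' g k"
proof -
 let ?A = "{k. f k \<noteq> 0} \<union> {k. f' k \<noteq> 0}"
 have A: "finite ?A" using assms by simp
 show ?thesis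
  by (subst (1 2 3) tprod_finite[OF A]) (auto simp: scale_def algebra_simps sum.distrib sum_distrib_left)
qed

lemma tprod_linear_right:
 assumes "fs g" "fs g'" shows "tprod f (scale z g + g') k = z * tprod f g k + tprod f g' k"
 using tprod_linear_left[OF assms, of z f k] by (simp add: tprod_commute)

lemma infsum_linear:
 fixes f g :: "'a => complex" assumes "f summable_on A" "g summable_on A"
 shows "(INFSUM n:A. z * f n + g n) = z * infsum f A + infsum g A"
 using infsum_add[OF summable_on_cmult_right[OF assms(1)] assms(2), of z] by (simp add: infsum_cmult_right')

text \<open>The torus has volume 1, so the sup norm dominates the L2 norm; here as the product
  estimate with the constant function 1.\<close>

lemma hb_of_ub: assumes "fs F" "ub F D" shows "hb 0 F D"
proof -
 let ?d = "const_fun 1"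
 have s: "{k. ?d k \<noteq> 0} = {0}" by (auto simp: const_fun_def)
 have d: "fs ?d" "hb 0 ?d 1"
 proof -
  show "hb 0 ?d 1" unfolding hb_L2_set_sq
  proof (intro conjI allI impI)
   fix A :: "(int \<times> int) set" assume A: "finite A"
   have "(\<Sum>k\<in>A. (jap k powr 0 * cmod (?d k))^2) = (\<Sum>k\<in>A. if k = 0 then 1 else 0)"
    by (intro sum.cong refl) (auto simp: const_fun_def)
   then show "(\<Sum>k\<in>A. (jap k powr 0 * cmod (?d k))^2) \<le> 1^2" using A by simp
  qed simp
 qed (simp add: s)
 have "tprod ?d F = F"
  by (rule ext, subst tprod_finite[of "{0}"]) (auto simp: s, simp add: const_fun_def)
 then show ?thesis using hb_tprod[OF d(1) assms(1) d(2) assms(2)] by simp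
qed

lemma jap_diff_le: "jap (k - l) \<le> 3 * jap k * jap l"
proof -
 have "jap (k - l) \<le> 1 + 2 * pi * nf (k - l)" by (rule jap_le)
 also have "\<dots> \<le> 1 + 2 * pi * (nf k + nf l)"
  unfolding freq_diff by (intro add_left_mono mult_left_mono norm_triangle_ineq4) auto
 also have "\<dots> \<le> 1 + jap k + jap l" using norm_freq_le_jap[of k] norm_freq_le_jap[of l] by (simp add: distrib_left)
 also have "\<dots> \<le> jap k * jap l + jap k * jap l + jap k * jap l"
 proof (intro add_mono)
  have "1 * 1 \<le> jap k * jap l" by (intro mult_mono jap_ge_1) auto
  then show "1 \<le> jap k * jap l" by simp
  have "jap k * 1 \<le> jap k * jap l" by (intro mult_left_mono jap_ge_1) auto
  then show "jap k \<le> jap k * jap l" by simp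
  have "1 * jap l \<le> jap k * jap l" by (intro mult_right_mono jap_ge_1) auto
  then show "jap l \<le> jap k * jap l" by simp
 qed
 finally show ?thesis by simp
qed

lemma summable_reflect:
 assumes "h summable_on (UNIV :: (int \<times> int) set)" shows "(\<lambda>l. h (k - l)) summable_on UNIV"
proof -
 have "bij_betw (\<lambda>l. k - l) UNIV UNIV" for k :: "int \<times> int" by (rule bij_betwI[where g = "\<lambda>l. k - l"]) auto
 from summable_on_reindex_bij_betw[OF this, of h k] assms show ?thesis by simp
qed

text \<open>The Peetre-type inequality \<open>jap_diff_le\<close> moves the weight from one factor
  to the other at a cost depending on \<open>k\<close> alone; what remains is a product of two
  square-summable families.\<close>

lemma summable_product_hb: assumes f: "hb s f C" and g: "hb (- s) g D" and s: "0 \<le> s"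
 shows "(\<lambda>l. cmod (f l * g (k - l))) summable_on UNIV"
proof -
 define c where "c = (3 * jap k) powr s"
 let ?x = "\<lambda>l. jap l powr s * cmod (f l)" and ?y = "\<lambda>l. jap l powr - s * cmod (g l)"
 show ?thesis
 proof (rule summable_le)
  show "(\<lambda>l. c * ((?x l)^2 + (?y (k - l))^2)) summable_on UNIV"
   by (rule summable_on_cmult_right[OF summable_on_add[OF hb_summable[OF f] summable_reflect[OF hb_summable[OF g]]]])
  fix l
  have "jap (k - l) powr s \<le> (3 * jap k * jap l) powr s" using s jap_diff_le[of k l] by (intro powr_mono2) auto
  also have "\<dots> = c * jap l powr s" unfolding c_def by (rule powr_mult)
  finally have "1 \<le> c * jap l powr s * jap (k - l) powr - s"
   using jap_pos[of "k - l"] by (simp add: powr_minus field_simps)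
  then have "1 * cmod (f l * g (k - l)) \<le> (c * jap l powr s * jap (k - l) powr - s) * cmod (f l * g (k - l))"
   by (intro mult_right_mono) auto
  also have "\<dots> = c * (?x l * ?y (k - l))" by (simp add: norm_mult mult_ac)
  also have "\<dots> \<le> c * ((?x l)^2 + (?y (k - l))^2)"
  proof (intro mult_left_mono)
   have "2 * (?x l * ?y (k - l)) \<le> (?x l)^2 + (?y (k - l))^2"
    using sum_squares_bound[of "?x l" "?y (k - l)"] by (simp add: mult.assoc)
   moreover have "0 \<le> ?x l * ?y (k - l)" by (intro mult_nonneg_nonneg) auto
   ultimately show "?x l * ?y (k - l) \<le> (?x l)^2 + (?y (k - l))^2" by linarith
  qed (simp add: c_def)
  finally show "norm (cmod (f l * g (k - l))) \<le> c * ((?x l)^2 + (?y (k - l))^2)" by simp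
 qed
qed

lemmas powr_expand = distrib_left right_diff_distrib powr_add powr_diff powr_minus field_simps

context lp begin

lemma para_eq: "par f g k = (INFSUM n. tprod (low n f) (blk n g) k)"
proof -
 let ?G = "\<lambda>j. \<Sum>i\<in>{-1..j - 2}. tprod (lp_block chi rho i f) (lp_block chi rho j g) k"
 have "par f g k = (INFSUM n. ?G (int n - 1))"
  unfolding para_def by (rule infsum_reindex_bij_betw[OF bij_int_index, symmetric])
 also have "?G (int n - 1) = tprod (low n f) (blk n g) k" for n
 proof -
  have "?G (int n - 1) = (\<Sum>i<n - 1. tprod (lp_block chi rho (int i - 1) f) (lp_block chi rho (int n - 1) g) k)"
   by (rule sum.reindex_bij_witness[where i = "\<lambda>i. int i - 1" and j = "\<lambda>i. nat (i + 1)"]) auto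
  then show ?thesis unfolding lp_block_blk low_sum by (subst tprod_sum_left) (auto simp: fs_blk)
 qed
 then have "(INFSUM n. ?G (int n - 1)) = (INFSUM n. tprod (low n f) (blk n g) k)" by (simp only:)
 finally show ?thesis .
qed

text \<open>An \<open>infsum\<close> that does not converge has the default value 0, so linearity of
  the paraproduct is only available where convergence at every frequency is known.\<close>

definition psum :: "tdist => tdist => bool" where
 "psum f g \<longleftrightarrow> (\<forall>k. (\<lambda>n. tprod (low n f) (blk n g) k) summable_on UNIV)"

text \<open>The norms of the pieces are summed as a geometric series, without any orthogonality in
  \<open>n\<close>. The strict inequality \<open>t + r < 0\<close> is the price, an arbitrarily
  small loss of regularity.\<close>

lemma para_bound: assumes "t + r < 0"
 shows "\<exists>B\<ge>0. \<forall>f g K. (\<forall>n y. hb 0 (tprod (tr y (low n f)) (fat n g)) (K * dyad n r)) -->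
   psum f g \<and> hb t (par f g) (B * K)"
proof -
 from hb_para_term[of t] obtain B where B: "0 \<le> B"
  "\<And>n f g K. \<forall>y. hb 0 (tprod (tr y (low n f)) (fat n g)) K ==> hb t (tprod (low n f) (blk n g)) (B * dyad n t * K)"
  by blast
 have "psum f g \<and> hb t (par f g) (B * geo (t + r) * K)"
  if K: "\<And>n y. hb 0 (tprod (tr y (low n f)) (fat n g)) (K * dyad n r)" for f g K
 proof -
  have b: "hb t (tprod (low n f) (blk n g)) (B * K * dyad n (t + r))" for n
  proof -
   have "hb t (tprod (low n f) (blk n g)) (B * dyad n t * (K * dyad n r))"
    by (rule B(2)) (use K in blast)
   then show ?thesis by (simp add: powr_expand)
  qed
  have s: "(\<lambda>n::nat. B * K * dyad n (t + r)) summable_on UNIV"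
   by (intro summable_on_cmult_right geo_summable assms)
  from hb_infsum[OF b s] have "psum f g" "hb t (\<lambda>k. INFSUM n. tprod (low n f) (blk n g) k) (INFSUM n. B * K * dyad n (t + r))"
   by (auto simp: psum_def intro: abs_summable_summable)
  moreover have "par f g = (\<lambda>k. INFSUM n. tprod (low n f) (blk n g) k)" by (rule ext) (rule para_eq)
  ultimately show ?thesis by (simp add: infsum_cmult_right' geo_def mult_ac)
 qed
 moreover have "0 \<le> B * geo (t + r)" using B geo_nonneg by simp
 ultimately show ?thesis by blast
qed

lemma hb0_low: "hb a f C ==> hb 0 (low n f) (cj powr max (- a) 0 * 2 powr (real n * max (- a) 0) * C)"
proof (cases "0 \<le> a")
 case True
 assume "hb a f C"
 from hb_weaken[OF hb_low[OF this] True] show ?thesis using True cj_ge_1 by (simp add: max_def)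
next
 case False
 assume "hb a f C"
 have cj: "0 \<le> cj" using cj_ge_1 by simp
 from hb_ball[OF hb_low[OF \<open>hb a f C\<close>, of n] _ _ cj, of n 0] jap_le_cj[OF low_freq]
 show ?thesis using False by (simp add: max_def)
qed

lemma hb_para_HC: assumes "t < b + min a 0"
 shows "\<exists>B\<ge>0. \<forall>f g C D. hb a f C --> bb b g D --> psum f g \<and> hb t (par f g) (B * C * D)"
proof -
 \<comment> \<open>Growth rate in \<open>n\<close> of the pieces: the low part of \<open>f\<close>
   grows like \<open>dyad n (- a)\<close> in L2 when \<open>a\<close> is negative and stays bounded
   otherwise, and the block of \<open>g\<close> contributes \<open>dyad n (- b)\<close>.\<close>
 define r where "r = max (- a) 0 - b"
 have "t + r < 0" using assms by (auto simp: r_def)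
 from para_bound[OF this] obtain B where B: "0 \<le> B"
  "\<And>f g K. \<forall>n y. hb 0 (tprod (tr y (low n f)) (fat n g)) (K * dyad n r) ==> psum f g \<and> hb t (par f g) (B * K)"
  by blast
 define c where "c = cj powr max (- a) 0 * (3 * 2 powr \<bar>b\<bar>)"
 have "psum f g \<and> hb t (par f g) (B * (c * C * D))" if f: "hb a f C" and g: "bb b g D" for f g C D
 proof (rule B(2); intro allI)
  fix n y
  have "hb 0 (tprod (tr y (low n f)) (fat n g)) ((cj powr max (- a) 0 * 2 powr (real n * max (- a) 0) * C) * (3 * 2 powr \<bar>b\<bar> * D * dyad n (- b)))"
   by (intro hb_tprod hb_tr hb0_low f ub_fat g) (auto simp: fs_fat fs_low tr_supp)
  also have "\<dots> = c * C * D * dyad n r" by (simp add: c_def r_def powr_expand)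
  finally show "hb 0 (tprod (tr y (low n f)) (fat n g)) \<dots>" .
 qed
 moreover have "0 \<le> B * c" using B by (simp add: c_def)
 ultimately show ?thesis by (intro exI[of _ "B * c"]) (simp add: mult.assoc)
qed

lemma hb0_fat: "hb a f C ==> hb 0 (fat n f) (((la / 2) powr - a + (2 * cj) powr - a) * dyad n (- a) * C)"
 using hb_annulus[OF hb_fat, of a f C "la / 2" n n "2 * cj" 0] fat_jap[of n f] la by auto

lemma hb_para_CH: assumes "a < 0" "t < a + b"
 shows "\<exists>B\<ge>0. \<forall>f g C D. bb a f C --> hb b g D --> psum f g \<and> hb t (par f g) (B * C * D)"
proof -
 define r where "r = - a - b"
 have "t + r < 0" using assms by (auto simp: r_def)
 from para_bound[OF this] obtain B where B: "0 \<le> B"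
  "\<And>f g K. \<forall>n y. hb 0 (tprod (tr y (low n f)) (fat n g)) (K * dyad n r) ==> psum f g \<and> hb t (par f g) (B * K)"
  by blast
 define c where "c = geo a * ((la / 2) powr - b + (2 * cj) powr - b)"
 have "psum f g \<and> hb t (par f g) (B * (c * C * D))" if f: "bb a f C" and g: "hb b g D" for f g C D
 proof (rule B(2); intro allI)
  fix n y
  have "hb 0 (tprod (fat n g) (tr y (low n f))) ((((la / 2) powr - b + (2 * cj) powr - b) * dyad n (- b) * D) * (geo a * C * dyad n (- a)))"
   by (intro hb_tprod ub_tr hb0_fat f ub_low g assms) (auto simp: fs_fat fs_low tr_supp)
  also have "\<dots> = c * C * D * dyad n r" by (simp add: c_def r_def powr_expand)
  finally show "hb 0 (tprod (tr y (low n f)) (fat n g)) \<dots>" unfolding tprod_commute[of "tr y (low n f)"] .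
 qed
 moreover have "0 \<le> B * c" using B geo_nonneg by (simp add: c_def)
 ultimately show ?thesis by (intro exI[of _ "B * c"]) (simp add: mult.assoc)
qed

lemma para_linear_left: assumes "psum f g" "psum f' g"
 shows "psum (scale z f + f') g" "par (scale z f + f') g = scale z (par f g) + par f' g"
proof -
 have e: "tprod (low n (scale z f + f')) (blk n g) k = z * tprod (low n f) (blk n g) k + tprod (low n f') (blk n g) k" for n k
  unfolding low_linear by (rule tprod_linear_left[OF fs_low fs_low])
 have s: "(\<lambda>n. tprod (low n f) (blk n g) k) summable_on UNIV" "(\<lambda>n. tprod (low n f') (blk n g) k) summable_on UNIV" for k
  using assms by (auto simp: psum_def)
 show "psum (scale z f + f') g" unfolding psum_def e
  by (intro allI summable_on_add summable_on_cmult_right s)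
 show "par (scale z f + f') g = scale z (par f g) + par f' g"
  by (rule ext) (simp add: para_eq e scale_apply infsum_linear[OF s])
qed

lemma para_linear_right: assumes "psum f g" "psum f g'"
 shows "psum f (scale z g + g')" "par f (scale z g + g') = scale z (par f g) + par f g'"
proof -
 have e: "tprod (low n f) (blk n (scale z g + g')) k = z * tprod (low n f) (blk n g) k + tprod (low n f) (blk n g') k" for n k
  unfolding blk_linear by (rule tprod_linear_right[OF fs_blk fs_blk])
 have s: "(\<lambda>n. tprod (low n f) (blk n g) k) summable_on UNIV" "(\<lambda>n. tprod (low n f) (blk n g') k) summable_on UNIV" for k
  using assms by (auto simp: psum_def)
 show "psum f (scale z g + g')" unfolding psum_def e
  by (intro allI summable_on_add summable_on_cmult_right s)
 show "par f (scale z g + g') = scale z (par f g) + par f g'"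
  by (rule ext) (simp add: para_eq e scale_apply infsum_linear[OF s])
qed

subsection \<open>The resonant product\<close>

lemma bij_pairs:
 "bij_betw (\<lambda>(j, i). (int i - 1, int j - 1)) (Sigma UNIV nbh) {(i, j). -1 \<le> i \<and> -1 \<le> j \<and> \<bar>i - j\<bar> \<le> 1}"
 by (rule bij_betwI[where g = "\<lambda>(i, j). (nat (j + 1), nat (i + 1))"]) (auto simp: nbh_iff)

lemma resonant_pairs:
 "reso f g k = (\<Sum>\<^sub>\<infinity>(j, i)\<in>Sigma UNIV nbh. tprod (blk i f) (blk j g) k)"
 unfolding resonant_def infsum_reindex_bij_betw[OF bij_pairs, symmetric]
 by (intro infsum_cong) (auto simp: lp_block_blk[symmetric])

lemma resonant_commute: "reso f g = reso g f"
proof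
 fix k
 let ?R = "{(i::int, j::int). -1 \<le> i \<and> -1 \<le> j \<and> \<bar>i - j\<bar> \<le> 1}"
 have b: "bij_betw (\<lambda>(i, j). (j, i)) ?R ?R" by (rule bij_betwI[where g = "\<lambda>(i, j). (j, i)"]) auto
 show "reso f g k = reso g f k" unfolding resonant_def
  by (subst infsum_reindex_bij_betw[OF b, symmetric]) (auto intro!: infsum_cong simp: tprod_commute)
qed

text \<open>Resonant pieces only lie in balls, so nothing is gained from localisation and
  \<open>a + b\<close> must be positive for the series to converge. The double sum over neighbouring
  indices converges absolutely and collapses to a sum over \<open>n\<close> with
  \<open>fat n f\<close>.\<close>

lemma hb_resonant: assumes ab: "0 < a + b" and t: "0 \<le> t" "t < a + b"
 shows "\<exists>B\<ge>0. \<forall>f g C D. hb a f C --> bb b g D -->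
   (\<forall>k. (\<lambda>n. tprod (fat n f) (blk n g) k) summable_on UNIV) \<and>
   (\<forall>k. reso f g k = (INFSUM n. tprod (fat n f) (blk n g) k)) \<and>
   hb t (reso f g) (B * C * D)"
proof -
 define c where "c = (la / 2) powr - a + (2 * cj) powr - a"
 have c0: "0 \<le> c" by (simp add: c_def)
 define B where "B = (3 * cj) powr t * c * geo (t - (a + b))"
 have "(\<forall>k. (\<lambda>n. tprod (fat n f) (blk n g) k) summable_on UNIV) \<and>
   (\<forall>k. reso f g k = (INFSUM n. tprod (fat n f) (blk n g) k)) \<and>
   hb t (reso f g) (B * C * D)" if f: "hb a f C" and g: "bb b g D" for f g C D
 proof -
  have C0: "0 \<le> C" and D0: "0 \<le> D" using hb_nonneg[OF f] bb_nonneg[OF g] .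
  have b: "hb 0 (tprod F (blk n g)) (c * C * D * dyad n (- (a + b)))"
   if "fs F" "hb 0 F (c * dyad n (- a) * C)" for F n
   using hb_tprod[OF that(1) fs_blk that(2) bbD[OF g, of n]] by (simp add: powr_expand)
  have b1: "hb 0 (tprod (blk i f) (blk n g)) (c * C * D * dyad n (- (a + b)))" if i: "i \<in> nbh n" for i n
   using hb_annulus[OF hb_blk[OF f, of i], of "la / 2" n "2 * cj" 0] lpf_nbh_jap[OF i blk_nonzero[of i f]] la
   by (intro b fs_blk) (auto simp: c_def)
  have b2: "hb 0 (tprod (fat n f) (blk n g)) (c * C * D * dyad n (- (a + b)))" for n
   using hb0_fat[OF f, of n] by (intro b fs_fat) (simp add: c_def)
  have ft: "tprod (fat n f) (blk n g) k = (\<Sum>i\<in>nbh n. tprod (blk i f) (blk n g) k)" for n k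
   unfolding fat_sum by (rule tprod_sum_left) (auto simp: fs_blk)
  have g0: "(\<lambda>n::nat. c * C * D * dyad n (- (a + b))) summable_on UNIV"
   by (intro summable_on_cmult_right geo_summable) (use ab in simp)
  have s1: "(\<lambda>n. tprod (fat n f) (blk n g) k) summable_on UNIV" for k
   by (rule abs_summable_summable[OF hb_infsum(1)[OF b2 g0]])
  have s2: "(\<lambda>(n, i). tprod (blk i f) (blk n g) k) summable_on Sigma UNIV nbh" for k
  proof (rule summable_le)
   show "(\<lambda>(n, i). c * C * D * dyad n (- (a + b))) summable_on Sigma UNIV nbh"
   proof (rule summable_on_SigmaI)
    show "((\<lambda>i. case (n, i) of (n, i) => c * C * D * dyad n (- (a + b))) has_sum
      real (card (nbh n)) * (c * C * D * dyad n (- (a + b)))) (nbh n)" for n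
     using has_sum_finite[OF finite_nbh, of "\<lambda>_. c * C * D * dyad n (- (a + b))" n] by simp
    show "(\<lambda>n. real (card (nbh n)) * (c * C * D * dyad n (- (a + b)))) summable_on UNIV"
     by (rule summable_le[OF summable_on_cmult_right[OF g0, of 3]])
       (use card_nbh_le c0 C0 D0 in \<open>auto simp: abs_mult intro!: mult_right_mono\<close>)
   qed (use c0 C0 D0 in auto)
   show "norm (case p of (n, i) => tprod (blk i f) (blk n g) k) \<le> (case p of (n, i) => c * C * D * dyad n (- (a + b)))"
    if "p \<in> Sigma UNIV nbh" for p using that hb0_coeff[OF b1, of "snd p" "fst p" k] by (cases p) auto
  qed
  have eq: "reso f g k = (INFSUM n. tprod (fat n f) (blk n g) k)" for k
   unfolding resonant_pairs infsum_Sigma'_banach[OF s2, symmetric] ft by simp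
  have b3: "hb t (tprod (fat n f) (blk n g)) ((3 * cj) powr t * c * C * D * dyad n (t - (a + b)))" for n
  proof -
   have j: "jap k \<le> 3 * cj * 2 ^ n" if "tprod (fat n f) (blk n g) k \<noteq> 0" for k
   proof -
    have "nf k \<le> 2 * lb * 2 ^ n + lb * 2 ^ n" by (rule tprod_supp_jap[OF fat_freq[of n f] blk_freq[of n g] that])
    then show ?thesis by (intro jap_le_cj_mult) auto
   qed
   have "0 \<le> 3 * cj" using cj_ge_1 by simp
   from hb_ball[OF b2[of n] j t(1) this] show ?thesis by (simp add: powr_expand)
  qed
  have "hb t (\<lambda>k. INFSUM n. tprod (fat n f) (blk n g) k) (\<Sum>\<^sub>\<infinity>n::nat. (3 * cj) powr t * c * C * D * dyad n (t - (a + b)))"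
   by (rule hb_infsum(2)[OF b3], intro summable_on_cmult_right geo_summable) (use t in simp)
  then have "hb t (reso f g) (B * C * D)"
   unfolding eq[abs_def, symmetric] infsum_cmult_right' geo_def[symmetric]
   by (simp add: eq[abs_def] B_def mult_ac)
  then show ?thesis using s1 eq by blast
 qed
 moreover have "0 \<le> B" using c0 geo_nonneg by (simp add: B_def)
 ultimately show ?thesis by blast
qed

lemma resonant_eq_sum: assumes "hb a f C" "bb b g D" "0 < a + b"
 shows "(\<lambda>n. tprod (fat n f) (blk n g) k) summable_on UNIV"
  "reso f g k = (INFSUM n. tprod (fat n f) (blk n g) k)"
 using hb_resonant[OF assms(3) order_refl assms(3)] assms(1,2) by blast+

lemma resonant_linear_left: assumes "hb a f C" "hb a f' C'" "bb b g D" "0 < a + b"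
 shows "reso (scale z f + f') g = scale z (reso f g) + reso f' g"
proof
 fix k
 have l: "hb a (scale z f + f') (cmod z * C + C')" by (intro hb_add' hb_scale assms)
 have e: "tprod (fat n (scale z f + f')) (blk n g) k = z * tprod (fat n f) (blk n g) k + tprod (fat n f') (blk n g) k" for n
  unfolding fat_linear by (rule tprod_linear_left[OF fs_fat fs_fat])
 show "reso (scale z f + f') g k = (scale z (reso f g) + reso f' g) k"
  unfolding plus_fun_apply scale_apply resonant_eq_sum(2)[OF l assms(3,4)] resonant_eq_sum(2)[OF assms(1,3,4)] resonant_eq_sum(2)[OF assms(2,3,4)] e
  by (rule infsum_linear[OF resonant_eq_sum(1)[OF assms(1,3,4)] resonant_eq_sum(1)[OF assms(2,3,4)]])
qed

lemma resonant_linear_right: assumes "hb a f C" "bb b g D" "bb b g' D'" "0 < a + b"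
 shows "reso f (scale z g + g') = scale z (reso f g) + reso f g'"
proof
 fix k
 have l: "bb b (scale z g + g') (cmod z * D + D')" by (intro bb_add bb_scale assms)
 have e: "tprod (fat n f) (blk n (scale z g + g')) k = z * tprod (fat n f) (blk n g) k + tprod (fat n f) (blk n g') k" for n
  unfolding blk_linear by (rule tprod_linear_right[OF fs_blk fs_blk])
 show "reso f (scale z g + g') k = (scale z (reso f g) + reso f g') k"
  unfolding plus_fun_apply scale_apply resonant_eq_sum(2)[OF assms(1) l assms(4)] resonant_eq_sum(2)[OF assms(1,2,4)] resonant_eq_sum(2)[OF assms(1,3,4)] e
  by (rule infsum_linear[OF resonant_eq_sum(1)[OF assms(1,2,4)] resonant_eq_sum(1)[OF assms(1,3,4)]])
qed

subsection \<open>Decomposition of products\<close>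

lemma lpf_pair_has_sum: "((\<lambda>(i, j). lpf i x * lpf j y) has_sum 1) UNIV"
proof -
 have i: "((\<lambda>j. lpf i x * lpf j y) has_sum lpf i x) UNIV" for i
  using has_sum_cmult_right[OF lpf_has_sum[of y], of "lpf i x"] by simp
 have "((\<lambda>(i, j). lpf i x * lpf j y) has_sum 1) (UNIV \<times> UNIV)"
  by (intro has_sum_SigmaI[where g = "\<lambda>i. lpf i x"] summable_on_SigmaI[where g = "\<lambda>i. lpf i x"])
    (auto simp: i lpf_nonneg lpf_has_sum has_sum_imp_summable[OF lpf_has_sum])
 then show ?thesis by simp
qed

text \<open>Insert the partition of unity into both factors. The symbols are nonnegative and sum to
  1, so the family indexed by frequency and pair of blocks is absolutely summable with the
  convolution; Fubini then permits sorting the pairs into the two strict halves and the neighbouring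
  ones.\<close>

lemma tprod_decomposition: assumes s: "(\<lambda>l. cmod (f l * g (k - l))) summable_on UNIV"
 shows "tprod f g k = par f g k + par g f k + reso f g k"
proof -
 define T where "T l p = (case p of (i, j) => cor (lpf i (freq l) * lpf j (freq (k - l))) * (f l * g (k - l)))" for l p
 define q where "q p = (case p of (i, j) => tprod (blk i f) (blk j g) k)" for p
 have Tl: "((\<lambda>p. T l p) has_sum f l * g (k - l)) UNIV" for l
  using has_sum_cmult_left[OF has_sum_of_real[OF lpf_pair_has_sum[of "freq l" "freq (k - l)"]], of "f l * g (k - l)"]
  by (simp add: T_def[abs_def] case_prod_unfold)
 have nT: "norm (T l p) = (case p of (i, j) => lpf i (freq l) * lpf j (freq (k - l))) * cmod (f l * g (k - l))" for l p
  using lpf_nonneg by (simp add: T_def norm_mult case_prod_unfold abs_mult)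
 have nTl: "((\<lambda>p. norm (T l p)) has_sum cmod (f l * g (k - l))) UNIV" for l
  unfolding nT using has_sum_cmult_left[OF lpf_pair_has_sum[of "freq l" "freq (k - l)"], of "cmod (f l * g (k - l))"] by simp
 have absT: "(\<lambda>(l, p). T l p) summable_on UNIV \<times> UNIV"
 proof (rule abs_summable_summable, rule summable_on_SigmaI)
  show "((\<lambda>p. norm (case (l, p) of (l, p) => T l p)) has_sum cmod (f l * g (k - l))) UNIV" for l
   using nTl[of l] by simp
 qed (use s in auto)
 have Tq: "(INFSUM l. T l p) = q p" for p
  by (cases p) (simp add: q_def T_def tprod_def blk_def mult_ac)
 have "(\<lambda>(l, p). T l p) \<circ> prod.swap summable_on UNIV \<times> UNIV"
  by (subst summable_on_reindex[symmetric]) (use absT in \<open>auto simp: product_swap\<close>)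
 then have absT': "(\<lambda>(p, l). T l p) summable_on UNIV \<times> UNIV"
  by (simp add: o_def case_prod_unfold)
 have qs: "q summable_on UNIV" using summable_on_Sigma_banach[OF absT'] by (simp add: Tq)
 have qsum: "(INFSUM p. q p) = tprod f g k"
  using infsum_swap_banach[OF absT] by (simp add: Tq infsumI[OF Tl] tprod_def)
 define P1 where "P1 = {(i::nat, j::nat). i + 1 < j}"
 define P2 where "P2 = {(i::nat, j::nat). j + 1 < i}"
 define P3 where "P3 = {(i, j). i \<in> nbh j}"
 have qX: "q summable_on X" for X by (rule summable_on_subset_banach[OF qs]) simp
 have half: "infsum q P = par u v k" if b: "bij_betw h (SIGMA j:UNIV. {..<j - 1}) P"
  and h: "\<And>j i. q (h (j, i)) = tprod (blk i u) (blk j v) k" for h P u v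
 proof -
  have s: "(\<lambda>(j, i). tprod (blk i u) (blk j v) k) summable_on (SIGMA j:UNIV. {..<j - 1})"
   using summable_on_reindex_bij_betw[OF b, of q] qX[of P] by (simp add: case_prod_unfold flip: h)
  have "infsum q P = (\<Sum>\<^sub>\<infinity>(j, i)\<in>(SIGMA j:UNIV. {..<j - 1}). tprod (blk i u) (blk j v) k)"
   using infsum_reindex_bij_betw[OF b, of q] by (simp add: case_prod_unfold flip: h)
  also have "\<dots> = (INFSUM j. \<Sum>i<j - 1. tprod (blk i u) (blk j v) k)" using infsum_Sigma'_banach[OF s] by simp
  also have "\<dots> = par u v k"
   unfolding para_eq low_sum by (subst tprod_sum_left) (auto simp: fs_blk)
  finally show ?thesis .
 qed
 have U: "UNIV = (P1 \<union> P2) \<union> P3" by (auto simp: P1_def P2_def P3_def nbh_iff)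
 have "(INFSUM p. q p) = infsum q (P1 \<union> P2) + infsum q P3"
  unfolding U by (rule infsum_Un_disjoint[OF qX qX]) (auto simp: P1_def P2_def P3_def nbh_iff)
 also have "infsum q (P1 \<union> P2) = infsum q P1 + infsum q P2"
  by (rule infsum_Un_disjoint[OF qX qX]) (auto simp: P1_def P2_def)
 also have "infsum q P1 = par f g k" by (rule half[of "\<lambda>(j, i). (i, j)"])
    (auto simp: P1_def q_def intro!: bij_betwI[where g = "\<lambda>(i, j). (j, i)"])
 also have "infsum q P2 = par g f k" by (rule half[of "\<lambda>(j, i). (j, i)"])
    (auto simp: P2_def q_def tprod_commute intro!: bij_betwI[where g = "\<lambda>(i, j). (i, j)"])
 also have "infsum q P3 = reso f g k"
 proof -
  have b: "bij_betw (\<lambda>(j, i). (i, j)) (Sigma UNIV nbh) P3"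
   by (rule bij_betwI[where g = "\<lambda>(i, j). (j, i)"]) (auto simp: P3_def)
  show ?thesis using infsum_reindex_bij_betw[OF b, of q] by (simp add: case_prod_unfold resonant_pairs q_def)
 qed
 finally show ?thesis by (simp add: qsum)
qed

lemma hb_of_bb: assumes "s < b" shows "\<exists>B\<ge>0. \<forall>g D. bb b g D --> hb s g (B * D)"
proof -
 define c where "c = la powr s + cj powr s"
 have "hb s g (c * geo (s - b) * D)" if g: "bb b g D" for g D
 proof -
  have b1: "hb s (blk n g) (c * D * dyad n (s - b))" for n
  proof -
   have "hb s (blk n g) ((la powr (s - 0) + cj powr (s - 0)) * dyad n (s - 0) * (D * dyad n (- b)))"
    by (rule hb_annulus[OF hb_of_ub[OF fs_blk bbD[OF g]] la(1)]) (use lpf_jap[OF blk_nonzero] in blast)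
   then show ?thesis by (simp add: c_def powr_expand)
  qed
  have "hb s (\<lambda>k. INFSUM n. blk n g k) (\<Sum>\<^sub>\<infinity>n::nat. c * D * dyad n (s - b))"
   by (rule hb_infsum(2)[OF b1], intro summable_on_cmult_right geo_summable) (use assms in simp)
  then show ?thesis by (simp add: infsumI[OF blk_has_sum] infsum_cmult_right' geo_def mult_ac)
 qed
 moreover have "0 \<le> c * geo (s - b)" using geo_nonneg by (simp add: c_def)
 ultimately show ?thesis by blast
qed

lemma tprod_decomposition_HC: assumes "hb a f C" "bb b g D" "0 < a" "0 < a + b"
 shows "tprod f g = par f g + par g f + reso f g"
  "(\<lambda>l. cmod (f l * g (k - l))) summable_on UNIV"
proof -
 obtain B where "\<And>g D. bb b g D ==> hb (- a) g (B * D)" using hb_of_bb[of "- a" b] assms by auto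
 then have g: "hb (- a) g (B * D)" using assms by blast
 show s: "(\<lambda>l. cmod (f l * g (k - l))) summable_on UNIV" for k
  by (rule summable_product_hb[OF assms(1) g]) (use assms in simp)
 show "tprod f g = par f g + par g f + reso f g" by (rule ext) (simp add: tprod_decomposition[OF s])
qed

end

section \<open>Schauder estimates\<close>

lemma bump_mult: assumes "bump b f" "\<And>n. cd n g" shows "bump b (\<lambda>x. g x * f x)"
 using assms by (auto simp: bump_def smooth_on_def intro!: cd_mult)

lemma partial_apply: "partial1 f k = 2 * of_real pi * \<i> * of_real (fst (freq k)) * f k"
 "partial2 f k = 2 * of_real pi * \<i> * of_real (snd (freq k)) * f k"
 by (simp_all add: partial1_def partial2_def freq_def)

lemma two_pow_sq: "((2::real) ^ n)^2 = dyad n 2"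
proof -
 have "((2::real) ^ n)^2 = 2 powr real n * 2 powr real n" by (simp add: power2_eq_square powr_realpow)
 also have "\<dots> = dyad n 2" unfolding powr_add[symmetric] by (simp add: mult.commute)
 finally show ?thesis .
qed

lemma powr_sq: "(dyad n r)^2 = dyad n (2 * r)"
 unfolding power2_eq_square powr_add[symmetric] by (simp add: algebra_simps)

lemma four_pow: "(4::real) ^ n = dyad n 2"
 unfolding two_pow_sq[symmetric] by (simp add: power_mult[symmetric] mult.commute[of n] power_mult)

lemma inv_lap_apply: "inv_one_minus_lap f k = f k / of_real ((jap k)^2)"
 by (simp add: inv_one_minus_lap_def jap_sq)

context lp begin

text \<open>Bounding the sup norm by the sum of the coefficients costs the number of frequencies in
  the block, of order \<open>2 ^ (2 * n)\<close>, which eats up the two derivatives gained. The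
  lossy bound is still what \<open>bb_inv_lap\<close> needs as a start.\<close>

lemma bb_inv_lap_crude:
 "\<exists>C\<ge>0. \<forall>f D. bb a f D --> bb a (inv_one_minus_lap f) (C * D)"
proof -
 define C where "C = (3 * lb / la)^2"
 have "bb a (inv_one_minus_lap f) (C * D)" if f: "bb a f D" for f D unfolding bb_def
 proof
  fix n
  let ?X = "inv_one_minus_lap f" and ?E = "D * dyad n (- a)"
  let ?A = "{k. nf k \<le> lb * 2 ^ n}"
  have E0: "0 \<le> ?E" by (rule ub_nonneg[OF bbD[OF f]])
  have c: "cmod (blk n ?X k) \<le> ?E / (la * 2 ^ n)^2" for k
  proof (cases "lpf n (freq k) = 0")
   case False
   have j: "la * 2 ^ n \<le> jap k" using lpf_jap[OF False] by simp
   have l: "0 < la * 2 ^ n" using la by simp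
   have "cmod (blk n ?X k) = cmod (blk n f k) / (jap k)^2"
    by (simp add: blk_def inv_lap_apply norm_mult norm_divide norm_power)
   also have "\<dots> \<le> ?E / (la * 2 ^ n)^2"
    using hb0_coeff[OF hb_of_ub[OF fs_blk bbD[OF f, of n]], of k] j l E0 by (intro frac_le power_mono) auto
   finally show ?thesis .
  qed (use E0 in \<open>simp add: blk_def\<close>)
  have "ub (blk n ?X) (\<Sum>k\<in>?A. cmod (blk n ?X k))"
   by (rule ub_coeff_sum[OF finite_freq_ball]) (use blk_freq in auto)
  moreover have "(\<Sum>k\<in>?A. cmod (blk n ?X k)) \<le> C * D * dyad n (- a)"
  proof -
   have "(\<Sum>k\<in>?A. cmod (blk n ?X k)) \<le> real (card ?A) * (?E / (la * 2 ^ n)^2)"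
    by (rule sum_bounded_above) (rule c)
   also have "\<dots> \<le> (3 * lb * 2 ^ n)^2 * (?E / (la * 2 ^ n)^2)"
   proof (intro mult_right_mono)
    have "real (card ?A) \<le> (2 * (lb * 2 ^ n) + 1)^2" using lb by (intro card_freq_ball) simp
    also have "\<dots> \<le> (3 * lb * 2 ^ n)^2"
    proof (rule power_mono)
     have "1 * 1 \<le> lb * 2 ^ n" using lb by (intro mult_mono) auto
     then show "2 * (lb * 2 ^ n) + 1 \<le> 3 * lb * 2 ^ n" by simp
    qed (use lb in simp)
    finally show "real (card ?A) \<le> (3 * lb * 2 ^ n)^2" .
   qed (use E0 in simp)
   also have "\<dots> = C * D * dyad n (- a)"
    using la by (simp add: C_def power_mult_distrib power_divide field_simps)
   finally show ?thesis .
  qed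
  ultimately show "ub (blk n ?X) (C * D * dyad n (- a))" by (rule ub_mono)
 qed
 moreover have "0 \<le> C" by (simp add: C_def)
 ultimately show ?thesis by blast
qed

text \<open>A smooth version of \<open>rho1 x / |x|^2\<close>: the \<open>chi\<close> term keeps the denominator away from zero at the
 origin and vanishes on the support of \<open>rho1\<close>.\<close>

definition qlap :: "real \<times> real => real" where
 "qlap x = inverse (fst x * fst x + snd x * snd x + chi ((2 * lb / la) *\<^sub>R x)) * rho1 x"

lemma chi_0: "chi 0 = 1"
proof -
 have r0: "rho 0 = 0" using rho_supp[of 0] la by force
 have "(\<lambda>j::nat. rho ((1 / 2 ^ j) *\<^sub>R 0)) sums (1 - chi 0)" using LP unfolding littlewood_paley_def by blast
 then have "(\<lambda>j::nat. 0::real) sums (1 - chi 0)" by (simp add: r0)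
 then show ?thesis using sums_unique2 sums_zero by fastforce
qed

lemma qlap_eq: "(norm x)^2 * qlap x = rho1 x"
proof (cases "rho1 x = 0")
 case False
 have n: "la \<le> norm x" using rho_supp[of "2 *\<^sub>R x"] False by (simp add: rho1_def)
 have "chi ((2 * lb / la) *\<^sub>R x) = 0"
 proof (rule ccontr)
  assume "chi ((2 * lb / la) *\<^sub>R x) \<noteq> 0"
  then have "norm ((2 * lb / la) *\<^sub>R x) \<le> lb" by (rule chi_supp)
  then have "2 * lb * norm x \<le> lb * la" using la lb by (simp add: field_simps)
  moreover have "2 * lb * la \<le> 2 * lb * norm x" using n lb by (intro mult_left_mono) auto
  ultimately have "lb * la \<le> 0" by simp
  moreover have "0 < lb * la" using la lb by simp
  ultimately show False by linarith
 qed
 moreover have "(norm x)^2 = fst x * fst x + snd x * snd x" by (simp add: norm_prod_def power2_eq_square)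
 ultimately have "qlap x = inverse ((norm x)^2) * rho1 x" by (simp add: qlap_def)
 moreover have "(norm x)^2 \<noteq> 0" using n la by auto
 ultimately show ?thesis by (simp add: mult.assoc[symmetric] del: power_eq_0_iff)
qed (simp add: qlap_def)

lemma bump_qlap: "bump lb qlap" unfolding qlap_def[abs_def]
proof (rule bump_mult[OF bump_rho1])
 fix n
 have c: "cd n chi" using bump_chi by (auto simp: bump_def smooth_on_def)
 show "cd n (\<lambda>x. inverse (fst x * fst x + snd x * snd x + chi ((2 * lb / la) *\<^sub>R x)))"
 proof (rule cd_inverse)
  show "cd n (\<lambda>x. fst x * fst x + snd x * snd x + chi ((2 * lb / la) *\<^sub>R x))"
   by (intro cd_add cd_mult cd_fst cd_snd cd_scaleR c)
  fix x :: "real \<times> real"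
  have nn: "0 \<le> chi y" for y using LP by (simp add: littlewood_paley_def)
  show "fst x * fst x + snd x * snd x + chi ((2 * lb / la) *\<^sub>R x) \<noteq> 0"
  proof
   assume z: "fst x * fst x + snd x * snd x + chi ((2 * lb / la) *\<^sub>R x) = 0"
   have "0 \<le> fst x * fst x" "0 \<le> snd x * snd x" by simp_all
   then have "fst x * fst x = 0" "snd x * snd x = 0" using z nn[of "(2 * lb / la) *\<^sub>R x"] by linarith+
   then have "x = 0" by (simp add: prod_eq_iff)
   then show False using z chi_0 by simp
  qed
 qed
qed

text \<open>The symbol of the inverse of 1 - \<Delta> is not a dilate of one fixed function, but
  that of the inverse Laplacian is. With X the image of f, the identity - \<Delta> X = f - X
  expresses a block of X by \<open>qlap\<close> applied to f - X with the factor
  \<open>4 ^ n\<close> in the denominator, and the crude bound controls X on the right. The lowest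
  block needs no gain.\<close>

lemma bb_inv_lap:
 "\<exists>C\<ge>0. \<forall>f D. bb a f D --> bb (a + 2) (inv_one_minus_lap f) (C * D)"
proof -
 from bb_inv_lap_crude[of a] obtain C1 where C1: "0 \<le> C1"
  "\<And>f D. bb a f D ==> bb a (inv_one_minus_lap f) (C1 * D)" by blast
 from ub_dil[OF bump_qlap, of "2 * lb"] obtain C2 where C2: "0 \<le> C2"
  "\<And>n F D. \<forall>k. F k \<noteq> 0 --> nf k \<le> 2 * lb * 2 ^ n ==> ub F D ==> ub (dil qlap n F) (C2 * D)" by blast
 define C where "C = C1 + 1 / (4 * pi^2) * (C2 * (3 * 2 powr \<bar>a\<bar> * (1 + C1)))"
 have "bb (a + 2) (inv_one_minus_lap f) (C * D)" if f: "bb a f D" for f D unfolding bb_def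
 proof
  fix n
  let ?X = "inv_one_minus_lap f"
  have D0: "0 \<le> D" by (rule bb_nonneg[OF f])
  have X: "bb a ?X (C1 * D)" by (rule C1(2)[OF f])
  show "ub (blk n ?X) (C * D * dyad n (- (a + 2)))"
  proof (cases "n = 0")
   case True
   have "C1 * D \<le> C * D" unfolding C_def using C1 C2 D0 by (intro mult_right_mono) auto
   then show ?thesis using ub_mono[OF bbD[OF X, of 0]] True by simp
  next
   case False
   let ?Y = "fat n (f - ?X)"
   have "ub ?Y (3 * 2 powr \<bar>a\<bar> * (D + C1 * D) * dyad n (- a))"
    by (intro ub_fat bb_diff f X)
   then have "ub (dil qlap n ?Y) (C2 * (3 * 2 powr \<bar>a\<bar> * (D + C1 * D) * dyad n (- a)))"
    by (rule C2(2)[rotated]) (use fat_freq in blast)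
   from ub_cmult[OF this, of "cor (1 / (4 * pi^2 * 4 ^ n))"]
   have u: "ub (\<lambda>k. cor (1 / (4 * pi^2 * 4 ^ n)) * dil qlap n ?Y k)
     (1 / (4 * pi^2 * 4 ^ n) * (C2 * (3 * 2 powr \<bar>a\<bar> * (D + C1 * D) * dyad n (- a))))"
    by (simp add: norm_divide norm_mult norm_power)
   have e: "blk n ?X = (\<lambda>k. cor (1 / (4 * pi^2 * 4 ^ n)) * dil qlap n ?Y k)"
   proof
    fix k
    have j0: "cor ((jap k)^2) \<noteq> 0" by simp
    have fk: "f k = cor ((jap k)^2) * ?X k" by (simp add: inv_lap_apply)
    have fX: "(f - ?X) k = cor (4 * pi^2 * (nf k)^2) * ?X k"
     unfolding fun_diff_def by (subst (1) fk) (simp add: jap_sq algebra_simps)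
    have nk: "(norm ((1 / 2 ^ n) *\<^sub>R freq k))^2 = (nf k)^2 / 4 ^ n"
     by (simp add: power_divide power_mult[symmetric] mult.commute[of n] power_mult)
    have "(nf k)^2 * qlap ((1 / 2 ^ n) *\<^sub>R freq k) = 4 ^ n * rho1 ((1 / 2 ^ n) *\<^sub>R freq k)"
     using qlap_eq[of "(1 / 2 ^ n) *\<^sub>R freq k"] unfolding nk by (simp add: field_simps)
    then have s: "1 / (4 * pi^2 * 4 ^ n) * (qlap ((1 / 2 ^ n) *\<^sub>R freq k) * (4 * pi^2 * (nf k)^2)) = lpf n (freq k)"
     using False by (simp add: lpf_rho1 field_simps)
    have "cor (1 / (4 * pi^2 * 4 ^ n)) * dil qlap n ?Y k
      = cor (1 / (4 * pi^2 * 4 ^ n) * (qlap ((1 / 2 ^ n) *\<^sub>R freq k) * (4 * pi^2 * (nf k)^2))) * fat n ?X k"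
     unfolding dil_def fat_def fX by simp
    also have "\<dots> = blk n (fat n ?X) k" unfolding s blk_def ..
    finally show "blk n ?X k = cor (1 / (4 * pi^2 * 4 ^ n)) * dil qlap n ?Y k" by (simp add: blk_fat)
   qed
   have "1 / (4 * pi^2 * 4 ^ n) * (C2 * (3 * 2 powr \<bar>a\<bar> * (D + C1 * D) * dyad n (- a)))
     = (C - C1) * D * dyad n (- (a + 2))" by (simp add: C_def four_pow powr_expand)
   also have "\<dots> \<le> C * D * dyad n (- (a + 2))" using C1 D0 by (intro mult_right_mono) auto
   finally show ?thesis unfolding e by (rule ub_mono[OF u])
  qed
 qed
 moreover have "0 \<le> C" using C1 C2 by (simp add: C_def)
 ultimately show ?thesis by blast
qed

lemma bb_derivative: assumes d: "d = fst \<or> d = snd"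
 shows "\<exists>C\<ge>0. \<forall>f D. bb a f D --> bb (a - 1) (\<lambda>k. 2 * of_real pi * \<i> * of_real (d (freq k)) * f k) (C * D)"
proof -
 have dcd: "cd n d" for n using d cd_fst cd_snd by auto
 have ds: "d (c *\<^sub>R x) = c * d x" for c x using d by auto
 from ub_dil[OF bump_mult[OF bump_rho1 dcd], of "2 * lb"] obtain C1 where C1: "0 \<le> C1"
  "\<And>n F D. \<forall>k. F k \<noteq> 0 --> nf k \<le> 2 * lb * 2 ^ n ==> ub F D ==> ub (dil (\<lambda>x. d x * rho1 x) n F) (C1 * D)" by blast
 from ub_dil[OF bump_mult[OF bump_chi dcd], of "2 * lb"] obtain C2 where C2: "0 \<le> C2"
  "\<And>n F D. \<forall>k. F k \<noteq> 0 --> nf k \<le> 2 * lb * 2 ^ n ==> ub F D ==> ub (dil (\<lambda>x. d x * chi x) n F) (C2 * D)" by blast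
 define C where "C = 2 * pi * (max C1 C2 * (3 * 2 powr \<bar>a\<bar>))"
 have "bb (a - 1) (\<lambda>k. 2 * of_real pi * \<i> * of_real (d (freq k)) * f k) (C * D)" if f: "bb a f D" for f D
  unfolding bb_def
 proof
  fix n
  let ?E = "3 * 2 powr \<bar>a\<bar> * D * dyad n (- a)"
  define r where "r = (if n = 0 then (\<lambda>x. d x * chi x) else (\<lambda>x. d x * rho1 x))"
  have E0: "0 \<le> ?E" by (rule ub_nonneg[OF ub_fat[OF f]])
  have ff: "\<forall>k. fat n f k \<noteq> 0 --> nf k \<le> 2 * lb * 2 ^ n" using fat_freq by blast
  have le: "C1 * ?E \<le> max C1 C2 * ?E" "C2 * ?E \<le> max C1 C2 * ?E" using mult_right_mono[OF _ E0] by auto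
  have "ub (dil r n (fat n f)) (max C1 C2 * ?E)"
   unfolding r_def using ub_mono[OF C1(2)[OF ff ub_fat[OF f]] le(1)] ub_mono[OF C2(2)[OF ff ub_fat[OF f]] le(2)]
   by (simp only: split: if_split) blast
  from ub_cmult[OF this, of "2 * of_real pi * \<i> * 2 ^ n"]
  have u: "ub (\<lambda>k. 2 * of_real pi * \<i> * 2 ^ n * dil r n (fat n f) k) (2 * pi * 2 ^ n * (max C1 C2 * ?E))"
   by (simp add: norm_mult norm_power)
  have r: "2 ^ n * r ((1 / 2 ^ n) *\<^sub>R freq k) = d (freq k) * lpf n (freq k)" for k
   by (cases "n = 0") (simp_all add: r_def ds lpf_rho1, simp add: lpf_def)
  have "blk n (\<lambda>k. 2 * of_real pi * \<i> * of_real (d (freq k)) * f k) = (\<lambda>k. 2 * of_real pi * \<i> * 2 ^ n * dil r n (fat n f) k)"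
  proof
   fix k
   have "2 * of_real pi * \<i> * 2 ^ n * dil r n (fat n f) k = 2 * of_real pi * \<i> * cor (2 ^ n * r ((1 / 2 ^ n) *\<^sub>R freq k)) * fat n f k"
    by (simp add: dil_def)
   also have "\<dots> = 2 * of_real pi * \<i> * of_real (d (freq k)) * blk n (fat n f) k"
    unfolding r by (simp add: blk_def)
   also have "\<dots> = 2 * of_real pi * \<i> * of_real (d (freq k)) * blk n f k" by (simp add: blk_fat)
   finally show "blk n (\<lambda>k. 2 * of_real pi * \<i> * of_real (d (freq k)) * f k) k = 2 * of_real pi * \<i> * 2 ^ n * dil r n (fat n f) k"
    by (simp add: blk_def)
  qed
  moreover have "2 * pi * 2 ^ n * (max C1 C2 * ?E) = C * D * dyad n (- (a - 1))"
   by (simp add: C_def powr_expand powr_realpow)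
  ultimately show "ub (blk n (\<lambda>k. 2 * of_real pi * \<i> * of_real (d (freq k)) * f k)) (C * D * dyad n (- (a - 1)))"
   using u by (simp only:)
 qed
 moreover have "0 \<le> C" using C1 by (simp add: C_def)
 ultimately show ?thesis by blast
qed

lemma bb_partial1: "\<exists>C\<ge>0. \<forall>f D. bb a f D --> bb (a - 1) (partial1 f) (C * D)"
 using bb_derivative[of fst a] by (simp add: partial_apply[abs_def])

lemma bb_partial2: "\<exists>C\<ge>0. \<forall>f D. bb a f D --> bb (a - 1) (partial2 f) (C * D)"
 using bb_derivative[of snd a] by (simp add: partial_apply[abs_def])

end

section \<open>Square summation over dyadic scales\<close>

lemma sum_powr_tail_le:
 assumes "0 < r" and lower: "\<And>n. n \<in> I ==> x \<le> 2 ^ n" and I: "finite I" and x: "0 < x"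
 shows "(\<Sum>n\<in>I. dyad n (- r)) \<le> geo (- r) * x powr - r"
proof (cases "I = {}")
 case False
 define n0 where "n0 = Min I"
 have n0: "n0 \<in> I" using I False by (simp add: n0_def)
 have ge: "n0 \<le> n" if "n \<in> I" for n using I that by (simp add: n0_def)
 have "(\<Sum>n\<in>I. dyad n (- r)) = (\<Sum>n\<in>I. dyad (n - n0) (- r) * dyad n0 (- r))"
  using ge by (intro sum.cong refl) (simp add: of_nat_diff algebra_simps flip: powr_add)
 also have "\<dots> = (\<Sum>n\<in>I. dyad (n - n0) (- r)) * dyad n0 (- r)" by (simp add: sum_distrib_right)
 also have "(\<Sum>n\<in>I. dyad (n - n0) (- r)) = (\<Sum>j\<in>(\<lambda>n. n - n0) ` I. dyad j (- r))"
  using ge by (subst sum.reindex) (auto simp: inj_on_def le_diff_iff' eq_diff_iff)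
 also have "\<dots> \<le> geo (- r)" unfolding geo_def
  by (rule finite_sum_le_infsum) (use assms geo_summable[of "- r"] in auto)
 also have "geo (- r) * dyad n0 (- r) \<le> geo (- r) * x powr - r"
 proof (intro mult_left_mono geo_nonneg)
  have "dyad n0 (- r) = (2 ^ n0) powr - r" by (simp add: powr_powr flip: powr_realpow)
  also have "\<dots> \<le> x powr - r" using lower[OF n0] x assms(1) by (intro powr_mono2') auto
  finally show "dyad n0 (- r) \<le> x powr - r" .
 qed
 finally show ?thesis by (simp add: mult_right_mono)
qed (use geo_nonneg in simp)

lemma sum_powr_head_le:
 assumes "0 < r" and upper: "\<And>n. n \<in> I ==> 2 ^ n \<le> x" and I: "finite I"
 shows "(\<Sum>n\<in>I. dyad n r) \<le> 2 powr r * geo (- r) * x powr r"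
proof (cases "I = {}")
 case False
 define n0 where "n0 = Max I"
 have n0: "n0 \<in> I" using I False by (simp add: n0_def)
 have "(\<Sum>n\<in>I. dyad n r) \<le> (\<Sum>n<Suc n0. dyad n r)"
  by (rule sum_mono2) (use I in \<open>auto simp: n0_def less_Suc_eq_le\<close>)
 also have "\<dots> \<le> geo (- r) * dyad (Suc n0) r" by (rule sum_powr_le[OF assms(1)])
 also have "dyad (Suc n0) r = 2 powr r * (2 ^ n0) powr r"
  by (simp add: powr_powr distrib_right powr_add flip: powr_realpow)
 also have "geo (- r) * (2 powr r * (2 ^ n0) powr r) \<le> geo (- r) * (2 powr r * x powr r)"
  using upper[OF n0] assms(1) by (intro mult_left_mono powr_mono2 geo_nonneg) auto
 finally show ?thesis by (simp only: mult_ac)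
qed (use geo_nonneg in simp)

text \<open>A sum of pieces localised in balls of radius \<open>2\<^sup>n\<close> whose \<open>L^2\<close> norms are square summable
 after rescaling by \<open>2\<^sup>n\<^sup>s\<close>: insert \<open>2\<^sup>-\<^sup>n\<^sup>s\<^sup>/\<^sup>2 2\<^sup>n\<^sup>s\<^sup>/\<^sup>2\<close> and use Cauchy--Schwarz in \<open>n\<close>.\<close>

lemma hb_square_sum: assumes s: "0 < s" and u: "0 < u"
 shows "\<exists>B\<ge>0. \<forall>H e E. (\<forall>n k. H n k \<noteq> 0 --> jap k \<le> u * 2 ^ n) -->
  (\<forall>n. hb 0 (H n) (dyad n (- s) * e n)) --> 0 \<le> E --> (\<forall>N. (\<Sum>n<N. (e n)^2) \<le> E^2) -->
  (\<forall>k. (\<lambda>n. H n k) summable_on (UNIV :: nat set)) \<and> hb s (\<lambda>k. INFSUM n. H n k) (B * E)"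
proof -
 define B where "B = sqrt (geo (- s) * u powr (2 * s))"
 have B0: "0 \<le> B" and Bsq: "B^2 = geo (- s) * u powr (2 * s)" using geo_nonneg by (auto simp: B_def)
 have "(\<forall>k. (\<lambda>n. H n k) summable_on (UNIV :: nat set)) \<and> hb s (\<lambda>k. INFSUM n. H n k) (B * E)"
  if supp: "\<And>n k. H n k \<noteq> 0 ==> jap k \<le> u * 2 ^ n" and H: "\<And>n. hb 0 (H n) (dyad n (- s) * e n)"
   and E: "0 \<le> E" "\<And>N. (\<Sum>n<N. (e n)^2) \<le> E^2" for H e E
 proof -
  have eE: "e n \<le> E" for n
  proof (rule power2_le_imp_le[OF _ E(1)])
   have "(e n)^2 \<le> (\<Sum>i<Suc n. (e i)^2)" by (rule member_le_sum) auto
   then show "(e n)^2 \<le> E^2" using E(2)[of "Suc n"] by linarith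
  qed
  have HE: "hb 0 (H n) (E * dyad n (- s))" for n
   by (rule hb_mono[OF H]) (use eE[of n] in \<open>simp add: mult.commute mult_right_mono\<close>)
  have gs: "(\<lambda>n::nat. E * dyad n (- s)) summable_on UNIV"
   by (intro summable_on_cmult_right geo_summable) (use s in simp)
  have sum: "(\<lambda>n. H n k) summable_on UNIV" for k
   by (rule abs_summable_summable[OF hb_infsum(1)[OF HE gs]])
  have fin: "hb s (\<lambda>k. \<Sum>n<N. H n k) (B * E)" for N unfolding hb_L2_set_sq
  proof (intro conjI allI impI)
   show "0 \<le> B * E" using B0 E by simp
   fix A :: "(int \<times> int) set" assume A: "finite A"
   have pt: "(jap k powr s * cmod (\<Sum>n<N. H n k))^2 \<le> (\<Sum>n<N. B^2 * (dyad n (2 * s) * (cmod (H n k))^2))" for k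
   proof -
    let ?I = "{n\<in>{..<N}. H n k \<noteq> 0}" and ?h = "\<lambda>n. dyad n s * (cmod (H n k))^2"
    let ?a = "\<lambda>n. dyad n (- (s / 2))" and ?b = "\<lambda>n. dyad n (s / 2) * cmod (H n k)"
    have "cmod (\<Sum>n<N. H n k) = cmod (\<Sum>n\<in>?I. H n k)"
     by (intro arg_cong[where f = cmod] sum.mono_neutral_right) auto
    also have "\<dots> \<le> (\<Sum>n\<in>?I. ?a n * ?b n)" by (rule order_trans[OF norm_sum]) (simp add: powr_minus flip: mult.assoc)
    finally have "(cmod (\<Sum>n<N. H n k))^2 \<le> (\<Sum>n\<in>?I. ?a n * ?b n)^2" by (rule power_mono) simp
    also have "\<dots> \<le> (\<Sum>n\<in>?I. dyad n (- s)) * (\<Sum>n\<in>?I. ?h n)"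
     using Cauchy_Schwarz_ineq_sum[of ?a ?b ?I] unfolding power_mult_distrib powr_sq by simp
    also have "\<dots> \<le> (geo (- s) * (jap k / u) powr - s) * (\<Sum>n\<in>?I. ?h n)"
     by (intro mult_right_mono sum_powr_tail_le sum_nonneg) (use supp s u in \<open>auto simp: divide_le_eq mult.commute\<close>)
    finally have "(jap k powr s * cmod (\<Sum>n<N. H n k))^2
      \<le> (jap k powr s)^2 * ((geo (- s) * (jap k / u) powr - s) * (\<Sum>n\<in>?I. ?h n))"
     by (simp add: power_mult_distrib mult_left_mono)
    also have "\<dots> = geo (- s) * u powr s * (jap k powr s * (\<Sum>n\<in>?I. ?h n))"
     using u by (simp add: powr_divide powr_minus power2_eq_square field_simps)
    also have "\<dots> \<le> geo (- s) * u powr s * (\<Sum>n\<in>?I. (u * 2 ^ n) powr s * ?h n)"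
     unfolding sum_distrib_left[of "jap k powr s"]
     by (intro mult_left_mono sum_mono mult_right_mono powr_mono2) (use supp s geo_nonneg in auto)
    also have "\<dots> \<le> geo (- s) * u powr s * (\<Sum>n<N. (u * 2 ^ n) powr s * ?h n)"
     by (intro mult_left_mono sum_mono2) (use geo_nonneg in auto)
    also have "\<dots> = (\<Sum>n<N. B^2 * (dyad n (2 * s) * (cmod (H n k))^2))"
     unfolding Bsq powr_sq[symmetric] unfolding mult_2[of s] powr_add
     using u by (simp add: sum_distrib_left powr_mult powr_powr power2_eq_square mult_ac flip: powr_realpow)
    finally show ?thesis .
   qed
   have "(\<Sum>k\<in>A. (jap k powr s * cmod (\<Sum>n<N. H n k))^2)
    \<le> (\<Sum>k\<in>A. \<Sum>n<N. B^2 * (dyad n (2 * s) * (cmod (H n k))^2))"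
    by (intro sum_mono pt)
   also have "\<dots> = B^2 * (\<Sum>n<N. dyad n (2 * s) * (\<Sum>k\<in>A. (cmod (H n k))^2))"
    by (subst sum.swap) (simp add: sum_distrib_left)
   also have "\<dots> \<le> B^2 * (\<Sum>n<N. (e n)^2)"
   proof (intro mult_left_mono sum_mono)
    fix n
    have "(\<Sum>k\<in>A. (cmod (H n k))^2) \<le> (dyad n (- s) * e n)^2"
     using H[of n] A by (simp add: hb_L2_set_sq)
    then show "dyad n (2 * s) * (\<Sum>k\<in>A. (cmod (H n k))^2) \<le> (e n)^2"
     unfolding power_mult_distrib powr_sq by (simp add: powr_minus field_simps)
   qed simp
   also have "\<dots> \<le> B^2 * E^2" by (intro mult_left_mono E) auto
   finally show "(\<Sum>k\<in>A. (jap k powr s * cmod (\<Sum>n<N. H n k))^2) \<le> (B * E)^2" by (simp add: power_mult_distrib)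
  qed
  have "hb s (\<lambda>k. INFSUM n. H n k) (B * E)"
  proof (rule hb_tendsto[where F = sequentially])
   show "(\<lambda>N. \<Sum>n<N. H n k) \<longlonglongrightarrow> (INFSUM n. H n k)" for k
    using has_sum_imp_sums[OF has_sum_infsum[OF sum[of k]]] by (simp add: sums_def)
  qed (use fin in auto)
  then show ?thesis using sum by blast
 qed
 then show ?thesis using B0 by blast
qed

text \<open>With this weight the L2 norm sees \<open>f\<close> itself above frequency
  \<open>2 ^ n\<close> and its gradient divided by \<open>2 ^ n\<close> below: the quantity that
  controls a commutator at scale \<open>n\<close>. Its squares, weighted by
  \<open>dyad n (2 * a)\<close>, sum to the Sobolev norm of order \<open>a\<close>.\<close>

definition wgt :: "nat => int \<times> int => real" where
 "wgt n k = min 1 (jap k / 2 ^ n)"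

lemma wgt_pos: "0 < wgt n k" by (simp add: wgt_def)

lemma wgt_le_1: "wgt n k \<le> 1" by (simp add: wgt_def)

definition ynorm :: "nat => tdist => real" where
 "ynorm n f = sqrt (INFSUM k. (wgt n k * cmod (f k))^2)"

lemma hb_ynorm: assumes "hb 0 f C" shows "hb 0 (\<lambda>k. cor (wgt n k) * f k) (ynorm n f)"
  "(\<lambda>k. (wgt n k * cmod (f k))^2) summable_on UNIV"
proof -
 have "hb 0 (\<lambda>k. cor (wgt n k) * f k) C"
  by (rule hb_mult_le_1[OF assms]) (use wgt_pos[of n] wgt_le_1[of n] in \<open>simp add: less_imp_le\<close>)
 from hb_summable[OF this] hb_summableI[OF hb_summable[OF this]]
 show "hb 0 (\<lambda>k. cor (wgt n k) * f k) (ynorm n f)" "(\<lambda>k. (wgt n k * cmod (f k))^2) summable_on UNIV"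
  using wgt_pos[of n] by (simp_all add: ynorm_def norm_mult abs_of_pos)
qed

text \<open>The two regimes of the minimum: scales below the frequency form a head sum, controlled
  because \<open>a\<close> is positive, and scales above it a tail, controlled because
  \<open>a\<close> is less than 1.\<close>

lemma sum_wgt_le: assumes a: "0 < a" "a < 1"
 shows "(\<Sum>n<N. dyad n (2 * a) * (wgt n k)^2) \<le> (2 powr (2 * a) * geo (- (2 * a)) + geo (- (2 * (1 - a)))) * jap k powr (2 * a)"
proof -
 let ?I = "{n\<in>{..<N}. 2 ^ n \<le> jap k}" and ?J = "{n\<in>{..<N}. \<not> 2 ^ n \<le> jap k}"
 have "(\<Sum>n<N. dyad n (2 * a) * (wgt n k)^2)
   = (\<Sum>n\<in>?I. dyad n (2 * a) * (wgt n k)^2) + (\<Sum>n\<in>?J. dyad n (2 * a) * (wgt n k)^2)"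
  by (subst sum.union_disjoint[symmetric]) (auto intro!: sum.cong)
 also have "(\<Sum>n\<in>?I. dyad n (2 * a) * (wgt n k)^2) \<le> (\<Sum>n\<in>?I. dyad n (2 * a))"
 proof (rule sum_mono)
  fix n
  have "(wgt n k)^2 \<le> 1" using wgt_pos[of n k] wgt_le_1[of n k] by (simp add: power_le_one)
  then show "dyad n (2 * a) * (wgt n k)^2 \<le> dyad n (2 * a)" by (simp add: mult_left_le)
 qed
 also have "\<dots> \<le> 2 powr (2 * a) * geo (- (2 * a)) * jap k powr (2 * a)"
  by (rule sum_powr_head_le) (use a in auto)
 also have "(\<Sum>n\<in>?J. dyad n (2 * a) * (wgt n k)^2) \<le> (\<Sum>n\<in>?J. (jap k)^2 * dyad n (- (2 * (1 - a))))"
 proof (rule sum_mono)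
  fix n
  have "wgt n k \<le> jap k / 2 ^ n" by (simp add: wgt_def)
  then have "(wgt n k)^2 \<le> (jap k / 2 ^ n)^2" using wgt_pos[of n k] by (intro power_mono) auto
  then have "dyad n (2 * a) * (wgt n k)^2 \<le> dyad n (2 * a) * (jap k / 2 ^ n)^2"
   by (intro mult_left_mono) auto
  also have "\<dots> = (jap k)^2 * dyad n (- (2 * (1 - a)))"
   unfolding power_divide two_pow_sq by (simp add: powr_expand)
  finally show "dyad n (2 * a) * (wgt n k)^2 \<le> (jap k)^2 * dyad n (- (2 * (1 - a)))" .
 qed
 also have "\<dots> = (jap k)^2 * (\<Sum>n\<in>?J. dyad n (- (2 * (1 - a))))" by (simp add: sum_distrib_left)
 also have "\<dots> \<le> (jap k)^2 * (geo (- (2 * (1 - a))) * jap k powr - (2 * (1 - a)))"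
  by (intro mult_left_mono sum_powr_tail_le) (use a in auto)
 also have "\<dots> = geo (- (2 * (1 - a))) * (jap k powr 2 * jap k powr - (2 * (1 - a)))" by simp
 also have "jap k powr 2 * jap k powr - (2 * (1 - a)) = jap k powr (2 * a)"
  unfolding powr_add[symmetric] by simp
 finally show ?thesis by (simp add: distrib_right)
qed

lemma sum_ynorm_le: assumes a: "0 < a" "a < 1" and f: "hb a f C"
 shows "(\<Sum>n<N. (dyad n a * ynorm n f)^2) \<le> (sqrt (2 powr (2 * a) * geo (- (2 * a)) + geo (- (2 * (1 - a)))) * C)^2"
proof -
 let ?c = "2 powr (2 * a) * geo (- (2 * a)) + geo (- (2 * (1 - a)))"
 have c0: "0 \<le> ?c" using geo_nonneg by simp
 have f0: "hb 0 f C" using f a by (intro hb_weaken[OF f]) auto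
 have s: "(\<lambda>k. dyad n (2 * a) * (wgt n k * cmod (f k))^2) summable_on UNIV" for n
  by (intro summable_on_cmult_right hb_ynorm(2)[OF f0])
 have fin: "((\<lambda>k. \<Sum>n<N. dyad n (2 * a) * (wgt n k * cmod (f k))^2) summable_on UNIV) \<and>
   (\<Sum>n<N. INFSUM k. dyad n (2 * a) * (wgt n k * cmod (f k))^2) = (INFSUM k. \<Sum>n<N. dyad n (2 * a) * (wgt n k * cmod (f k))^2)"
 proof (induction N)
  case (Suc N)
  then show ?case using summable_on_add[OF conjunct1[OF Suc] s[of N]] infsum_add[OF conjunct1[OF Suc] s[of N]] by simp
 qed simp
 have "(dyad n a * ynorm n f)^2 = (INFSUM k. dyad n (2 * a) * (wgt n k * cmod (f k))^2)" for n
 proof -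
  have "(dyad n a)^2 = dyad n (2 * a)" by (rule powr_sq)
  then show ?thesis by (simp add: power_mult_distrib ynorm_def infsum_nonneg infsum_cmult_right')
 qed
 then have "(\<Sum>n<N. (dyad n a * ynorm n f)^2) = (INFSUM k. \<Sum>n<N. dyad n (2 * a) * (wgt n k * cmod (f k))^2)"
  using fin by simp
 also have "\<dots> \<le> (INFSUM k. ?c * (jap k powr a * cmod (f k))^2)"
 proof (rule infsum_mono)
  fix k
  have "(\<Sum>n<N. dyad n (2 * a) * (wgt n k * cmod (f k))^2) = (\<Sum>n<N. dyad n (2 * a) * (wgt n k)^2) * (cmod (f k))^2"
   by (simp add: sum_distrib_right power_mult_distrib mult.assoc)
  also have "\<dots> \<le> ?c * jap k powr (2 * a) * (cmod (f k))^2"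
   by (intro mult_right_mono sum_wgt_le a) auto
  also have "\<dots> = ?c * (jap k powr a * cmod (f k))^2"
   by (simp add: power_mult_distrib power2_eq_square[of "jap k powr a"] flip: powr_add)
  finally show "(\<Sum>n<N. dyad n (2 * a) * (wgt n k * cmod (f k))^2) \<le> ?c * (jap k powr a * cmod (f k))^2" .
 qed (use fin summable_on_cmult_right[OF hb_summable[OF f]] in auto)
 also have "\<dots> = ?c * (INFSUM k. (jap k powr a * cmod (f k))^2)" by (rule infsum_cmult_right')
 also have "\<dots> \<le> ?c * C^2" by (intro mult_left_mono hb_infsum_le f c0)
 also have "\<dots> = (sqrt ?c * C)^2" using c0 by (simp add: power_mult_distrib)
 finally show ?thesis .
qed

section \<open>The commutator\<close>

definition cut :: "nat => tdist => tdist" where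
 "cut n f = (\<lambda>k. if jap k < 2 ^ n then f k else 0)"

definition ann :: "nat => tdist => tdist" where
 "ann n f = (\<lambda>k. if 2 ^ n \<le> jap k \<and> jap k < 2 ^ (n + 1) then f k else 0)"

lemma fs_jap: "(\<And>k. F k \<noteq> 0 ==> jap k \<le> R) ==> fs F"
 by (rule finite_subset[OF _ finite_freq_ball[of R]]) (auto intro: order_trans[OF norm_freq_le_jap'])

lemma fs_cut: "fs (cut n f)" by (rule fs_jap[of _ "2 ^ n"]) (auto simp: cut_def split: if_splits)

lemma fs_ann: "fs (ann n f)"
 by (rule fs_jap[of _ "2 ^ (n + 1)"]) (auto simp: ann_def split: if_splits)

lemma tprod_zero_right [simp]: "tprod f (\<lambda>_. 0) = (\<lambda>_. 0)" by (simp add: tprod_def)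

lemma tprod_diff_left:
 assumes "fs F" "fs F'" shows "tprod (\<lambda>k. F k - F' k) G k = tprod F G k - tprod F' G k"
proof -
 have "(\<lambda>k. F k - F' k) = scale (-1) F' + F" by (auto simp: scale_def fun_eq_iff)
 then show ?thesis by (simp add: tprod_linear_left[OF assms(2,1)])
qed

lemma tprod_sum_right: assumes "finite I" "\<And>i. i \<in> I ==> fs (G i)"
 shows "tprod F (\<lambda>k. \<Sum>i\<in>I. G i k) k = (\<Sum>i\<in>I. tprod F (G i) k)"
 using tprod_sum_left[OF assms, where G = F and k = k] by (simp add: tprod_commute)

lemma two_sided_geo:
 "(\<lambda>j::nat. 2 powr - \<bar>real j - real n\<bar>) summable_on UNIV"
 "(\<Sum>\<^sub>\<infinity>j::nat. 2 powr - \<bar>real j - real n\<bar>) \<le> 2 * geo (- 1)"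
proof -
 have fin: "(\<Sum>j\<in>I. 2 powr - \<bar>real j - real n\<bar>) \<le> 2 * geo (- 1)" if I: "finite I" for I :: "nat set"
 proof -
  let ?A = "{j\<in>I. j \<le> n}" and ?B = "{j\<in>I. \<not> j \<le> n}"
  have g: "(\<Sum>j\<in>K. dyad j (- 1)) \<le> geo (- 1)" if "finite K" for K :: "nat set"
   unfolding geo_def by (rule finite_sum_le_infsum) (use that geo_summable[of "- 1"] in auto)
  have "(\<Sum>j\<in>I. 2 powr - \<bar>real j - real n\<bar>) = (\<Sum>j\<in>?A. 2 powr - \<bar>real j - real n\<bar>) + (\<Sum>j\<in>?B. 2 powr - \<bar>real j - real n\<bar>)"
   using I by (subst sum.union_disjoint[symmetric]) (auto intro!: sum.cong)
  also have "(\<Sum>j\<in>?A. 2 powr - \<bar>real j - real n\<bar>) = (\<Sum>j\<in>(\<lambda>j. n - j) ` ?A. dyad j (- 1))"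
   by (subst sum.reindex) (auto simp: inj_on_def of_nat_diff intro!: sum.cong)
  also have "(\<Sum>j\<in>?B. 2 powr - \<bar>real j - real n\<bar>) = (\<Sum>j\<in>(\<lambda>j. j - n) ` ?B. dyad j (- 1))"
   by (subst sum.reindex) (auto simp: inj_on_def of_nat_diff intro!: sum.cong)
  finally show ?thesis using g[of "(\<lambda>j. n - j) ` ?A"] g[of "(\<lambda>j. j - n) ` ?B"] I by simp
 qed
 show s: "(\<lambda>j::nat. 2 powr - \<bar>real j - real n\<bar>) summable_on UNIV"
  by (rule nonneg_bdd_above_summable_on) (auto intro!: bdd_aboveI fin)
 show "(\<Sum>\<^sub>\<infinity>j::nat. 2 powr - \<bar>real j - real n\<bar>) \<le> 2 * geo (- 1)"
  by (rule infsum_le_finite_sums[OF s]) (use fin in auto)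
qed

lemma powr_shift_le: assumes "\<bar>real j - real n\<bar> \<le> real m"
 shows "dyad j (- b) \<le> 2 powr (real m * \<bar>b\<bar>) * dyad n (- b)"
proof -
 have "\<bar>(real j - real n) * - b\<bar> \<le> real m * \<bar>b\<bar>"
  unfolding abs_mult abs_minus_cancel using assms by (intro mult_right_mono) auto
 then have "real j * - b \<le> real m * \<bar>b\<bar> + real n * - b" by (simp add: algebra_simps)
 then have "dyad j (- b) \<le> 2 powr (real m * \<bar>b\<bar> + real n * - b)" by simp
 then show ?thesis by (simp only: powr_add)
qed

context lp begin

lemma fat_blk_zero: assumes "n + 2 < j \<or> j + 2 < n" shows "fat n (blk j g) = (\<lambda>_. 0)"
proof
 fix k
 have "(\<Sum>i\<in>nbh n. lpf i (freq k)) * lpf j (freq k) = 0" unfolding sum_distrib_right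
 proof (rule sum.neutral, rule ballI)
  fix i assume "i \<in> nbh n"
  then have "i + 1 < j \<or> j + 1 < i" using assms by (auto simp: nbh_iff)
  then show "lpf i (freq k) * lpf j (freq k) = 0"
   using lpf_disjoint[of i j "freq k"] lpf_disjoint[of j i "freq k"] by (auto simp: mult.commute)
 qed
 then show "fat n (blk j g) k = 0"
  by (simp add: fat_def blk_def mult.assoc[symmetric] flip: of_real_mult del: of_real_sum)
qed

lemma fat_eq_sum_blk: "fat n g = (\<lambda>k. \<Sum>j<n + 3. fat n (blk j g) k)"
proof
 fix k
 let ?c = "cor (\<Sum>i\<in>nbh n. lpf i (freq k))"
 have "((\<lambda>j. ?c * blk j g k) has_sum ?c * g k) UNIV" by (rule has_sum_cmult_right[OF blk_has_sum])
 then have h: "((\<lambda>j. fat n (blk j g) k) has_sum fat n g k) UNIV" by (simp only: fat_def)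
 have "((\<lambda>j. fat n (blk j g) k) has_sum (\<Sum>j<n + 3. fat n (blk j g) k)) UNIV"
 proof (subst has_sum_cong_neutral[where S = UNIV and T = "{..<n + 3}"])
  fix j assume "j \<in> UNIV - {..<n + 3}"
  then show "fat n (blk j g) k = 0" by (subst fat_blk_zero) auto
 qed auto
 with h show "fat n g k = (\<Sum>j<n + 3. fat n (blk j g) k)" by (rule has_sum_unique)
qed

text \<open>The cut-off of \<open>f\<close> is sharp because sharp dyadic shells partition the
  frequencies, so the later summation by parts is an exact regrouping.\<close>

definition Uc :: "nat => tdist => tdist => tdist" where
 "Uc n f g = (\<lambda>k. fat n (par f g) k - tprod (cut n f) (fat n g) k)"

definition dU :: "nat => nat => tdist => tdist => tdist" where
 "dU n j f g = (\<lambda>k. fat n (tprod (low j f) (blk j g)) k - tprod (cut n f) (fat n (blk j g)) k)"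

lemma Uc_eq_infsum: assumes "psum f g" shows "Uc n f g k = (INFSUM j. dU n j f g k)"
proof -
 have s1: "(\<lambda>j. fat n (tprod (low j f) (blk j g)) k) summable_on UNIV"
  unfolding fat_def by (intro summable_on_cmult_right) (use assms in \<open>auto simp: psum_def\<close>)
 have e1: "(INFSUM j. fat n (tprod (low j f) (blk j g)) k) = fat n (par f g) k"
  unfolding fat_def para_eq infsum_cmult_right' ..
 have z: "tprod (cut n f) (fat n (blk j g)) k = 0" if "j \<in> UNIV - {..<n + 3}" for j
 proof -
  have "fat n (blk j g) = (\<lambda>_. 0)" by (rule fat_blk_zero) (use that in auto)
  then show ?thesis by (simp add: tprod_def)
 qed
 have "((\<lambda>j. tprod (cut n f) (fat n (blk j g)) k) has_sum (\<Sum>j<n + 3. tprod (cut n f) (fat n (blk j g)) k)) UNIV"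
  by (subst has_sum_cong_neutral[where S = UNIV and T = "{..<n + 3}"]) (use z in auto)
 moreover have "(\<Sum>j<n + 3. tprod (cut n f) (fat n (blk j g)) k) = tprod (cut n f) (fat n g) k"
  by (subst (2) fat_eq_sum_blk) (simp add: tprod_sum_right fs_fat)
 ultimately have h2: "((\<lambda>j. tprod (cut n f) (fat n (blk j g)) k) has_sum tprod (cut n f) (fat n g) k) UNIV" by simp
 show ?thesis
  unfolding dU_def Uc_def infsum_minus[OF s1 has_sum_imp_summable[OF h2]] e1 infsumI[OF h2] ..
qed

lemma dU_low_zero: assumes m: "8 * cj / la \<le> 2 ^ m" "2 \<le> m" and j: "j + m < n"
 shows "dU n j f g = (\<lambda>_. 0)"
proof
 fix k
 have "fat n (tprod (low j f) (blk j g)) k = 0"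
 proof (rule ccontr)
  assume nz: "fat n (tprod (low j f) (blk j g)) k \<noteq> 0"
  then have "tprod (low j f) (blk j g) k \<noteq> 0" by (auto simp: fat_def)
  then have "jap k \<le> 2 * cj * 2 ^ j" by (rule low_blk_jap)
  moreover have "la / 2 * 2 ^ n \<le> jap k" using fat_jap[OF nz] by simp
  moreover have "la / 2 * (2 ^ m * 2 ^ j) \<le> la / 2 * 2 ^ n"
   unfolding power_add[symmetric] using j la by (intro mult_left_mono power_increasing) auto
  moreover have "8 * cj \<le> la * 2 ^ m" using m la by (simp add: field_simps)
  then have "8 * cj * 2 ^ j \<le> la * 2 ^ m * 2 ^ j" by (rule mult_right_mono) simp
  moreover have "0 < cj * 2 ^ j" using cj_ge_1 by simp
  ultimately show False by simp
 qed
 moreover have "fat n (blk j g) = (\<lambda>_. 0)" by (rule fat_blk_zero) (use j m in auto)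
 ultimately show "dU n j f g k = 0" by (simp add: dU_def tprod_def)
qed

text \<open>If block \<open>j\<close> of \<open>g\<close> is far above the output frequency, the
  partner frequency of \<open>f\<close> must be high as well. So \<open>f\<close> may be restricted
  to frequencies where \<open>wgt\<close> equals 1, and \<open>hb_high_block\<close> makes the low
  output small.\<close>

lemma hb_dU_high: assumes m: "8 * cj / la \<le> 2 ^ m" "2 \<le> m"
 shows "\<exists>C\<ge>0. \<forall>n j f g D Y. n + m < j --> bb b g D --> hb 0 (\<lambda>k. cor (wgt n k) * f k) Y -->
  hb 0 (dU n j f g) (C * D * Y * dyad n (- b) * 2 powr - (real j - real n))"
proof -
 \<comment> \<open>The bound decays like \<open>2 powr (- (real j - real n) * (real M + b))\<close>;
   this choice makes the rate at least 1.\<close>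
 define M where "M = nat \<lceil>1 - b\<rceil>"
 have M: "1 - b \<le> real M" unfolding M_def by linarith
 from hb_high_block[of M] obtain B where B: "0 \<le> B"
  "\<And>n F g K. [|\<forall>k. F k \<noteq> 0 --> (\<exists>i<n - 1. lpf i (freq k) \<noteq> 0); \<forall>y. hb 0 (tprod (tr y F) (fat n g)) K|]
   ==> hb (- real M) (tprod F (blk n g)) (B * K / 2 ^ (n * M))" by blast
 have cj0: "0 \<le> 2 * cj" using cj_ge_1 by simp
 define C where "C = (2 * cj) powr M * B * (3 * 2 powr \<bar>b\<bar>)"
 have "hb 0 (dU n j f g) (C * D * Y * dyad n (- b) * 2 powr - (real j - real n))"
  if j: "n + m < j" and g: "bb b g D" and Y: "hb 0 (\<lambda>k. cor (wgt n k) * f k) Y" for n j f g D Y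
 proof -
  have D0: "0 \<le> D" and Y0: "0 \<le> Y" using bb_nonneg[OF g] hb_nonneg[OF Y] .
  define F where "F = (\<lambda>l. if 2 ^ n \<le> jap l then low j f l else 0)"
  have F: "hb 0 F Y"
  proof (rule hb_le1[OF Y])
   fix l
   show "jap l powr 0 * cmod (F l) \<le> jap l powr 0 * cmod (cor (wgt n l) * f l)"
   proof (cases "2 ^ n \<le> jap l")
    case True
    then have "wgt n l = 1" by (simp add: wgt_def)
    moreover have "cmod (low j f l) \<le> cmod (f l)"
     using norm_sum_lpf_le_1[of "{..<j - 1}" "freq l"] unfolding low_def norm_mult
     by (simp add: mult_left_le_one_le del: of_real_sum)
    ultimately show ?thesis using True by (simp add: F_def)
   qed (simp add: F_def)
  qed
  have fsF: "fs F" by (rule fs_mono[OF fs_low[of j f]]) (simp add: F_def)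
  have K: "hb 0 (tprod (tr y F) (fat j g)) (Y * (3 * 2 powr \<bar>b\<bar> * D * dyad j (- b)))" for y
   by (intro hb_tprod hb_tr F ub_fat g) (auto simp: fs_fat tr_supp fsF)
  have G: "hb (- real M) (tprod F (blk j g)) (B * (Y * (3 * 2 powr \<bar>b\<bar> * D * dyad j (- b))) / 2 ^ (j * M))"
   by (rule B(2)) (use K low_nonzero in \<open>auto simp: F_def split: if_splits\<close>)
  have eq: "fat n (tprod (low j f) (blk j g)) k = fat n (tprod F (blk j g)) k" for k
  proof (cases "(\<Sum>i\<in>nbh n. lpf i (freq k)) = 0")
   case False
   then have "\<exists>i\<in>nbh n. lpf i (freq k) \<noteq> 0" by (meson sum.neutral)
   then have jk: "jap k \<le> 2 * cj * 2 ^ n" using lpf_nbh_jap by blast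
   have "low j f l * blk j g (k - l) = F l * blk j g (k - l)" for l
   proof (cases "2 ^ n \<le> jap l \<or> blk j g (k - l) = 0")
    case False
    then have jl: "jap l < 2 ^ n" and nz: "blk j g (k - l) \<noteq> 0" by auto
    have "la * 2 ^ j \<le> nf (k - l)" using lpf_lower[OF blk_nonzero[OF nz]] j by simp
    also have "\<dots> \<le> nf k + nf l" unfolding freq_diff by (rule norm_triangle_ineq4)
    also have "\<dots> \<le> 2 * cj * 2 ^ n + 1 * 2 ^ n"
     using norm_freq_le_jap'[of k] norm_freq_le_jap'[of l] jk jl by simp
    also have "\<dots> \<le> 2 * cj * 2 ^ n + cj * 2 ^ n" using cj_ge_1 by (intro add_left_mono mult_right_mono) auto
    finally have 1: "la * 2 ^ j \<le> 3 * cj * 2 ^ n" by simp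
    have "8 * cj \<le> la * 2 ^ m" using m la by (simp add: field_simps)
    then have "8 * cj * 2 ^ n \<le> la * 2 ^ m * 2 ^ n" by (rule mult_right_mono) simp
    also have "\<dots> = la * 2 ^ (n + m)" by (simp add: power_add)
    also have "\<dots> \<le> la * 2 ^ j" using j la by (intro mult_left_mono power_increasing) auto
    finally have "8 * cj * 2 ^ n \<le> 3 * cj * 2 ^ n" using 1 by simp
    moreover have "0 < cj * 2 ^ n" using cj_ge_1 by simp
    ultimately show ?thesis by simp
   qed (auto simp: F_def)
   then have "tprod (low j f) (blk j g) k = tprod F (blk j g) k" unfolding tprod_def by (simp only:)
   then show ?thesis by (simp add: fat_def)
  qed (simp add: fat_def del: of_real_sum)
  have z: "fat n (blk j g) = (\<lambda>_. 0)" by (rule fat_blk_zero) (use j m in auto)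
  have dUe: "dU n j f g = fat n (tprod F (blk j g))" by (rule ext) (simp add: dU_def z eq)
  have "hb 0 (dU n j f g) ((2 * cj) powr (0 - - real M) * dyad n (0 - - real M) * (B * (Y * (3 * 2 powr \<bar>b\<bar> * D * dyad j (- b))) / 2 ^ (j * M)))"
   unfolding dUe by (rule hb_ball[OF hb_fat[OF G] _ _ cj0]) (use fat_jap in auto)
  then show ?thesis
  proof (rule hb_mono)
   have "(real j - real n) * 1 \<le> (real j - real n) * (real M + b)" using j M by (intro mult_left_mono) auto
   then have "2 powr (real n * real M + real j * - b - real j * real M) \<le> 2 powr (real n * - b + - (real j - real n))"
    by (intro powr_mono) (simp_all add: algebra_simps)
   from mult_left_mono[OF this[unfolded powr_add powr_diff], of "C * D * Y"]
   show "(2 * cj) powr (0 - - real M) * dyad n (0 - - real M) * (B * (Y * (3 * 2 powr \<bar>b\<bar> * D * dyad j (- b))) / 2 ^ (j * M))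
     \<le> C * D * Y * dyad n (- b) * 2 powr - (real j - real n)"
    using B D0 Y0 by (simp add: C_def powr_realpow[symmetric] mult_ac)
  qed
 qed
 moreover have "0 \<le> C" using B by (simp add: C_def)
 ultimately show ?thesis by blast
qed

text \<open>For comparable scales two errors remain. Commuting the frequency projection with
  multiplication by the low part of \<open>f\<close> gains a gradient over \<open>2 ^ n\<close>;
  exchanging the low part for the sharp cut-off only affects frequencies of order at least
  \<open>2 ^ n\<close>. Both are measured by \<open>wgt\<close>.\<close>

lemma hb_dU_mid: assumes m: "2 \<le> m"
 shows "\<exists>C\<ge>0. \<forall>n j f g D Y. \<bar>real j - real n\<bar> \<le> real m --> bb b g D --> hb 0 (\<lambda>k. cor (wgt n k) * f k) Y -->
  hb 0 (dU n j f g) (C * D * Y * dyad n (- b))"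
proof -
 let ?R = "lb * 2 ^ (m + 1)"
 from ub_blk[of ?R] obtain C3 where C3: "0 \<le> C3"
  "\<And>n F D. \<forall>k. F k \<noteq> 0 --> nf k \<le> ?R * 2 ^ n ==> ub F D ==> ub (blk n F) (C3 * D)" by blast
 from hb_blk_commutator[of ?R] obtain C1 where C1: "0 \<le> C1"
  "\<And>n F G Y D. [|\<forall>k. F k \<noteq> 0 --> nf k \<le> ?R * 2 ^ n; \<forall>k. G k \<noteq> 0 --> nf k \<le> ?R * 2 ^ n;
   hb 0 (\<lambda>k. cor (nf k) * F k) Y; ub G D|] ==>
   hb 0 (\<lambda>k. blk n (tprod F G) k - tprod F (blk n G) k) (C1 * Y * D / 2 ^ n)" by blast
 define c where "c = cj * 2 ^ m"
 have c1: "1 \<le> c"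
 proof -
  have "1 * 1 \<le> cj * 2 ^ m" using cj_ge_1 by (intro mult_mono) auto
  then show ?thesis by (simp add: c_def)
 qed
 \<comment> \<open>Below \<open>eps * 2 ^ n\<close> the smooth low part and the sharp cut-off both
   act as the identity, so their difference vanishes there.\<close>
 define eps where "eps = la / 2 ^ (m + 1)"
 have eps: "0 < eps" "eps \<le> 1"
 proof -
  show "0 < eps" using la by (simp add: eps_def)
  have "la \<le> 1 * 2 ^ (m + 1)" using la one_le_power[of "2::real" "m + 1"] by linarith
  then show "eps \<le> 1" by (simp add: eps_def)
 qed
 define w where "w = 2 powr (real m * \<bar>b\<bar>)"
 define K1 where "K1 = 3 * (C1 * c * 2 * w)"
 define K2 where "K2 = (1 / eps) * (3 * (C3 * w))"
 have "hb 0 (dU n j f g) ((K1 + K2) * D * Y * dyad n (- b))"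
  if j: "\<bar>real j - real n\<bar> \<le> real m" and g: "bb b g D" and Y: "hb 0 (\<lambda>k. cor (wgt n k) * f k) Y" for n j f g D Y
 proof -
  have D0: "0 \<le> D" and Y0: "0 \<le> Y" using bb_nonneg[OF g] hb_nonneg[OF Y] .
  have jn: "j \<le> n + m" "n \<le> j + m" using j by auto
  let ?F = "low j f" and ?G = "blk j g"
  have pj: "dyad j (- b) \<le> w * dyad n (- b)" unfolding w_def by (rule powr_shift_le[OF j])
  have ubG: "ub ?G (D * (w * dyad n (- b)))"
   by (rule ub_mono[OF bbD[OF g]]) (intro mult_left_mono pj D0)
  have supp: "nf k \<le> ?R * 2 ^ l" if "l \<in> nbh n" "nf k \<le> lb * 2 ^ j" for k l
  proof -
   have "lb * 2 ^ j \<le> lb * 2 ^ (m + 1 + l)" using that jn lb by (intro mult_left_mono power_increasing) (auto simp: nbh_iff)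
   then show ?thesis using that by (simp add: power_add)
  qed
  have lowf: "cmod (low j f k) \<le> cmod (f k)" for k
   using norm_sum_lpf_le_1[of "{..<j - 1}" "freq k"] unfolding low_def norm_mult
   by (simp add: mult_left_le_one_le del: of_real_sum)
  have grad: "hb 0 (\<lambda>k. cor (nf k) * ?F k) (c * 2 ^ n * Y)"
  proof (rule hb_le[OF Y])
   show "0 \<le> c * 2 ^ n" using c1 by simp
   fix k
   have "nf k * cmod (?F k) \<le> (c * 2 ^ n * wgt n k) * cmod (f k)"
   proof (cases "?F k = 0")
    case False
    have "jap k \<le> cj * 2 ^ j" by (rule jap_le_cj[OF low_freq[OF False]])
    also have "\<dots> \<le> cj * 2 ^ (n + m)" using jn cj_ge_1 by (intro mult_left_mono power_increasing) auto
    also have "\<dots> = c * 2 ^ n" by (simp add: c_def power_add)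
    finally have 1: "nf k \<le> c * 2 ^ n" using norm_freq_le_jap'[of k] by linarith
    have "1 * jap k \<le> c * jap k" using c1 by (intro mult_right_mono) auto
    then have "nf k \<le> c * jap k" using norm_freq_le_jap'[of k] by linarith
    then have "nf k \<le> c * 2 ^ n * wgt n k" using 1 by (simp add: wgt_def min_def)
    moreover from this have "0 \<le> c * 2 ^ n * wgt n k" using norm_ge_zero order_trans by blast
    ultimately show ?thesis by (intro mult_mono lowf) auto
   next
    case True then show ?thesis using c1 wgt_pos[of n k] by simp
   qed
   then show "jap k powr 0 * cmod (cor (nf k) * ?F k) \<le> c * 2 ^ n * (jap k powr 0 * cmod (cor (wgt n k) * f k))"
    using wgt_pos[of n k] by (simp add: norm_mult mult.assoc)
  qed
  have comm: "hb 0 (\<lambda>k. blk l (tprod ?F ?G) k - tprod ?F (blk l ?G) k) (C1 * c * 2 * w * D * Y * dyad n (- b))" if l: "l \<in> nbh n" for l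
  proof -
   have "hb 0 (\<lambda>k. blk l (tprod ?F ?G) k - tprod ?F (blk l ?G) k) (C1 * (c * 2 ^ n * Y) * (D * (w * dyad n (- b))) / 2 ^ l)"
    by (rule C1(2)[OF _ _ grad ubG]) (use supp[OF l] low_freq[of j f] blk_freq[of j g] in blast)+
   then show ?thesis
   proof (rule hb_mono)
    have "(2::real) ^ n \<le> 2 ^ (l + 1)" using l by (intro power_increasing) (auto simp: nbh_iff)
    then have nl: "(2::real) ^ n / 2 ^ l \<le> 2" by (simp add: field_simps)
    have "C1 * (c * 2 ^ n * Y) * (D * (w * dyad n (- b))) / 2 ^ l = (C1 * c * w * D * Y * dyad n (- b)) * (2 ^ n / 2 ^ l)"
     by (simp add: mult_ac)
    also have "\<dots> \<le> (C1 * c * w * D * Y * dyad n (- b)) * 2"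
     using C1 c1 D0 Y0 nl by (intro mult_left_mono) (auto simp: w_def)
    finally show "C1 * (c * 2 ^ n * Y) * (D * (w * dyad n (- b))) / 2 ^ l \<le> C1 * c * 2 * w * D * Y * dyad n (- b)"
     by (simp only: mult_ac)
   qed
  qed
  have E0: "0 \<le> C1 * c * 2 * w * D * Y * dyad n (- b)" using C1 c1 D0 Y0 by (simp add: w_def)
  have p1: "hb 0 (\<lambda>k. fat n (tprod ?F ?G) k - tprod ?F (fat n ?G) k) (K1 * D * Y * dyad n (- b))"
  proof -
   have "hb 0 (\<lambda>k. \<Sum>l\<in>nbh n. blk l (tprod ?F ?G) k - tprod ?F (blk l ?G) k) (\<Sum>l\<in>nbh n. C1 * c * 2 * w * D * Y * dyad n (- b))"
    by (rule hb_sum) ((rule comm, assumption) | simp)+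
   moreover have "(\<Sum>l\<in>nbh n. blk l (tprod ?F ?G) k - tprod ?F (blk l ?G) k) = fat n (tprod ?F ?G) k - tprod ?F (fat n ?G) k" for k
    unfolding fat_sum[of n ?G] by (subst tprod_sum_right) (auto simp: fs_blk sum_subtractf fat_sum)
   ultimately show ?thesis using hb_mono[OF _ sum_nbh_le[OF E0, of n]] by (simp only: K1_def mult.assoc)
  qed
  have diff: "hb 0 (\<lambda>k. ?F k - cut n f k) ((1 / eps) * Y)"
  proof (rule hb_le[OF Y])
   show "0 \<le> 1 / eps" using eps by simp
   fix k
   let ?lo = "\<Sum>i<j - 1. lpf i (freq k)"
   have lo: "0 \<le> ?lo" "?lo \<le> 1" using sum_lpf_le_1[of "{..<j - 1}" "freq k"] by (auto intro: sum_nonneg lpf_nonneg)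
   have "cmod (?F k - cut n f k) \<le> (1 / eps) * wgt n k * cmod (f k)"
   proof (cases "jap k < eps * 2 ^ n")
    case True
    have "lpf i (freq k) = 0" if i: "i \<notin> {..<j - 1}" for i
    proof (rule ccontr)
     assume nz: "lpf i (freq k) \<noteq> 0"
     have "la / 2 * 2 ^ j \<le> la * 2 ^ (j - 1)" using la by (cases j) auto
     also have "\<dots> \<le> la * 2 ^ i" using i la by (intro mult_left_mono power_increasing) auto
     also have "\<dots> \<le> jap k" using lpf_jap[OF nz] by simp
     finally have "la / 2 * 2 ^ j < eps * 2 ^ n" using True by linarith
     moreover have "eps * 2 ^ n \<le> eps * 2 ^ (j + m)" using jn eps by (intro mult_left_mono power_increasing) auto
     moreover have "eps * 2 ^ (j + m) = la / 2 * 2 ^ j" by (simp add: eps_def power_add)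
     ultimately show False by simp
    qed
    then have "(\<lambda>i. lpf i (freq k)) sums ?lo" by (intro sums_finite) auto
    then have "?lo = 1" using lpf_sums[of "freq k"] sums_unique2 by blast
    moreover have "eps * 2 ^ n \<le> 1 * 2 ^ n" using eps by (intro mult_right_mono) auto
    then have "jap k < 2 ^ n" using True by linarith
    ultimately show ?thesis using eps wgt_pos[of n k] by (simp add: low_def cut_def del: of_real_sum)
   next
    case False
    then have "eps \<le> jap k / 2 ^ n" by (simp add: field_simps)
    then have "eps \<le> wgt n k" using eps by (simp add: wgt_def)
    then have 1: "1 \<le> (1 / eps) * wgt n k" using eps by (simp add: field_simps)
    have "?F k - cut n f k = cor (?lo - (if jap k < 2 ^ n then 1 else 0)) * f k"
     by (simp add: low_def cut_def algebra_simps del: of_real_sum)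
    then have "cmod (?F k - cut n f k) = \<bar>?lo - (if jap k < 2 ^ n then 1 else 0)\<bar> * cmod (f k)"
     by (simp only: norm_mult norm_of_real)
    also have "\<dots> \<le> 1 * cmod (f k)" using lo by (intro mult_right_mono) (auto simp del: sum.lessThan_Suc)
    also have "\<dots> \<le> ((1 / eps) * wgt n k) * cmod (f k)" by (intro mult_right_mono 1) auto
    finally show ?thesis .
   qed
   then show "jap k powr 0 * cmod (?F k - cut n f k) \<le> 1 / eps * (jap k powr 0 * cmod (cor (wgt n k) * f k))"
    using wgt_pos[of n k] by (simp add: norm_mult)
  qed
  have ubf: "ub (fat n ?G) (3 * (C3 * w) * D * dyad n (- b))"
  proof -
   have "ub (\<lambda>k. \<Sum>l\<in>nbh n. blk l ?G k) (\<Sum>l\<in>nbh n. C3 * (D * (w * dyad n (- b))))"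
   proof (rule ub_sum)
    fix l assume l: "l \<in> nbh n"
    show "ub (blk l ?G) (C3 * (D * (w * dyad n (- b))))"
     by (rule C3(2)[OF _ ubG]) (use supp[OF l] blk_freq[of j g] in blast)
   qed (auto simp: fs_blk)
   from ub_mono[OF this sum_nbh_le] show ?thesis unfolding fat_sum using C3 D0 by (simp add: w_def mult_ac)
  qed
  have p2: "hb 0 (tprod (\<lambda>k. ?F k - cut n f k) (fat n ?G)) (K2 * D * Y * dyad n (- b))"
  proof -
   have "hb 0 (tprod (\<lambda>k. ?F k - cut n f k) (fat n ?G)) ((1 / eps) * Y * (3 * (C3 * w) * D * dyad n (- b)))"
    by (rule hb_tprod[OF fs_diff[OF fs_low fs_cut] fs_fat diff ubf])
   then show ?thesis by (simp only: K2_def mult_ac)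
  qed
  have "dU n j f g = (\<lambda>k. (fat n (tprod ?F ?G) k - tprod ?F (fat n ?G) k) + tprod (\<lambda>k. ?F k - cut n f k) (fat n ?G) k)"
   by (rule ext) (simp add: dU_def tprod_diff_left[OF fs_low fs_cut])
  then show ?thesis using hb_add[OF p1 p2] by (simp only: distrib_right)
 qed
 moreover have "0 \<le> K1 + K2" using C1 C3 c1 eps by (simp add: K1_def K2_def w_def)
 ultimately show ?thesis by blast
qed

text \<open>Sum over the blocks of \<open>g\<close>: those far below \<open>n\<close> contribute
  nothing, the comparable ones a bounded amount, and those far above decay, so a two-sided geometric
  series dominates all three.\<close>

lemma hb_Uc:
 "\<exists>C\<ge>0. \<forall>n f g D Y. psum f g --> bb b g D --> hb 0 (\<lambda>k. cor (wgt n k) * f k) Y -->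
  hb 0 (Uc n f g) (C * D * Y * dyad n (- b))"
proof -
 obtain m0 :: nat where m0: "8 * cj / la < 2 ^ m0" using real_arch_pow[of 2 "8 * cj / la"] by auto
 define m where "m = m0 + 2"
 have m: "8 * cj / la \<le> 2 ^ m" "2 \<le> m"
 proof -
  have "(2::real) ^ m0 \<le> 2 ^ m" by (intro power_increasing) (auto simp: m_def)
  then show "8 * cj / la \<le> 2 ^ m" using m0 by linarith
 qed (simp add: m_def)
 from hb_dU_high[OF m, of b] obtain C1 where C1: "0 \<le> C1"
  "\<And>n j f g D Y. [|n + m < j; bb b g D; hb 0 (\<lambda>k. cor (wgt n k) * f k) Y|] ==>
  hb 0 (dU n j f g) (C1 * D * Y * dyad n (- b) * 2 powr - (real j - real n))" by blast
 from hb_dU_mid[OF m(2), of b] obtain C2 where C2: "0 \<le> C2"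
  "\<And>n j f g D Y. [|\<bar>real j - real n\<bar> \<le> real m; bb b g D; hb 0 (\<lambda>k. cor (wgt n k) * f k) Y|] ==>
  hb 0 (dU n j f g) (C2 * D * Y * dyad n (- b))" by blast
 define C where "C = C1 + C2 * 2 ^ m"
 have C0: "0 \<le> C" using C1 C2 by (simp add: C_def)
 have "hb 0 (Uc n f g) (C * (2 * geo (- 1)) * D * Y * dyad n (- b))"
  if ps: "psum f g" and g: "bb b g D" and Y: "hb 0 (\<lambda>k. cor (wgt n k) * f k) Y" for n f g D Y
 proof -
  define E where "E = D * Y * dyad n (- b)"
  have E0: "0 \<le> E" using bb_nonneg[OF g] hb_nonneg[OF Y] by (simp add: E_def)
  have bnd: "hb 0 (dU n j f g) (C * E * 2 powr - \<bar>real j - real n\<bar>)" for j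
  proof -
   consider "j + m < n" | "n + m < j" | "\<bar>real j - real n\<bar> \<le> real m" by linarith
   then show ?thesis
   proof cases
    case 1
    then show ?thesis using dU_low_zero[OF m 1, of f g] C0 E0 by (simp add: hb_mono[OF hb_zero])
   next
    case 2
    have "C1 * E * 2 powr - \<bar>real j - real n\<bar> \<le> C * E * 2 powr - \<bar>real j - real n\<bar>"
     using C2 E0 by (intro mult_right_mono) (auto simp: C_def)
    moreover have "hb 0 (dU n j f g) (C1 * E * 2 powr - \<bar>real j - real n\<bar>)"
     using C1(2)[OF 2 g Y] 2 by (simp add: E_def mult.assoc)
    ultimately show ?thesis by (rule hb_mono[rotated])
   next
    case 3
    have "1 \<le> 2 ^ m * 2 powr - \<bar>real j - real n\<bar>"
     using 3 by (simp add: powr_realpow[symmetric] ge_one_powr_ge_zero flip: powr_add)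
    then have "C2 * E * 1 \<le> C2 * E * (2 ^ m * 2 powr - \<bar>real j - real n\<bar>)" using C2 E0 by (intro mult_left_mono) auto
    also have "\<dots> = C2 * 2 ^ m * E * 2 powr - \<bar>real j - real n\<bar>" by (simp only: mult_ac)
    also have "\<dots> \<le> C * E * 2 powr - \<bar>real j - real n\<bar>" using C1 E0 by (intro mult_right_mono) (auto simp: C_def)
    finally have le: "C2 * E \<le> C * E * 2 powr - \<bar>real j - real n\<bar>" by simp
    have "hb 0 (dU n j f g) (C2 * E)" using C2(2)[OF 3 g Y] by (simp add: E_def mult.assoc)
    then show ?thesis by (rule hb_mono) (rule le)
   qed
  qed
  have s: "(\<lambda>j. C * E * 2 powr - \<bar>real j - real n\<bar>) summable_on UNIV"
   by (intro summable_on_cmult_right two_sided_geo)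
  have "hb 0 (\<lambda>k. INFSUM j. dU n j f g k) (INFSUM j. C * E * 2 powr - \<bar>real j - real n\<bar>)"
   by (rule hb_infsum(2)[OF bnd s])
  moreover have "(INFSUM j. C * E * 2 powr - \<bar>real j - real n\<bar>) \<le> C * (2 * geo (- 1)) * D * Y * dyad n (- b)"
  proof -
   have "(INFSUM j. C * E * 2 powr - \<bar>real j - real n\<bar>) = C * E * (INFSUM j. 2 powr - \<bar>real j - real n\<bar>)"
    by (rule infsum_cmult_right')
   also have "\<dots> \<le> C * E * (2 * geo (- 1))" using C0 E0 by (intro mult_left_mono two_sided_geo) auto
   finally show ?thesis by (simp add: E_def mult_ac)
  qed
  moreover have "Uc n f g = (\<lambda>k. INFSUM j. dU n j f g k)" by (rule ext) (rule Uc_eq_infsum[OF ps])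
  ultimately show ?thesis by (simp only:) (erule (1) hb_mono)
 qed
 moreover have "0 \<le> C * (2 * geo (- 1))" using C0 geo_nonneg by simp
 ultimately show ?thesis by blast
qed

end

section \<open>Associativity, smooth functions and construction of the commutator\<close>

lemma tprod_assoc: assumes "fs F" "fs G" "fs H" shows "tprod (tprod F G) H = tprod F (tprod G H)"
proof
 fix k :: "int \<times> int"
 let ?A = "{l. F l \<noteq> 0}"
 have s: "tprod (\<lambda>m. F l * G (m - l)) H k = F l * tprod G H (k - l)" for l
 proof -
  have "bij_betw (\<lambda>m. m - l) UNIV UNIV" by (rule bij_betwI[where g = "\<lambda>m. m + l"]) auto
  from infsum_reindex_bij_betw[OF this, of "\<lambda>m. G m * H (k - l - m)"]
  show ?thesis by (simp add: tprod_def mult.assoc infsum_cmult_right')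
 qed
 have f: "fs (\<lambda>m. F l * G (m - l))" for l
  by (rule fs_mono[OF fs_shift[OF assms(2), of "- l"]]) simp
 have "tprod F G = (\<lambda>m. \<Sum>l\<in>?A. F l * G (m - l))" using tprod_finite[OF assms(1) subset_refl] by blast
 then have "tprod (tprod F G) H k = (\<Sum>l\<in>?A. F l * tprod G H (k - l))"
  by (simp only: tprod_sum_left[OF assms(1) f] s)
 then show "tprod (tprod F G) H k = tprod F (tprod G H) k" by (simp only: tprod_finite[OF assms(1) subset_refl])
qed

lemma sobolev_normE:
 assumes "f \<in> sobolev s" obtains C where "0 \<le> C" "sobolev_norm s f = ennreal C" "hb s f C"
proof -
 let ?C = "sqrt (INFSUM k. (jap k powr s * cmod (f k))^2)"
 have "0 \<le> ?C" by (simp add: infsum_nonneg)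
 moreover have "sobolev_norm s f = ennreal ?C" by (rule sobolev_norm_eq[OF assms])
 ultimately show thesis using sobolev_norm_le_iff[of ?C s f] by (intro that[of ?C]) auto
qed

lemma hb_of_summable: assumes "(\<lambda>k. jap k powr s * cmod (f k)) summable_on UNIV"
 shows "hb s f (INFSUM k. jap k powr s * cmod (f k))" unfolding hb_def
proof (intro allI impI)
 fix A :: "(int \<times> int) set" assume A: "finite A"
 have "L2_set (\<lambda>k. jap k powr s * cmod (f k)) A \<le> (\<Sum>k\<in>A. jap k powr s * cmod (f k))"
  by (rule L2_set_le_sum) simp
 also have "\<dots> \<le> (INFSUM k. jap k powr s * cmod (f k))"
  by (rule finite_sum_le_infsum[OF assms A]) auto
 finally show "L2_set (\<lambda>k. jap k powr s * cmod (f k)) A \<le> (INFSUM k. jap k powr s * cmod (f k))" .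
qed

lemma smooth_summable:
 assumes "smooth_fun f" shows "(\<lambda>k. jap k powr s * cmod (f k)) summable_on UNIV"
proof -
 define N where "N = nat \<lceil>s\<rceil>"
 have N: "s \<le> real N" unfolding N_def by linarith
 obtain B where B: "\<And>k. (1 + nf k) ^ (N + 4) * cmod (f k) \<le> B"
  using assms unfolding smooth_fun_def by blast
 show ?thesis
 proof (rule summable_le[OF summable_on_cmult_right[OF summable_wt]])
  fix k
  let ?x = "1 + nf k"
  have x: "1 \<le> ?x" by simp
  have "jap k \<le> 1 + 2 * pi * nf k" by (rule jap_le)
  also have "\<dots> \<le> 8 * ?x"
  proof -
   have "pi * nf k \<le> 4 * nf k" using pi_less_4 by (intro mult_right_mono) auto
   then show ?thesis by simp
  qed
  finally have "jap k ^ N \<le> (8 * ?x) ^ N" by (intro power_mono) auto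
  moreover have "jap k powr s \<le> jap k ^ N"
   using N jap_ge_1[of k] by (simp add: powr_mono flip: powr_realpow)
  ultimately have j: "jap k powr s \<le> 8 ^ N * ?x ^ N" unfolding power_mult_distrib by linarith
  have w: "wt k \<le> ?x^2"
  proof -
   have "\<bar>real_of_int (fst k)\<bar> \<le> nf k" "\<bar>real_of_int (snd k)\<bar> \<le> nf k"
    using norm_fst_le[of "fst (freq k)" "snd (freq k)"] norm_snd_le[of "snd (freq k)" "fst (freq k)"]
    by (simp_all add: freq_def)
   then show ?thesis unfolding wt_def power2_eq_square by (intro mult_mono) auto
  qed
  have "(wt k)^2 \<le> (?x^2)^2" using w less_imp_le[OF wt_pos[of k]] by (intro power_mono) auto
  then have w2: "(wt k)^2 \<le> ?x ^ 4" by simp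
  have "(jap k powr s * cmod (f k)) * (wt k)^2 \<le> (8 ^ N * ?x ^ N * cmod (f k)) * ?x ^ 4"
   using j w2 by (intro mult_mono mult_right_mono) auto
  also have "\<dots> = 8 ^ N * (?x ^ (N + 4) * cmod (f k))" by (simp add: power_add mult_ac)
  also have "\<dots> \<le> 8 ^ N * B" by (intro mult_left_mono B) auto
  finally have "(jap k powr s * cmod (f k)) * (wt k)^2 \<le> 8 ^ N * B" .
  moreover have "0 < (wt k)^2" using wt_pos[of k] by (rule zero_less_power)
  ultimately have "jap k powr s * cmod (f k) \<le> 8 ^ N * B / (wt k)^2" by (subst pos_le_divide_eq)
  then show "norm (jap k powr s * cmod (f k)) \<le> 8 ^ N * B * (1 / (wt k)^2)" by simp
 qed
qed

lemma fs_smooth: assumes "fs f" shows "smooth_fun f" unfolding smooth_fun_def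
proof
 fix n
 let ?g = "\<lambda>k. (1 + nf k) ^ n * cmod (f k)"
 have "?g k \<le> (\<Sum>k\<in>{k. f k \<noteq> 0}. ?g k)" for k
 proof (cases "f k = 0")
  case False
  then show ?thesis using assms by (intro member_le_sum) auto
 qed (simp add: sum_nonneg)
 then show "\<exists>B. \<forall>k. ?g k \<le> B" by blast
qed

lemma infsum_Sigma_nonneg_summable:
 fixes P :: "nat => real" and u :: "int \<times> int => real"
 assumes "P summable_on UNIV" "u summable_on UNIV" "\<And>n. 0 \<le> P n" "\<And>l. 0 \<le> u l"
  and F: "\<And>n l. cmod (F n l) \<le> P n * u l"
 shows "(\<lambda>(n, l). F n l) summable_on UNIV \<times> UNIV"
proof (rule summable_le)
 show "(\<lambda>(n, l). P n * u l) summable_on UNIV \<times> UNIV"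
  by (rule summable_on_SigmaI[where g = "\<lambda>n. P n * infsum u UNIV"])
    (use assms(1-4) in \<open>auto intro!: has_sum_cmult_right has_sum_infsum summable_on_cmult_left\<close>)
qed (use F in auto)

context lp begin

lemma bb_of_summable: assumes "(\<lambda>k. jap k powr b * cmod (g k)) summable_on UNIV"
 shows "bb b g ((la powr - b + cj powr - b) * (INFSUM k. jap k powr b * cmod (g k)))"
 unfolding bb_def
proof
 fix n
 let ?A = "{k. nf k \<le> lb * 2 ^ n}" and ?c = "la powr - b + cj powr - b"
 have "ub (blk n g) (\<Sum>k\<in>?A. cmod (blk n g k))"
  by (rule ub_coeff_sum[OF finite_freq_ball]) (use blk_freq in auto)
 moreover have "(\<Sum>k\<in>?A. cmod (blk n g k)) \<le> (\<Sum>k\<in>?A. ?c * dyad n (- b) * (jap k powr b * cmod (g k)))"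
 proof (rule sum_mono)
  fix k
  show "cmod (blk n g k) \<le> ?c * dyad n (- b) * (jap k powr b * cmod (g k))"
  proof (cases "lpf n (freq k) = 0")
   case False
   have "cmod (blk n g k) \<le> 1 * cmod (g k)"
    unfolding blk_def norm_mult by (intro mult_right_mono norm_lpf_le_1) auto
   also have "1 = jap k powr - b * jap k powr b" by (simp flip: powr_add)
   also have "jap k powr - b * jap k powr b * cmod (g k) \<le> (?c * dyad n (- b)) * jap k powr b * cmod (g k)"
    using lpf_jap[OF False] la by (intro mult_right_mono jap_powr_le) auto
   finally show ?thesis by (simp only: mult.assoc)
  qed (simp add: blk_def)
 qed
 moreover have "\<dots> = ?c * dyad n (- b) * (\<Sum>k\<in>?A. jap k powr b * cmod (g k))" for La
  by (rule sum_distrib_left[symmetric])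
 ultimately have "ub (blk n g) (?c * dyad n (- b) * (\<Sum>k\<in>?A. jap k powr b * cmod (g k)))"
  by (auto simp: sum_distrib_left intro: ub_mono)
 moreover have "(\<Sum>k\<in>?A. jap k powr b * cmod (g k)) \<le> (INFSUM k. jap k powr b * cmod (g k))"
  by (rule finite_sum_le_infsum[OF assms finite_freq_ball]) auto
 ultimately show "ub (blk n g) (?c * (INFSUM k. jap k powr b * cmod (g k)) * dyad n (- b))"
  by (auto simp: mult_ac intro!: mult_left_mono elim!: ub_mono)
qed

lemma bb_smooth: "smooth_fun f ==> \<exists>D. bb b f D"
 using bb_of_summable[OF smooth_summable] by blast

lemma hb_smooth: "smooth_fun f ==> \<exists>C. hb s f C"
 using hb_of_summable[OF smooth_summable] by blast

lemma Uc_freq: "Uc n f g k \<noteq> 0 ==> nf k \<le> 3 * lb * 2 ^ n"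
proof -
 assume "Uc n f g k \<noteq> 0"
 then have "fat n (par f g) k \<noteq> 0 \<or> tprod (cut n f) (fat n g) k \<noteq> 0" by (auto simp: Uc_def)
 then show ?thesis
 proof
  assume "fat n (par f g) k \<noteq> 0"
  from fat_freq[OF this] have "nf k \<le> 2 * lb * 2 ^ n" .
  also have "\<dots> \<le> 3 * lb * 2 ^ n" using lb by simp
  finally show ?thesis .
 next
  assume t: "tprod (cut n f) (fat n g) k \<noteq> 0"
  have c: "nf l \<le> lb * 2 ^ n" if "cut n f l \<noteq> 0" for l
  proof -
   have "nf l \<le> 1 * 2 ^ n" using that norm_freq_le_jap'[of l] by (auto simp: cut_def split: if_splits)
   also have "\<dots> \<le> lb * 2 ^ n" using lb by (intro mult_right_mono) auto
   finally show ?thesis .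
  qed
  have "nf k \<le> lb * 2 ^ n + 2 * lb * 2 ^ n" by (rule tprod_supp_jap[OF c fat_freq t])
  then show ?thesis by simp
 qed
qed

lemma fs_Uc: "fs (Uc n f g)" by (rule fs_freq[OF Uc_freq])

lemma Uc_linear_left: assumes "psum f g" "psum f' g"
 shows "Uc n (scale z f + f') g = scale z (Uc n f g) + Uc n f' g"
proof -
 have c: "cut n (scale z f + f') = scale z (cut n f) + cut n f'"
  by (auto simp: cut_def scale_def fun_eq_iff)
 show ?thesis
  by (rule ext) (simp add: Uc_def para_linear_left[OF assms] fat_linear c tprod_linear_left[OF fs_cut fs_cut] scale_apply, simp add: algebra_simps)
qed

lemma Uc_linear_right: assumes "psum f g" "psum f g'"
 shows "Uc n f (scale z g + g') = scale z (Uc n f g) + Uc n f g'"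
 by (rule ext) (simp add: Uc_def para_linear_right[OF assms] fat_linear tprod_linear_right[OF fs_fat fs_fat] scale_apply, simp add: algebra_simps)

text \<open>\<open>T1\<close> compares \<open>f \<prec> g\<close>, block by block, with the product of \<open>g\<close> and \<open>f\<close> cut off at frequency \<open>2\<^sup>n\<close>;
 summation by parts turns the contribution of the removed high frequencies of \<open>f\<close> into \<open>T2\<close>.\<close>

definition rn :: "nat => tdist => tdist => tdist" where
 "rn n g h = tprod (fat n g) (blk n h)"

definition Wc :: "nat => tdist => tdist => tdist" where
 "Wc i g h = (\<lambda>k. \<Sum>n<Suc i. rn n g h k)"

definition T1 :: "nat => tdist => tdist => tdist => tdist" where
 "T1 n f g h = tprod (Uc n f g) (blk n h)"

definition T2 :: "nat => tdist => tdist => tdist => tdist" where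
 "T2 i f g h = tprod (ann i f) (Wc i g h)"

definition Tc :: "tdist => tdist => tdist => tdist" where
 "Tc f g h = (\<lambda>k. (INFSUM n. T1 n f g h k) - (INFSUM i. T2 i f g h k))"

lemma fs_rn: "fs (rn n g h)" unfolding rn_def by (intro fs_tprod fs_fat fs_blk)

lemma fs_Wc: "fs (Wc i g h)" unfolding Wc_def by (intro fs_sum fs_rn) simp

lemma rn_linear_left: "rn n (scale z g + g') h = scale z (rn n g h) + rn n g' h"
 by (rule ext) (simp add: rn_def fat_linear tprod_linear_left[OF fs_fat fs_fat] scale_apply)

lemma rn_linear_right: "rn n g (scale z h + h') = scale z (rn n g h) + rn n g h'"
 by (rule ext) (simp add: rn_def blk_linear tprod_linear_right[OF fs_blk fs_blk] scale_apply)

lemma Wc_linear_left: "Wc n (scale z g + g') h = scale z (Wc n g h) + Wc n g' h"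
 by (rule ext) (simp add: Wc_def rn_linear_left scale_apply sum.distrib sum_distrib_left del: sum.lessThan_Suc)

lemma Wc_linear_right: "Wc n g (scale z h + h') = scale z (Wc n g h) + Wc n g h'"
 by (rule ext) (simp add: Wc_def rn_linear_right scale_apply sum.distrib sum_distrib_left del: sum.lessThan_Suc)

lemma ann_linear: "ann n (scale z f + f') = scale z (ann n f) + ann n f'"
 by (auto simp: ann_def scale_def fun_eq_iff)

lemma hb_ann: "hb 0 (\<lambda>k. cor (wgt n k) * f k) Y ==> hb 0 (ann n f) Y"
 by (erule hb_le1) (auto simp: ann_def wgt_def)

text \<open>The pieces of both series lie in balls of radius of order \<open>2 ^ n\<close> and are
  bounded by the weighted norm of \<open>f\<close> at scale \<open>n\<close>, so
  \<open>hb_square_sum\<close> reaches the full index \<open>a + b + c\<close> without loss.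
  Negativity of \<open>b + c\<close> makes the partial sums \<open>Wc\<close> grow geometrically
  instead of requiring the resonant series to converge.\<close>

lemma hb_Tc: assumes a: "0 < a" "a < 1" and bc: "b + c < 0" "0 < a + b + c"
 shows "\<exists>B\<ge>0. \<forall>f g h C D D'. hb a f C --> bb b g D --> bb c h D' --> psum f g \<and>
  (\<forall>k. (\<lambda>n. T1 n f g h k) summable_on UNIV) \<and> (\<forall>k. (\<lambda>n. T2 n f g h k) summable_on UNIV) \<and>
  hb (a + b + c) (Tc f g h) (B * C * D * D')"
proof -
 have u0: "0 < 5 * cj" using cj_ge_1 by simp
 from hb_square_sum[OF bc(2) u0] obtain B0 where B0: "0 \<le> B0"
  "\<And>H e E. [|\<forall>n k. H n k \<noteq> 0 --> jap k \<le> 5 * cj * 2 ^ n; \<forall>n. hb 0 (H n) (dyad n (- (a + b + c)) * e n);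
   0 \<le> E; \<forall>N. (\<Sum>n<N. (e n)^2) \<le> E^2|] ==>
   (\<forall>k. (\<lambda>n. H n k) summable_on UNIV) \<and> hb (a + b + c) (\<lambda>k. INFSUM n. H n k) (B0 * E)" by blast
 from hb_Uc[of b] obtain C1 where C1: "0 \<le> C1"
  "\<And>n f g D Y. [|psum f g; bb b g D; hb 0 (\<lambda>k. cor (wgt n k) * f k) Y|] ==>
   hb 0 (Uc n f g) (C1 * D * Y * dyad n (- b))" by blast
 have "b - 1 < b + min a 0" using a by simp
 from hb_para_HC[OF this] have ps: "\<And>f g C D. hb a f C ==> bb b g D ==> psum f g" by blast
 define K where "K = sqrt (2 powr (2 * a) * geo (- (2 * a)) + geo (- (2 * (1 - a))))"
 have K0: "0 \<le> K" using geo_nonneg by (simp add: K_def)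
 define r where "r = - (b + c)"
 have r: "0 < r" using bc by (simp add: r_def)
 define C2 where "C2 = 3 * 2 powr \<bar>b\<bar> * (geo (- r) * 2 powr r)"
 have C20: "0 \<le> C2" using geo_nonneg by (simp add: C2_def)
 have jcj: "jap k \<le> 5 * cj * 2 ^ n" if "nf k \<le> 5 * lb * 2 ^ n" for k n
  using that by (intro jap_le_cj_mult) auto
 have "psum f g \<and>
  (\<forall>k. (\<lambda>n. T1 n f g h k) summable_on UNIV) \<and> (\<forall>k. (\<lambda>n. T2 n f g h k) summable_on UNIV) \<and>
  hb (a + b + c) (Tc f g h) (B0 * ((C1 + C2) * K) * C * D * D')"
  if f: "hb a f C" and g: "bb b g D" and h: "bb c h D'" for f g h C D D'
 proof -
  have nn: "0 \<le> C" "0 \<le> D" "0 \<le> D'" using hb_nonneg[OF f] bb_nonneg[OF g] bb_nonneg[OF h] .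
  have f0: "hb 0 f C" by (rule hb_weaken[OF f]) (use a in simp)
  have psfg: "psum f g" by (rule ps[OF f g])
  define y where "y n = ynorm n f" for n
  have y: "hb 0 (\<lambda>k. cor (wgt n k) * f k) (y n)" for n unfolding y_def by (rule hb_ynorm(1)[OF f0])
  have sumy: "(\<Sum>n<N. (q * (dyad n a * y n))^2) \<le> (q * (K * C))^2" for N q
  proof -
   have "(\<Sum>n<N. (q * (dyad n a * y n))^2) = q^2 * (\<Sum>n<N. (dyad n a * y n)^2)"
    by (simp add: power_mult_distrib sum_distrib_left)
   also have "\<dots> \<le> q^2 * (K * C)^2"
    unfolding K_def y_def by (intro mult_left_mono sum_ynorm_le a f) auto
   finally show ?thesis by (simp add: power_mult_distrib)
  qed
  let ?q1 = "C1 * D * D'" and ?q2 = "C2 * D * D'"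
  have t1: "(\<forall>k. (\<lambda>n. T1 n f g h k) summable_on UNIV) \<and> hb (a + b + c) (\<lambda>k. INFSUM n. T1 n f g h k) (B0 * (?q1 * (K * C)))"
  proof (rule B0(2)[where H = "\<lambda>n. T1 n f g h" and E = "?q1 * (K * C)" and e = "\<lambda>n. ?q1 * (dyad n a * y n)"]; (intro allI impI)?)
   fix n k assume "T1 n f g h k \<noteq> 0"
   then have "nf k \<le> 3 * lb * 2 ^ n + lb * 2 ^ n"
    unfolding T1_def by (intro tprod_supp_jap[OF Uc_freq blk_freq])
   also have "\<dots> \<le> 5 * lb * 2 ^ n" using lb by simp
   finally show "jap k \<le> 5 * cj * 2 ^ n" by (rule jcj)
  next
   fix n
   show "hb 0 (T1 n f g h) (dyad n (- (a + b + c)) * (?q1 * (dyad n a * y n)))"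
    using hb_tprod[OF fs_Uc fs_blk C1(2)[OF psfg g y, of n] bbD[OF h, of n]] by (simp add: T1_def powr_expand)
  next
   show "0 \<le> ?q1 * (K * C)" using C1 nn K0 by simp
  next
   fix N show "(\<Sum>n<N. (?q1 * (dyad n a * y n))^2) \<le> (?q1 * (K * C))^2" by (rule sumy)
  qed
  have ubW: "ub (Wc i g h) (C2 * D * D' * dyad i r)" for i
  proof -
   have "ub (Wc i g h) (\<Sum>n<Suc i. 3 * 2 powr \<bar>b\<bar> * D * dyad n (- b) * (D' * dyad n (- c)))"
    unfolding Wc_def
   proof (rule ub_sum)
    show "ub (rn n g h) (3 * 2 powr \<bar>b\<bar> * D * dyad n (- b) * (D' * dyad n (- c)))" for n
     unfolding rn_def by (intro ub_tprod fs_fat fs_blk ub_fat g bbD h)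
   qed (auto simp: fs_rn)
   moreover have "(\<Sum>n<Suc i. 3 * 2 powr \<bar>b\<bar> * D * dyad n (- b) * (D' * dyad n (- c))) \<le> C2 * D * D' * dyad i r"
   proof -
    have "(\<Sum>n<Suc i. 3 * 2 powr \<bar>b\<bar> * D * dyad n (- b) * (D' * dyad n (- c)))
      = 3 * 2 powr \<bar>b\<bar> * D * D' * (\<Sum>n<Suc i. dyad n r)"
     unfolding sum_distrib_left r_def by (intro sum.cong refl) (simp add: powr_expand)
    also have "\<dots> \<le> 3 * 2 powr \<bar>b\<bar> * D * D' * (geo (- r) * dyad (Suc i) r)"
     using nn by (intro mult_left_mono sum_powr_le r) auto
    finally show ?thesis unfolding of_nat_Suc distrib_right powr_add mult_1 by (simp only: C2_def mult_ac)
   qed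
   ultimately show ?thesis by (rule ub_mono)
  qed
  have t2: "(\<forall>k. (\<lambda>n. T2 n f g h k) summable_on UNIV) \<and> hb (a + b + c) (\<lambda>k. INFSUM n. T2 n f g h k) (B0 * (?q2 * (K * C)))"
  proof (rule B0(2)[where H = "\<lambda>n. T2 n f g h" and E = "?q2 * (K * C)" and e = "\<lambda>n. ?q2 * (dyad n a * y n)"]; (intro allI impI)?)
   fix n k assume t: "T2 n f g h k \<noteq> 0"
   have A: "nf l \<le> 2 * lb * 2 ^ n" if "ann n f l \<noteq> 0" for l
   proof -
    have "nf l \<le> 2 * (1 * 2 ^ n)" using that norm_freq_le_jap'[of l] by (auto simp: ann_def split: if_splits)
    also have "\<dots> \<le> 2 * (lb * 2 ^ n)" using lb by (intro mult_left_mono mult_right_mono) auto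
    finally show ?thesis by simp
   qed
   have W: "nf l \<le> 3 * lb * 2 ^ n" if nz: "Wc n g h l \<noteq> 0" for l
   proof -
    from nz obtain i where i: "i < Suc n" "rn i g h l \<noteq> 0" unfolding Wc_def by (meson sum.not_neutral_contains_not_neutral lessThan_iff)
    have "nf l \<le> 2 * lb * 2 ^ i + lb * 2 ^ i"
     using i(2) unfolding rn_def by (intro tprod_supp_jap[OF fat_freq blk_freq])
    also have "\<dots> = 3 * lb * 2 ^ i" by simp
    also have "\<dots> \<le> 3 * lb * 2 ^ n" using i lb by (intro mult_left_mono power_increasing) auto
    finally show ?thesis .
   qed
   have "nf k \<le> 2 * lb * 2 ^ n + 3 * lb * 2 ^ n"
    using t unfolding T2_def by (intro tprod_supp_jap[OF A W])
   then show "jap k \<le> 5 * cj * 2 ^ n" by (intro jcj) simp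
  next
   fix n
   show "hb 0 (T2 n f g h) (dyad n (- (a + b + c)) * (?q2 * (dyad n a * y n)))"
    using hb_tprod[OF fs_ann fs_Wc hb_ann[OF y[of n]] ubW[of n]] by (simp add: T2_def r_def powr_expand)
  next
   show "0 \<le> ?q2 * (K * C)" using C20 nn K0 by simp
  next
   fix N show "(\<Sum>n<N. (?q2 * (dyad n a * y n))^2) \<le> (?q2 * (K * C))^2" by (rule sumy)
  qed
  have "hb (a + b + c) (Tc f g h) (B0 * (?q1 * (K * C)) + B0 * (?q2 * (K * C)))"
   unfolding Tc_def using t1 t2 by (intro hb_diff) auto
  moreover have "B0 * (?q1 * (K * C)) + B0 * (?q2 * (K * C)) = B0 * ((C1 + C2) * K) * C * D * D'"
   by (simp add: algebra_simps)
  ultimately show ?thesis using t1 t2 psfg by simp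
 qed
 moreover have "0 \<le> B0 * ((C1 + C2) * K)" using B0 C1 C20 K0 by simp
 ultimately show ?thesis by blast
qed

lemma Tc_linear:
 assumes p: "\<And>n k. T1 n f g h k = z * T1 n f1 g1 h1 k + T1 n f2 g2 h2 k" "\<And>n k. T2 n f g h k = z * T2 n f1 g1 h1 k + T2 n f2 g2 h2 k"
  and s: "\<And>k. (\<lambda>n. T1 n f1 g1 h1 k) summable_on UNIV" "\<And>k. (\<lambda>n. T1 n f2 g2 h2 k) summable_on UNIV"
   "\<And>k. (\<lambda>n. T2 n f1 g1 h1 k) summable_on UNIV" "\<And>k. (\<lambda>n. T2 n f2 g2 h2 k) summable_on UNIV"
 shows "Tc f g h = scale z (Tc f1 g1 h1) + Tc f2 g2 h2"
 by (rule ext) (simp add: Tc_def p scale_apply infsum_linear[OF s(1,2)] infsum_linear[OF s(3,4)], simp add: algebra_simps)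

definition idx :: "int \<times> int => nat" where "idx l = nat \<lfloor>log 2 (jap l)\<rfloor>"

lemma idx_less: "jap l < 2 ^ n \<longleftrightarrow> idx l < n"
proof -
 have "jap l < 2 ^ n \<longleftrightarrow> log 2 (jap l) < n" by (simp add: log_less_iff powr_realpow)
 then show ?thesis using jap_ge_1[of l] by (auto simp: idx_def nat_less_iff floor_less_iff)
qed

lemma cut_idx: "cut n f l = (if idx l < n then f l else 0)" by (simp add: cut_def idx_less)

lemma ann_idx: "ann n f l = (if idx l = n then f l else 0)"
 using idx_less[of l n] idx_less[of l "n + 1"] by (auto simp: ann_def not_less)

text \<open>For smooth arguments everything converges absolutely. Cutting \<open>f\<close> off at
  shell \<open>n\<close> in the n-th resonant term omits the shells at or above \<open>n\<close>;
  the omitted terms, collected by shell instead of by \<open>n\<close>, are exactly the sum of the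
  \<open>T2\<close>.\<close>

lemma Tc_smooth: assumes sf: "smooth_fun f" and sg: "smooth_fun g" and sh: "smooth_fun h"
 shows "Tc f g h = reso (par f g) h - tprod f (reso g h)"
proof
 fix k
 obtain Cf where Cf: "hb 0 f Cf" using hb_smooth[OF sf] by blast
 obtain Dg where Dg: "bb 2 g Dg" using bb_smooth[OF sg] by blast
 obtain Cg where Cg: "hb 1 g Cg" using hb_smooth[OF sg] by blast
 obtain Dh where Dh: "bb 1 h Dh" using bb_smooth[OF sh] by blast
 from hb_para_HC[of 1 2 0] obtain Bp where "\<forall>f g C D. hb 0 f C --> bb 2 g D --> psum f g \<and> hb 1 (par f g) (Bp * C * D)"
  by auto
 then have ps: "psum f g" and Hp: "hb 1 (par f g) (Bp * Cf * Dg)" using Cf Dg by blast+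
 define p where "p n = rn n g h" for n
 have fp: "fs (p n)" for n unfolding p_def by (rule fs_rn)
 have rgh: "reso g h l = (INFSUM n. p n l)" for l
  unfolding p_def rn_def by (rule resonant_eq_sum(2)[OF Cg Dh]) simp
 have rp: "reso (par f g) h k = (INFSUM n. tprod (fat n (par f g)) (blk n h) k)"
  and rps: "(\<lambda>n. tprod (fat n (par f g)) (blk n h) k) summable_on UNIV"
  by (rule resonant_eq_sum[OF Hp Dh], simp)+
 define P where "P n = (((la / 2) powr - 1 + (2 * cj) powr - 1) * dyad n (- 1) * Cg) * (Dh * dyad n (- 1))" for n
 have pP: "cmod (p n l) \<le> P n" for n l
  unfolding p_def rn_def P_def by (rule hb0_coeff[OF hb_tprod[OF fs_fat fs_blk hb0_fat[OF Cg] bbD[OF Dh]]])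
 have P0: "0 \<le> P n" for n using pP[of n 0] norm_ge_zero order_trans by blast
 have Ps: "P summable_on UNIV"
 proof -
  have "P n = (((la / 2) powr - 1 + (2 * cj) powr - 1) * Cg * Dh) * dyad n (- 2)" for n
   using powr_sq[of n "-1"] by (simp add: P_def power2_eq_square)
  then have "P = (\<lambda>n. (((la / 2) powr - 1 + (2 * cj) powr - 1) * Cg * Dh) * dyad n (- 2))" by blast
  then show ?thesis by (simp only:) (intro summable_on_cmult_right geo_summable, simp)
 qed
 have fsum: "(\<lambda>l. cmod (f l)) summable_on UNIV" using smooth_summable[OF sf, of 0] by simp
 define F where "F n l = f l * p n (k - l)" for n l
 have Fs: "(\<lambda>(n, l). F n l) summable_on UNIV \<times> UNIV"
  by (rule infsum_Sigma_nonneg_summable[OF Ps fsum P0])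
    (auto simp: F_def norm_mult mult.commute[of "P _"] intro!: mult_left_mono pP)
 have Fsub: "(\<lambda>(n, l). F n l) summable_on X" for X
  by (rule summable_on_subset_banach[OF Fs]) simp
 define r where "r n = (INFSUM l. F n l)" for n
 define q where "q n = (INFSUM l:{l. idx l < n}. F n l)" for n
 define d where "d n = (INFSUM l:{l. \<not> idx l < n}. F n l)" for n
 have Fn: "F n summable_on X" for n X
 proof -
  have "(\<lambda>(n, l). F n l) summable_on Pair n ` X" by (rule Fsub)
  then show ?thesis by (subst (asm) summable_on_reindex) (auto simp: o_def inj_on_def)
 qed
 have rqd: "r n = q n + d n" for n
 proof -
  have "UNIV = {l. idx l < n} \<union> {l. \<not> idx l < n}" by auto
  then show ?thesis unfolding r_def q_def d_def
   using infsum_Un_disjoint[OF Fn Fn, of "{l. idx l < n}" "{l. \<not> idx l < n}" n] by auto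
 qed
 have rs: "r summable_on UNIV" unfolding r_def[abs_def]
  using summable_on_Sigma_banach[OF Fs] by simp
 \<comment> \<open>The omitted pairs: slicing \<open>S\<close> by \<open>n\<close> gives
   \<open>d\<close>, slicing it by the shell of \<open>l\<close> gives \<open>T2\<close>.\<close>
 define S where "S = (SIGMA n:UNIV. {l. \<not> idx l < n})"
 have ds: "d summable_on UNIV" and dS: "(INFSUM n. d n) = (\<Sum>\<^sub>\<infinity>(n, l)\<in>S. F n l)"
  unfolding d_def[abs_def] S_def by (rule summable_on_Sigma_banach[OF Fsub], rule infsum_Sigma'_banach[OF Fsub])
 have qs: "q summable_on UNIV" using summable_on_minus[OF rs ds] by (simp add: rqd)
 have qsum: "(INFSUM n. q n) = (INFSUM n. r n) - (INFSUM n. d n)"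
  using infsum_minus[OF rs ds] by (simp add: rqd)
 have rsum: "(INFSUM n. r n) = tprod f (reso g h) k"
 proof -
  have "(INFSUM n. r n) = (INFSUM l. INFSUM n. F n l)" unfolding r_def by (rule infsum_swap_banach[OF Fs])
  then show ?thesis by (simp add: F_def infsum_cmult_right' tprod_def rgh)
 qed
 have qe: "tprod (cut n f) (p n) k = q n" for n
  unfolding tprod_def q_def F_def by (rule infsum_cong_neutral) (auto simp: cut_idx)
 have t1: "T1 n f g h k = tprod (fat n (par f g)) (blk n h) k - q n" for n
 proof -
  have "T1 n f g h k = tprod (fat n (par f g)) (blk n h) k - tprod (tprod (cut n f) (fat n g)) (blk n h) k"
   unfolding T1_def Uc_def by (rule tprod_diff_left[OF fs_fat fs_tprod[OF fs_cut fs_fat]])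
  also have "tprod (tprod (cut n f) (fat n g)) (blk n h) = tprod (cut n f) (p n)"
   unfolding p_def rn_def by (rule tprod_assoc[OF fs_cut fs_fat fs_blk])
  finally show ?thesis by (simp add: qe)
 qed
 have t1s: "(INFSUM n. T1 n f g h k) = reso (par f g) h k - (INFSUM n. q n)"
  unfolding t1 rp by (rule infsum_minus[OF rps qs])
 have t2: "T2 i f g h k = (\<Sum>\<^sub>\<infinity>(n, l)\<in>{..<Suc i} \<times> {l. idx l = i}. F n l)" for i
 proof -
  have "T2 i f g h k = (\<Sum>n<Suc i. tprod (ann i f) (p n) k)"
   unfolding T2_def Wc_def p_def by (rule tprod_sum_right) (auto simp: fs_rn)
  also have "\<dots> = (\<Sum>n<Suc i. INFSUM l:{l. idx l = i}. F n l)"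
   unfolding tprod_def F_def by (intro sum.cong refl infsum_cong_neutral) (auto simp: ann_idx)
  also have "\<dots> = (\<Sum>\<^sub>\<infinity>n\<in>{..<Suc i}. INFSUM l:{l. idx l = i}. F n l)" by simp
  also have "\<dots> = (\<Sum>\<^sub>\<infinity>(n, l)\<in>{..<Suc i} \<times> {l. idx l = i}. F n l)"
   by (rule infsum_Sigma'_banach[OF Fsub])
  finally show ?thesis .
 qed
 have t2s: "(INFSUM i. T2 i f g h k) = (\<Sum>\<^sub>\<infinity>(n, l)\<in>S. F n l)"
 proof -
  have b: "bij_betw (\<lambda>(i, p). p) (SIGMA i:UNIV. {..<Suc i} \<times> {l. idx l = i}) S"
   by (rule bij_betwI[where g = "\<lambda>(n, l). (idx l, (n, l))"]) (auto simp: S_def)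
  have s: "(\<lambda>(i, p). (\<lambda>(n, l). F n l) p) summable_on (SIGMA i:UNIV. {..<Suc i} \<times> {l. idx l = i})"
   using summable_on_reindex_bij_betw[OF b, of "\<lambda>(n, l). F n l"] Fsub[of S] by (simp add: case_prod_unfold)
  have "(\<Sum>\<^sub>\<infinity>(n, l)\<in>S. F n l) = (\<Sum>\<^sub>\<infinity>(i, p)\<in>(SIGMA i:UNIV. {..<Suc i} \<times> {l. idx l = i}). (\<lambda>(n, l). F n l) p)"
   using infsum_reindex_bij_betw[OF b, of "\<lambda>(n, l). F n l"] by (simp add: case_prod_unfold)
  also have "\<dots> = (INFSUM i. T2 i f g h k)"
   unfolding t2 by (rule infsum_Sigma'_banach[OF s, symmetric])
  finally show ?thesis ..
 qed
 show "Tc f g h k = (reso (par f g) h - tprod f (reso g h)) k"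
  unfolding Tc_def t1s t2s qsum rsum dS by simp
qed

text \<open>Without a witness nothing could be said about the chosen \<open>commutator\<close>. The
  formula for \<open>Tc\<close> does not mention the exponents, which is why a single operator
  serves all admissible ones.\<close>

theorem commutator_exists: "is_commutator chi rho Tc" unfolding is_commutator_def
proof (intro conjI allI impI)
 show "Tc f g h = reso (par f g) h - tprod f (reso g h)"
  if "smooth_fun f" "smooth_fun g" "smooth_fun h" for f g h using Tc_smooth that .
 fix a b c :: real assume abc: "0 < a" "a < 1" "b + c < 0" "0 < a + b + c"
 from hb_Tc[OF abc] obtain B where B: "0 \<le> B"
  "\<And>f g h C D D'. [|hb a f C; bb b g D; bb c h D'|] ==> psum f g \<and>
  (\<forall>k. (\<lambda>n. T1 n f g h k) summable_on UNIV) \<and> (\<forall>k. (\<lambda>n. T2 n f g h k) summable_on UNIV) \<and>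
  hb (a + b + c) (Tc f g h) (B * C * D * D')" by blast
 have S: "psum f g" "\<And>k. (\<lambda>n. T1 n f g h k) summable_on UNIV" "\<And>k. (\<lambda>n. T2 n f g h k) summable_on UNIV"
  if "f \<in> sobolev a" "g \<in> besov chi rho b" "h \<in> besov chi rho c" for f g h
  using that B(2) unfolding sobolev_iff besov_iff by blast+
 show "bounded_trilinear_on Tc (sobolev a) (sobolev_norm a) (besov chi rho b) (besov_norm chi rho b)
   (besov chi rho c) (besov_norm chi rho c) (sobolev (a + b + c)) (sobolev_norm (a + b + c))"
  unfolding bounded_trilinear_on_def
 proof (intro conjI ballI allI)
  fix f g h assume fgh: "f \<in> sobolev a" "g \<in> besov chi rho b" "h \<in> besov chi rho c"
  then show "Tc f g h \<in> sobolev (a + b + c)" using B(2) unfolding sobolev_iff besov_iff by blast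
 next
  fix z f f' g h assume A: "f \<in> sobolev a" "f' \<in> sobolev a" "g \<in> besov chi rho b" "h \<in> besov chi rho c"
  show "Tc (scale z f + f') g h = scale z (Tc f g h) + Tc f' g h"
  proof (rule Tc_linear)
   show "T1 n (scale z f + f') g h k = z * T1 n f g h k + T1 n f' g h k" for n k
    unfolding T1_def Uc_linear_left[OF S(1)[OF A(1,3,4)] S(1)[OF A(2,3,4)]] by (rule tprod_linear_left[OF fs_Uc fs_Uc])
   show "T2 n (scale z f + f') g h k = z * T2 n f g h k + T2 n f' g h k" for n k
    unfolding T2_def ann_linear by (rule tprod_linear_left[OF fs_ann fs_ann])
  qed (use S A in blast)+
 next
  fix z f g g' h assume A: "f \<in> sobolev a" "g \<in> besov chi rho b" "g' \<in> besov chi rho b" "h \<in> besov chi rho c"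
  show "Tc f (scale z g + g') h = scale z (Tc f g h) + Tc f g' h"
  proof (rule Tc_linear)
   show "T1 n f (scale z g + g') h k = z * T1 n f g h k + T1 n f g' h k" for n k
    unfolding T1_def Uc_linear_right[OF S(1)[OF A(1,2,4)] S(1)[OF A(1,3,4)]] by (rule tprod_linear_left[OF fs_Uc fs_Uc])
   show "T2 n f (scale z g + g') h k = z * T2 n f g h k + T2 n f g' h k" for n k
    unfolding T2_def Wc_linear_left by (rule tprod_linear_right[OF fs_Wc fs_Wc])
  qed (use S A in blast)+
 next
  fix z f g h h' assume A: "f \<in> sobolev a" "g \<in> besov chi rho b" "h \<in> besov chi rho c" "h' \<in> besov chi rho c"
  show "Tc f g (scale z h + h') = scale z (Tc f g h) + Tc f g h'"
  proof (rule Tc_linear)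
   show "T1 n f g (scale z h + h') k = z * T1 n f g h k + T1 n f g h' k" for n k
    unfolding T1_def blk_linear by (rule tprod_linear_right[OF fs_blk fs_blk])
   show "T2 n f g (scale z h + h') k = z * T2 n f g h k + T2 n f g h' k" for n k
    unfolding T2_def Wc_linear_right by (rule tprod_linear_right[OF fs_Wc fs_Wc])
  qed (use S A in blast)+
 next
  show "\<exists>B::real. \<forall>f\<in>sobolev a. \<forall>g\<in>besov chi rho b. \<forall>h\<in>besov chi rho c.
    sobolev_norm (a + b + c) (Tc f g h) \<le> ennreal B * sobolev_norm a f * besov_norm chi rho b g * besov_norm chi rho c h"
  proof (intro exI[of _ "B * (2 powr b * 2 powr c)"] ballI)
   fix f g h assume A: "f \<in> sobolev a" "g \<in> besov chi rho b" "h \<in> besov chi rho c"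
   from A(1) obtain C where C: "0 \<le> C" "sobolev_norm a f = ennreal C" "hb a f C" by (rule sobolev_normE)
   from A(2) obtain D where D: "0 \<le> D" "besov_norm chi rho b g = ennreal D"
    unfolding besov_def by (metis ennreal_cases infinity_ennreal_def less_irrefl mem_Collect_eq)
   from A(3) obtain D' where D': "0 \<le> D'" "besov_norm chi rho c h = ennreal D'"
    unfolding besov_def by (metis ennreal_cases infinity_ennreal_def less_irrefl mem_Collect_eq)
   have g: "bb b g (2 powr b * D)" using besov_normD[of b g D] D by simp
   have h: "bb c h (2 powr c * D')" using besov_normD[of c h D'] D' by simp
   have "hb (a + b + c) (Tc f g h) (B * C * (2 powr b * D) * (2 powr c * D'))" using B(2)[OF C(3) g h] by blast
   then have "sobolev_norm (a + b + c) (Tc f g h) \<le> ennreal (B * C * (2 powr b * D) * (2 powr c * D'))"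
    using B(1) C D D' by (subst sobolev_norm_le_iff) auto
   also have "B * C * (2 powr b * D) * (2 powr c * D') = B * (2 powr b * 2 powr c) * C * D * D'" by (simp only: mult_ac)
   also have "ennreal \<dots> = ennreal (B * (2 powr b * 2 powr c)) * sobolev_norm a f * besov_norm chi rho b g * besov_norm chi rho c h"
    unfolding C(2) D(2) D'(2) using B(1) C(1) D(1) D'(1) by (simp add: ennreal_mult)
   finally show "sobolev_norm (a + b + c) (Tc f g h) \<le> ennreal (B * (2 powr b * 2 powr c)) * sobolev_norm a f * besov_norm chi rho b g * besov_norm chi rho c h" .
  qed
 qed
qed

lemma commutator_is: "is_commutator chi rho (commutator chi rho)"
 unfolding commutator_def by (rule someI[of _ Tc]) (rule commutator_exists)

end

section \<open>Derivatives, the Leibniz rule and bounded bilinear maps\<close>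

lemma scale_one [simp]: "scale 1 f = f" by (simp add: scale_def)

lemma scale_add: "scale z (f + g) = scale z f + scale z g"
 by (simp add: scale_def fun_eq_iff algebra_simps)

lemma scale_scale: "scale z (scale y f) = scale (z * y) f" by (simp add: scale_def mult.assoc)

lemma diff_scale: "f - g = scale (-1) g + (f :: tdist)" by (simp add: scale_def fun_eq_iff)

lemma hb_multiplier:
 assumes "hb s u C" "\<And>k. cmod (f k) \<le> jap k powr r * cmod (u k)" shows "hb (s - r) f C"
proof (rule hb_le1[OF assms(1)])
 fix k
 have "jap k powr (s - r) * cmod (f k) \<le> jap k powr (s - r) * (jap k powr r * cmod (u k))"
  by (intro mult_left_mono assms) auto
 then show "jap k powr (s - r) * cmod (f k) \<le> jap k powr s * cmod (u k)"
  by (simp add: mult.assoc[symmetric] flip: powr_add)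
qed

lemma hb_laplacian: "hb s u C ==> hb (s - 2) (laplacian u) C"
 by (erule hb_multiplier) (simp add: laplacian_def norm_mult norm_power jap_sq mult_right_mono)

lemma hb_inv_lap: "hb s f C ==> hb (s + 2) (inv_one_minus_lap f) C"
 using hb_multiplier[of s f C "inv_one_minus_lap f" "-2"]
 by (simp add: inv_lap_apply norm_divide norm_power powr_minus divide_inverse norm_mult norm_inverse mult.commute)

lemma hb_derivative: assumes "hb s u C" "\<And>k. \<bar>d k\<bar> \<le> nf k"
 shows "hb (s - 1) (\<lambda>k. 2 * of_real pi * \<i> * of_real (d k) * u k) C"
proof (rule hb_multiplier[OF assms(1)])
 show "cmod (2 * of_real pi * \<i> * of_real (d k) * u k) \<le> jap k powr 1 * cmod (u k)" for k
  using order_trans[OF mult_left_mono[OF assms(2)[of k]] norm_freq_le_jap] by (simp add: norm_mult mult_right_mono)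
qed

lemma hb_partial1: "hb s u C ==> hb (s - 1) (partial1 u) C"
 unfolding partial_apply[abs_def] by (erule hb_derivative) (simp add: norm_prod_def real_le_rsqrt)

lemma hb_partial2: "hb s u C ==> hb (s - 1) (partial2 u) C"
 unfolding partial_apply[abs_def] by (erule hb_derivative) (simp add: norm_prod_def real_le_rsqrt)

lemma laplacian_linear: "laplacian (scale z f + g) = scale z (laplacian f) + laplacian g"
 by (simp add: laplacian_def scale_def fun_eq_iff algebra_simps)

lemma partial_linear: "partial1 (scale z f + g) = scale z (partial1 f) + partial1 g"
 "partial2 (scale z f + g) = scale z (partial2 f) + partial2 g"
 by (simp_all add: partial1_def partial2_def scale_def fun_eq_iff algebra_simps)

lemma inv_lap_linear: "inv_one_minus_lap (scale z f + g) = scale z (inv_one_minus_lap f) + inv_one_minus_lap g"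
 by (simp add: inv_one_minus_lap_def scale_def fun_eq_iff add_divide_distrib)

text \<open>The Leibniz rule for 1 - \<Delta>, which reduces to a polynomial identity for each pair
  of frequencies.\<close>

lemma leibniz_tprod: assumes "fs F" "fs G"
 shows "cor ((jap k)^2) * tprod F G k = tprod F (\<lambda>k. cor ((jap k)^2) * G k) k
  - tprod (laplacian F) G k - 2 * (tprod (partial1 F) (partial1 G) k + tprod (partial2 F) (partial2 G) k)"
proof -
 let ?A = "{k. F k \<noteq> 0}"
 have A: "finite ?A" by (rule assms(1))
 have sub: "{k. laplacian F k \<noteq> 0} \<subseteq> ?A" "{k. partial1 F k \<noteq> 0} \<subseteq> ?A" "{k. partial2 F k \<noteq> 0} \<subseteq> ?A"
  by (auto simp: laplacian_def partial1_def partial2_def)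
 have e: "cor ((jap k)^2) * (F l * G (k - l)) = F l * (cor ((jap (k - l))^2) * G (k - l))
   - laplacian F l * G (k - l) - 2 * (partial1 F l * partial1 G (k - l) + partial2 F l * partial2 G (k - l))" for l
 proof -
  define x y x' y' where "x = real_of_int (fst l)" and "y = real_of_int (snd l)"
   and "x' = real_of_int (fst (k - l))" and "y' = real_of_int (snd (k - l))"
  have k: "real_of_int (fst k) = x + x'" "real_of_int (snd k) = y + y'" by (auto simp: x_def x'_def y_def y'_def)
  have n: "(nf k)^2 = (x + x')^2 + (y + y')^2" "(nf l)^2 = x^2 + y^2" "(nf (k - l))^2 = x'^2 + y'^2"
   unfolding k[symmetric] unfolding x_def x'_def y_def y'_def by (simp_all add: norm_prod_def freq_def)
  have p: "partial1 F l = 2 * of_real pi * \<i> * of_real x * F l" "partial2 F l = 2 * of_real pi * \<i> * of_real y * F l"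
   "partial1 G (k - l) = 2 * of_real pi * \<i> * of_real x' * G (k - l)" "partial2 G (k - l) = 2 * of_real pi * \<i> * of_real y' * G (k - l)"
   by (simp_all add: partial1_def partial2_def x_def x'_def y_def y'_def)
  have i: "(2 * P * \<i> * a * A) * (2 * P * \<i> * b * B) = - (4 * P^2 * a * b) * (A * B)" for P a b A B :: complex
   by (simp add: power2_eq_square)
  have q: "partial1 F l * partial1 G (k - l) = - (4 * (cor pi)^2 * cor x * cor x') * (F l * G (k - l))"
   "partial2 F l * partial2 G (k - l) = - (4 * (cor pi)^2 * cor y * cor y') * (F l * G (k - l))"
   unfolding p by (rule i)+
  have j: "(1 + 4 * P^2 * ((X + X')^2 + (Y + Y')^2)) * (A * B) = A * ((1 + 4 * P^2 * (X'^2 + Y'^2)) * B)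
   - - (4 * P^2 * (X^2 + Y^2)) * A * B - 2 * (- (4 * P^2 * X * X') * (A * B) + - (4 * P^2 * Y * Y') * (A * B))"
   for P X Y X' Y' A B :: complex by algebra
  show ?thesis
   using j[of "of_real pi" "of_real x" "of_real x'" "of_real y" "of_real y'" "F l" "G (k - l)"]
   unfolding q jap_sq n laplacian_def
   by (simp only: of_real_add of_real_mult of_real_power of_real_1 of_real_numeral of_real_minus)
 qed
 have "cor ((jap k)^2) * tprod F G k = (\<Sum>l\<in>?A. cor ((jap k)^2) * (F l * G (k - l)))"
  by (simp add: tprod_finite[OF A] sum_distrib_left)
 also have "\<dots> = (\<Sum>l\<in>?A. F l * (cor ((jap (k - l))^2) * G (k - l))) - (\<Sum>l\<in>?A. laplacian F l * G (k - l))
   - 2 * ((\<Sum>l\<in>?A. partial1 F l * partial1 G (k - l)) + (\<Sum>l\<in>?A. partial2 F l * partial2 G (k - l)))"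
  unfolding e by (simp only: sum_subtractf sum.distrib sum_distrib_left distrib_left)
 finally show ?thesis by (simp only: tprod_finite[OF A order_refl] tprod_finite[OF A sub(1)] tprod_finite[OF A sub(2)] tprod_finite[OF A sub(3)])
qed

lemma tprod_coeff_le: assumes f: "hb 0 f C" and g: "hb 0 g D" shows "cmod (tprod f g k) \<le> C * D"
proof -
 have s: "(\<lambda>l. cmod (f l * g (k - l))) summable_on UNIV"
  by (rule summable_product_hb[OF f _ order_refl]) (use g in simp)
 have "cmod (tprod f g k) \<le> (INFSUM l. cmod (f l * g (k - l)))"
  unfolding tprod_def by (rule norm_infsum_bound[OF s])
 also have "\<dots> \<le> C * D"
 proof (rule infsum_le_finite_sums[OF s])
  fix A :: "(int \<times> int) set" assume A: "finite A"
  have "(\<Sum>l\<in>A. cmod (f l * g (k - l))) = (\<Sum>l\<in>A. \<bar>cmod (f l)\<bar> * \<bar>cmod (g (k - l))\<bar>)" by (simp add: norm_mult)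
  also have "\<dots> \<le> L2_set (\<lambda>l. cmod (f l)) A * L2_set (\<lambda>l. cmod (g (k - l))) A" by (rule L2_set_mult_ineq)
  also have "\<dots> \<le> C * D"
  proof (intro mult_mono L2_set_nonneg hb_nonneg[OF f])
   show "L2_set (\<lambda>l. cmod (f l)) A \<le> C" using hbD[OF f A] by simp
   have "L2_set (\<lambda>l. cmod (g (k - l))) A = L2_set (\<lambda>l. cmod (g l)) ((\<lambda>l. k - l) ` A)"
    unfolding L2_set_def by (subst sum.reindex) (auto simp: inj_on_def)
   then show "L2_set (\<lambda>l. cmod (g (k - l))) A \<le> D" using hbD[OF g, of "(\<lambda>l. k - l) ` A"] A by simp
  qed
  finally show "(\<Sum>l\<in>A. cmod (f l * g (k - l))) \<le> C * D" .
 qed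
 finally show ?thesis .
qed

context lp begin

lemma psum_HC: "hb a f C ==> bb b g D ==> psum f g"
proof -
 have "b + min a 0 - 1 < b + min a 0" by linarith
 from hb_para_HC[OF this] show "hb a f C ==> bb b g D ==> psum f g" by blast
qed

lemma psum_has_sum: "psum f g ==> ((\<lambda>n. tprod (low n f) (blk n g) k) has_sum par f g k) UNIV"
 unfolding psum_def para_eq by (intro has_sum_infsum) blast

text \<open>The multipliers commute with the blocks, so the Leibniz rule holds piece by piece. It
  explains the shape of the ansatz: applying 1 - \<Delta> to u \<prec> X gives u \<prec> \<xi> up to
  the very terms with \<Delta>u and \<nabla>u that \<open>ansatz_B\<close> contains.\<close>

lemma para_leibniz: assumes u: "hb s u C" and g: "bb a g D"
 shows "cor ((jap k)^2) * par u (inv_one_minus_lap g) k =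
   (par u g - par (laplacian u) (inv_one_minus_lap g) - scale 2 (para_grad chi rho u (inv_one_minus_lap g))) k"
proof -
 let ?X = "inv_one_minus_lap g"
 from bb_inv_lap[of a] g obtain D1 where X: "bb (a + 2) ?X D1" by blast
 from bb_partial1[of "a + 2"] X obtain D2 where X1: "bb (a + 2 - 1) (partial1 ?X) D2" by blast
 from bb_partial2[of "a + 2"] X obtain D3 where X2: "bb (a + 2 - 1) (partial2 ?X) D3" by blast
 note hs = psum_has_sum[OF psum_HC[OF u X]] psum_has_sum[OF psum_HC[OF u g]]
  psum_has_sum[OF psum_HC[OF hb_laplacian[OF u] X]] psum_has_sum[OF psum_HC[OF hb_partial1[OF u] X1]]
  psum_has_sum[OF psum_HC[OF hb_partial2[OF u] X2]]
 have c: "laplacian (low n u) = low n (laplacian u)" "partial1 (low n u) = low n (partial1 u)" "partial2 (low n u) = low n (partial2 u)"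
  "partial1 (blk n ?X) = blk n (partial1 ?X)" "partial2 (blk n ?X) = blk n (partial2 ?X)"
  "(\<lambda>k. cor ((jap k)^2) * blk n ?X k) = blk n g" for n
  by (auto simp: laplacian_def partial1_def partial2_def low_def blk_def inv_lap_apply fun_eq_iff)
 have e: "cor ((jap k)^2) * tprod (low n u) (blk n ?X) k = tprod (low n u) (blk n g) k + (- 1) * tprod (low n (laplacian u)) (blk n ?X) k
   + (- 2) * (tprod (low n (partial1 u)) (blk n (partial1 ?X)) k + tprod (low n (partial2 u)) (blk n (partial2 ?X)) k)" for n
  unfolding leibniz_tprod[OF fs_low fs_blk] c by simp
 have "((\<lambda>n. cor ((jap k)^2) * tprod (low n u) (blk n ?X) k) has_sum
   (par u g k + (- 1) * par (laplacian u) ?X k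
   + (- 2) * (par (partial1 u) (partial1 ?X) k + par (partial2 u) (partial2 ?X) k))) UNIV"
  unfolding e by (intro has_sum_add has_sum_cmult_right hs)
 from has_sum_unique[OF has_sum_cmult_right[OF hs(1)] this] show ?thesis
  by (simp add: para_grad_def scale_def)
qed

text \<open>Bounded bilinear maps from H^s and C^a to H^t, in terms of bounds rather than norms.
  Each noise term can then be assembled from simpler ones without tracking constants.\<close>

definition bil :: "(tdist => tdist => tdist) => real => real => real => bool" where
 "bil F s a t \<longleftrightarrow>
   (\<exists>B\<ge>0. \<forall>u g C D. hb s u C --> bb a g D --> hb t (F u g) (B * C * D)) \<and>
   (\<forall>z u u' g C C' D. hb s u C --> hb s u' C' --> bb a g D --> F (scale z u + u') g = scale z (F u g) + F u' g) \<and>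
   (\<forall>z u g g' C D D'. hb s u C --> bb a g D --> bb a g' D' --> F u (scale z g + g') = scale z (F u g) + F u g')"

lemma bilI:
 assumes "\<exists>B\<ge>0. \<forall>u g C D. hb s u C --> bb a g D --> hb t (F u g) (B * C * D)"
  and "\<And>z u u' g C C' D. hb s u C ==> hb s u' C' ==> bb a g D ==> F (scale z u + u') g = scale z (F u g) + F u' g"
  and "\<And>z u g g' C D D'. hb s u C ==> bb a g D ==> bb a g' D' ==> F u (scale z g + g') = scale z (F u g) + F u g'"
 shows "bil F s a t" using assms unfolding bil_def by blast

lemma bil_bound: "bil F s a t ==> \<exists>B\<ge>0. \<forall>u g C D. hb s u C --> bb a g D --> hb t (F u g) (B * C * D)"
 by (simp add: bil_def)

lemma bil_left: "bil F s a t ==> hb s u C ==> hb s u' C' ==> bb a g D ==> F (scale z u + u') g = scale z (F u g) + F u' g"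
 unfolding bil_def by blast

lemma bil_right: "bil F s a t ==> hb s u C ==> bb a g D ==> bb a g' D' ==> F u (scale z g + g') = scale z (F u g) + F u g'"
 unfolding bil_def by blast

lemma bil_diff_right: "bil F s a t ==> hb s u C ==> bb a g D ==> bb a g' D' ==> F u (g' - g) = F u g' - F u g"
 unfolding diff_scale[of g'] diff_scale[of "F u g'"] by (rule bil_right)

lemma bil_weaken: assumes "bil F s a t" "t' \<le> t" shows "bil F s a t'"
proof (rule bilI)
 from bil_bound[OF assms(1)] show "\<exists>B\<ge>0. \<forall>u g C D. hb s u C --> bb a g D --> hb t' (F u g) (B * C * D)"
  using hb_weaken[OF _ assms(2)] by meson
qed (rule bil_left[OF assms(1)] bil_right[OF assms(1)]; assumption)+

lemma bil_add:
 assumes F: "bil F s a t" and G: "bil G s a t" shows "bil (\<lambda>u g. F u g + G u g) s a t"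
proof (rule bilI)
 from bil_bound[OF F] obtain B where B: "0 \<le> B" "\<And>u g C D. hb s u C ==> bb a g D ==> hb t (F u g) (B * C * D)" by blast
 from bil_bound[OF G] obtain B' where B': "0 \<le> B'" "\<And>u g C D. hb s u C ==> bb a g D ==> hb t (G u g) (B' * C * D)" by blast
 have "hb t (F u g + G u g) ((B + B') * C * D)" if "hb s u C" "bb a g D" for u g C D
  using hb_add'[OF B(2)[OF that] B'(2)[OF that]] by (simp only: distrib_right)
 then show "\<exists>B\<ge>0. \<forall>u g C D. hb s u C --> bb a g D --> hb t (F u g + G u g) (B * C * D)"
  using B(1) B'(1) by (intro exI[of _ "B + B'"]) auto
qed (simp_all add: bil_left[OF F] bil_left[OF G] bil_right[OF F] bil_right[OF G], simp_all add: scale_add add_ac)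

lemma bil_scale: assumes F: "bil F s a t" shows "bil (\<lambda>u g. scale y (F u g)) s a t"
proof (rule bilI)
 from bil_bound[OF F] obtain B where B: "0 \<le> B" "\<And>u g C D. hb s u C ==> bb a g D ==> hb t (F u g) (B * C * D)" by blast
 have "hb t (scale y (F u g)) ((cmod y * B) * C * D)" if "hb s u C" "bb a g D" for u g C D
  using hb_scale[OF B(2)[OF that], of y] by (simp only: mult.assoc)
 then show "\<exists>B\<ge>0. \<forall>u g C D. hb s u C --> bb a g D --> hb t (scale y (F u g)) (B * C * D)"
  using B(1) by (intro exI[of _ "cmod y * B"]) auto
qed (simp_all add: bil_left[OF F] bil_right[OF F] scale_add scale_scale mult.commute)

lemma bil_comp_left: assumes F: "bil F s' a t" and b: "\<And>u C. hb s u C ==> hb s' (phi u) C"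
  and l: "\<And>z u u'. phi (scale z u + u') = scale z (phi u) + phi u'"
 shows "bil (\<lambda>u g. F (phi u) g) s a t"
proof (rule bilI)
 from bil_bound[OF F] obtain B where B: "0 \<le> B" "\<And>u g C D. hb s' u C ==> bb a g D ==> hb t (F u g) (B * C * D)" by blast
 show "\<exists>B\<ge>0. \<forall>u g C D. hb s u C --> bb a g D --> hb t (F (phi u) g) (B * C * D)"
  using B b by blast
qed (auto simp: l intro: bil_left[OF F] bil_right[OF F] b)

lemma bil_comp_right:
 assumes F: "bil F s a' t" and b: "\<exists>K\<ge>0. \<forall>g D. bb a g D --> bb a' (phi g) (K * D)"
  and l: "\<And>z u u'. phi (scale z u + u') = scale z (phi u) + phi u'"
 shows "bil (\<lambda>u g. F u (phi g)) s a t"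
proof (rule bilI)
 from bil_bound[OF F] obtain B where B: "0 \<le> B" "\<And>u g C D. hb s u C ==> bb a' g D ==> hb t (F u g) (B * C * D)" by blast
 from b obtain K where K: "0 \<le> K" "\<And>g D. bb a g D ==> bb a' (phi g) (K * D)" by blast
 have "hb t (F u (phi g)) ((B * K) * C * D)" if "hb s u C" "bb a g D" for u g C D
  using B(2)[OF that(1) K(2)[OF that(2)]] by (simp only: mult_ac)
 then show "\<exists>B\<ge>0. \<forall>u g C D. hb s u C --> bb a g D --> hb t (F u (phi g)) (B * C * D)"
  using B(1) K(1) by (intro exI[of _ "B * K"]) auto
 show "F (scale z u + u') (phi g) = scale z (F u (phi g)) + F u' (phi g)" if "hb s u C" "hb s u' C'" "bb a g D" for z u u' g C C' D
  by (rule bil_left[OF F that(1,2) K(2)[OF that(3)]])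
 show "F u (phi (scale z g + g')) = scale z (F u (phi g)) + F u (phi g')" if "hb s u C" "bb a g D" "bb a g' D'" for z u g g' C D D'
  unfolding l by (rule bil_right[OF F that(1) K(2)[OF that(2)] K(2)[OF that(3)]])
qed

lemma bil_para: "t < a + min s 0 ==> bil par s a t"
proof (rule bilI)
 assume "t < a + min s 0"
 from hb_para_HC[OF this] show "\<exists>B\<ge>0. \<forall>u g C D. hb s u C --> bb a g D --> hb t (par u g) (B * C * D)" by meson
qed (rule para_linear_left(2) para_linear_right(2); erule (1) psum_HC)+

lemma bil_para_flip: assumes "a < 0" "t < a + s" shows "bil (\<lambda>u g. par g u) s a t"
proof (rule bilI)
 from hb_para_CH[OF assms] obtain B where B: "0 \<le> B"
  "\<And>g u C D. bb a g D ==> hb s u C ==> psum g u \<and> hb t (par g u) (B * D * C)" by blast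
 then have p: "\<And>g u C D. bb a g D ==> hb s u C ==> psum g u" by blast
 have "hb t (par g u) (B * C * D)" if "hb s u C" "bb a g D" for u g C D
  using B(2)[OF that(2,1)] by (simp add: mult_ac)
 then show "\<exists>B\<ge>0. \<forall>u g C D. hb s u C --> bb a g D --> hb t (par g u) (B * C * D)" using B(1) by blast
 show "par g (scale z u + u') = scale z (par g u) + par g u'" if "hb s u C" "hb s u' C'" "bb a g D" for z u u' g C C' D
  by (rule para_linear_right(2)[OF p[OF that(3,1)] p[OF that(3,2)]])
 show "par (scale z g + g') u = scale z (par g u) + par g' u" if "hb s u C" "bb a g D" "bb a g' D'" for z u g g' C D D'
  by (rule para_linear_left(2)[OF p[OF that(2,1)] p[OF that(3,1)]])
qed

lemma bil_resonant: "0 \<le> t ==> t < s + a ==> bil reso s a t"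
proof (rule bilI)
 assume t: "0 \<le> t" "t < s + a"
 then have "0 < s + a" by simp
 from hb_resonant[OF this t] show "\<exists>B\<ge>0. \<forall>u g C D. hb s u C --> bb a g D --> hb t (reso u g) (B * C * D)" by meson
 show "reso (scale z u + u') g = scale z (reso u g) + reso u' g" if "hb s u C" "hb s u' C'" "bb a g D" for z u u' g C C' D
  by (rule resonant_linear_left[OF that]) fact
 show "reso u (scale z g + g') = scale z (reso u g) + reso u g'" if "hb s u C" "bb a g D" "bb a g' D'" for z u g g' C D D'
  by (rule resonant_linear_right[OF that]) fact
qed

lemma bil_tprod: assumes "0 < s" "a < 0" "0 < s + a" "t < a" shows "bil tprod s a t"
proof -
 have e: "tprod u g = par u g + par g u + reso u g" if "hb s u C" "bb a g D" for u g C D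
  by (rule tprod_decomposition_HC(1)[OF that assms(1,3)])
 have b: "bil (\<lambda>u g. par u g + par g u + reso u g) s a t"
  using assms by (intro bil_add bil_para bil_para_flip bil_weaken[OF bil_resonant[of 0]]) auto
 show ?thesis
 proof (rule bilI)
  show "\<exists>B\<ge>0. \<forall>u g C D. hb s u C --> bb a g D --> hb t (tprod u g) (B * C * D)"
   using bil_bound[OF b] by (auto simp: e)
  show "tprod (scale z u + u') g = scale z (tprod u g) + tprod u' g" if h: "hb s u C" "hb s u' C'" "bb a g D" for z u u' g C C' D
   using bil_left[OF b h] by (simp only: e[OF h(1,3)] e[OF h(2,3)] e[OF hb_add'[OF hb_scale[OF h(1)] h(2)] h(3)])
  show "tprod u (scale z g + g') = scale z (tprod u g) + tprod u g'" if h: "hb s u C" "bb a g D" "bb a g' D'" for z u g g' C D D'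
   using bil_right[OF b h] by (simp only: e[OF h(1,2)] e[OF h(1,3)] e[OF h(1) bb_add[OF bb_scale[OF h(2)] h(3)]])
 qed
qed

end

section \<open>The commutator on Sobolev functions\<close>

context lp begin

lemma commutator_facts: assumes "0 < a" "a < 1" "b + c < 0" "0 < a + b + c"
 shows hb_commutator3: "\<exists>B\<ge>0. \<forall>f g h C D D'. hb a f C --> bb b g D --> bb c h D' -->
   hb (a + b + c) (commutator chi rho f g h) (B * C * D * D')"
  and commutator_linear1: "hb a f C ==> hb a f' C' ==> bb b g D ==> bb c h D' ==>
   commutator chi rho (scale z f + f') g h = scale z (commutator chi rho f g h) + commutator chi rho f' g h"
  and commutator_linear2: "hb a f C ==> bb b g D ==> bb b g' D'' ==> bb c h D' ==>
   commutator chi rho f (scale z g + g') h = scale z (commutator chi rho f g h) + commutator chi rho f g' h"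
  and commutator_linear3: "hb a f C ==> bb b g D ==> bb c h D' ==> bb c h' D'' ==>
   commutator chi rho f g (scale z h + h') = scale z (commutator chi rho f g h) + commutator chi rho f g h'"
proof -
 let ?C = "commutator chi rho"
 have T: "bounded_trilinear_on ?C (sobolev a) (sobolev_norm a) (besov chi rho b) (besov_norm chi rho b)
   (besov chi rho c) (besov_norm chi rho c) (sobolev (a + b + c)) (sobolev_norm (a + b + c))"
  using commutator_is assms unfolding is_commutator_def by blast
 note s = sobolev_iff besov_iff
 have m: "\<And>f C. hb a f C ==> f \<in> sobolev a" "\<And>f D. bb b f D ==> f \<in> besov chi rho b" "\<And>f D. bb c f D ==> f \<in> besov chi rho c"
  unfolding s by blast+
 show "hb a f C ==> hb a f' C' ==> bb b g D ==> bb c h D' ==> ?C (scale z f + f') g h = scale z (?C f g h) + ?C f' g h"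
  using T m unfolding bounded_trilinear_on_def by meson
 show "hb a f C ==> bb b g D ==> bb b g' D'' ==> bb c h D' ==> ?C f (scale z g + g') h = scale z (?C f g h) + ?C f g' h"
  using T m unfolding bounded_trilinear_on_def by meson
 show "hb a f C ==> bb b g D ==> bb c h D' ==> bb c h' D'' ==> ?C f g (scale z h + h') = scale z (?C f g h) + ?C f g h'"
  using T m unfolding bounded_trilinear_on_def by meson
 from T obtain B where B: "\<And>f g h. f \<in> sobolev a ==> g \<in> besov chi rho b ==> h \<in> besov chi rho c ==>
   sobolev_norm (a + b + c) (?C f g h) \<le> ennreal B * sobolev_norm a f * besov_norm chi rho b g * besov_norm chi rho c h"
  unfolding bounded_trilinear_on_def by (elim conjE exE) metis
 \<comment> \<open>The constant supplied by the definition of a bounded trilinear map may be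
   negative, where \<open>ennreal\<close> truncates it to 0. The powers of 2 convert Besov norms
   into \<open>bb\<close> bounds.\<close>
 let ?B = "max B 0 * (2 powr - b * 2 powr - c)"
 have "hb (a + b + c) (?C f g h) (?B * C * D * D')" if f: "hb a f C" and g: "bb b g D" and h: "bb c h D'" for f g h C D D'
 proof -
  have nn: "0 \<le> C" "0 \<le> D" "0 \<le> D'" using hb_nonneg[OF f] bb_nonneg[OF g] bb_nonneg[OF h] .
  have "sobolev_norm (a + b + c) (?C f g h) \<le> ennreal B * sobolev_norm a f * besov_norm chi rho b g * besov_norm chi rho c h"
   using that by (intro B) (auto simp: s)
  also have "\<dots> \<le> ennreal (max B 0) * ennreal C * ennreal (2 powr - b * D) * ennreal (2 powr - c * D')"
   using sobolev_norm_le_iff[OF nn(1)] f besov_normI[OF g] besov_normI[OF h]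
   by (intro mult_mono) (auto intro: ennreal_leI)
  also have "\<dots> = ennreal (max B 0 * C * (2 powr - b * D) * (2 powr - c * D'))"
   using nn by (simp add: ennreal_mult)
  also have "max B 0 * C * (2 powr - b * D) * (2 powr - c * D') = ?B * C * D * D'" by (simp only: mult_ac)
  finally show ?thesis using nn by (subst (asm) sobolev_norm_le_iff) auto
 qed
 then show "\<exists>B\<ge>0. \<forall>f g h C D D'. hb a f C --> bb b g D --> bb c h D' --> hb (a + b + c) (?C f g h) (B * C * D * D')"
  by (intro exI[of _ ?B]) auto
qed

lemma fs_summable: "fs f ==> (\<lambda>k. jap k powr s * cmod (f k)) summable_on UNIV"
 by (rule smooth_summable[OF fs_smooth])

lemma hb_fs: "fs f ==> \<exists>C. hb s f C" by (rule hb_smooth[OF fs_smooth])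

lemma bb_fs': "fs f ==> \<exists>D. bb s f D" by (rule bb_smooth[OF fs_smooth])

lemma hb_truncate: assumes u: "hb s u C" and t: "t < s" and e: "0 < e"
 shows "\<exists>u'. fs u' \<and> hb t (u - u') e"
proof -
 define r where "r = s - t"
 have r: "0 < r" using t by (simp add: r_def)
 have C0: "0 \<le> C" by (rule hb_nonneg[OF u])
 define R where "R = ((C + 1) / e) powr (1 / r)"
 have R: "R powr r = (C + 1) / e" using r C0 e by (simp add: R_def powr_powr)
 have R0: "0 < R" using C0 e by (simp add: R_def)
 define u' where "u' k = (if nf k \<le> R then u k else 0)" for k
 have "fs u'" by (rule fs_freq[of _ R]) (auto simp: u'_def split: if_splits)
 moreover have "hb t (u - u') ((1 / R powr r) * C)"
 proof (rule hb_le[OF u])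
  fix k
  show "jap k powr t * cmod ((u - u') k) \<le> 1 / R powr r * (jap k powr s * cmod (u k))"
  proof (cases "nf k \<le> R")
   case False
   then have "R \<le> jap k" using norm_freq_le_jap'[of k] by linarith
   then have "R powr r \<le> jap k powr r" using R0 r by (intro powr_mono2) auto
   then have "1 \<le> 1 / R powr r * jap k powr r" using R0 by (simp add: field_simps)
   then have "1 * (jap k powr t * cmod (u k)) \<le> (1 / R powr r * jap k powr r) * (jap k powr t * cmod (u k))"
    by (intro mult_right_mono) auto
   also have "\<dots> = 1 / R powr r * ((jap k powr r * jap k powr t) * cmod (u k))" by simp
   also have "jap k powr r * jap k powr t = jap k powr s" by (simp add: r_def flip: powr_add)
   finally show ?thesis using False by (simp add: u'_def)
  qed (simp add: u'_def)
 qed simp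
 moreover have "(1 / R powr r) * C \<le> e" unfolding R using C0 e by (simp add: field_simps)
 ultimately show ?thesis using hb_mono by blast
qed

text \<open>A density argument run at the smaller exponent \<open>a\<close>, where frequency
  truncations of \<open>u\<close> converge to \<open>u\<close>.\<close>

lemma hb_dense_zero:
 fixes L :: "tdist => complex" assumes u: "hb s u C" "a < s"
  and add: "\<And>v w c d. hb a v c ==> hb a w d ==> L (v + w) = L v + L w"
  and bd: "\<And>v c. hb a v c ==> cmod (L v) \<le> M * c" and z: "\<And>v. fs v ==> L v = 0"
 shows "L u = 0"
proof (rule ccontr)
 assume L: "L u \<noteq> 0"
 have M: "0 < \<bar>M\<bar> + 1" by (rule add_nonneg_pos) auto
 define e where "e = cmod (L u) / 2 / (\<bar>M\<bar> + 1)"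
 have e: "0 < e" using L M by (simp add: e_def)
 from hb_truncate[OF u e] obtain v where v: "fs v" "hb a (u - v) e" by blast
 from hb_fs[OF v(1)] obtain c where "hb a v c" by blast
 from add[OF v(2) this] have "cmod (L u) \<le> M * e" using bd[OF v(2)] by (simp add: z v)
 also have "\<dots> \<le> (\<bar>M\<bar> + 1) * e" using e by (intro mult_right_mono) auto
 also have "\<dots> = cmod (L u) / 2" unfolding e_def using M by (metis less_irrefl nonzero_mult_div_cancel_left times_divide_eq_right)
 finally show False using L by simp
qed

text \<open>The chosen commutator is explicit only for smooth triples, whereas for the approximate
  operators \<open>u\<close> is merely Sobolev. Both sides are continuous in \<open>u\<close> at a
  slightly smaller exponent and agree on trigonometric polynomials.\<close>

lemma commutator_fs: assumes u: "hb s u C" and s: "0 < s" and X: "fs X" and g: "fs g"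
 shows "commutator chi rho u X g = reso (par u X) g - tprod u (reso X g)"
proof
 fix k
 \<comment> \<open>Below \<open>s\<close>, so that truncation converges, and below 1; together with
   \<open>b = - a / 4\<close> for both other slots the exponents are admissible, as the total is
   \<open>a / 2\<close>.\<close>
 define a where "a = min (s / 2) (1 / 2)"
 have a: "0 < a" "a < 1" "a < s" using s by (auto simp: a_def)
 define b where "b = - a / 4"
 have b: "b < 0" "b + b < 0" "0 < a + b + b" using a by (auto simp: b_def)
 let ?C = "commutator chi rho" and ?r = "reso X g"
 let ?R = "\<lambda>u. reso (par u X) g - tprod u ?r"
 from bb_fs'[OF X] obtain D where D: "bb b X D" by blast
 from bb_fs'[OF X] obtain D1 where D1: "bb 1 X D1" by blast
 from bb_fs'[OF g] obtain D' where D': "bb b g D'" by blast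
 from bb_fs'[OF g] obtain D1' where D1': "bb 1 g D1'" by blast
 from hb_fs[OF X] obtain D2 where D2: "hb 1 X D2" by blast
 have bp: "bil par a 1 0" by (rule bil_para) (use a in auto)
 have br: "bil reso 0 1 0" by (rule bil_resonant) auto
 have "bil reso 1 1 0" by (rule bil_resonant) auto
 from bil_bound[OF this] D2 D1' obtain K where K: "hb 0 ?r K" by blast
 from hb_commutator3[OF a(1,2) b(2,3)] D D' obtain B1 where
  B1: "\<And>u c. hb a u c ==> hb (a + b + b) (?C u X g) (B1 * c * D * D')" by blast
 from bil_bound[OF bp] D1 obtain B2 where B2: "\<And>u c. hb a u c ==> hb 0 (par u X) (B2 * c * D1)" by blast
 from bil_bound[OF br] D1' obtain B3 where B3: "\<And>u c. hb 0 u c ==> hb 0 (reso u g) (B3 * c * D1')" by blast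
 have w0: "hb 0 v c" if "hb a v c" for v c by (rule hb_weaken[OF that]) (use a in simp)
 have sm: "(\<lambda>l. v l * ?r (k - l)) summable_on UNIV" if v: "hb a v c" for v c
  by (rule abs_summable_summable, rule summable_product_hb[OF w0[OF v] _ order_refl]) (use K in simp)
 have "?C u X g k - ?R u k = 0"
 proof (rule hb_dense_zero[OF u a(3), where L = "\<lambda>v. ?C v X g k - ?R v k"])
  fix v w c d assume v: "hb a v c" and w: "hb a w d"
  have "tprod (v + w) ?r k = tprod v ?r k + tprod w ?r k"
   unfolding tprod_def using infsum_add[OF sm[OF v] sm[OF w]] by (simp add: distrib_right)
  then show "?C (v + w) X g k - ?R (v + w) k = (?C v X g k - ?R v k) + (?C w X g k - ?R w k)"
   using commutator_linear1[OF a(1,2) b(2,3) v w D D', of 1] bil_left[OF bp v w D1, of 1]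
    bil_left[OF br B2[OF v] B2[OF w] D1', of 1] by simp
 next
  fix v c assume v: "hb a v c"
  have "cmod (?C v X g k) \<le> B1 * c * D * D'" using hb0_coeff[OF hb_weaken[OF B1[OF v]]] b by simp
  moreover have "cmod (reso (par v X) g k) \<le> B3 * (B2 * c * D1) * D1'"
   by (rule hb0_coeff[OF B3[OF B2[OF v]]])
  moreover have "cmod (tprod v ?r k) \<le> c * K" by (rule tprod_coeff_le[OF w0[OF v] K])
  moreover have "cmod (x - (y - z)) \<le> cmod x + cmod y + cmod z" for x y z :: complex
   using norm_triangle_ineq4[of x "y - z"] norm_triangle_ineq4[of y z] by linarith
  ultimately have "cmod (?C v X g k - ?R v k) \<le> B1 * c * D * D' + B3 * (B2 * c * D1) * D1' + c * K"
   unfolding fun_diff_def by (smt (verit))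
  then show "cmod (?C v X g k - ?R v k) \<le> (B1 * D * D' + B3 * B2 * D1 * D1' + K) * c" by (simp add: algebra_simps)
 next
  fix v assume "fs v"
  then have "?C v X g = ?R v" using commutator_is fs_smooth X g unfolding is_commutator_def by blast
  then show "?C v X g k - ?R v k = 0" by simp
 qed
 then show "?C u X g k = ?R u k" by simp
qed

end

lemma hb_limit: assumes "\<And>n. hb s f (C n)" "C \<longlonglongrightarrow> c" shows "hb s f c"
 unfolding hb_def using hbD[OF assms(1)] by (blast intro: LIMSEQ_le_const[OF assms(2)])

lemma hb_zeroD: "hb s f 0 ==> f = 0"
 using hb_coeff[of s f 0] by (auto simp: fun_eq_iff mult_le_0_iff)

section \<open>The fixed-point problem\<close>

text \<open>The free resolvent of \<Delta> at \<open>mu\<close>, since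
  \<open>mu - 1 + (jap k)^2\<close> is the symbol of mu - \<Delta>.\<close>

definition gr :: "real => tdist => tdist" where
 "gr mu f = (\<lambda>k. f k / cor (mu - 1 + (jap k)^2))"

lemma gr_denom:
 assumes "1 \<le> mu" shows "mu \<le> mu - 1 + (jap k)^2" "(jap k)^2 \<le> mu - 1 + (jap k)^2" "0 < mu - 1 + (jap k)^2"
proof -
 have "1 \<le> (jap k)^2" using jap_ge_1[of k] by (simp add: one_le_power)
 then show "mu \<le> mu - 1 + (jap k)^2" "(jap k)^2 \<le> mu - 1 + (jap k)^2" "0 < mu - 1 + (jap k)^2" using assms by auto
qed

lemma gr_add: "gr mu (f + g) = gr mu f + gr mu g"
 by (simp add: gr_def fun_eq_iff add_divide_distrib)

lemma gr_diff: "gr mu (f - g) = gr mu f - gr mu g"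
 by (simp add: gr_def fun_eq_iff diff_divide_distrib)

lemma hb_gr: assumes l: "1 \<le> mu" and f: "hb s f C" and st: "s \<le> t" "t \<le> s + 2"
 shows "hb t (gr mu f) (mu powr ((t - s) / 2 - 1) * C)"
proof (rule hb_le[OF f])
 fix k
 define m where "m = mu - 1 + (jap k)^2"
 have m: "mu \<le> m" "(jap k)^2 \<le> m" "0 < m" unfolding m_def by (rule gr_denom[OF l])+
 let ?\<theta> = "(t - s) / 2"
 have e: "2 * ?\<theta> = t - s" by simp
 have "jap k powr (t - s) = (jap k powr 2) powr ?\<theta>" using powr_powr[of "jap k" 2 ?\<theta>] unfolding e by (rule sym)
 also have "jap k powr 2 = (jap k)^2" by simp
 also have "((jap k)^2) powr ?\<theta> \<le> m powr ?\<theta>" using m st by (intro powr_mono2) auto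
 also have "\<dots> = m powr (?\<theta> - 1) * m" using m by (simp add: powr_diff)
 also have "\<dots> \<le> mu powr (?\<theta> - 1) * m"
  using m l st by (intro mult_right_mono powr_mono2') auto
 finally have 1: "jap k powr (t - s) / m \<le> mu powr (?\<theta> - 1)" using m by (simp add: divide_le_eq)
 have "jap k powr t * cmod (gr mu f k) = (jap k powr (t - s) * jap k powr s) * cmod (f k) / m"
  unfolding powr_add[symmetric] using m by (simp add: gr_def norm_divide m_def del: of_real_add of_real_diff of_real_power)
 also have "\<dots> = (jap k powr (t - s) / m) * (jap k powr s * cmod (f k))" by simp
 also have "\<dots> \<le> mu powr (?\<theta> - 1) * (jap k powr s * cmod (f k))" by (intro mult_right_mono 1) auto
 finally show "jap k powr t * cmod (gr mu f k) \<le> mu powr (?\<theta> - 1) * (jap k powr s * cmod (f k))" .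
qed simp

definition pb :: "real => real => real => tdist \<times> tdist => real => bool" where
 "pb s t w x C \<longleftrightarrow> hb s (fst x) C \<and> hb t (snd x) (w * C)"

lemma pb_mono: "pb s t w x C ==> C \<le> D ==> 0 \<le> w ==> pb s t w x D"
 by (auto simp: pb_def intro: hb_mono mult_left_mono elim!: hb_mono)

lemma pb_add: "pb s t w x C ==> pb s t w y D ==> pb s t w (x + y) (C + D)"
 using hb_add'[of s "fst x" C "fst y" D] hb_add'[of t "snd x" "w * C" "snd y" "w * D"]
 by (simp add: pb_def distrib_left)

lemma pb_diff: "pb s t w x C ==> pb s t w y D ==> pb s t w (x - y) (C + D)"
 using hb_diff'[of s "fst x" C "fst y" D] hb_diff'[of t "snd x" "w * C" "snd y" "w * D"]
 by (simp add: pb_def distrib_left)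

lemma pb_limit:
 assumes "\<And>n. pb s t w x (C n)" "C \<longlonglongrightarrow> c" shows "pb s t w x c"
 using hb_limit[of s "fst x" C c] hb_limit[of t "snd x" "\<lambda>n. w * C n" "w * c"] tendsto_mult_left[OF assms(2)] assms
 by (simp add: pb_def)

lemma pb_zeroD: "pb s t w x 0 ==> x = 0" by (auto simp: pb_def prod_eq_iff dest: hb_zeroD)

lemma pb_nonneg: "pb s t w x C ==> 0 \<le> C" by (auto simp: pb_def dest: hb_nonneg)

locale contraction =
 fixes s t w q :: real and T :: "tdist \<times> tdist => tdist \<times> tdist"
 assumes w: "0 \<le> w" and q: "0 \<le> q" "q < 1" and T: "pb s t w x C ==> pb s t w (T x) (q * C)"
  and T_add: "pb s t w x C ==> pb s t w y D ==> T (x + y) = T x + T y"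
begin

text \<open>Some finite bound \<open>C\<close> must be known beforehand, but under iteration of the
  equation it is multiplied by \<open>q ^ n\<close> and disappears in the limit.\<close>

lemma a_priori: assumes x: "pb s t w x C" and g: "pb s t w g c" and e: "x = T x + g"
 shows "pb s t w x (c / (1 - q))"
proof -
 have c: "0 \<le> c" by (rule pb_nonneg[OF g])
 have "pb s t w x (q ^ n * C + c / (1 - q))" for n
 proof (induction n)
  case 0 show ?case by (rule pb_mono[OF x _ w]) (use c q in simp)
 next
  case (Suc n)
  from pb_add[OF T[OF Suc] g] have "pb s t w x (q * (q ^ n * C + c / (1 - q)) + c)" by (simp only: e[symmetric])
  moreover have "q * (q ^ n * C + c / (1 - q)) + c = q ^ Suc n * C + c / (1 - q)" using q by (simp add: field_simps)
  ultimately show ?case by simp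
 qed
 moreover have "(\<lambda>n. q ^ n * C + c / (1 - q)) \<longlonglongrightarrow> 0 * C + c / (1 - q)"
  using q by (intro tendsto_intros LIMSEQ_realpow_zero) auto
 ultimately show ?thesis using pb_limit by fastforce
qed

text \<open>The Neumann series, summed coefficient by coefficient; no completeness of the spaces is
  invoked. \<open>T\<close> is only finitely additive, so the limit equation is deduced from the
  norm bounds on the tails.\<close>

lemma solution_exists: assumes g: "pb s t w g c"
 shows "\<exists>x C. pb s t w x C \<and> x = T x + g"
proof -
 define v where "v n = (T ^^ n) g" for n
 have v: "pb s t w (v n) (q ^ n * c)" for n
  by (induction n) (use g T in \<open>auto simp: v_def mult.assoc\<close>)
 define S where "S I = (\<lambda>k. INFSUM i:I. fst (v i) k, \<lambda>k. INFSUM i:I. snd (v i) k)" for I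
 have hs: "((\<lambda>i. q ^ (i + N) * c) has_sum q ^ N * c / (1 - q)) UNIV" for N
 proof -
  have "(\<lambda>i. q ^ i) sums (1 / (1 - q))" using q by (intro geometric_sums) simp
  then have "((\<lambda>i. q ^ i) has_sum 1 / (1 - q)) UNIV" using q by (intro sums_nonneg_imp_has_sum) auto
  from has_sum_cmult_right[OF this, of "q ^ N * c"] show ?thesis by (simp add: power_add mult_ac)
 qed
 have bij: "bij_betw (\<lambda>i. i + N) UNIV {N..}" for N :: nat
  by (rule bij_betwI[where g = "\<lambda>i. i - N"]) auto
 have hsN: "((\<lambda>i. q ^ i * c) has_sum q ^ N * c / (1 - q)) {N..}" for N
  using has_sum_reindex_bij_betw[OF bij[of N], of "\<lambda>i. q ^ i * c"] hs[of N] by simp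
 have hsum: "(\<lambda>i. q ^ i * c) summable_on {N..}" "(\<Sum>\<^sub>\<infinity>i\<in>{N..}. q ^ i * c) = q ^ N * c / (1 - q)" for N
  using hsN[of N] by (auto intro: has_sum_imp_summable infsumI)
 have f: "hb s (fst (v i)) (q ^ i * c)" "hb t (snd (v i)) (w * (q ^ i * c))" for i using v[of i] by (auto simp: pb_def)
 have tail: "pb s t w (S {N..}) (q ^ N * c / (1 - q))" for N
  using hb_infsum(2)[OF f(1) hsum(1)[of N]] hb_infsum(2)[OF f(2) summable_on_cmult_right[OF hsum(1)[of N]]]
  by (simp add: pb_def S_def hsum(2) infsum_cmult_right')
 have split: "S {N..} = v N + S {Suc N..}" for N
 proof -
  have a: "(\<lambda>i. fst (v i) k) summable_on {Suc N..}" "(\<lambda>i. snd (v i) k) summable_on {Suc N..}" for k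
   by (rule abs_summable_summable[OF hb_infsum(1)[OF f(1) hsum(1)]],
     rule abs_summable_summable[OF hb_infsum(1)[OF f(2) summable_on_cmult_right[OF hsum(1)]]])
  have "{N..} = insert N {Suc N..}" by auto
  then show ?thesis using a by (simp add: S_def prod_eq_iff fun_eq_iff infsum_insert)
 qed
 \<comment> \<open>The defect of the equation on the N-th tail. It does not depend on
   \<open>N\<close>, and it is bounded by tails that tend to 0.\<close>
 define r where "r N = S {Suc N..} - T (S {N..})" for N
 have "r (Suc N) = r N" for N
 proof -
  have "T (S {N..}) = v (Suc N) + T (S {Suc N..})"
   unfolding split[of N] T_add[OF v tail] by (simp add: v_def)
  then show ?thesis unfolding r_def split[of "Suc N"] by simp
 qed
 then have r: "r N = r 0" for N by (induction N) auto
 let ?b = "\<lambda>N. q ^ Suc N * c / (1 - q) + q * (q ^ N * c / (1 - q))"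
 have "pb s t w (r 0) (?b N)" for N
  unfolding r[of N, symmetric] unfolding r_def by (intro pb_diff tail T)
 moreover have "?b \<longlonglongrightarrow> 0 * c / (1 - q) + q * (0 * c / (1 - q))"
  using q by (intro tendsto_intros LIMSEQ_Suc LIMSEQ_realpow_zero) auto
 ultimately have "pb s t w (r 0) 0" using pb_limit by fastforce
 then have "S {0..} = T (S {0..}) + g" using split[of 0] by (auto simp: r_def v_def dest: pb_zeroD)
 then show ?thesis using tail[of 0] by metis
qed

end

text \<open>The pair \<open>(u, u - u \<prec> X)\<close> is measured in \<open>\<H>\<^sup>3\<^sup>/\<^sup>4 \<times> \<H>\<^sup>1\<^sup>7\<^sup>/\<^sup>1\<^sup>6\<close>; the weight
 \<open>mu\<^sup>1\<^sup>/\<^sup>8\<close> of the second component makes the fixed-point map a contraction for large \<open>mu\<close>, although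
 neither \<open>u \<mapsto> u \<prec> X\<close> nor \<open>v \<mapsto> v \<circ> xi\<close> is small.\<close>

abbreviation pbl :: "real => tdist \<times> tdist => real => bool" where
 "pbl mu \<equiv> pb (3/4) (17/16) (mu powr (1/8))"

text \<open>The first component is the equation for u, the second the one for v = u - u \<prec> X,
  in which \<open>a3\<close> stands for u \<prec> X. The factor \<open>1 - cor mu\<close> appears
  because X is defined with 1 - \<Delta> while the resolvent inverts mu - \<Delta>.\<close>

definition comb :: "real => tdist => tdist => tdist => tdist => tdist \<times> tdist" where
 "comb mu a1 a2 a3 a4 = (gr mu (a1 + a4), gr mu (a2 + scale (1 - cor mu) a3 + a4))"

text \<open>The binding term is \<open>a3\<close>: raising it from 15/16 to 17/16 leaves
  \<open>mu powr (-15/16)\<close> from the resolvent against its coefficient \<open>mu\<close>,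
  hence \<open>mu powr (1/16)\<close>, which only the weight \<open>mu powr (1/8)\<close> turns into
  a negative power. The price of the weight is paid by \<open>a4\<close>, where the resolvent has
  room to spare.\<close>

lemma pbl_comb:
 assumes l: "1 \<le> mu" and a1: "hb (-17/16) a1 C" and a2: "hb (-5/16) a2 C" and a3: "hb (15/16) a3 C"
  and a4: "hb 0 a4 (mu powr (1/8) * C)"
 shows "pbl mu (comb mu a1 a2 a3 a4) (3 * mu powr (-1/16) * C)"
proof -
 have C: "0 \<le> C" by (rule hb_nonneg[OF a1])
 have mono: "hb r f D ==> D \<le> mu powr p * C ==> p \<le> p' ==> hb r f (mu powr p' * C)" for r f D p p'
  by (erule hb_mono) (meson C l mult_right_mono order_trans powr_mono)
 have b1: "hb (3/4) (gr mu a1) (mu powr (-1/16) * C)" by (rule mono[OF hb_gr[OF l a1]]) auto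
 have b2: "hb (3/4) (gr mu a4) (mu powr (-1/16) * C)"
  by (rule mono[OF hb_gr[OF l a4], where p = "-1/2"]) (auto simp flip: mult.assoc powr_add)
 have b3: "hb (17/16) (gr mu a2) (mu powr (1/16) * C)" by (rule mono[OF hb_gr[OF l a2]]) auto
 have "cmod (1 - cor mu) \<le> mu"
  using l by (metis abs_of_nonpos diff_le_0_iff_le diff_le_eq le_add_same_cancel1 minus_diff_eq norm_of_real of_real_1 of_real_diff zero_le_one)
 then have a3': "hb (15/16) (scale (1 - cor mu) a3) (mu * C)"
  by (intro hb_mono[OF hb_scale[OF a3]] mult_right_mono C)
 have b4: "hb (17/16) (gr mu (scale (1 - cor mu) a3)) (mu powr (1/16) * C)"
 proof -
  have "mu powr (1/16) = mu powr (-15/16) * mu powr 1" unfolding powr_add[symmetric] by simp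
  then have "mu powr (1/16) = mu powr (-15/16) * mu" using l by simp
  then show ?thesis using hb_gr[OF l a3', of "17/16"] by (simp add: mult.assoc)
 qed
 have b5: "hb (17/16) (gr mu a4) (mu powr (1/16) * C)"
  by (rule mono[OF hb_gr[OF l a4], where p = "-11/32"]) (auto simp flip: mult.assoc powr_add)
 have w: "mu powr (1/16) = mu powr (1/8) * mu powr (-1/16)" unfolding powr_add[symmetric] by simp
 have "hb (3/4) (gr mu a1 + gr mu a4) (3 * mu powr (-1/16) * C)"
  by (rule hb_mono[OF hb_add'[OF b1 b2]]) (use C in simp)
 moreover have "hb (17/16) (gr mu a2 + gr mu (scale (1 - cor mu) a3) + gr mu a4) (mu powr (1/8) * (3 * mu powr (-1/16) * C))"
  by (rule hb_mono[OF hb_add'[OF hb_add'[OF b3 b4] b5]]) (simp add: w)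
 ultimately show ?thesis by (simp add: pb_def comb_def gr_add)
qed

lemma scale_zero_right [simp]: "scale z 0 = 0" and scale_zero [simp]: "scale 0 f = 0"
 by (simp_all add: scale_def fun_eq_iff)

lemma comb_diff: "comb mu a1 a2 a3 a4 - comb mu b1 b2 b3 b4 = comb mu (a1 - b1) (a2 - b2) (a3 - b3) (a4 - b4)"
proof -
 have "scale z (a3 - b3) = scale z a3 - scale z b3" for z by (simp add: scale_def fun_eq_iff right_diff_distrib)
 then show ?thesis by (simp add: comb_def gr_add gr_diff)
qed

lemma comb_add: "comb mu a1 a2 a3 a4 + comb mu b1 b2 b3 b4 = comb mu (a1 + b1) (a2 + b2) (a3 + b3) (a4 + b4)"
 by (simp add: comb_def gr_add scale_add)

lemma hb0_truncate: assumes f: "hb 0 f F" and e: "0 < e"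
 shows "\<exists>f'. fs f' \<and> hb 0 (f - f') e"
proof -
 let ?g = "\<lambda>k. (cmod (f k))^2"
 have s: "?g summable_on UNIV" using hb_summable[OF f] by simp
 define S where "S = (INFSUM k. ?g k)"
 have "(sum ?g \<longlongrightarrow> S) (finite_subsets_at_top UNIV)"
  using has_sum_infsum[OF s] unfolding S_def has_sum_def .
 moreover have "S - e\<^sup>2 < S" using e by simp
 ultimately have "\<forall>\<^sub>F A in finite_subsets_at_top UNIV. S - e\<^sup>2 < sum ?g A" by (rule order_tendstoD)
 then obtain A where A: "finite A" "S - e\<^sup>2 < sum ?g A" unfolding eventually_finite_subsets_at_top by blast
 define f' where "f' k = (if k \<in> A then f k else 0)" for k
 have "fs f'" by (rule finite_subset[OF _ A(1)]) (auto simp: f'_def)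
 moreover have "hb 0 (f - f') e" unfolding hb_L2_set_sq
 proof (intro conjI allI impI)
  fix B :: "(int \<times> int) set" assume B: "finite B"
  have "(\<Sum>k\<in>B. (jap k powr 0 * cmod ((f - f') k))^2) = (\<Sum>k\<in>B. if k \<in> A then 0 else ?g k)"
   by (intro sum.cong) (auto simp: f'_def)
  also have "\<dots> = sum ?g (B - A)" using B by (simp add: sum.If_cases Diff_eq)
  also have "\<dots> + sum ?g A \<le> S"
  proof -
   have "sum ?g ((B - A) \<union> A) = sum ?g (B - A) + sum ?g A" using B A(1) by (intro sum.union_disjoint) auto
   moreover have "sum ?g ((B - A) \<union> A) \<le> S" unfolding S_def using B A(1) by (intro finite_sum_le_infsum[OF s]) auto
   ultimately show ?thesis by linarith
  qed
  then have "sum ?g (B - A) \<le> e^2" using A(2) by linarith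
  finally show "(\<Sum>k\<in>B. (jap k powr 0 * cmod ((f - f') k))^2) \<le> e^2" .
 qed (use e in simp)
 ultimately show ?thesis by blast
qed

lemma powr_16_le: assumes "0 < (x :: real)" "x ^ 16 \<le> mu" shows "mu powr (-1/16) * x \<le> 1"
proof -
 have m: "0 < mu" using assms zero_less_power[of x 16] by linarith
 have "x = (x powr 16) powr (1/16)" using assms(1) unfolding powr_powr by simp
 also have "\<dots> \<le> mu powr (1/16)" using assms by (intro powr_mono2) auto
 finally show ?thesis using m by (simp add: powr_minus field_simps)
qed

text \<open>For the Anderson operator \<open>Q3 u = u \<prec> X\<close> and \<open>Q4 v = v \<circ> xi\<close>, while \<open>Q1\<close> and \<open>Q2\<close> collect the
 remaining terms of the equations for \<open>u\<close> and \<open>u - Q3 u\<close>.\<close>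

locale ansatz =
 fixes Q1 Q2 Q3 Q4 :: "tdist => tdist" and M :: real assumes M: "1 \<le> M"
  and b1: "hb (3/4) u C ==> hb (-17/16) (Q1 u) (M * C)"
  and b2: "hb (3/4) u C ==> hb (-5/16) (Q2 u) (M * C)"
  and b3: "hb (3/4) u C ==> hb (15/16) (Q3 u) (M * C)"
  and b4: "hb (17/16) v C ==> hb 0 (Q4 v) (M * C)"
  and l1: "hb (3/4) u C ==> hb (3/4) u' C' ==> Q1 (scale z u + u') = scale z (Q1 u) + Q1 u'"
  and l2: "hb (3/4) u C ==> hb (3/4) u' C' ==> Q2 (scale z u + u') = scale z (Q2 u) + Q2 u'"
  and l3: "hb (3/4) u C ==> hb (3/4) u' C' ==> Q3 (scale z u + u') = scale z (Q3 u) + Q3 u'"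
  and l4: "hb (17/16) v C ==> hb (17/16) v' C' ==> Q4 (scale z v + v') = scale z (Q4 v) + Q4 v'"
  and Q3_eq: "hb (3/4) u C ==> cor ((jap k)^2) * Q3 u k = Q1 u k - Q2 u k"
begin

definition Opr :: "tdist => tdist" where
 "Opr u = laplacian u + Q1 u + Q4 (u - Q3 u)"

definition Dom :: "tdist set" where
 "Dom = {u. (\<exists>C. hb (3/4) u C) \<and> (\<exists>C. hb (17/16) (u - Q3 u) C) \<and> (\<exists>C. hb 0 (Opr u) C)}"

definition Tm :: "real => tdist \<times> tdist => tdist \<times> tdist" where
 "Tm mu x = comb mu (Q1 (fst x)) (Q2 (fst x)) (Q3 (fst x)) (Q4 (snd x))"

lemma DomE:
 assumes "u \<in> Dom" obtains C C' C'' where "hb (3/4) u C" "hb (17/16) (u - Q3 u) C'" "hb 0 (Opr u) C''"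
 using assms unfolding Dom_def by blast

lemma DomI: "hb (3/4) u C ==> hb (17/16) (u - Q3 u) C' ==> hb 0 (Opr u) C'' ==> u \<in> Dom"
 unfolding Dom_def by blast

lemma Dom_L2: "u \<in> Dom ==> u \<in> L2" "u \<in> Dom ==> Opr u \<in> L2"
proof -
 show "u \<in> L2" if "u \<in> Dom"
 proof -
  from that obtain C where "hb (3/4) u C" by (rule DomE)
  then have "hb 0 u C" by (rule hb_weaken) simp
  then show ?thesis unfolding L2_iff by blast
 qed
 show "Opr u \<in> L2" if "u \<in> Dom" using that unfolding L2_iff by (auto elim: DomE)
qed

lemma Dom_linear: assumes "u \<in> Dom" "u' \<in> Dom"
 shows "scale z u + u' \<in> Dom" "Opr (scale z u + u') = scale z (Opr u) + Opr u'"
proof -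
 from assms(1) obtain A1 A2 A3 where u: "hb (3/4) u A1" "hb (17/16) (u - Q3 u) A2" "hb 0 (Opr u) A3" by (rule DomE)
 from assms(2) obtain B1 B2 B3 where u': "hb (3/4) u' B1" "hb (17/16) (u' - Q3 u') B2" "hb 0 (Opr u') B3" by (rule DomE)
 have e: "scale z u + u' - Q3 (scale z u + u') = scale z (u - Q3 u) + (u' - Q3 u')"
  unfolding l3[OF u(1) u'(1)] by (simp add: scale_def fun_eq_iff algebra_simps)
 show o: "Opr (scale z u + u') = scale z (Opr u) + Opr u'"
  unfolding Opr_def e l1[OF u(1) u'(1)] l4[OF u(2) u'(2)] laplacian_linear by (simp add: scale_add add_ac)
 show "scale z u + u' \<in> Dom"
  by (rule DomI[OF hb_add'[OF hb_scale[OF u(1)] u'(1)]]; (unfold e o)?) (rule hb_add'[OF hb_scale] u u')+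
qed

lemma Dom_scale: "u \<in> Dom ==> scale z u \<in> Dom"
 and Opr_scale: "u \<in> Dom ==> Opr (scale z u) = scale z (Opr u)"
proof -
 assume u: "u \<in> Dom"
 have z: "scale (-1) u + u = 0" by (simp add: scale_def fun_eq_iff)
 have 0: "0 \<in> Dom" using Dom_linear(1)[OF u u, of "-1"] by (simp add: z)
 have "Opr 0 = scale (-1) (Opr u) + Opr u" using Dom_linear(2)[OF u u, of "-1"] by (simp only: z)
 also have "\<dots> = 0" by (simp add: scale_def fun_eq_iff)
 finally have "Opr 0 = 0" .
 then show "scale z u \<in> Dom" "Opr (scale z u) = scale z (Opr u)" using Dom_linear[OF u 0, of z] by simp_all
qed

lemma Tm_bound:
 assumes "1 \<le> mu" "pbl mu x C" shows "pbl mu (Tm mu x) (3 * mu powr (-1/16) * (M * C))"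
proof -
 have u: "hb (3/4) (fst x) C" and v: "hb (17/16) (snd x) (mu powr (1/8) * C)" using assms(2) by (auto simp: pb_def)
 have "hb 0 (Q4 (snd x)) (mu powr (1/8) * (M * C))" using b4[OF v] by (simp only: mult.left_commute)
 from pbl_comb[OF assms(1) b1[OF u] b2[OF u] b3[OF u] this] show ?thesis unfolding Tm_def .
qed

lemma Tm_add: "pbl mu x C ==> pbl mu y D ==> Tm mu (x + y) = Tm mu x + Tm mu y"
 using l1[of "fst x" C "fst y" D 1] l2[of "fst x" C "fst y" D 1] l3[of "fst x" C "fst y" D 1]
  l4[of "snd x" "mu powr (1/8) * C" "snd y" "mu powr (1/8) * D" 1]
 by (simp add: Tm_def pb_def comb_add)

text \<open>The constant of the fixed-point map is \<open>3 * mu powr (-1/16) * M\<close>, which is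
  at most \<open>1/2\<close> from \<open>(6 * M) ^ 16\<close> on. This number becomes the threshold
  for K.\<close>

lemma contraction_Tm:
 assumes "(6 * M) ^ 16 \<le> mu" shows "1 \<le> mu" "contraction (3/4) (17/16) (mu powr (1/8)) (1/2) (Tm mu)"
proof -
 have "1 \<le> (6 * M) ^ 16" using M by (intro one_le_power) simp
 then show l: "1 \<le> mu" using assms by linarith
 have m: "3 * mu powr (-1/16) * M \<le> 1/2" using powr_16_le[OF _ assms] M by simp
 show "contraction (3/4) (17/16) (mu powr (1/8)) (1/2) (Tm mu)"
 proof
  fix x C assume x: "pbl mu x C"
  have "3 * mu powr (-1/16) * (M * C) = (3 * mu powr (-1/16) * M) * C" by simp
  also have "\<dots> \<le> 1/2 * C" by (intro mult_right_mono m pb_nonneg[OF x])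
  finally show "pbl mu (Tm mu x) (1/2 * C)" by (intro pb_mono[OF Tm_bound[OF l x]]) auto
 qed (auto intro: Tm_add)
qed

text \<open>For v = u - Q3 u the two components are the same equation, because \<open>Q3_eq\<close>
  turns Q1 u into Q2 u plus 1 - \<Delta> applied to Q3 u. The pair is a regularity device and adds
  no condition.\<close>

lemma solution_pair: assumes l: "1 \<le> mu" and u: "hb (3/4) u C"
 shows "scale (cor mu) u - Opr u = f \<longleftrightarrow> (u, u - Q3 u) = Tm mu (u, u - Q3 u) + (gr mu f, gr mu f)"
proof -
 define d where "d k = cor (mu - 1 + (jap k)^2)" for k
 have d: "d k \<noteq> 0" for k unfolding d_def of_real_eq_0_iff using gr_denom(3)[OF l, of k] by linarith
 have dd: "d k * x = cor mu * x - x + cor ((jap k)^2) * x" for k x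
  by (simp add: d_def algebra_simps)
 define v where "v = u - Q3 u"
 have lap: "laplacian u k = u k - cor ((jap k)^2) * u k" for k
  by (simp add: laplacian_def jap_sq algebra_simps)
 have e1: "u k = (Q1 u k + Q4 v k) / d k + f k / d k \<longleftrightarrow> (scale (cor mu) u - Opr u) k = f k" for k
 proof -
  have "u k = (Q1 u k + Q4 v k) / d k + f k / d k \<longleftrightarrow> d k * u k = Q1 u k + Q4 v k + f k"
   using d[of k] by (simp add: field_simps)
  also have "\<dots> \<longleftrightarrow> (scale (cor mu) u - Opr u) k = f k"
   by (auto simp: dd Opr_def scale_def lap v_def algebra_simps)
  finally show ?thesis .
 qed
 have e2: "v k = (Q2 u k + (1 - cor mu) * Q3 u k + Q4 v k) / d k + f k / d k \<longleftrightarrow>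
   u k = (Q1 u k + Q4 v k) / d k + f k / d k" for k
 proof -
  have "v k = (Q2 u k + (1 - cor mu) * Q3 u k + Q4 v k) / d k + f k / d k \<longleftrightarrow>
    d k * u k = d k * Q3 u k + Q2 u k + (1 - cor mu) * Q3 u k + Q4 v k + f k"
   using d[of k] by (simp add: v_def field_simps)
  also have "\<dots> \<longleftrightarrow> d k * u k = Q1 u k + Q4 v k + f k"
   unfolding dd[of k "Q3 u k"] Q3_eq[OF u] by (simp add: algebra_simps)
  also have "\<dots> \<longleftrightarrow> u k = (Q1 u k + Q4 v k) / d k + f k / d k"
   using d[of k] by (simp add: field_simps)
  finally show ?thesis .
 qed
 have "(u, v) = Tm mu (u, v) + (gr mu f, gr mu f) \<longleftrightarrow> (\<forall>k. u k = (Q1 u k + Q4 v k) / d k + f k / d k) \<and>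
   (\<forall>k. v k = (Q2 u k + (1 - cor mu) * Q3 u k + Q4 v k) / d k + f k / d k)"
  unfolding Tm_def comb_def gr_def d_def[symmetric] by (simp add: fun_eq_iff[of u] fun_eq_iff[of v] scale_apply del: split_paired_All)
 also have "\<dots> \<longleftrightarrow> scale (cor mu) u - Opr u = f"
  unfolding e2 e1 by (simp add: fun_eq_iff del: split_paired_All)
 finally show ?thesis by (simp add: v_def)
qed

text \<open>The exponent is dictated by the second component:
  \<open>17/32 - 1 = 1/8 - 19/32\<close>. The first component would allow
  \<open>-20/32\<close>.\<close>

lemma pbl_gr:
 assumes l: "1 \<le> mu" and f: "hb 0 f F" shows "pbl mu (gr mu f, gr mu f) (mu powr (-19/32) * F)"
 unfolding pb_def fst_conv snd_conv
proof
 have F: "0 \<le> F" by (rule hb_nonneg[OF f])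
 have "hb (3/4) (gr mu f) (mu powr (-5/8) * F)" using hb_gr[OF l f, of "3/4"] by simp
 then show "hb (3/4) (gr mu f) (mu powr (-19/32) * F)"
  by (rule hb_mono) (intro mult_right_mono powr_mono F l, simp)
 have "hb (17/16) (gr mu f) (mu powr (-15/32) * F)" using hb_gr[OF l f, of "17/16"] by simp
 moreover have "mu powr (-15/32) = mu powr (1/8) * mu powr (-19/32)" unfolding powr_add[symmetric] by simp
 ultimately show "hb (17/16) (gr mu f) (mu powr (1/8) * (mu powr (-19/32) * F))" by (simp only: mult.assoc)
qed

lemma Dom_pbl: assumes "u \<in> Dom" "1 \<le> mu" shows "\<exists>C. pbl mu (u, u - Q3 u) C"
proof -
 from assms(1) obtain A B where u: "hb (3/4) u A" "hb (17/16) (u - Q3 u) B" by (rule DomE)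
 have "1 \<le> mu powr (1/8)" using assms(2) by (simp add: ge_one_powr_ge_zero)
 then have "1 * max A B \<le> mu powr (1/8) * max A B"
  using hb_nonneg[OF u(1)] by (intro mult_right_mono) auto
 then have "pbl mu (u, u - Q3 u) (max A B)" unfolding pb_def fst_conv snd_conv
  by (intro conjI hb_mono[OF u(1)] hb_mono[OF u(2)]) auto
 then show ?thesis by blast
qed

lemma solution_bound:
 assumes l: "(6 * M) ^ 16 \<le> mu" and u: "u \<in> Dom" and e: "scale (cor mu) u - Opr u = f" and f: "hb 0 f F"
 shows "pbl mu (u, u - Q3 u) (2 * (mu powr (-19/32) * F))"
proof -
 note l1 = contraction_Tm(1)[OF l]
 interpret contraction "3/4" "17/16" "mu powr (1/8)" "1/2" "Tm mu" by (rule contraction_Tm(2)[OF l])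
 from Dom_pbl[OF u l1] obtain C where C: "pbl mu (u, u - Q3 u) C" by blast
 from u obtain A where A: "hb (3/4) u A" by (rule DomE)
 have "(u, u - Q3 u) = Tm mu (u, u - Q3 u) + (gr mu f, gr mu f)" using e unfolding solution_pair[OF l1 A] .
 from a_priori[OF C pbl_gr[OF l1 f] this] show ?thesis by (simp add: mult.commute)
qed

lemma solution_exists: assumes l: "(6 * M) ^ 16 \<le> mu" and f: "hb 0 f F"
 shows "\<exists>u\<in>Dom. scale (cor mu) u - Opr u = f"
proof -
 note l1 = contraction_Tm(1)[OF l]
 interpret contraction "3/4" "17/16" "mu powr (1/8)" "1/2" "Tm mu" by (rule contraction_Tm(2)[OF l])
 from solution_exists[OF pbl_gr[OF l1 f]] obtain x C where x: "pbl mu x C" "x = Tm mu x + (gr mu f, gr mu f)" by blast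
 define u v where "u = fst x" and "v = snd x"
 have xuv: "x = (u, v)" by (simp add: u_def v_def)
 have u: "hb (3/4) u C" and v: "hb (17/16) v (mu powr (1/8) * C)" using x(1) by (auto simp: pb_def xuv)
 \<comment> \<open>A fixed point is a pair whose components are not yet related. Subtracting the two
   equations cancels \<open>Q4 v\<close> and the source, and by \<open>Q3_eq\<close> the rest is
   \<open>Q3 u\<close> multiplied by the symbol \<open>d\<close>.\<close>
 have "u - v = Q3 u"
 proof
  fix k
  define d where "d = cor (mu - 1 + (jap k)^2)"
  have d: "d \<noteq> 0" unfolding d_def of_real_eq_0_iff using gr_denom(3)[OF l1, of k] by linarith
  have "u = gr mu (Q1 u + Q4 v) + gr mu f" "v = gr mu (Q2 u + scale (1 - cor mu) (Q3 u) + Q4 v) + gr mu f"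
   using x(2) unfolding xuv Tm_def comb_def by simp_all
  from this[THEN fun_cong, of k] have "u k = (Q1 u k + Q4 v k) / d + f k / d" "v k = (Q2 u k + (1 - cor mu) * Q3 u k + Q4 v k) / d + f k / d"
   unfolding gr_def plus_fun_apply scale_apply d_def[symmetric] .
  then have "u k - v k = (Q1 u k - Q2 u k - (1 - cor mu) * Q3 u k) / d"
   using d by (simp add: field_simps)
  also have "Q1 u k - Q2 u k - (1 - cor mu) * Q3 u k = d * Q3 u k"
   unfolding Q3_eq[OF u, symmetric] d_def by (simp add: algebra_simps)
  finally show "(u - v) k = Q3 u k" using d by simp
 qed
 then have v_eq: "v = u - Q3 u" by (simp add: algebra_simps)
 have e: "scale (cor mu) u - Opr u = f" using x(2) unfolding xuv v_eq solution_pair[OF l1 u] .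
 have "Opr u = scale (cor mu) u - f" using e by (simp add: algebra_simps)
 then have "hb 0 (Opr u) (cmod (cor mu) * C + F)"
  by (simp only:) (intro hb_diff' hb_scale hb_weaken[OF u] f, simp)
 with u v have "u \<in> Dom" unfolding v_eq by (intro DomI)
 with e show ?thesis by blast
qed

lemma solution_unique: assumes l: "(6 * M) ^ 16 \<le> mu" and "u \<in> Dom" "u' \<in> Dom"
  and e: "scale (cor mu) u - Opr u = scale (cor mu) u' - Opr u'" shows "u = u'"
proof -
 note D = Dom_linear[OF assms(3,2), of "-1"]
 have "scale (cor mu) (scale (-1) u' + u) - Opr (scale (-1) u' + u) = 0"
  unfolding D(2) using e by (simp add: fun_eq_iff scale_def algebra_simps)
 then have "pbl mu (scale (-1) u' + u, scale (-1) u' + u - Q3 (scale (-1) u' + u)) (2 * (mu powr (-19/32) * 0))"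
  by (rule solution_bound[OF l D(1)]) (simp add: hb_zero zero_fun_def)
 then have "scale (-1) u' + u = 0" by (auto simp: pb_def dest: hb_zeroD)
 then show ?thesis by (simp add: fun_eq_iff scale_def)
qed

text \<open>As \<open>mu\<close> grows, \<open>mu\<close> times the solution for a right-hand side
  \<open>g\<close> tends to \<open>g\<close>: for a trigonometric polynomial the free part differs
  from \<open>g\<close> by order \<open>1 / mu\<close>, and both perturbation terms are of order
  \<open>mu powr (-1/16)\<close>.\<close>

lemma Dom_dense: assumes f: "hb 0 f F" and e: "0 < e" shows "\<exists>u\<in>Dom. hb 0 (f - u) e"
proof -
 have "0 < e / 2" using e by simp
 from hb0_truncate[OF f this] obtain g where g: "fs g" "hb 0 (f - g) (e / 2)" by blast
 obtain G G2 where G: "hb 0 g G" "hb 2 g G2" using hb_of_summable[OF smooth_summable[OF fs_smooth[OF g(1)]]] by blast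
 define K where "K = G2 + 4 * M * G"
 have K: "0 \<le> K" using hb_nonneg[OF G(1)] hb_nonneg[OF G(2)] M by (simp add: K_def)
 define mu where "mu = max ((6 * M) ^ 16) ((2 * (K + 1) / e) ^ 16)"
 have l: "(6 * M) ^ 16 \<le> mu" by (simp add: mu_def)
 note l1 = contraction_Tm(1)[OF l]
 have small: "mu powr (-1/16) * K \<le> e / 2"
 proof -
  have "mu powr (-1/16) * (2 * (K + 1) / e) \<le> 1" using K e by (intro powr_16_le) (auto simp: mu_def)
  then have "mu powr (-1/16) * (K + 1) \<le> e / 2" using e by (simp add: field_simps)
  moreover have "mu powr (-1/16) * K \<le> mu powr (-1/16) * (K + 1)" by (intro mult_left_mono) auto
  ultimately show ?thesis by linarith
 qed
 from solution_exists[OF l G(1)] obtain u where u: "u \<in> Dom" "scale (cor mu) u - Opr u = g" by blast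
 define v where "v = u - Q3 u"
 from u(1) obtain A where A: "hb (3/4) u A" by (rule DomE)
 have bd: "hb (3/4) u (2 * (mu powr (-19/32) * G))" "hb (17/16) v (mu powr (1/8) * (2 * (mu powr (-19/32) * G)))"
  using solution_bound[OF l u G(1)] by (auto simp: pb_def v_def)
 have "u = gr mu (Q1 u + Q4 v) + gr mu g"
  using u(2) unfolding solution_pair[OF l1 A] v_def[symmetric] Tm_def comb_def by simp
 then have "scale mu u = scale mu (gr mu (Q1 u + Q4 v) + gr mu g)" by simp
 then have eq: "g - scale mu u = (g - scale mu (gr mu g)) - scale mu (gr mu (Q1 u)) - scale mu (gr mu (Q4 v))"
  by (simp add: gr_add scale_add algebra_simps)
 have mle: "mu powr p \<le> mu powr (-1/16)" if "p \<le> -1/16" for p using that l1 by (intro powr_mono) auto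
 have t1: "hb 0 (g - scale mu (gr mu g)) (mu powr (-1/16) * G2)"
 proof -
  have "g - scale mu (gr mu g) = (\<lambda>k. - gr mu (laplacian g) k)"
  proof
   fix k
   define d where "d = cor (mu - 1 + (jap k)^2)"
   have d: "d \<noteq> 0" unfolding d_def of_real_eq_0_iff using gr_denom(3)[OF l1, of k] by linarith
   have l: "laplacian g k = (cor mu - d) * g k" by (simp add: d_def jap_sq laplacian_def)
   show "(g - scale mu (gr mu g)) k = - gr mu (laplacian g) k"
    unfolding fun_diff_def scale_apply gr_def d_def[symmetric] l using d by (simp add: field_simps)
  qed
  moreover have "hb 0 (gr mu (laplacian g)) (mu powr (-1) * G2)"
   using hb_gr[OF l1 hb_laplacian[OF G(2)], of 0] by simp
  then have "hb 0 (gr mu (laplacian g)) (mu powr (-1/16) * G2)"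
   by (rule hb_mono) (intro mult_right_mono mle hb_nonneg[OF G(2)], simp)
  ultimately show ?thesis by (simp add: hb_minus)
 qed
 have G0: "0 \<le> M * G" using hb_nonneg[OF G(1)] M by simp
 have mu1: "cmod (cor mu) = mu powr 1" using l1 by simp
 have t2: "hb 0 (scale mu (gr mu (Q1 u))) (mu powr (-1/16) * (2 * (M * G)))"
 proof (rule hb_mono[OF hb_scale[OF hb_gr[OF l1 b1[OF bd(1)], of 0]]])
  have "cmod (cor mu) * (mu powr ((0 - -17/16) / 2 - 1) * (M * (2 * (mu powr (-19/32) * G))))
   = (mu powr 1 * mu powr (-15/32) * mu powr (-19/32)) * (2 * (M * G))" unfolding mu1 by simp
  also have "\<dots> = mu powr (-1/16) * (2 * (M * G))" unfolding powr_add[symmetric] by simp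
  finally show "cmod (cor mu) * (mu powr ((0 - -17/16) / 2 - 1) * (M * (2 * (mu powr (-19/32) * G)))) \<le> mu powr (-1/16) * (2 * (M * G))" by (rule eq_refl)
 qed auto
 have t3: "hb 0 (scale mu (gr mu (Q4 v))) (mu powr (-1/16) * (2 * (M * G)))"
 proof (rule hb_mono[OF hb_scale[OF hb_gr[OF l1 b4[OF bd(2)], of 0]]])
  have "cmod (cor mu) * (mu powr ((0 - 0) / 2 - 1) * (M * (mu powr (1/8) * (2 * (mu powr (-19/32) * G)))))
   = (mu powr 1 * mu powr (-1) * mu powr (1/8) * mu powr (-19/32)) * (2 * (M * G))" unfolding mu1 by simp
  also have "\<dots> = mu powr (-15/32) * (2 * (M * G))" unfolding powr_add[symmetric] by simp
  also have "\<dots> \<le> mu powr (-1/16) * (2 * (M * G))" using G0 by (intro mult_right_mono mle) auto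
  finally show "cmod (cor mu) * (mu powr ((0 - 0) / 2 - 1) * (M * (mu powr (1/8) * (2 * (mu powr (-19/32) * G))))) \<le> mu powr (-1/16) * (2 * (M * G))" .
 qed auto
 have "hb 0 (g - scale mu u) (mu powr (-1/16) * K)"
  unfolding eq by (rule hb_mono[OF hb_diff'[OF hb_diff'[OF t1 t2] t3]]) (simp add: K_def algebra_simps)
 then have "hb 0 (g - scale mu u) (e / 2)" using small by (rule hb_mono)
 from hb_add'[OF g(2) this] have "hb 0 (f - scale mu u) e" by simp
 then show ?thesis using Dom_scale[OF u(1)] by blast
qed

end

text \<open>The difference of the two fixed points solves the primed equation with the difference of
  the two maps, evaluated at the unprimed solution, as source; \<open>a_priori\<close> then applies.
  The constant is \<open>12 = 3 * 2 * 2\<close>: from \<open>pbl_comb\<close>, from the bound on the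
  solution, and from \<open>1 / (1 - 1/2)\<close>.\<close>

lemma ansatz_compare: assumes A: "ansatz Q1 Q2 Q3 Q4 M" and A': "ansatz Q1' Q2' Q3' Q4' M"
  and l: "(6 * M) ^ 16 \<le> mu" and f: "hb 0 f F"
  and u: "u \<in> ansatz.Dom Q1 Q3 Q4" "scale (cor mu) u - ansatz.Opr Q1 Q3 Q4 u = f"
  and u': "u' \<in> ansatz.Dom Q1' Q3' Q4'" "scale (cor mu) u' - ansatz.Opr Q1' Q3' Q4' u' = f"
  and eta: "0 \<le> eta" and d1: "\<And>u C. hb (3/4) u C ==> hb (-17/16) (Q1' u - Q1 u) (eta * C)"
  and d2: "\<And>u C. hb (3/4) u C ==> hb (-5/16) (Q2' u - Q2 u) (eta * C)"
  and d3: "\<And>u C. hb (3/4) u C ==> hb (15/16) (Q3' u - Q3 u) (eta * C)"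
  and d4: "\<And>v C. hb (17/16) v C ==> hb 0 (Q4' v - Q4 v) (eta * C)"
 shows "pbl mu (u' - u, (u' - Q3' u') - (u - Q3 u)) (12 * eta * F)"
proof -
 interpret A: ansatz Q1 Q2 Q3 Q4 M by (rule A)
 interpret A': ansatz Q1' Q2' Q3' Q4' M by (rule A')
 note l1 = A.contraction_Tm(1)[OF l]
 interpret contraction "3/4" "17/16" "mu powr (1/8)" "1/2" "A'.Tm mu" by (rule A'.contraction_Tm(2)[OF l])
 define x x' where "x = (u, u - Q3 u)" and "x' = (u', u' - Q3' u')"
 let ?c = "2 * (mu powr (-19/32) * F)"
 have x: "pbl mu x ?c" unfolding x_def by (rule A.solution_bound[OF l u f])
 have x': "pbl mu x' ?c" unfolding x'_def by (rule A'.solution_bound[OF l u' f])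
 from u(1) obtain B where B: "hb (3/4) u B" by (rule A.DomE)
 from u'(1) obtain B' where B': "hb (3/4) u' B'" by (rule A'.DomE)
 let ?g = "A'.Tm mu x - A.Tm mu x"
 have e: "x = A.Tm mu x + (gr mu f, gr mu f)" using u(2) unfolding A.solution_pair[OF l1 B] x_def .
 have e': "x' = A'.Tm mu x' + (gr mu f, gr mu f)" using u'(2) unfolding A'.solution_pair[OF l1 B'] x'_def .
 have d: "pbl mu (x' - x) (?c + ?c)" by (rule pb_diff[OF x' x])
 have "A'.Tm mu x' = A'.Tm mu (x' - x) + A'.Tm mu x" using A'.Tm_add[OF d x] by simp
 moreover have "x' - x = (A'.Tm mu x' + (gr mu f, gr mu f)) - (A.Tm mu x + (gr mu f, gr mu f))"
  by (rule arg_cong2[where f = "(-)", OF e' e])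
 ultimately have fx: "x' - x = A'.Tm mu (x' - x) + ?g" by (simp only: add_diff_cancel_right add_diff_eq)
 have g: "pbl mu ?g (3 * mu powr (-1/16) * (eta * ?c))"
 proof -
  have u: "hb (3/4) (fst x) ?c" and v: "hb (17/16) (snd x) (mu powr (1/8) * ?c)" using x by (auto simp: pb_def)
  have "hb 0 (Q4' (snd x) - Q4 (snd x)) (mu powr (1/8) * (eta * ?c))" using d4[OF v] by (simp only: mult.left_commute)
  from pbl_comb[OF l1 d1[OF u] d2[OF u] d3[OF u] this] show ?thesis unfolding A.Tm_def A'.Tm_def comb_diff .
 qed
 from a_priori[OF d g fx] have "pbl mu (x' - x) (3 * mu powr (-1/16) * (eta * ?c) / (1 - 1/2))" .
 then have "pbl mu (x' - x) (12 * eta * F)"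
 proof (rule pb_mono)
  have F: "0 \<le> F" by (rule hb_nonneg[OF f])
  have "mu powr (-1/16) * mu powr (-19/32) \<le> 1 * 1"
   using l1 powr_mono[of "-1/16" 0 mu] powr_mono[of "-19/32" 0 mu] by (intro mult_mono) auto
  then have "12 * eta * F * (mu powr (-1/16) * mu powr (-19/32)) \<le> 12 * eta * F * 1"
   using F eta by (intro mult_left_mono) auto
  then show "3 * mu powr (-1/16) * (eta * ?c) / (1 - 1/2) \<le> 12 * eta * F" by (simp add: mult_ac)
 qed simp
 then show ?thesis by (simp add: x_def x'_def)
qed

section \<open>Resolvents and self-adjointness\<close>

lemma jap_uminus [simp]: "jap (- k) = jap k" by (simp add: jap_def freq_def norm_prod_def)

text \<open>The coefficients of the complex conjugate function. With it the inner product is the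
  coefficient at 0 of a product, so product estimates give Cauchy-Schwarz.\<close>

definition refl :: "tdist => tdist" where "refl g = (\<lambda>k. cnj (g (- k)))"

lemma hb_refl: assumes "hb s g C" shows "hb s (refl g) C" unfolding hb_def
proof (intro allI impI)
 fix A :: "(int \<times> int) set" assume A: "finite A"
 have "L2_set (\<lambda>k. jap k powr s * cmod (refl g k)) A = L2_set (\<lambda>k. jap k powr s * cmod (g k)) (uminus ` A)"
  unfolding L2_set_def by (subst sum.reindex) (auto simp: refl_def inj_on_def)
 then show "L2_set (\<lambda>k. jap k powr s * cmod (refl g k)) A \<le> C" using hbD[OF assms, of "uminus ` A"] A by simp
qed

lemma hb0_iff: "hb 0 f C \<longleftrightarrow> f \<in> L2 \<and> L2_norm f \<le> C"
 using L2_norm_hb[of f] L2_norm_le[of f C] L2_iff[of f] hb_mono by blast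

lemma L2_add [simp]: "f \<in> L2 ==> g \<in> L2 ==> f + g \<in> L2"
 unfolding L2_iff using hb_add' by blast

lemma L2_diff [simp]: "f \<in> L2 ==> g \<in> L2 ==> f - g \<in> L2"
 unfolding L2_iff using hb_diff' by blast

lemma L2_scale [simp]: "f \<in> L2 ==> scale z f \<in> L2" unfolding L2_iff using hb_scale by blast

lemma uminus_scale: "- f = scale (-1) f" by (simp add: scale_def fun_eq_iff)

lemma L2_uminus [simp]: "f \<in> L2 ==> - f \<in> L2" unfolding uminus_scale by (rule L2_scale)

lemma L2_inner_tprod: "L2_inner f g = tprod f (refl g) 0"
 by (simp add: L2_inner_def tprod_def refl_def)

lemma L2_inner_summable:
 assumes "f \<in> L2" "g \<in> L2" shows "(\<lambda>k. f k * cnj (g k)) summable_on UNIV"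
proof (rule Infinite_Sum.abs_summable_summable)
 from assms obtain C D where "hb 0 f C" "hb 0 g D" unfolding L2_iff by blast
 from summable_product_hb[OF this(1) _ order_refl, of "refl g" D 0] hb_refl[OF this(2)]
 show "(\<lambda>k. norm (f k * cnj (g k))) summable_on UNIV" by (simp add: refl_def)
qed

lemma L2_inner_le:
 assumes "f \<in> L2" "g \<in> L2" shows "cmod (L2_inner f g) \<le> L2_norm f * L2_norm g"
 unfolding L2_inner_tprod by (rule tprod_coeff_le) (intro L2_norm_hb hb_refl assms)+

lemma L2_inner_add_left: "f \<in> L2 ==> f' \<in> L2 ==> g \<in> L2 ==> L2_inner (f + f') g = L2_inner f g + L2_inner f' g"
 unfolding L2_inner_def plus_fun_apply distrib_right by (intro infsum_add L2_inner_summable)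

lemma L2_inner_scale_left: "L2_inner (scale z f) g = z * L2_inner f g"
 unfolding L2_inner_def scale_apply mult.assoc by (rule infsum_cmult_right')

lemma L2_inner_commute: "L2_inner g f = cnj (L2_inner f g)"
 unfolding L2_inner_def infsum_cnj[symmetric] by (simp add: mult.commute)

lemma L2_inner_add_right: "f \<in> L2 ==> g \<in> L2 ==> g' \<in> L2 ==> L2_inner f (g + g') = L2_inner f g + L2_inner f g'"
 unfolding L2_inner_commute[of f] by (simp add: L2_inner_add_left)

lemma L2_inner_scale_right: "L2_inner f (scale z g) = cnj z * L2_inner f g"
 unfolding L2_inner_commute[of f] by (simp add: L2_inner_scale_left)

lemma L2_inner_uminus: "L2_inner (- f) g = - L2_inner f g" "L2_inner f (- g) = - L2_inner f g"
 unfolding uminus_scale L2_inner_scale_left L2_inner_scale_right by simp_all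

lemma L2_inner_diff_left: "f \<in> L2 ==> f' \<in> L2 ==> g \<in> L2 ==> L2_inner (f - f') g = L2_inner f g - L2_inner f' g"
 using L2_inner_add_left[of f "- f'" g] by (simp add: L2_inner_uminus)

lemma L2_inner_diff_right: "f \<in> L2 ==> g \<in> L2 ==> g' \<in> L2 ==> L2_inner f (g - g') = L2_inner f g - L2_inner f g'"
 using L2_inner_add_right[of f g "- g'"] by (simp add: L2_inner_uminus)

lemma L2_inner_self: assumes "f \<in> L2" shows "L2_inner f f = cor ((L2_norm f)^2)"
proof -
 have "L2_inner f f = (INFSUM k. cor ((norm (f k))^2))"
  unfolding L2_inner_def complex_norm_square ..
 also have "\<dots> = cor (INFSUM k. (norm (f k))^2)"
  using hb_summable[OF L2_norm_hb[OF assms]] by (intro infsumI has_sum_of_real has_sum_infsum) simp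
 also have "(INFSUM k. (norm (f k))^2) = (L2_norm f)^2" unfolding L2_norm_def by (simp add: infsum_nonneg)
 finally show ?thesis .
qed

lemma L2_norm_diff_sq: assumes "f \<in> L2" "g \<in> L2"
 shows "(L2_norm (f - g))^2 = (L2_norm f)^2 - 2 * Re (L2_inner g f) + (L2_norm g)^2"
proof -
 have n: "(L2_norm u)^2 = Re (L2_inner u u)" if "u \<in> L2" for u using L2_inner_self[OF that] by simp
 show ?thesis using assms L2_inner_commute[of f g]
  by (simp add: n L2_inner_diff_left L2_inner_diff_right)
qed

lemma Im_inner_bound:
 assumes "u \<in> L2" "b \<in> L2" "Im (L2_inner b u) = y * (L2_norm u)^2" shows "\<bar>y\<bar> * L2_norm u \<le> L2_norm b"
proof (cases "L2_norm u = 0")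
 case False
 then have p: "0 < L2_norm u" using L2_norm_nonneg[of u] by simp
 have "\<bar>y\<bar> * L2_norm u * L2_norm u = \<bar>Im (L2_inner b u)\<bar>"
  unfolding assms(3) by (simp add: abs_mult power2_eq_square)
 also have "\<dots> \<le> cmod (L2_inner b u)" by (rule abs_Im_le_cmod)
 also have "\<dots> \<le> L2_norm b * L2_norm u" by (intro L2_inner_le assms)
 finally show ?thesis using p by simp
qed (simp add: L2_norm_nonneg)

lemma L2_norm_zeroD: "f \<in> L2 ==> L2_norm f = 0 ==> f = 0"
 using L2_norm_hb[of f] hb_zeroD by fastforce

lemma L2_norm_add: "f \<in> L2 ==> g \<in> L2 ==> L2_norm (f + g) \<le> L2_norm f + L2_norm g"
 by (intro L2_norm_le hb_add' L2_norm_hb)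

lemma L2_norm_diff: "f \<in> L2 ==> g \<in> L2 ==> L2_norm (f - g) \<le> L2_norm f + L2_norm g"
 by (intro L2_norm_le hb_diff' L2_norm_hb)

lemma L2_norm_scale: "f \<in> L2 ==> L2_norm (scale z f) \<le> cmod z * L2_norm f"
 by (intro L2_norm_le hb_scale L2_norm_hb)

lemma L2_norm_uminus: "f \<in> L2 ==> L2_norm (- f) \<le> L2_norm f"
 using L2_norm_scale[of f "-1"] by (simp add: uminus_scale)

lemma L2_zero [simp]: "0 \<in> L2" unfolding L2_iff using hb_zero[of 0] by (auto simp: zero_fun_def)

lemma op_norm_le:
 assumes "0 \<le> C" "\<And>f. f \<in> L2 ==> L2_norm f \<le> 1 ==> hb s (T f) C" shows "op_norm s T \<le> ennreal C"
 unfolding op_norm_def by (rule SUP_least) (use assms sobolev_norm_le_iff in auto)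

text \<open>\<open>S\<close> is minus the inverse of the operator \<open>h\<close> with domain \<open>D\<close>.\<close>

locale resolvent_pair =
 fixes D :: "tdist set" and h S :: "tdist => tdist"
 assumes D_L2: "u \<in> D ==> u \<in> L2" and h_L2: "u \<in> D ==> h u \<in> L2"
  and D_linear: "u \<in> D ==> v \<in> D ==> scale z u + v \<in> D"
  and h_linear: "u \<in> D ==> v \<in> D ==> h (scale z u + v) = scale z (h u) + h v"
  and S_D: "f \<in> L2 ==> S f \<in> D" and h_S: "f \<in> L2 ==> h (S f) = - f"
  and S_h: "u \<in> D ==> S (- h u) = u"
  and S_sym: "f \<in> L2 ==> g \<in> L2 ==> L2_inner (S f) g = L2_inner f (S g)"
  and S_pos: "f \<in> L2 ==> (L2_norm (S f))^2 \<le> Re (L2_inner f (S f))"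
  and D_dense: "f \<in> L2 ==> 0 < e ==> \<exists>u\<in>D. hb 0 (f - u) e"
begin

lemma S_L2 [simp]: "f \<in> L2 ==> S f \<in> L2" by (rule D_L2[OF S_D])

lemma S_linear: assumes "f \<in> L2" "g \<in> L2" shows "S (scale z f + g) = scale z (S f) + S g"
proof -
 have "h (scale z (S f) + S g) = scale z (- f) + - g"
  unfolding h_linear[OF S_D[OF assms(1)] S_D[OF assms(2)]] h_S[OF assms(1)] h_S[OF assms(2)] ..
 then have "- h (scale z (S f) + S g) = scale z f + g" by (simp add: scale_def fun_eq_iff)
 then show ?thesis using S_h[OF D_linear[OF S_D[OF assms(1)] S_D[OF assms(2)], of z]] by simp
qed

lemma S_norm: assumes "f \<in> L2" shows "L2_norm (S f) \<le> L2_norm f"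
proof (cases "L2_norm (S f) = 0")
 case False
 then have p: "0 < L2_norm (S f)" using L2_norm_nonneg[of "S f"] by simp
 have "L2_norm (S f) * L2_norm (S f) \<le> Re (L2_inner f (S f))" using S_pos[OF assms] by (simp add: power2_eq_square)
 also have "\<dots> \<le> cmod (L2_inner f (S f))" by (rule complex_Re_le_cmod)
 also have "\<dots> \<le> L2_norm f * L2_norm (S f)" using assms by (intro L2_inner_le) auto
 finally show ?thesis using p by simp
qed (simp add: L2_norm_nonneg)

lemma h_inner: assumes "u \<in> D" "v \<in> D" shows "L2_inner (h u) v = L2_inner u (h v)"
proof -
 have "L2_inner (S (- h u)) (- h v) = L2_inner (- h u) (S (- h v))"
  using h_L2 assms by (intro S_sym) auto
 then show ?thesis using S_h assms by (simp add: L2_inner_uminus)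
qed

lemma neg_coercive: "neg_coercive (D, h)" unfolding neg_coercive_def fst_conv snd_conv
proof
 fix u assume u: "u \<in> D"
 then show "(L2_norm u)^2 \<le> Re (L2_inner (- h u) u)" using S_pos[of "- h u"] h_L2[OF u] S_h[OF u] by simp
qed

text \<open>The operator is symmetric with a bounded everywhere defined inverse. For
  \<open>v\<close> in the adjoint domain with image \<open>w\<close>, the element
  \<open>S (- w)\<close> of the domain has the same image; testing the adjoint relation on
  \<open>S f\<close>, with \<open>f\<close> the difference, shows that \<open>f\<close> is
  orthogonal to itself.\<close>

lemma self_adjoint: "self_adjoint (D, h)" unfolding self_adjoint_def fst_conv snd_conv
proof (intro conjI allI ballI impI)
 show "D \<subseteq> L2" "h ` D \<subseteq> L2" using D_L2 h_L2 by auto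
 show "scale z u + v \<in> D" "h (scale z u + v) = scale z (h u) + h v" if "u \<in> D" "v \<in> D" for z u v
  using D_linear h_linear that by blast+
 show "\<exists>u\<in>D. L2_norm (f - u) < e" if f: "f \<in> L2" and e: "0 < e" for f e
 proof -
  from D_dense[OF f, of "e / 2"] e obtain u where "u \<in> D" "hb 0 (f - u) (e / 2)" by auto
  then show ?thesis using L2_norm_le[of "f - u" "e / 2"] e by (intro bexI[of _ u]) auto
 qed
 fix v w assume v: "v \<in> L2" and w: "w \<in> L2"
 show "(\<forall>u\<in>D. L2_inner (h u) v = L2_inner u w) \<longleftrightarrow> v \<in> D \<and> h v = w"
 proof
  assume "v \<in> D \<and> h v = w" then show "\<forall>u\<in>D. L2_inner (h u) v = L2_inner u w" using h_inner by blast
 next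
  assume a: "\<forall>u\<in>D. L2_inner (h u) v = L2_inner u w"
  define v' where "v' = S (- w)"
  have v': "v' \<in> D" "h v' = w" "v' \<in> L2" using w S_D[of "- w"] h_S[of "- w"] by (auto simp: v'_def)
  define f where "f = v - v'"
  have f: "f \<in> L2" using v v' by (simp add: f_def)
  have "L2_inner f v = - L2_inner (h (S f)) v" using f by (simp add: h_S L2_inner_uminus)
  also have "\<dots> = L2_inner (S f) (- w)" using a S_D[OF f] by (simp add: L2_inner_uminus)
  also have "\<dots> = L2_inner f v'" unfolding v'_def using f w by (intro S_sym) auto
  finally have "L2_inner f f = 0" using f v v' by (simp add: f_def L2_inner_diff_right)
  then have "f = 0" using f by (intro L2_norm_zeroD) (simp_all add: L2_inner_self)
  then show "v \<in> D \<and> h v = w" using v' by (simp add: f_def)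
 qed
qed

lemma op_inverse_eq: assumes "f \<in> L2" shows "op_inverse (D, h) f = S (- f)"
 unfolding op_inverse_def fst_conv snd_conv
proof (rule inv_into_f_eq)
 show "inj_on h D" by (rule inj_onI) (metis S_h)
 show "S (- f) \<in> D" "h (S (- f)) = f" using assms S_D[of "- f"] h_S[of "- f"] by auto
qed

lemma boundedly_invertible: "boundedly_invertible (D, h)"
 unfolding boundedly_invertible_def fst_conv snd_conv
proof
 show "bij_betw h D L2"
  by (rule bij_betwI[where g = "\<lambda>f. S (- f)"]) (auto simp: h_L2 S_D S_h h_S)
 have "op_norm 0 (op_inverse (D, h)) \<le> ennreal 1"
 proof (rule op_norm_le)
  fix f assume f: "f \<in> L2" "L2_norm f \<le> 1"
  have "L2_norm (S (- f)) \<le> 1" using S_norm[of "- f"] L2_norm_uminus[of f] f by simp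
  then show "hb 0 (op_inverse (D, h) f) 1" using f by (simp add: op_inverse_eq hb0_iff)
 qed simp
 then show "op_norm 0 (op_inverse (D, h)) < \<infinity>" by (simp add: le_less_trans)
qed

lemma S_real: assumes "f \<in> L2" shows "Im (L2_inner (S f) f) = 0"
proof -
 have "L2_inner (S f) f = cnj (L2_inner (S f) f)"
  using S_sym[OF assms assms] L2_inner_commute[of f "S f"] by simp
 then show ?thesis by (metis Reals_cnj_iff complex_is_Real_iff)
qed

lemma Im_coercive:
 assumes f: "f \<in> L2" shows "\<bar>Im ze\<bar> * L2_norm f \<le> L2_norm (scale ze f + S f)"
  and "Im (L2_inner (scale ze f + S f) f) = Im ze * (L2_norm f)^2"
proof -
 have "L2_inner (scale ze f + S f) f = ze * cor ((L2_norm f)^2) + L2_inner (S f) f"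
  using f by (simp add: L2_inner_add_left L2_inner_scale_left L2_inner_self)
 then show e: "Im (L2_inner (scale ze f + S f) f) = Im ze * (L2_norm f)^2" using S_real[OF f] by simp
 show "\<bar>Im ze\<bar> * L2_norm f \<le> L2_norm (scale ze f + S f)"
  using f by (intro Im_inner_bound e) auto
qed

text \<open>The Lax--Milgram iteration, with \<open>\<tau>\<close> chosen such that \<open>1 - \<tau> (ze + S)\<close> is a contraction.\<close>

lemma zeta_solvable: assumes y: "Im ze \<noteq> 0" and g: "g \<in> L2"
 shows "\<exists>u\<in>L2. scale ze u + S u = g"
proof -
 define K where "K = 1 + cmod ze"
 define t where "t = \<bar>Im ze\<bar> / K^2"
 \<comment> \<open>The factor \<open>- \<i> * sgn (Im ze)\<close> moves the imaginary part of the
   form, the one under control, into the real part. The modulus \<open>t\<close> minimises the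
   quadratic \<open>1 - 2 * (t * \<bar>Im ze\<bar>) + (t * K)^2\<close>.\<close>
 define \<tau> where "\<tau> = - \<i> * cor (sgn (Im ze) * t)"
 define phi where "phi u = u - scale \<tau> (scale ze u + S u)" for u
 define q where "q = sqrt (1 - (\<bar>Im ze\<bar> / K)\<^sup>2)"
 have K: "0 < K" "\<bar>Im ze\<bar> \<le> K" using abs_Im_le_cmod[of ze] by (auto simp: K_def intro: add_pos_nonneg)
 have r: "0 < \<bar>Im ze\<bar> / K" "\<bar>Im ze\<bar> / K \<le> 1" using K y by auto
 then have r2: "0 < (\<bar>Im ze\<bar> / K)^2" "(\<bar>Im ze\<bar> / K)^2 \<le> 1" by (auto simp: power_le_one)
 then have q: "0 \<le> q" "q < 1" "q^2 = 1 - (\<bar>Im ze\<bar> / K)\<^sup>2" by (auto simp: q_def real_sqrt_lt_1_iff)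
 have t0: "0 < t" using K y by (simp add: t_def)
 have \<tau>: "cmod \<tau> = t" "\<tau> \<noteq> 0" using t0 y by (auto simp: \<tau>_def norm_mult abs_mult abs_sgn_eq sgn_if)
 have phiL2: "phi u \<in> L2" if "u \<in> L2" for u using that by (simp add: phi_def)
 have contr: "hb 0 (phi u) (q * C)" if hu: "hb 0 u C" for u C
 proof -
  have u: "u \<in> L2" "L2_norm u \<le> C" using hu by (auto simp: hb0_iff)
  define b where "b = scale ze u + S u"
  have b: "b \<in> L2" using u by (simp add: b_def)
  have nb: "L2_norm b \<le> K * L2_norm u"
  proof -
   have "L2_norm b \<le> L2_norm (scale ze u) + L2_norm (S u)" unfolding b_def using u by (intro L2_norm_add) auto
   then show ?thesis using L2_norm_scale[OF u(1), of ze] S_norm[OF u(1)] by (simp add: K_def distrib_right)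
  qed
  have "(L2_norm (phi u))^2 = (L2_norm u)^2 - 2 * Re (\<tau> * L2_inner b u) + (L2_norm (scale \<tau> b))^2"
   unfolding phi_def b_def[symmetric] using u b by (simp add: L2_norm_diff_sq L2_inner_scale_left)
  moreover have "(L2_norm (scale \<tau> b))^2 \<le> (t * (K * L2_norm u))^2"
   using order_trans[OF L2_norm_scale[OF b, of \<tau>] mult_left_mono[OF nb norm_ge_zero]]
   by (intro power_mono L2_norm_nonneg) (simp add: \<tau>)
  moreover have "Re (\<tau> * L2_inner b u) = t * \<bar>Im ze\<bar> * (L2_norm u)^2"
  proof -
   have "Re (\<tau> * L2_inner b u) = sgn (Im ze) * t * Im (L2_inner b u)" by (simp add: \<tau>_def)
   also have "Im (L2_inner b u) = Im ze * (L2_norm u)^2" unfolding b_def by (rule Im_coercive(2)[OF u(1)])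
   finally show ?thesis by (simp add: abs_sgn[of "Im ze"] mult_ac)
  qed
  ultimately have "(L2_norm (phi u))^2 \<le> (1 - 2 * (t * \<bar>Im ze\<bar>) + (t * K)^2) * (L2_norm u)^2"
   by (simp add: algebra_simps power_mult_distrib)
  also have "1 - 2 * (t * \<bar>Im ze\<bar>) + (t * K)^2 = q^2"
   unfolding q(3) t_def using K by (simp add: power2_eq_square field_simps)
  finally have "(L2_norm (phi u))^2 \<le> (q * L2_norm u)^2" by (simp add: power_mult_distrib)
  then have "L2_norm (phi u) \<le> q * L2_norm u" using q(1) L2_norm_nonneg[of u] by (intro power2_le_imp_le[of "L2_norm (phi u)" "q * L2_norm u"]) auto
  also have "\<dots> \<le> q * C" using q(1) u by (intro mult_left_mono)
  finally show ?thesis using phiL2[OF u(1)] by (simp add: hb0_iff)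
 qed
 have add: "phi (u + v) = phi u + phi v" if "hb 0 u C" "hb 0 v C'" for u v C C'
  using S_linear[of u v 1] that by (simp add: phi_def scale_add hb0_iff)
 \<comment> \<open>The contraction argument is formulated for pairs; here both components carry the
   same L2 equation.\<close>
 interpret contraction 0 0 1 q "\<lambda>x. (phi (fst x), phi (snd x))"
  by unfold_locales (use q(1,2) contr in \<open>auto simp: pb_def intro: add\<close>)
 have "pb 0 0 1 (scale \<tau> g, scale \<tau> g) (cmod \<tau> * L2_norm g)"
  using hb_scale[OF L2_norm_hb[OF g]] by (simp add: pb_def)
 from solution_exists[OF this] obtain x C where x: "pb 0 0 1 x C" "x = (phi (fst x), phi (snd x)) + (scale \<tau> g, scale \<tau> g)" by blast
 define u where "u = fst x"
 have "u \<in> L2" using x(1) by (auto simp: pb_def hb0_iff u_def)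
 moreover have "u = phi u + scale \<tau> g" using x(2) unfolding u_def by (metis fst_conv fst_add)
 then have "scale \<tau> (scale ze u + S u) = scale \<tau> g" by (simp add: phi_def algebra_simps)
 then have "scale ze u + S u = g" using \<tau>(2) by (simp add: scale_def fun_eq_iff)
 ultimately show ?thesis by blast
qed

text \<open>Applying \<open>S\<close> turns the unbounded equation into
  \<open>u = S (- (f + scale z u))\<close>, which after division by \<open>z\<close> is an equation
  for \<open>1 / z + S\<close> with the bounded \<open>S\<close>, solvable because
  \<open>1 / z\<close> is not real.\<close>

lemma shifted_solvable: assumes z: "Im z \<noteq> 0" and f: "f \<in> L2"
 shows "\<exists>u\<in>D. h u - scale z u = f"
proof -
 have z0: "z \<noteq> 0" using z by auto
 have "Im (1 / z) \<noteq> 0" using z by (simp add: Im_divide power2_eq_square sum_squares_eq_zero_iff)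
 moreover have "scale (- 1 / z) (S f) \<in> L2" using f by simp
 ultimately obtain u where u: "u \<in> L2" "scale (1 / z) u + S u = scale (- 1 / z) (S f)" using zeta_solvable by blast
 have "u = scale (-1) (scale z (S u) + S f)"
 proof
  fix k
  have "(1 / z) * u k + S u k = (- 1 / z) * S f k" using fun_cong[OF u(2), of k] by (simp only: plus_fun_apply scale_apply)
  then have "z * ((1 / z) * u k + S u k) = z * ((- 1 / z) * S f k)" by (rule arg_cong)
  then have "u k + z * S u k = - S f k" using z0 by (simp add: distrib_left)
  then have "u k = - S f k - z * S u k" by (simp only: eq_diff_eq)
  then show "u k = scale (-1) (scale z (S u) + S f) k" by (simp add: scale_def)
 qed
 also have "\<dots> = scale (-1) (S (scale z u + f)) + S 0"
  using S_linear[OF u(1) f, of z] S_linear[of 0 0 1] by simp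
 also have "\<dots> = S (- (scale z u + f))"
  using S_linear[of "scale z u + f" 0 "-1"] u(1) f by (simp add: uminus_scale)
 finally have e: "u = S (- (scale z u + f))" .
 have l: "- (scale z u + f) \<in> L2" using u f by simp
 have "h u = scale z u + f" using h_S[OF l] unfolding e[symmetric] by (simp only: minus_minus)
 moreover have "u \<in> D" using S_D[OF l] unfolding e[symmetric] .
 ultimately show ?thesis by (intro bexI[of _ u]) auto
qed

lemma shifted_bound:
 assumes u: "u \<in> D" shows "\<bar>Im z\<bar> * L2_norm u \<le> L2_norm (h u - scale z u)"
proof (rule Im_inner_bound[of u, where y = "- Im z", unfolded abs_minus])
 show L: "u \<in> L2" "h u - scale z u \<in> L2" using u D_L2 h_L2 by (auto intro: L2_diff)
 have "L2_inner (h u) u = cnj (L2_inner (h u) u)"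
  using h_inner[OF u u] L2_inner_commute[of u "h u"] by simp
 then have "Im (L2_inner (h u) u) = 0" by (metis Reals_cnj_iff complex_is_Real_iff)
 then show "Im (L2_inner (h u - scale z u) u) = - Im z * (L2_norm u)^2"
  using L(1) h_L2[OF u] by (simp add: L2_inner_diff_left L2_inner_scale_left L2_inner_self)
qed

lemma shifted_inverse: assumes z: "Im z \<noteq> 0" and f: "f \<in> L2"
 defines "u \<equiv> op_inverse (shift_op (D, h) z) f"
 shows "u \<in> D" "h u - scale z u = f" "\<bar>Im z\<bar> * L2_norm u \<le> L2_norm f" "u = S (- (f + scale z u))"
proof -
 from shifted_solvable[OF z f] obtain v where v: "v \<in> D" "h v - scale z v = f" by blast
 have "u = v" unfolding u_def op_inverse_def shift_op_def fst_conv snd_conv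
 proof (rule inv_into_f_eq)
  show "v \<in> D" "h v - scale z v = f" by (rule v)+
  show "inj_on (\<lambda>u. h u - scale z u) D"
  proof (rule inj_onI)
   fix a b assume ab: "a \<in> D" "b \<in> D" "h a - scale z a = h b - scale z b"
   have d: "scale (-1) b + a \<in> D" by (rule D_linear[OF ab(2,1)])
   have "h (scale (-1) b + a) - scale z (scale (-1) b + a) = 0"
    unfolding h_linear[OF ab(2,1)] using ab(3) by (simp add: scale_def fun_eq_iff algebra_simps)
   then have "\<bar>Im z\<bar> * L2_norm (scale (-1) b + a) \<le> L2_norm 0" using shifted_bound[OF d, of z] by simp
   moreover have "L2_norm 0 = 0" by (simp add: L2_norm_def)
   ultimately have "L2_norm (scale (-1) b + a) = 0"
    using z L2_norm_nonneg[of "scale (-1) b + a"] by (simp add: mult_le_0_iff)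
   then have "scale (-1) b + a = 0" using D_L2[OF d] by (intro L2_norm_zeroD)
   then show "a = b" by (simp add: scale_def fun_eq_iff)
  qed
 qed
 then show u: "u \<in> D" "h u - scale z u = f" using v by auto
 show "\<bar>Im z\<bar> * L2_norm u \<le> L2_norm f" using shifted_bound[OF u(1), of z] u(2) by simp
 have "h u = f + scale z u" using u(2) by (simp add: algebra_simps)
 then show "u = S (- (f + scale z u))" using S_h[OF u(1)] by simp
qed

end

text \<open>Both resolvents solve bounded equations with \<open>S\<close> and \<open>S'\<close>.
  Their difference solves the primed one, with the error of \<open>S' - S\<close> on
  \<open>- (f + scale z u)\<close> as source; the imaginary part of \<open>1 / z\<close> bounds it,
  and \<open>1 + cmod z / \<bar>Im z\<bar>\<close> bounds the argument of the error.\<close>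

lemma resolvent_compare:
 assumes A: "resolvent_pair D h S" and A': "resolvent_pair D' h' S'" and z: "Im z \<noteq> 0" and eta: "0 \<le> eta"
  and d: "\<And>f. f \<in> L2 ==> L2_norm (S' f - S f) \<le> eta * L2_norm f" and f: "f \<in> L2" "L2_norm f \<le> 1"
 shows "hb 0 (op_inverse (shift_op (D', h') z) f - op_inverse (shift_op (D, h) z) f)
   ((cmod (1 / z) / \<bar>Im (1 / z)\<bar>) * (eta * (1 + cmod z / \<bar>Im z\<bar>)))"
proof -
 interpret A: resolvent_pair D h S by (rule A)
 interpret A': resolvent_pair D' h' S' by (rule A')
 define u u' where "u = op_inverse (shift_op (D, h) z) f" and "u' = op_inverse (shift_op (D', h') z) f"
 note u = A.shifted_inverse[OF z f(1), folded u_def] and u' = A'.shifted_inverse[OF z f(1), folded u'_def]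
 have z0: "z \<noteq> 0" using z by auto
 have L: "u \<in> L2" "u' \<in> L2" using A.D_L2[OF u(1)] A'.D_L2[OF u'(1)] .
 define ze where "ze = 1 / z"
 have iz: "Im ze \<noteq> 0" using z by (simp add: ze_def Im_divide power2_eq_square sum_squares_eq_zero_iff)
 define g where "g = - (f + scale z u)"
 have g: "g \<in> L2" using f L by (simp add: g_def)
 define e where "e = S' g - S g"
 have eL: "e \<in> L2" using g by (simp add: e_def)
 have "u' - u = S' (- (f + scale z u')) - S g" using u(4) u'(4) by (simp add: g_def)
 also have "- (f + scale z u') = scale (- z) (u' - u) + g" by (simp add: g_def scale_def fun_eq_iff algebra_simps)
 also have "S' \<dots> = scale (- z) (S' (u' - u)) + S' g" using L g by (intro A'.S_linear) auto
 finally have "u' - u = scale (- z) (S' (u' - u)) + e" unfolding e_def add_diff_eq .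
 then have pt: "(u' - u) k = - z * S' (u' - u) k + e k" for k by (metis plus_fun_apply scale_apply)
 have eq: "scale ze (u' - u) + S' (u' - u) = scale ze e"
 proof
  fix k
  have "ze * (u' - u) k = ze * (- z * S' (u' - u) k + e k)" using pt[of k] by (rule arg_cong)
  then show "(scale ze (u' - u) + S' (u' - u)) k = scale ze e k"
   unfolding plus_fun_apply scale_apply using z0 by (simp add: ze_def algebra_simps)
 qed
 have "\<bar>Im ze\<bar> * L2_norm (u' - u) \<le> cmod ze * L2_norm e"
  using A'.Im_coercive(1)[of "u' - u" ze] L L2_norm_scale[OF eL, of ze] by (simp add: eq)
 moreover have "L2_norm e \<le> eta * (1 + cmod z / \<bar>Im z\<bar>)"
 proof -
  have "L2_norm u \<le> 1 / \<bar>Im z\<bar>" using u(3) f(2) z by (simp add: pos_le_divide_eq mult.commute)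
  then have "cmod z * L2_norm u \<le> cmod z / \<bar>Im z\<bar>" using mult_left_mono[of "L2_norm u" "1 / \<bar>Im z\<bar>" "cmod z"] by simp
  moreover have "L2_norm g \<le> L2_norm f + L2_norm (scale z u)"
   unfolding g_def using f L L2_norm_uminus[of "f + scale z u"] L2_norm_add[of f "scale z u"] by simp
  ultimately have "L2_norm g \<le> 1 + cmod z / \<bar>Im z\<bar>" using L2_norm_scale[OF L(1), of z] f(2) by linarith
  then have "eta * L2_norm g \<le> eta * (1 + cmod z / \<bar>Im z\<bar>)" using eta by (intro mult_left_mono)
  then show ?thesis using d[OF g] by (simp add: e_def)
 qed
 then have "cmod ze * L2_norm e \<le> cmod ze * (eta * (1 + cmod z / \<bar>Im z\<bar>))" by (intro mult_left_mono) auto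
 ultimately have "\<bar>Im ze\<bar> * L2_norm (u' - u) \<le> cmod ze * (eta * (1 + cmod z / \<bar>Im z\<bar>))" by linarith
 then have "L2_norm (u' - u) \<le> (cmod ze / \<bar>Im ze\<bar>) * (eta * (1 + cmod z / \<bar>Im z\<bar>))"
  using iz by (simp add: pos_le_divide_eq mult.commute)
 then show ?thesis using L by (simp add: hb0_iff u_def u'_def ze_def)
qed

section \<open>The noise terms of the Anderson operator\<close>

context lp begin

lemma bil_lap: "bil F (s - 2) a t ==> bil (\<lambda>u g. F (laplacian u) g) s a t"
 by (rule bil_comp_left[where s' = "s - 2"], assumption, erule hb_laplacian, rule laplacian_linear)

lemma bil_para_grad: assumes "t < a - 1 + min (s - 1) 0" shows "bil (para_grad chi rho) s a t"
proof -
 have b: "bil par (s - 1) (a - 1) t" by (rule bil_para[OF assms])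
 have l: "bil (\<lambda>u g. par (partial1 u) g) s (a - 1) t" "bil (\<lambda>u g. par (partial2 u) g) s (a - 1) t"
  by (rule bil_comp_left[OF b]; simp add: hb_partial1 hb_partial2 partial_linear)+
 have "bil (\<lambda>u g. par (partial1 u) (partial1 g)) s a t" "bil (\<lambda>u g. par (partial2 u) (partial2 g)) s a t"
  by (rule bil_comp_right[OF l(1) bb_partial1 partial_linear(1)], rule bil_comp_right[OF l(2) bb_partial2 partial_linear(2)])
 from bil_add[OF this] show ?thesis by (simp add: para_grad_def[abs_def])
qed

lemma bil_inv_lap: "bil F s (a + 2) t ==> bil (\<lambda>u g. F u (inv_one_minus_lap g)) s a t"
 by (rule bil_comp_right, assumption, rule bb_inv_lap, rule inv_lap_linear)

definition F1 :: "tdist => tdist => tdist" where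
 "F1 u xi = par u xi + par xi u"

text \<open>This is 1 - \<Delta> applied to \<open>ansatz_B\<close>, without the term u \<prec>
  \<Xi>2.\<close>

definition F2 :: "tdist => tdist => tdist" where
 "F2 u xi = par (laplacian u) (inv_one_minus_lap xi) + scale 2 (para_grad chi rho u (inv_one_minus_lap xi)) + par xi u"

definition F3 :: "tdist => tdist => tdist" where
 "F3 u xi = par u (inv_one_minus_lap xi)"

definition Kc :: "tdist => tdist => tdist => tdist" where
 "Kc u xi xi' = commutator chi rho u (inv_one_minus_lap xi) xi'"

lemma bil_F1: "t < -33/32 ==> bil F1 (3/4) (-33/32) t"
 unfolding F1_def[abs_def] by (intro bil_add bil_para bil_para_flip) auto

lemma bil_F2: "0 < s ==> s < 1 ==> t < s - 33/32 ==> bil F2 s (-33/32) t" unfolding F2_def[abs_def]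
 by (intro bil_add bil_para_flip bil_inv_lap bil_lap bil_scale[where F = "\<lambda>u g. para_grad chi rho u (inv_one_minus_lap g)"] bil_para bil_para_grad) auto

lemma bil_F3: "0 < s ==> t < a + 2 ==> bil F3 s a t"
 unfolding F3_def[abs_def] by (intro bil_inv_lap bil_para) auto

lemma Kc_facts:
 shows hb_Kc: "\<exists>B\<ge>0. \<forall>u xi xi' C D D'. hb (3/4) u C --> bb (-33/32) xi D --> bb (-33/32) xi' D' --> hb (11/16) (Kc u xi xi') (B * C * D * D')"
  and Kc_linear1: "hb (3/4) u C ==> hb (3/4) u' C' ==> bb (-33/32) xi D ==> bb (-33/32) xi' D' ==>
   Kc (scale z u + u') xi xi' = scale z (Kc u xi xi') + Kc u' xi xi'"
  and Kc_diff: "hb (3/4) u C ==> bb (-33/32) xi D ==> bb (-33/32) xi' D' ==>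
   Kc u xi' xi' - Kc u xi xi = Kc u (xi' - xi) xi' + Kc u xi (xi' - xi)"
proof -
 have a: "0 < (3/4::real)" "3/4 < (1::real)" "31/32 + - 33/32 < (0::real)" "0 < 3/4 + 31/32 + (- 33/32 :: real)" by auto
 from bb_inv_lap[of "-33/32"] obtain K where K: "0 \<le> K" "\<And>f D. bb (-33/32) f D ==> bb (31/32) (inv_one_minus_lap f) (K * D)"
  by auto
 from hb_commutator3[OF a] obtain B where B: "0 \<le> B" "\<And>f g h C D D'. hb (3/4) f C ==> bb (31/32) g D ==> bb (-33/32) h D' ==>
   hb (3/4 + 31/32 + -33/32) (commutator chi rho f g h) (B * C * D * D')" by auto
 have "hb (11/16) (Kc u xi xi') ((B * K) * C * D * D')" if "hb (3/4) u C" "bb (-33/32) xi D" "bb (-33/32) xi' D'" for u xi xi' C D D'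
  using B(2)[OF that(1) K(2)[OF that(2)] that(3)] by (simp add: Kc_def mult_ac)
 then show "\<exists>B\<ge>0. \<forall>u xi xi' C D D'. hb (3/4) u C --> bb (-33/32) xi D --> bb (-33/32) xi' D' --> hb (11/16) (Kc u xi xi') (B * C * D * D')"
  using B(1) K(1) by (intro exI[of _ "B * K"]) auto
 show "Kc (scale z u + u') xi xi' = scale z (Kc u xi xi') + Kc u' xi xi'"
  if "hb (3/4) u C" "hb (3/4) u' C'" "bb (-33/32) xi D" "bb (-33/32) xi' D'"
  unfolding Kc_def by (rule commutator_linear1[OF a that(1,2) K(2)[OF that(3)] that(4)])
 show "Kc u xi' xi' - Kc u xi xi = Kc u (xi' - xi) xi' + Kc u xi (xi' - xi)"
  if h: "hb (3/4) u C" "bb (-33/32) xi D" "bb (-33/32) xi' D'"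
 proof -
  have "Kc u (xi' - xi) xi' = scale (-1) (Kc u xi xi') + Kc u xi' xi'"
   unfolding Kc_def diff_scale[of xi'] inv_lap_linear by (rule commutator_linear2[OF a h(1) K(2)[OF h(2)] K(2)[OF h(3)] h(3)])
  moreover have "Kc u xi (xi' - xi) = scale (-1) (Kc u xi xi) + Kc u xi xi'"
   unfolding Kc_def diff_scale[of xi'] by (rule commutator_linear3[OF a h(1) K(2)[OF h(2)] h(2) h(3)])
  ultimately show ?thesis by (simp add: scale_def fun_eq_iff)
 qed
qed

text \<open>\<open>N1\<close> to \<open>N4\<close> instantiate \<open>Q1\<close> to
  \<open>Q4\<close>. Only u \<prec> X is split off from u, so the resonant products of \<xi> with
  \<open>ansatz_B\<close> and with the remainder merge into the single term \<open>N4\<close>, and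
  \<Xi>2 enters only through its product with u.\<close>

definition N1 :: "tdist => tdist => tdist => tdist" where
 "N1 xi Xi u = F1 u xi + (Kc u xi xi + tprod u Xi)"

definition N2 :: "tdist => tdist => tdist => tdist" where
 "N2 xi Xi u = F2 u xi + (Kc u xi xi + tprod u Xi)"

definition N3 :: "tdist => tdist => tdist" where "N3 xi u = F3 u xi"

definition N4 :: "tdist => tdist => tdist" where "N4 xi v = reso v xi"

lemma noise_bilinear:
 "bil F1 (3/4) (-33/32) (-17/16)" "bil F2 (3/4) (-33/32) (-5/16)" "bil F3 (3/4) (-33/32) (15/16)"
 "bil reso (17/16) (-33/32) 0" "bil tprod (3/4) (-1/16) (-1/8)"
 by (rule bil_F1 bil_F2 bil_F3 bil_resonant bil_tprod; simp)+

text \<open>The bound is stated for all large constants so that one constant for all the noise terms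
  is obtained from a conjunction of eventual statements.\<close>

lemma bil_eventually: assumes "bil F s a t"
 shows "\<forall>\<^sub>F B in at_top. \<forall>u g C D. hb s u C --> bb a g D --> hb t (F u g) (B * C * D)"
proof -
 from bil_bound[OF assms] obtain B0 where B0: "\<And>u g C D. hb s u C ==> bb a g D ==> hb t (F u g) (B0 * C * D)" by blast
 have "hb t (F u g) (B * C * D)" if "B0 \<le> B" "hb s u C" "bb a g D" for B u g C D
  by (rule hb_mono[OF B0[OF that(2,3)]]) (intro mult_right_mono that(1) hb_nonneg[OF that(2)] bb_nonneg[OF that(3)])
 then show ?thesis unfolding eventually_at_top_linorder by blast
qed

lemma Kc_eventually:
 "\<forall>\<^sub>F B in at_top. \<forall>u xi xi' C D D'. hb (3/4) u C --> bb (-33/32) xi D --> bb (-33/32) xi' D' --> hb (-1/8) (Kc u xi xi') (B * C * D * D')"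
proof -
 from hb_Kc obtain B0 where B0: "\<And>u xi xi' C D D'. hb (3/4) u C ==> bb (-33/32) xi D ==> bb (-33/32) xi' D' ==>
   hb (11/16) (Kc u xi xi') (B0 * C * D * D')" by blast
 have "hb (-1/8) (Kc u xi xi') (B * C * D * D')" if B: "B0 \<le> B" and h: "hb (3/4) u C" "bb (-33/32) xi D" "bb (-33/32) xi' D'" for B u xi xi' C D D'
  by (rule hb_mono[OF hb_weaken[OF B0[OF h]]], simp)
    (intro mult_right_mono B hb_nonneg[OF h(1)] bb_nonneg[OF h(2)] bb_nonneg[OF h(3)])
 then show ?thesis unfolding eventually_at_top_linorder by blast
qed

text \<open>The square of \<open>D\<close> is due to the commutator, which is quadratic in the
  noise; the other terms are linear, and \<open>1 \<le> D\<close>. In a difference one factor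
  becomes \<open>eta\<close>, and the commutator contributes two terms, which makes the total of
  four behind the constant \<open>4 * B\<close>.\<close>

lemma noise_ansatz:
 "\<exists>B\<ge>1. (\<forall>xi Xi D. bb (-33/32) xi D --> bb (-1/16) Xi D --> 1 \<le> D --> ansatz (N1 xi Xi) (N2 xi Xi) (N3 xi) (N4 xi) (B * D^2)) \<and>
  (\<forall>xi Xi xi' Xi' D eta u C. bb (-33/32) xi D --> bb (-1/16) Xi D --> bb (-33/32) xi' D --> bb (-1/16) Xi' D --> 1 \<le> D -->
    bb (-33/32) (xi' - xi) eta --> bb (-1/16) (Xi' - Xi) eta -->
    (hb (3/4) u C --> hb (-17/16) (N1 xi' Xi' u - N1 xi Xi u) (B * D * eta * C) \<and>
     hb (-5/16) (N2 xi' Xi' u - N2 xi Xi u) (B * D * eta * C) \<and> hb (15/16) (N3 xi' u - N3 xi u) (B * D * eta * C)) \<and>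
    (hb (17/16) u C --> hb 0 (N4 xi' u - N4 xi u) (B * D * eta * C)))"
proof -
 note nb = noise_bilinear[THEN bil_eventually]
 from eventually_happens'[OF _ eventually_conj[OF eventually_ge_at_top[of 1] eventually_conj[OF nb(1) eventually_conj[OF nb(2)
  eventually_conj[OF nb(3) eventually_conj[OF nb(4) eventually_conj[OF nb(5) Kc_eventually]]]]]]]
 obtain B where B: "1 \<le> B"
  "\<And>u xi C D. hb (3/4) u C ==> bb (-33/32) xi D ==> hb (-17/16) (F1 u xi) (B * C * D)"
  "\<And>u xi C D. hb (3/4) u C ==> bb (-33/32) xi D ==> hb (-5/16) (F2 u xi) (B * C * D)"
  "\<And>u xi C D. hb (3/4) u C ==> bb (-33/32) xi D ==> hb (15/16) (F3 u xi) (B * C * D)"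
  "\<And>u xi C D. hb (17/16) u C ==> bb (-33/32) xi D ==> hb 0 (reso u xi) (B * C * D)"
  "\<And>u xi C D. hb (3/4) u C ==> bb (-1/16) xi D ==> hb (-1/8) (tprod u xi) (B * C * D)"
  "\<And>u xi xi' C D D'. hb (3/4) u C ==> bb (-33/32) xi D ==> bb (-33/32) xi' D' ==> hb (-1/8) (Kc u xi xi') (B * C * D * D')"
  by auto
 note w = hb_weaken[of "-1/8" _ _ "-17/16"] hb_weaken[of "-1/8" _ _ "-5/16"]
 have A: "ansatz (N1 xi Xi) (N2 xi Xi) (N3 xi) (N4 xi) (4 * B * D^2)"
  if g: "bb (-33/32) xi D" and g2: "bb (-1/16) Xi D" and D: "1 \<le> D" for xi Xi D
 proof
  have D2: "D \<le> D^2" "1 \<le> D^2" using D by (auto simp: power2_eq_square mult_ge1_I)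
  have "1 * 1 \<le> 4 * B * D^2" using B(1) D2 by (intro mult_mono) auto
  then show "1 \<le> 4 * B * D^2" by simp
  have m: "B * C * D + (B * C * D * D + B * C * D) \<le> 4 * B * D^2 * C" "B * C * D \<le> 4 * B * D^2 * C" if "0 \<le> C" for C
  proof -
   have 1: "(B * C) * D \<le> (B * C) * D^2" using D2 B(1) that by (intro mult_left_mono) auto
   have 0: "0 \<le> (B * C) * D^2" using B(1) that by simp
   have e: "B * C * D * D = (B * C) * D^2" "4 * B * D^2 * C = 4 * ((B * C) * D^2)" by (simp_all add: power2_eq_square)
   show "B * C * D + (B * C * D * D + B * C * D) \<le> 4 * B * D^2 * C" "B * C * D \<le> 4 * B * D^2 * C"
    unfolding e using 0 1 by linarith+
  qed
  fix u u' :: tdist and C C' z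
  assume u: "hb (3/4) u C"
  note m = m[OF hb_nonneg[OF u]]
  have k: "hb (-1/8) (Kc u xi xi + tprod u Xi) (B * C * D * D + B * C * D)"
   by (rule hb_add'[OF B(7)[OF u g g] B(6)[OF u g2]])
  show "hb (-17/16) (N1 xi Xi u) (4 * B * D^2 * C)"
   unfolding N1_def by (rule hb_mono[OF hb_add'[OF B(2)[OF u g] w(1)[OF k]] m(1)]) simp
  show "hb (-5/16) (N2 xi Xi u) (4 * B * D^2 * C)"
   unfolding N2_def by (rule hb_mono[OF hb_add'[OF B(3)[OF u g] w(2)[OF k]] m(1)]) simp
  show "hb (15/16) (N3 xi u) (4 * B * D^2 * C)"
   unfolding N3_def by (rule hb_mono[OF B(4)[OF u g] m(2)])
  show "cor ((jap k)^2) * N3 xi u k = N1 xi Xi u k - N2 xi Xi u k" for k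
   unfolding N3_def F3_def para_leibniz[OF u g] by (simp add: N1_def N2_def F1_def F2_def)
  assume u': "hb (3/4) u' C'"
  note l = bil_left[OF noise_bilinear(1) u u' g, of z] bil_left[OF noise_bilinear(2) u u' g, of z] bil_left[OF noise_bilinear(3) u u' g, of z]
   bil_left[OF noise_bilinear(5) u u' g2, of z] Kc_linear1[OF u u' g g, of z]
  show "N1 xi Xi (scale z u + u') = scale z (N1 xi Xi u) + N1 xi Xi u'" unfolding N1_def l scale_add by (simp only: add_ac)
  show "N2 xi Xi (scale z u + u') = scale z (N2 xi Xi u) + N2 xi Xi u'" unfolding N2_def l scale_add by (simp only: add_ac)
  show "N3 xi (scale z u + u') = scale z (N3 xi u) + N3 xi u'" unfolding N3_def l ..
 next
  fix v v' :: tdist and C C' z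
  assume v: "hb (17/16) v C"
  have D2: "D \<le> D^2" using D by (auto simp: power2_eq_square)
  have "(B * C) * D \<le> (B * C) * (4 * D^2)" using D2 B(1) hb_nonneg[OF v] D by (intro mult_left_mono) auto
  then have m: "B * C * D \<le> 4 * B * D^2 * C" by (simp add: mult_ac)
  show "hb 0 (N4 xi v) (4 * B * D^2 * C)" unfolding N4_def by (rule hb_mono[OF B(5)[OF v g] m])
  assume v': "hb (17/16) v' C'"
  show "N4 xi (scale z v + v') = scale z (N4 xi v) + N4 xi v'" unfolding N4_def by (rule bil_left[OF noise_bilinear(4) v v' g])
 qed
 have E: "(hb (3/4) u C --> hb (-17/16) (N1 xi' Xi' u - N1 xi Xi u) (4 * B * D * eta * C) \<and>
     hb (-5/16) (N2 xi' Xi' u - N2 xi Xi u) (4 * B * D * eta * C) \<and> hb (15/16) (N3 xi' u - N3 xi u) (4 * B * D * eta * C)) \<and>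
    (hb (17/16) u C --> hb 0 (N4 xi' u - N4 xi u) (4 * B * D * eta * C))"
  if g: "bb (-33/32) xi D" "bb (-33/32) xi' D" "bb (-33/32) (xi' - xi) eta" and g2: "bb (-1/16) Xi D" "bb (-1/16) Xi' D" "bb (-1/16) (Xi' - Xi) eta"
   and D: "1 \<le> D" for xi Xi xi' Xi' D eta u C
 proof (intro conjI impI)
  have eta: "0 \<le> eta" by (rule bb_nonneg[OF g(3)])
  have m2: "B * C * eta \<le> 4 * B * D * eta * C" if "0 \<le> C" for C
  proof -
   have "(B * C * eta) * 1 \<le> (B * C * eta) * (4 * D)" using B(1) that eta D by (intro mult_left_mono) auto
   then show ?thesis by (simp add: mult_ac)
  qed
  {
   assume u: "hb (3/4) u C"
   have C: "0 \<le> C" by (rule hb_nonneg[OF u])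
   have m: "B * C * eta + ((B * C * eta * D + B * C * D * eta) + B * C * eta) \<le> 4 * B * D * eta * C"
   proof -
    have "(B * C * eta) * 1 \<le> (B * C * eta) * D" using B(1) C eta D by (intro mult_left_mono) auto
    then show ?thesis by (simp add: algebra_simps)
   qed
   have k: "hb (-1/8) ((Kc u (xi' - xi) xi' + Kc u xi (xi' - xi)) + tprod u (Xi' - Xi)) ((B * C * eta * D + B * C * D * eta) + B * C * eta)"
    by (rule hb_add'[OF hb_add'[OF B(7)[OF u g(3,2)] B(7)[OF u g(1,3)]] B(6)[OF u g2(3)]])
   have "N1 xi' Xi' u - N1 xi Xi u = F1 u (xi' - xi) + ((Kc u (xi' - xi) xi' + Kc u xi (xi' - xi)) + tprod u (Xi' - Xi))"
    unfolding N1_def Kc_diff[OF u g(1,2), symmetric] bil_diff_right[OF noise_bilinear(1) u g(1,2)] bil_diff_right[OF noise_bilinear(5) u g2(1,2)]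
    by (simp only: add_ac diff_conv_add_uminus minus_add_distrib)
   then show "hb (-17/16) (N1 xi' Xi' u - N1 xi Xi u) (4 * B * D * eta * C)"
    by (simp only:) (rule hb_mono[OF hb_add'[OF B(2)[OF u g(3)] w(1)[OF k]] m], simp)
   have "N2 xi' Xi' u - N2 xi Xi u = F2 u (xi' - xi) + ((Kc u (xi' - xi) xi' + Kc u xi (xi' - xi)) + tprod u (Xi' - Xi))"
    unfolding N2_def Kc_diff[OF u g(1,2), symmetric] bil_diff_right[OF noise_bilinear(2) u g(1,2)] bil_diff_right[OF noise_bilinear(5) u g2(1,2)]
    by (simp only: add_ac diff_conv_add_uminus minus_add_distrib)
   then show "hb (-5/16) (N2 xi' Xi' u - N2 xi Xi u) (4 * B * D * eta * C)"
    by (simp only:) (rule hb_mono[OF hb_add'[OF B(3)[OF u g(3)] w(2)[OF k]] m], simp)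
   show "hb (15/16) (N3 xi' u - N3 xi u) (4 * B * D * eta * C)"
    unfolding N3_def bil_diff_right[OF noise_bilinear(3) u g(1,2), symmetric] by (rule hb_mono[OF B(4)[OF u g(3)] m2[OF C]])
  }
  assume v: "hb (17/16) u C"
  show "hb 0 (N4 xi' u - N4 xi u) (4 * B * D * eta * C)"
   unfolding N4_def bil_diff_right[OF noise_bilinear(4) v g(1,2), symmetric] by (rule hb_mono[OF B(5)[OF v g(3)] m2[OF hb_nonneg[OF v]]])
 qed
 show ?thesis by (rule exI[of _ "4 * B"]) (use A E B(1) in \<open>auto simp del: mult.assoc\<close>)
qed

end

section \<open>Identification with the Anderson operators\<close>

lemma hb_jap_sq: "hb 0 (\<lambda>k. cor ((jap k)^2) * u k) C \<longleftrightarrow> hb 2 u C"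
 unfolding hb_def norm_mult norm_of_real by (simp del: of_real_power)

lemma jap_sq_inv_lap: "cor ((jap k)^2) * inv_one_minus_lap f k = f k" by (simp add: inv_lap_apply)

lemma laplacian_jap: "laplacian u k = u k - cor ((jap k)^2) * u k"
 by (simp add: laplacian_def jap_sq algebra_simps)

lemma tprod_const_fun: "tprod u (const_fun c) = scale c u"
proof
 fix k
 have "tprod u (const_fun c) k = tprod (const_fun c) u k" by (simp only: tprod_commute)
 also have "\<dots> = (\<Sum>l\<in>{0}. const_fun c l * u (k - l))"
  by (rule tprod_finite) (auto simp: const_fun_def split: if_splits)
 finally show "tprod u (const_fun c) k = scale c u k" by (simp add: const_fun_def scale_def)
qed

lemma fs_const_fun: "fs (const_fun c)"
 by (rule finite_subset[of _ "{0}"]) (auto simp: const_fun_def split: if_splits)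

definition shift :: "int \<times> int => tdist => tdist" where "shift l u = (\<lambda>k. u (k - l))"

lemma hb_shift: assumes "hb 0 u C" shows "hb 0 (shift l u) C" unfolding hb_def
proof (intro allI impI)
 fix A :: "(int \<times> int) set" assume "finite A"
 moreover have "L2_set (\<lambda>k. jap k powr 0 * cmod (shift l u k)) A = L2_set (\<lambda>k. jap k powr 0 * cmod (u k)) ((\<lambda>k. k - l) ` A)"
  unfolding L2_set_def shift_def by (subst sum.reindex) (auto simp: inj_on_def)
 ultimately show "L2_set (\<lambda>k. jap k powr 0 * cmod (shift l u k)) A \<le> C" using hbD[OF assms] by auto
qed

lemma hb_tprod_fs:
 assumes "fs xi" "hb 0 u C" shows "hb 0 (tprod xi u) ((\<Sum>l | xi l \<noteq> 0. cmod (xi l)) * C)"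
proof -
 have "hb 0 (\<lambda>k. \<Sum>l | xi l \<noteq> 0. xi l * shift l u k) (\<Sum>l | xi l \<noteq> 0. cmod (xi l) * C)"
  by (intro hb_sum assms hb_cmult hb_shift)
 then show ?thesis by (simp add: tprod_finite[OF assms(1) order_refl, symmetric] shift_def sum_distrib_right)
qed

context lp begin

lemma inv_lap_fs: "fs xi ==> fs (inv_one_minus_lap xi)" by (erule fs_mono) (simp add: inv_lap_apply)

lemma resonant_supp:
 assumes f: "\<And>k. f k \<noteq> 0 ==> nf k \<le> R" and g: "\<And>k. g k \<noteq> 0 ==> nf k \<le> S" and nz: "reso f g k \<noteq> 0"
 shows "nf k \<le> R + S"
proof (rule ccontr)
 assume k: "\<not> ?thesis"
 from hb_fs[OF fs_freq[OF f]] obtain C where C: "hb 1 f C" by blast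
 from bb_fs'[OF fs_freq[OF g]] obtain D where D: "bb 1 g D" by blast
 have "tprod (fat n f) (blk n g) k = 0" for n
 proof (rule ccontr)
  assume "tprod (fat n f) (blk n g) k \<noteq> 0"
  then have "nf k \<le> R + S"
   by (rule tprod_supp_jap[rotated 2]) (auto simp: fat_def blk_def intro: f g)
  with k show False by simp
 qed
 then have "reso f g k = 0" using resonant_eq_sum(2)[OF C D] by simp
 with nz show False ..
qed

lemma fs_resonant: assumes "fs f" "fs g" shows "fs (reso f g)"
proof -
 have *: "\<exists>R. \<forall>k. f k \<noteq> 0 --> nf k \<le> R" if "fs f" for f :: tdist
 proof (intro exI allI impI)
  fix k assume "f k \<noteq> 0"
  then show "nf k \<le> (\<Sum>k | f k \<noteq> 0. nf k)" using that by (intro member_le_sum) auto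
 qed
 from *[OF assms(1)] *[OF assms(2)] obtain R S where "\<forall>k. f k \<noteq> 0 --> nf k \<le> R" "\<forall>k. g k \<noteq> 0 --> nf k \<le> S" by blast
 then show ?thesis by (intro fs_freq[of _ "R + S"] resonant_supp) auto
qed

text \<open>Applying 1 - \<Delta> to the remainder reproduces all terms of the operator that are too
  singular for L2, with the opposite sign. What survives is in L2, so the image lies in L2 exactly
  when the remainder lies in H^2.\<close>

lemma Opr_plus_remainder:
 assumes u: "hb (3/4) u C" and g: "bb (-33/32) xi D" and g2: "bb (-1/16) Xi D'"
 shows "(laplacian u + N1 xi Xi u + w) k + cor ((jap k)^2) * ansatz_R chi rho xi Xi u k
   = (u + (Kc u xi xi + (par Xi u + reso u Xi)) + w) k"
proof -
 let ?X = "inv_one_minus_lap xi"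
 have R: "cor ((jap k)^2) * ansatz_R chi rho xi Xi u k = cor ((jap k)^2) * u k - cor ((jap k)^2) * par u ?X k
   - (par (laplacian u) ?X + scale 2 (para_grad chi rho u ?X) + par xi u + par u Xi) k"
  by (simp add: ansatz_R_def ansatz_B_def Let_def right_diff_distrib jap_sq_inv_lap del: of_real_power)
 have t: "tprod u Xi = par u Xi + par Xi u + reso u Xi"
  by (rule tprod_decomposition_HC(1)[OF u g2]) auto
 show ?thesis unfolding R para_leibniz[OF u g]
  by (simp add: N1_def F1_def t laplacian_jap algebra_simps)
qed

lemma Opr_L2_iff:
 assumes u: "hb (3/4) u C" and g: "bb (-33/32) xi D" and g2: "bb (-1/16) Xi D'" and w: "hb 0 w E"
 shows "(\<exists>C. hb 0 (laplacian u + N1 xi Xi u + w) C) \<longleftrightarrow> (\<exists>C. hb 2 (ansatz_R chi rho xi Xi u) C)"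
proof -
 let ?W = "u + (Kc u xi xi + (par Xi u + reso u Xi)) + w"
 let ?J = "\<lambda>k. cor ((jap k)^2) * ansatz_R chi rho xi Xi u k" and ?O = "laplacian u + N1 xi Xi u + w"
 from hb_Kc obtain B where "hb (11/16) (Kc u xi xi) (B * C * D * D)" using u g by blast
 then have 1: "hb 0 (Kc u xi xi) (B * C * D * D)" by (rule hb_weaken) simp
 have "bil (\<lambda>u g. par g u) (3/4) (-1/16) 0" by (rule bil_para_flip) auto
 from bil_bound[OF this] obtain B2 where 2: "hb 0 (par Xi u) (B2 * C * D')" using u g2 by blast
 have "bil reso (3/4) (-1/16) 0" by (rule bil_resonant) auto
 from bil_bound[OF this] obtain B3 where 3: "hb 0 (reso u Xi) (B3 * C * D')" using u g2 by blast
 have 0: "hb 0 u C" by (rule hb_weaken[OF u]) simp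
 from hb_add'[OF hb_add'[OF 0 hb_add'[OF 1 hb_add'[OF 2 3]]] w] obtain K where K: "hb 0 ?W K" by blast
 note pe = Opr_plus_remainder[OF u g g2, of w]
 have e: "?O = ?W - ?J" "?J = ?W - ?O"
  using pe by (rule_tac ext, simp only: fun_diff_def eq_diff_eq)+ (simp only: add.commute)
 show ?thesis unfolding hb_jap_sq[symmetric]
 proof
  assume "\<exists>C. hb 0 ?O C" then show "\<exists>C. hb 0 ?J C" using hb_diff'[OF K] e(2) by metis
 next
  assume "\<exists>C. hb 0 ?J C" then show "\<exists>C. hb 0 ?O C" using hb_diff'[OF K] e(1) by metis
 qed
qed

text \<open>A bootstrap makes the domain independent of \<gamma>. The term u \<prec> X lies in H^t
  for every t < 1 as soon as u has positive regularity, while \<open>ansatz_B\<close> and the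
  remainder lie in H^(17/16); hence membership at \<gamma> and at 3/4 are equivalent.\<close>

lemma anderson_eq:
 assumes g: "\<And>b. b < -1 ==> \<exists>D. bb b xi D" and g2: "bb (-1/16) Xi D'" and ga: "2/3 < ga" "ga < 1"
  and A: "ansatz (N1 xi Xi) (N2 xi Xi) (N3 xi) (N4 xi) M"
 shows "anderson_domain chi rho xi Xi ga = ansatz.Dom (N1 xi Xi) (N3 xi) (N4 xi)"
  and "u \<in> ansatz.Dom (N1 xi Xi) (N3 xi) (N4 xi) ==> snd (anderson chi rho xi Xi ga) u = ansatz.Opr (N1 xi Xi) (N3 xi) (N4 xi) u"
proof -
 interpret ansatz "N1 xi Xi" "N2 xi Xi" "N3 xi" "N4 xi" M by (rule A)
 let ?X = "inv_one_minus_lap xi" and ?B = "ansatz_B chi rho xi Xi" and ?R = "ansatz_R chi rho xi Xi"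
 from g[of "-33/32"] obtain D where D: "bb (-33/32) xi D" by auto
 have dec: "u = N3 xi u + ?B u + ?R u" "u - N3 xi u = ?B u + ?R u" for u
  by (simp_all add: ansatz_R_def N3_def F3_def)
 have hB: "\<exists>C. hb (17/16) (?B u) C" if u: "hb s u C" and s: "2/3 < s" "s < 1" for u s C
 proof -
  have "bil F2 s (-33/32) (-15/16)" using s by (intro bil_F2) auto
  from bil_bound[OF this] u D obtain B1 where 1: "hb (-15/16) (F2 u xi) (B1 * C * D)" by blast
  have "bil par s (-1/16) (-15/16)" using s by (intro bil_para) auto
  from bil_bound[OF this] u g2 obtain B2 where 2: "hb (-15/16) (par u Xi) (B2 * C * D')" by blast
  have "hb (-15/16 + 2) (inv_one_minus_lap (F2 u xi + par u Xi)) (B1 * C * D + B2 * C * D')"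
   by (intro hb_inv_lap hb_add' 1 2)
  then show ?thesis by (auto simp: ansatz_B_def Let_def F2_def)
 qed
 have h3: "\<exists>C. hb t (N3 xi u) C" if u: "hb s u C" and s: "0 < s" and t: "t < 1" for u s t C
 proof -
  \<comment> \<open>The midpoint of \<open>t - 2\<close> and \<open>-1\<close>: regular enough to
    place u \<prec> X in H^t, and still an exponent at which the noise is controlled.\<close>
  have "(t - 3) / 2 < -1" using t by simp
  from g[OF this] obtain D where D: "bb ((t - 3) / 2) xi D" by blast
  have "t < (t - 3) / 2 + 2" using t by (simp add: field_simps)
  then have "bil F3 s ((t - 3) / 2) t" using s by (intro bil_F3)
  from bil_bound[OF this] u D show ?thesis unfolding N3_def by blast
 qed
 have h34: "\<exists>C. hb (3/4) u C" if "hb ga u C" "hb 2 (?R u) C'" for u C C'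
 proof -
  from h3[OF that(1), of "3/4"] ga obtain C1 where 1: "hb (3/4) (N3 xi u) C1" by auto
  from hB[OF that(1) ga] obtain C2 where "hb (17/16) (?B u) C2" by blast
  then have 2: "hb (3/4) (?B u) C2" by (rule hb_weaken) simp
  have 3: "hb (3/4) (?R u) C'" by (rule hb_weaken[OF that(2)]) simp
  from hb_add'[OF hb_add'[OF 1 2] 3] show ?thesis unfolding dec(1)[of u, symmetric] by blast
 qed
 have hv: "\<exists>C. hb (17/16) (u - N3 xi u) C" if "hb (3/4) u C" "hb 2 (?R u) C'" for u C C'
 proof -
  from hB[OF that(1)] obtain C2 where 2: "hb (17/16) (?B u) C2" by auto
  have 3: "hb (17/16) (?R u) C'" by (rule hb_weaken[OF that(2)]) simp
  from hb_add'[OF 2 3] show ?thesis unfolding dec(2) by blast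
 qed
 show eq: "anderson_domain chi rho xi Xi ga = Dom"
 proof (intro set_eqI iffI)
  fix u assume "u \<in> anderson_domain chi rho xi Xi ga"
  then obtain C C' where u: "hb ga u C" and R: "hb 2 (?R u) C'" unfolding anderson_domain_def sobolev_iff by blast
  from h34[OF u R] obtain C1 where u1: "hb (3/4) u C1" by blast
  from hv[OF u1 R] obtain C2 where v: "hb (17/16) (u - N3 xi u) C2" by blast
  from Opr_L2_iff[OF u1 D g2 b4[OF v]] R obtain C3 where "hb 0 (Opr u) C3" unfolding Opr_def by blast
  with u1 v show "u \<in> Dom" by (intro DomI)
 next
  fix u assume "u \<in> Dom"
  then obtain C C' C'' where u: "hb (3/4) u C" "hb (17/16) (u - N3 xi u) C'" "hb 0 (Opr u) C''" by (rule DomE)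
  from Opr_L2_iff[OF u(1) D g2 b4[OF u(2)]] u(3) have "\<exists>C. hb 2 (?R u) C" unfolding Opr_def by blast
  moreover have "\<exists>C. hb ga u C"
  proof -
   from h3[OF u(1), of ga] ga obtain C1 where 1: "hb ga (N3 xi u) C1" by auto
   have 2: "hb ga (u - N3 xi u) C'" by (rule hb_weaken[OF u(2)]) (use ga in simp)
   from hb_add'[OF 1 2] show ?thesis by auto
  qed
  ultimately show "u \<in> anderson_domain chi rho xi Xi ga" unfolding anderson_domain_def sobolev_iff by blast
 qed
 assume "u \<in> Dom"
 then have "u \<in> anderson_domain chi rho xi Xi ga" using eq by simp
 then obtain C C' where u: "hb ga u C" and R: "hb 2 (?R u) C'" unfolding anderson_domain_def sobolev_iff by blast
 from hB[OF u ga] obtain C2 where B: "hb (17/16) (?B u) C2" by blast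
 have R': "hb (17/16) (?R u) C'" by (rule hb_weaken[OF R]) simp
 have "N4 xi (?B u + ?R u) = N4 xi (?B u) + N4 xi (?R u)" using l4[OF B R', of 1] by simp
 then show "snd (anderson chi rho xi Xi ga) u = Opr u"
  unfolding Opr_def dec(2) by (simp add: anderson_def resonant_noise_def N1_def N4_def F1_def Kc_def add_ac)
qed

text \<open>For trigonometric polynomials the commutator is explicit, and the products with the
  resonant part of X and \<xi> cancel between it and u \<Xi>. The remaining resonant terms recombine
  to u \<circ> \<xi>, and the constant subtracted in \<open>Xi\<close> leaves precisely
  \<open>- scale c u\<close>. The product with \<xi> is bounded on L2, so the domain is that of the
  Laplacian.\<close>

lemma approx_eq: assumes xi: "fs xi" and Xi: "Xi = reso xi (inv_one_minus_lap xi) - const_fun c"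
  and A: "ansatz (N1 xi Xi) (N2 xi Xi) (N3 xi) (N4 xi) M"
 shows "ansatz.Dom (N1 xi Xi) (N3 xi) (N4 xi) = sobolev 2"
  and "u \<in> sobolev 2 ==> ansatz.Opr (N1 xi Xi) (N3 xi) (N4 xi) u = laplacian u + tprod xi u - scale c u"
proof -
 interpret ansatz "N1 xi Xi" "N2 xi Xi" "N3 xi" "N4 xi" M by (rule A)
 let ?X = "inv_one_minus_lap xi"
 have X: "fs ?X" by (rule inv_lap_fs[OF xi])
 from bb_fs'[OF xi] obtain D where D: "bb 1 xi D" by blast
 from bb_fs'[OF X] obtain D2 where D2: "bb 2 ?X D2" by blast
 from hb_fs[OF xi] obtain E where E: "hb 0 xi E" by blast
 have O: "Opr u = laplacian u + tprod xi u - scale c u" if u: "hb (3/4) u C" for u C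
 proof -
  have Kc: "Kc u xi xi = reso (N3 xi u) xi - tprod u (reso ?X xi)"
   unfolding Kc_def N3_def F3_def by (rule commutator_fs[OF u _ X xi]) simp
  have "Xi = scale (-1) (const_fun c) + reso ?X xi"
   unfolding Xi resonant_commute[of xi] by (simp add: scale_def fun_eq_iff)
  then have "tprod u Xi = scale (-1) (tprod u (const_fun c)) + tprod u (reso ?X xi)"
   by (simp only:) (rule ext, simp only: tprod_linear_right[OF fs_const_fun fs_resonant[OF X xi]] plus_fun_apply scale_apply)
  then have t: "tprod u Xi = tprod u (reso ?X xi) - scale c u"
   unfolding tprod_const_fun by (simp add: scale_def fun_eq_iff)
  from b3[OF u] have v3: "hb (3/4) (N3 xi u) (M * C)" by (rule hb_weaken) simp
  have "bil reso (3/4) 1 0" by (rule bil_resonant) auto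
  from bil_left[OF this v3 hb_diff'[OF u v3] D, of 1]
  have r: "reso u xi = reso (N3 xi u) xi + N4 xi (u - N3 xi u)" by (simp add: N4_def)
  have "tprod xi u = par u xi + par xi u + reso u xi"
   unfolding tprod_commute[of xi] by (rule tprod_decomposition_HC(1)[OF u D]) auto
  then show ?thesis unfolding Opr_def N1_def F1_def Kc t r by (simp add: algebra_simps)
 qed
 have O2: "Opr u = laplacian u + tprod xi u - scale c u" if "hb 2 u C" for u C
  by (rule O, rule hb_weaken[OF that]) simp
 then show "u \<in> sobolev 2 ==> Opr u = laplacian u + tprod xi u - scale c u" unfolding sobolev_iff by blast
 show "Dom = sobolev 2"
 proof (intro set_eqI iffI)
  fix u assume "u \<in> Dom"
  then obtain C C' C'' where u: "hb (3/4) u C" "hb 0 (Opr u) C''" by (rule DomE)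
  have u0: "hb 0 u C" by (rule hb_weaken[OF u(1)]) simp
  from hb_tprod_fs[OF xi u0] obtain T where T: "hb 0 (tprod xi u) T" by blast
  have "(\<lambda>k. cor ((jap k)^2) * u k) = u - (Opr u - tprod xi u + scale c u)"
   unfolding O[OF u(1)] by (simp add: fun_eq_iff laplacian_jap)
  moreover have "hb 0 (u - (Opr u - tprod xi u + scale c u)) (C + (C'' + T + cmod c * C))"
   by (intro hb_diff' hb_add' hb_scale u u0 T)
  ultimately show "u \<in> sobolev 2" unfolding sobolev_iff hb_jap_sq[symmetric] by metis
 next
  fix u assume "u \<in> sobolev 2"
  then obtain C where u: "hb 2 u C" unfolding sobolev_iff by blast
  have u1: "hb (3/4) u C" "hb (17/16) u C" "hb 0 u C" by (rule hb_weaken[OF u], simp)+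
  from hb_tprod_fs[OF xi u1(3)] obtain T where T: "hb 0 (tprod xi u) T" by blast
  have "bil par (3/4) 2 (17/16)" by (rule bil_para) auto
  from bil_bound[OF this] u1(1) D2 obtain B where "hb (17/16) (N3 xi u) (B * C * D2)" unfolding N3_def F3_def by blast
  from hb_diff'[OF u1(2) this] have v: "hb (17/16) (u - N3 xi u) (C + B * C * D2)" .
  have "hb 0 (laplacian u + tprod xi u - scale c u) (C + T + cmod c * C)"
   using hb_laplacian[OF u] by (intro hb_diff' hb_add' hb_scale T u1) simp
  then have "hb 0 (Opr u) (C + T + cmod c * C)" unfolding O[OF u1(1)] .
  with u1 v show "u \<in> Dom" by (intro DomI)
 qed
qed

end

section \<open>Symmetry, coercivity and passage to the limit\<close>

lemma shift_L2: "u \<in> L2 ==> shift l u \<in> L2" unfolding L2_iff using hb_shift by blast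

lemma L2_inner_shift: "L2_inner (shift l u) v = L2_inner u (shift (- l) v)"
proof -
 have "bij_betw (\<lambda>k. k + l) UNIV UNIV" by (rule bij_betwI[where g = "\<lambda>k. k - l"]) auto
 from infsum_reindex_bij_betw[OF this, of "\<lambda>k. shift l u k * cnj (v k)"]
 show ?thesis by (simp add: L2_inner_def shift_def)
qed

lemma sum_fun_apply: "(\<Sum>i\<in>I. f i) k = (\<Sum>i\<in>I. f i k)" for f :: "'i => tdist"
 by (induction I rule: infinite_finite_induct) auto

lemma tprod_shift: "fs xi ==> tprod xi u = (\<Sum>l | xi l \<noteq> 0. scale (xi l) (shift l u))"
 by (rule ext) (simp add: tprod_finite[OF _ order_refl] sum_fun_apply scale_def shift_def)

lemma L2_inner_sum_left: assumes "finite I" "\<And>i. i \<in> I ==> f i \<in> L2" "g \<in> L2"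
 shows "L2_inner (\<Sum>i\<in>I. f i) g = (\<Sum>i\<in>I. L2_inner (f i) g) \<and> (\<Sum>i\<in>I. f i) \<in> L2"
 using assms(1,2)
proof (induction I rule: finite_induct)
 case empty
 have "L2_inner 0 g = 0" by (simp add: L2_inner_def)
 with L2_zero show ?case by (simp only: sum.empty simp_thms)
next
 case (insert i I)
 then have "L2_inner (\<Sum>i\<in>I. f i) g = (\<Sum>i\<in>I. L2_inner (f i) g)" "(\<Sum>i\<in>I. f i) \<in> L2" "f i \<in> L2" by auto
 then show ?case
  unfolding sum.insert[OF insert(1,2)] using L2_inner_add_left[OF _ _ assms(3)] L2_add by metis
qed

lemma L2_inner_tprod_left: assumes "fs xi" "u \<in> L2" "v \<in> L2"
 shows "L2_inner (tprod xi u) v = (\<Sum>l | xi l \<noteq> 0. xi l * L2_inner (shift l u) v)"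
 unfolding tprod_shift[OF assms(1)]
 by (subst L2_inner_sum_left[THEN conjunct1]) (use assms in \<open>auto simp: L2_inner_scale_left shift_L2\<close>)

lemma tprod_L2: assumes "fs xi" "u \<in> L2" shows "tprod xi u \<in> L2"
 using assms(2) hb_tprod_fs[OF assms(1)] unfolding L2_iff by blast

lemma tprod_sym:
 assumes xi: "fs xi" and r: "\<And>k. xi (- k) = cnj (xi k)" and u: "u \<in> L2" and v: "v \<in> L2"
 shows "L2_inner (tprod xi u) v = L2_inner u (tprod xi v)"
proof -
 let ?A = "{l. xi l \<noteq> 0}"
 have b: "bij_betw uminus ?A ?A" by (rule bij_betwI[where g = uminus]) (auto simp: r)
 have "L2_inner u (tprod xi v) = (\<Sum>l\<in>?A. cnj (xi l) * L2_inner u (shift l v))"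
  unfolding L2_inner_commute[of u] L2_inner_tprod_left[OF xi v u] by simp
 also have "\<dots> = (\<Sum>l\<in>?A. cnj (xi (- l)) * L2_inner u (shift (- l) v))"
  by (rule sum.reindex_bij_betw[OF b, symmetric])
 finally show ?thesis unfolding L2_inner_tprod_left[OF xi u v] by (simp add: r L2_inner_shift)
qed

lemma tprod_form_bound: assumes "fs xi" "u \<in> L2"
 shows "cmod (L2_inner (tprod xi u) u) \<le> (\<Sum>l | xi l \<noteq> 0. cmod (xi l)) * (L2_norm u)^2"
proof -
 note b = hb_tprod_fs[OF assms(1) L2_norm_hb[OF assms(2)]]
 have "cmod (L2_inner (tprod xi u) u) \<le> L2_norm (tprod xi u) * L2_norm u" by (intro L2_inner_le tprod_L2 assms)
 also have "\<dots> \<le> (\<Sum>l | xi l \<noteq> 0. cmod (xi l)) * L2_norm u * L2_norm u"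
  by (intro mult_right_mono L2_norm_le[OF b] L2_norm_nonneg)
 finally show ?thesis by (simp add: power2_eq_square mult.assoc)
qed

lemma laplacian_L2: "u \<in> sobolev 2 ==> laplacian u \<in> L2"
 unfolding sobolev_iff L2_iff using hb_laplacian[of 2] by force

lemma laplacian_sym: "L2_inner (laplacian u) v = L2_inner u (laplacian v)"
 unfolding L2_inner_def laplacian_def by (rule infsum_cong) simp

lemma laplacian_nonpos: assumes "u \<in> sobolev 2" shows "Re (L2_inner (laplacian u) u) \<le> 0"
proof -
 have u: "u \<in> L2" using assms hb_weaken[of 2 u _ 0] unfolding sobolev_iff L2_iff by fastforce
 have "((\<lambda>k. laplacian u k * cnj (u k)) has_sum L2_inner (laplacian u) u) UNIV"
  unfolding L2_inner_def by (rule has_sum_infsum[OF L2_inner_summable[OF laplacian_L2[OF assms] u]])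
 from has_sum_Re[OF this] have "((\<lambda>k. - (Re (laplacian u k * cnj (u k)))) has_sum - Re (L2_inner (laplacian u) u)) UNIV"
  by (rule has_sum_uminusI)
 moreover have "0 \<le> - (Re (laplacian u k * cnj (u k)))" for k
 proof -
  have "laplacian u k * cnj (u k) = cor (- (4 * pi^2 * (nf k)^2) * (cmod (u k))^2)"
   by (simp add: laplacian_def complex_norm_square[symmetric] mult.assoc)
  then show ?thesis by (simp only: Re_complex_of_real) simp
 qed
 ultimately have "0 \<le> - Re (L2_inner (laplacian u) u)" by (rule has_sum_nonneg)
 then show ?thesis by simp
qed

context ansatz begin

definition Sol :: "real => tdist => tdist" where
 "Sol mu f = (SOME u. u \<in> Dom \<and> scale (cor mu) u - Opr u = f)"

lemma Sol: assumes "(6 * M) ^ 16 \<le> mu" "f \<in> L2"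
 shows "Sol mu f \<in> Dom" "scale (cor mu) (Sol mu f) - Opr (Sol mu f) = f"
proof -
 from assms(2) obtain F where "hb 0 f F" unfolding L2_iff by blast
 from solution_exists[OF assms(1) this] have "\<exists>u. u \<in> Dom \<and> scale (cor mu) u - Opr u = f" by blast
 from someI_ex[OF this] show "Sol mu f \<in> Dom" "scale (cor mu) (Sol mu f) - Opr (Sol mu f) = f"
  unfolding Sol_def by blast+
qed

lemma Sol_eq: "(6 * M) ^ 16 \<le> mu ==> u \<in> Dom ==> Sol mu (scale (cor mu) u - Opr u) = u"
 by (rule solution_unique[OF _ Sol(1)]) (auto simp: Sol(2) Dom_L2)

lemma Dom_norm_le: assumes l: "(6 * M) ^ 16 \<le> mu" and u: "u \<in> Dom"
 shows "hb (3/4) u (L2_norm (scale (cor mu) u - Opr u))"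
proof -
 let ?f = "scale (cor mu) u - Opr u"
 have f: "?f \<in> L2" using Dom_L2[OF u] by simp
 have hb: "hb (3/4) u (2 * (mu powr (-19/32) * L2_norm ?f))"
  using solution_bound[OF l u refl L2_norm_hb[OF f]] by (simp add: pb_def)
 have "6 ^ 16 \<le> (6 * M) ^ 16" using M by (intro power_mono) auto
 then have m: "6 ^ 16 \<le> mu" using l by linarith
 have "2 * mu powr (-19/32) \<le> 2 * mu powr (-1/16)" using contraction_Tm(1)[OF l] by (intro mult_left_mono powr_mono) auto
 also have "\<dots> \<le> 1" using powr_16_le[OF _ m] by simp
 finally have "2 * mu powr (-19/32) \<le> 1" by simp
 from mult_right_mono[OF this L2_norm_nonneg[of ?f]] show ?thesis by (intro hb_mono[OF hb]) simp
qed

text \<open>A substitute for the spectral theorem. Let T = mu - A be symmetric and nonnegative with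
  an inverse of norm at most 1. Nonnegativity tested on u minus the inverse image g of u gives that
  the forms of (T u, u) and (u, g) add up to at least twice the square of the norm of u, and the
  second is at most that square once.\<close>

lemma coercive_step:
 assumes sym: "\<And>u v. u \<in> Dom ==> v \<in> Dom ==> L2_inner (Opr u) v = L2_inner u (Opr v)"
  and l: "(6 * M) ^ 16 \<le> mu"
  and pos: "\<And>u. u \<in> Dom ==> 0 \<le> Re (L2_inner (scale (cor mu) u - Opr u) u)"
  and u: "u \<in> Dom" shows "(L2_norm u)^2 \<le> Re (L2_inner (scale (cor mu) u - Opr u) u)"
proof -
 let ?T = "\<lambda>u. scale (cor mu) u - Opr u"
 have uL: "u \<in> L2" "Opr u \<in> L2" using Dom_L2[OF u] .
 define f where "f = ?T u"
 define g where "g = Sol mu u"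
 have g: "g \<in> Dom" "?T g = u" using Sol[OF l uL(1)] by (auto simp: g_def)
 have gL: "g \<in> L2" "Opr g \<in> L2" using Dom_L2[OF g(1)] .
 have fL: "f \<in> L2" using uL by (simp add: f_def)
 have fg: "L2_inner f g = cor ((L2_norm u)^2)"
 proof -
  have "L2_inner f g = L2_inner u (?T g)"
   unfolding f_def using uL gL sym[OF u g(1)] by (simp add: L2_inner_diff_left L2_inner_diff_right L2_inner_scale_left L2_inner_scale_right)
  then show ?thesis using uL by (simp add: g(2) L2_inner_self)
 qed
 have d: "scale (-1) g + u \<in> Dom" by (rule Dom_linear(1)[OF g(1) u])
 have e: "scale (-1) g + u = u - g" by (simp add: scale_def fun_eq_iff)
 have "?T (scale (-1) g + u) = scale (-1) (?T g) + ?T u"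
  unfolding Dom_linear(2)[OF g(1) u] by (simp add: scale_def fun_eq_iff algebra_simps)
 then have "?T (u - g) = f - u" unfolding e g(2) f_def[symmetric] by (simp add: scale_def fun_eq_iff)
 then have "0 \<le> Re (L2_inner (f - u) (u - g))" using pos[OF d] unfolding e by simp
 also have "L2_inner (f - u) (u - g) = L2_inner f u - cor ((L2_norm u)^2) - (cor ((L2_norm u)^2) - L2_inner u g)"
  using uL gL fL by (simp add: L2_inner_diff_left L2_inner_diff_right fg L2_inner_self)
 finally have "2 * (L2_norm u)^2 \<le> Re (L2_inner f u) + Re (L2_inner u g)" by simp
 moreover have "Re (L2_inner u g) \<le> (L2_norm u)^2"
 proof -
  have "L2_norm g \<le> L2_norm u"
   using L2_norm_le[OF hb_weaken[OF Dom_norm_le[OF l g(1)], of 0]] by (simp add: g(2))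
  then have "L2_norm u * L2_norm g \<le> L2_norm u * L2_norm u" by (intro mult_left_mono L2_norm_nonneg)
  then show ?thesis using complex_Re_le_cmod[of "L2_inner u g"] L2_inner_le[OF uL(1) gL(1)] by (simp add: power2_eq_square)
 qed
 ultimately show ?thesis by (simp add: f_def)
qed

text \<open>Coercivity at \<open>mu + 1\<close> says that the form at \<open>mu\<close> is
  nonnegative, which is what \<open>coercive_step\<close> needs there. The descent starts where
  \<open>mu + real n\<close> exceeds the crude bound \<open>La\<close>, and \<open>La\<close> leaves
  no trace in the result.\<close>

lemma coercive:
 assumes sym: "\<And>u v. u \<in> Dom ==> v \<in> Dom ==> L2_inner (Opr u) v = L2_inner u (Opr v)"
  and base: "\<And>u. u \<in> Dom ==> Re (L2_inner (Opr u) u) \<le> La * (L2_norm u)^2"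
  and l: "(6 * M) ^ 16 \<le> mu" and u: "u \<in> Dom"
 shows "(L2_norm u)^2 \<le> Re (L2_inner (scale (cor mu) u - Opr u) u)"
proof -
 have form: "Re (L2_inner (scale (cor mu) u - Opr u) u) = mu * (L2_norm u)^2 - Re (L2_inner (Opr u) u)" if "u \<in> Dom" for u mu
  using Dom_L2[OF that] by (simp add: L2_inner_diff_left L2_inner_scale_left L2_inner_self del: of_real_power)
 have pos: "0 \<le> Re (L2_inner (scale (cor mu) u - Opr u) u)"
  if "(6 * M) ^ 16 \<le> mu" "La \<le> mu + real n" "u \<in> Dom" for mu n u using that
 proof (induction n arbitrary: mu u)
  case 0
  then have "La * (L2_norm u)^2 \<le> mu * (L2_norm u)^2" by (intro mult_right_mono) auto
  then show ?case unfolding form[OF 0(3)] using base[OF 0(3)] by linarith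
 next
  case (Suc n)
  have *: "(6 * M) ^ 16 \<le> mu + 1" "La \<le> mu + 1 + real n" using Suc.prems by auto
  from coercive_step[OF sym *(1) Suc.IH[OF *] Suc.prems(3)] show ?case
   unfolding form[OF Suc.prems(3)] by (simp add: distrib_right)
 qed
 obtain n where "La - mu \<le> real n" using real_arch_simple by blast
 then have "La \<le> mu + real n" by linarith
 from coercive_step[OF sym l pos[OF l this] u] show ?thesis .
qed

lemma resolvent_pairI: assumes l: "(6 * M) ^ 16 \<le> mu"
  and sym: "\<And>f g. f \<in> L2 ==> g \<in> L2 ==> L2_inner (Sol mu f) g = L2_inner f (Sol mu g)"
  and pos: "\<And>f. f \<in> L2 ==> (L2_norm (Sol mu f))^2 \<le> Re (L2_inner f (Sol mu f))"
  and h: "\<And>u. u \<in> Dom ==> h u = Opr u - scale (cor mu) u"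
 shows "resolvent_pair Dom h (Sol mu)"
proof
 fix u v z assume u: "u \<in> Dom"
 show "u \<in> L2" "h u \<in> L2" using Dom_L2[OF u] by (auto simp: h[OF u])
 have "- h u = scale (cor mu) u - Opr u" by (simp add: h[OF u])
 then show "Sol mu (- h u) = u" using Sol_eq[OF l u] by simp
 assume v: "v \<in> Dom"
 show uv: "scale z u + v \<in> Dom" by (rule Dom_linear(1)[OF u v])
 show "h (scale z u + v) = scale z (h u) + h v"
  unfolding h[OF u] h[OF v] h[OF uv] Dom_linear(2)[OF u v] by (simp add: scale_def fun_eq_iff algebra_simps)
next
 fix f assume f: "f \<in> L2"
 show S: "Sol mu f \<in> Dom" by (rule Sol(1)[OF l f])
 have "h (Sol mu f) = - (scale (cor mu) (Sol mu f) - Opr (Sol mu f))" unfolding h[OF S] by simp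
 then show "h (Sol mu f) = - f" unfolding Sol(2)[OF l f] .
 show "(L2_norm (Sol mu f))^2 \<le> Re (L2_inner f (Sol mu f))" by (rule pos[OF f])
 show "\<exists>u\<in>Dom. hb 0 (f - u) e" if "0 < e" for e by (rule Dom_dense[OF L2_norm_hb[OF f] that])
qed (rule sym)

lemma resolvent_pair_sym:
 assumes sym: "\<And>u v. u \<in> Dom ==> v \<in> Dom ==> L2_inner (Opr u) v = L2_inner u (Opr v)"
  and base: "\<And>u. u \<in> Dom ==> Re (L2_inner (Opr u) u) \<le> La * (L2_norm u)^2"
  and l: "(6 * M) ^ 16 \<le> mu" and h: "\<And>u. u \<in> Dom ==> h u = Opr u - scale (cor mu) u"
 shows "resolvent_pair Dom h (Sol mu)"
proof (rule resolvent_pairI[OF l _ _ h])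
 let ?T = "\<lambda>u. scale (cor mu) u - Opr u"
 have T: "L2_inner (?T u) v = L2_inner u (?T v)" if "u \<in> Dom" "v \<in> Dom" for u v
  using sym[OF that] Dom_L2[OF that(1)] Dom_L2[OF that(2)]
  by (simp add: L2_inner_diff_left L2_inner_diff_right L2_inner_scale_left L2_inner_scale_right)
 show "L2_inner (Sol mu f) g = L2_inner f (Sol mu g)" if "f \<in> L2" "g \<in> L2" for f g
  using T[OF Sol(1)[OF l that(1)] Sol(1)[OF l that(2)]] Sol(2)[OF l that(1)] Sol(2)[OF l that(2)] by simp
 show "(L2_norm (Sol mu f))^2 \<le> Re (L2_inner f (Sol mu f))" if "f \<in> L2" for f
  using coercive[OF sym base l Sol(1)[OF l that]] Sol(2)[OF l that] by simp
qed

lemma resolvent_pair_limit: assumes l: "(6 * M) ^ 16 \<le> mu"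
  and h: "\<And>u. u \<in> Dom ==> h u = Opr u - scale (cor mu) u"
  and lim: "\<And>e. 0 < e ==> \<exists>D' h' S'. resolvent_pair D' h' S' \<and> (\<forall>f\<in>L2. L2_norm (S' f - Sol mu f) \<le> e * L2_norm f)"
 shows "resolvent_pair Dom h (Sol mu)"
proof (rule resolvent_pairI[OF l _ _ h])
 let ?S = "Sol mu"
 have SL: "?S f \<in> L2" if "f \<in> L2" for f by (rule Dom_L2(1)[OF Sol(1)[OF l that]])
 have "\<forall>n. \<exists>S'. (\<exists>D' h'. resolvent_pair D' h' S') \<and> (\<forall>f\<in>L2. L2_norm (S' f - ?S f) \<le> inverse (real (Suc n)) * L2_norm f)"
  using lim by (metis inverse_positive_iff_positive of_nat_0_less_iff zero_less_Suc)
 then obtain V where V: "\<And>n. \<exists>D' h'. resolvent_pair D' h' (V n)" "\<And>n f. f \<in> L2 ==> L2_norm (V n f - ?S f) \<le> inverse (real (Suc n)) * L2_norm f"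
  by metis
 have VL: "V n f \<in> L2" if "f \<in> L2" for n f using V(1)[of n] resolvent_pair.S_L2 that by blast
 have inv: "(\<lambda>n. inverse (real (Suc n)) * c) \<longlonglongrightarrow> 0" for c
  using tendsto_mult[OF LIMSEQ_inverse_real_of_nat tendsto_const[of c]] by simp
 have lim: "(\<lambda>n. L2_inner f (V n g)) \<longlonglongrightarrow> L2_inner f (?S g)" if f: "f \<in> L2" and g: "g \<in> L2" for f g
 proof (rule LIM_zero_cancel, rule Lim_null_comparison[OF always_eventually inv[of "L2_norm g * L2_norm f"]], rule allI)
  fix n
  have "L2_inner f (V n g) - L2_inner f (?S g) = L2_inner f (V n g - ?S g)" using f g VL SL by (simp add: L2_inner_diff_right)
  also have "cmod \<dots> \<le> L2_norm f * L2_norm (V n g - ?S g)" using f g VL SL by (intro L2_inner_le) auto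
  also have "\<dots> \<le> L2_norm f * (inverse (real (Suc n)) * L2_norm g)" by (intro mult_left_mono V g L2_norm_nonneg)
  finally show "cmod (L2_inner f (V n g) - L2_inner f (?S g)) \<le> inverse (real (Suc n)) * (L2_norm g * L2_norm f)"
   by (simp only: mult_ac)
 qed
 fix f assume f: "f \<in> L2"
 have le: "L2_norm (?S f) \<le> sqrt (Re (L2_inner f (V n f))) + inverse (real (Suc n)) * L2_norm f" for n
 proof -
  have "L2_norm (V n f - (V n f - ?S f)) \<le> L2_norm (V n f) + L2_norm (V n f - ?S f)" using f SL VL by (intro L2_norm_diff) auto
  moreover have "L2_norm (V n f) \<le> sqrt (Re (L2_inner f (V n f)))"
   using V(1)[of n] resolvent_pair.S_pos f real_le_rsqrt by blast
  ultimately show ?thesis using V(2)[OF f, of n] by simp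
 qed
 have "L2_norm (?S f) \<le> sqrt (Re (L2_inner f (?S f))) + 0"
  by (rule LIMSEQ_le_const[OF tendsto_add[OF tendsto_real_sqrt[OF tendsto_Re[OF lim[OF f f]]] inv]]) (use le in blast)
 then show "(L2_norm (?S f))^2 \<le> Re (L2_inner f (?S f))"
  using L2_norm_nonneg[of "?S f"] by (simp add: sqrt_ge_absD)
 fix g assume g: "g \<in> L2"
 have "L2_inner (V n f) g = L2_inner f (V n g)" for n using V(1)[of n] resolvent_pair.S_sym f g by blast
 then have "L2_inner f (V n g) = cnj (L2_inner g (V n f))" for n by (metis L2_inner_commute)
 then have "L2_inner f (?S g) = cnj (L2_inner g (?S f))"
  using LIMSEQ_unique[OF lim[OF f g]] tendsto_cnj[OF lim[OF g f]] by simp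
 then show "L2_inner (?S f) g = L2_inner f (?S g)" by (metis L2_inner_commute)
qed

end

section \<open>Mollified noise and bounds uniform in the mollification\<close>

lemma op_norm_tendsto_zero':
 assumes "\<And>e. 0 < e ==> \<forall>\<^sub>F x in F. \<forall>f\<in>L2. L2_norm f \<le> 1 --> hb s (T x f) e"
 shows "((\<lambda>x. op_norm s (T x)) \<longlongrightarrow> 0) F"
proof (rule order_tendstoI)
 fix a :: ennreal assume "0 < a"
 then obtain e where e: "0 < e" "ennreal e < a"
 proof (cases a)
  case (real r)
  then show thesis using \<open>0 < a\<close> by (intro that[of "r / 2"]) (auto simp: ennreal_less_iff)
 next
  case top
  then show thesis by (intro that[of 1]) auto
 qed
 from assms[OF e(1)] show "\<forall>\<^sub>F x in F. op_norm s (T x) < a"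
 proof eventually_elim
  case (elim x)
  then have "op_norm s (T x) \<le> ennreal e" using e(1) by (intro op_norm_le) auto
  then show ?case using e(2) by (rule le_less_trans)
 qed
qed simp

text \<open>Near the origin the limit 1 gives the bound, away from it continuity on a compact set.
  The value at the origin is not tied to the limit, so it enters the bound on its own.\<close>

lemma mollifier_bounded:
 assumes "mollifier m" shows "\<exists>B\<ge>0. \<forall>x. \<bar>m x\<bar> \<le> B"
proof -
 from assms obtain b where b: "\<And>x. m x \<noteq> 0 ==> norm x \<le> b" unfolding mollifier_def by blast
 have lim: "(m \<longlongrightarrow> 1) (at 0)" and cont: "continuous_on (- {0}) m"
  using assms unfolding mollifier_def smooth_on_def by (blast, metis continuously_diff.simps(1))
 from lim have "\<forall>\<^sub>F x in at 0. dist (m x) 1 < 1" by (rule tendstoD) simp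
 then obtain d where d: "0 < d" "\<And>x. x \<noteq> 0 ==> dist x 0 < d ==> dist (m x) 1 < 1" unfolding eventually_at by blast
 let ?K = "cball (0 :: real \<times> real) b - ball 0 d"
 have "compact ?K" by (intro compact_diff compact_cball open_ball)
 moreover have "continuous_on ?K m" by (rule continuous_on_subset[OF cont]) (use d(1) in auto)
 ultimately have "bounded (m ` ?K)" by (intro compact_imp_bounded compact_continuous_image)
 then obtain B where B: "\<And>x. x \<in> ?K ==> \<bar>m x\<bar> \<le> B" unfolding bounded_iff by (force simp del: split_paired_All)
 have "\<bar>m x\<bar> \<le> max (max B 2) \<bar>m 0\<bar>" for x
 proof (cases "x = 0 \<or> m x = 0")
  case False
  show ?thesis
  proof (cases "norm x < d")
   case True
   then have "\<bar>m x - 1\<bar> < 1" using d(2)[of x] False by (simp add: dist_real_def)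
   then show ?thesis by linarith
  next
   case nd: False
   then have "x \<in> ?K" using b[of x] False by (auto simp: dist_norm)
   from B[OF this] show ?thesis by linarith
  qed
 qed auto
 then show ?thesis by (intro exI[of _ "max (max B 2) \<bar>m 0\<bar>"]) auto
qed

lemma mollify_supp:
 assumes m: "\<And>x. m x \<noteq> 0 ==> norm x \<le> b" and e: "0 < eps" and k: "mollify m eps f k \<noteq> 0"
 shows "nf k \<le> b / eps"
proof -
 have "m (eps *\<^sub>R freq k) \<noteq> 0" using k by (auto simp: mollify_def)
 from m[OF this] show ?thesis using e by (simp add: pos_le_divide_eq mult.commute)
qed

lemma mollify_real:
 assumes "radial m" "\<And>k. f (- k) = cnj (f k)" shows "mollify m eps f (- k) = cnj (mollify m eps f k)"
proof -
 have "m (eps *\<^sub>R freq (- k)) = m (eps *\<^sub>R freq k)"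
  using assms(1) unfolding radial_def freq_uminus by (metis norm_minus_cancel scaleR_minus_right)
 then show ?thesis by (simp add: mollify_def assms(2))
qed

context lp begin

definition ball_supp :: "real => real => tdist => bool" where
 "ball_supp R s f \<longleftrightarrow> (\<forall>k. f k \<noteq> 0 --> nf k \<le> R) \<and> (\<forall>k. cmod (f k) \<le> s)"

lemma ball_bounds: "\<exists>K. \<forall>f s. ball_supp R s f --> bb a f (K * s) \<and> hb a f (K * s)"
proof -
 let ?A = "{k. nf k \<le> R}"
 define J where "J = (\<Sum>k\<in>?A. jap k powr a)"
 define c where "c = la powr - a + cj powr - a"
 have J: "0 \<le> J" "0 \<le> c" by (auto simp: J_def c_def intro: sum_nonneg)
 have "bb a f ((c + 1) * J * s) \<and> hb a f ((c + 1) * J * s)" if "ball_supp R s f" for f s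
 proof -
  have f: "\<And>k. f k \<noteq> 0 ==> nf k \<le> R" and s: "\<And>k. cmod (f k) \<le> s" using that by (auto simp: ball_supp_def)
  have sm: "(\<lambda>k. jap k powr a * cmod (f k)) summable_on UNIV" by (rule fs_summable[OF fs_freq[OF f]])
  have "(INFSUM k. jap k powr a * cmod (f k)) = (INFSUM k:?A. jap k powr a * cmod (f k))"
   by (rule infsum_cong_neutral) (use f in auto)
  also have "\<dots> = (\<Sum>k\<in>?A. jap k powr a * cmod (f k))" using finite_freq_ball by (rule infsum_finite)
  also have "\<dots> \<le> (\<Sum>k\<in>?A. jap k powr a * s)" using s by (intro sum_mono mult_left_mono) auto
  finally have le: "(INFSUM k. jap k powr a * cmod (f k)) \<le> J * s" by (simp add: J_def sum_distrib_right)
  have "0 \<le> s" using s norm_ge_zero order_trans by blast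
  then have "0 \<le> J * s" "0 \<le> c * (J * s)" "(c + 1) * J * s = c * (J * s) + J * s" using J by (auto simp: algebra_simps)
  then show ?thesis
   using bb_mono[OF bb_of_summable[OF sm, folded c_def]] hb_mono[OF hb_of_summable[OF sm]] le mult_left_mono[OF le J(2)] by simp
 qed
 then show ?thesis by blast
qed

definition mXi :: "(real \<times> real => real) => tdist => real => tdist" where
 "mXi m xi eps = reso (mollify m eps xi) (inv_one_minus_lap (mollify m eps xi)) - const_fun (of_real (renorm_const m eps))"

text \<open>The convergence of the enhanced noise says nothing about large \<open>eps\<close>, yet
  one threshold for K has to serve every positive \<open>eps\<close>. For \<open>eps\<close> bounded
  below all frequencies lie in one fixed ball, and crude counting suffices.\<close>

lemma mollified_bounds: assumes m: "mollifier m" and e0: "0 < eps0"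
 shows "\<exists>D. \<forall>eps\<ge>eps0. bb a (mollify m eps xi) D \<and> bb a' (mXi m xi eps) D"
proof -
 from m obtain b0 where b0: "\<And>x. m x \<noteq> 0 ==> norm x \<le> b0" unfolding mollifier_def by blast
 define b where "b = max b0 0"
 have b: "\<And>x. m x \<noteq> 0 ==> norm x \<le> b" "0 \<le> b" using b0 by (auto simp: b_def le_max_iff_disj simp del: split_paired_All)
 from mollifier_bounded[OF m] obtain Mm where Mm: "0 \<le> Mm" "\<And>x. \<bar>m x\<bar> \<le> Mm" by blast
 define R where "R = b / eps0"
 have R: "0 \<le> R" using b e0 by (simp add: R_def)
 let ?A = "{k. nf k \<le> R}"
 define s where "s = Mm * (\<Sum>k\<in>?A. cmod (xi k))"
 have s0: "0 \<le> s" unfolding s_def by (intro mult_nonneg_nonneg sum_nonneg Mm(1) norm_ge_zero)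
 have supp0: "nf k \<le> R" if "eps0 \<le> eps" "m (eps *\<^sub>R freq k) \<noteq> 0" for eps k
 proof -
  have "eps0 * nf k \<le> eps * nf k" using that by (intro mult_right_mono) auto
  also have "\<dots> \<le> b" using b(1)[OF that(2)] that e0 by simp
  finally show ?thesis using e0 by (simp add: R_def pos_le_divide_eq mult.commute)
 qed
 have supp: "nf k \<le> R" if "eps0 \<le> eps" "mollify m eps xi k \<noteq> 0" for eps k
  by (rule supp0[OF that(1)]) (use that(2) in \<open>auto simp: mollify_def\<close>)
 have coef: "cmod (mollify m eps xi k) \<le> s" if "eps0 \<le> eps" for eps k
 proof (cases "mollify m eps xi k = 0")
  case False
  have "cmod (xi k) \<le> (\<Sum>k\<in>?A. cmod (xi k))" using supp[OF that False] by (intro member_le_sum finite_freq_ball) auto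
  then show ?thesis unfolding mollify_def s_def norm_mult norm_of_real using Mm by (intro mult_mono) auto
 qed (use s0 in simp)
 have supp: "ball_supp R s (mollify m eps xi)" if "eps0 \<le> eps" for eps
  using supp[OF that] coef[OF that] by (simp add: ball_supp_def)
 let ?I = "\<lambda>eps. inv_one_minus_lap (mollify m eps xi)"
 have Isupp: "ball_supp R s (?I eps)" if "eps0 \<le> eps" for eps unfolding ball_supp_def
 proof (intro conjI allI impI)
  fix k
  show "nf k \<le> R" if "?I eps k \<noteq> 0"
   using supp[OF \<open>eps0 \<le> eps\<close>] that by (auto simp: ball_supp_def inv_lap_apply)
  have "1 \<le> (jap k)^2" using jap_ge_1[of k] by (simp add: one_le_power)
  then have "cmod (?I eps k) \<le> cmod (mollify m eps xi k) / 1"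
   unfolding inv_lap_apply norm_divide norm_of_real by (intro divide_left_mono) auto
  then show "cmod (?I eps k) \<le> s" using coef[OF that, of k] by simp
 qed
 have cst: "\<bar>renorm_const m eps\<bar> \<le> real (card ?A) * Mm^2" if "eps0 \<le> eps" for eps
 proof -
  let ?t = "\<lambda>k. \<bar>m (eps *\<^sub>R freq k)\<bar>\<^sup>2 / (1 + 4 * pi^2 * (nf k)^2)"
  have "renorm_const m eps = (INFSUM k:?A. ?t k)"
   unfolding renorm_const_def by (rule infsum_cong_neutral) (use supp0[OF that] in auto)
  also have "\<dots> = (\<Sum>k\<in>?A. ?t k)" using finite_freq_ball by (rule infsum_finite)
  finally have e: "renorm_const m eps = (\<Sum>k\<in>?A. ?t k)" .
  have t: "0 \<le> ?t k" "?t k \<le> Mm^2" for k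
  proof -
   show "0 \<le> ?t k" by (intro divide_nonneg_nonneg add_nonneg_nonneg) auto
   have "?t k \<le> \<bar>m (eps *\<^sub>R freq k)\<bar>\<^sup>2 / 1" by (intro divide_left_mono) (auto intro: add_pos_nonneg)
   also have "\<dots> \<le> Mm^2" using Mm(2) by (simp only: div_by_1) (intro power_mono, auto)
   finally show "?t k \<le> Mm^2" .
  qed
  have "\<bar>renorm_const m eps\<bar> = (\<Sum>k\<in>?A. ?t k)" unfolding e using t(1) by (intro abs_of_nonneg sum_nonneg)
  also have "\<dots> \<le> (\<Sum>k\<in>?A. Mm^2)" by (intro sum_mono t)
  finally show ?thesis by simp
 qed
 from ball_bounds[of R a] obtain K1 where K1: "\<And>f s. ball_supp R s f ==> bb a f (K1 * s) \<and> hb a f (K1 * s)" by blast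
 from ball_bounds[of R 1] obtain K2 where K2: "\<And>f s. ball_supp R s f ==> bb 1 f (K2 * s) \<and> hb 1 f (K2 * s)" by blast
 from ball_bounds[of "R + R" a'] obtain K3 where K3: "\<And>f s. ball_supp (R + R) s f ==> bb a' f (K3 * s) \<and> hb a' f (K3 * s)" by blast
 have "bil reso 1 1 0" by (rule bil_resonant) auto
 from bil_bound[OF this] obtain B where B: "\<And>u g C D. hb 1 u C ==> bb 1 g D ==> hb 0 (reso u g) (B * C * D)" by blast
 define s' where "s' = B * (K2 * s) * (K2 * s) + real (card ?A) * Mm^2"
 have "bb a (mollify m eps xi) (K1 * s) \<and> bb a' (mXi m xi eps) (K3 * s')" if e: "eps0 \<le> eps" for eps
 proof
  show "bb a (mollify m eps xi) (K1 * s)" using K1 supp[OF e] by blast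
  have h: "hb 1 (mollify m eps xi) (K2 * s)" using K2 supp[OF e] by blast
  have i: "bb 1 (?I eps) (K2 * s)" using K2 Isupp[OF e] by blast
  let ?r = "reso (mollify m eps xi) (?I eps)" and ?c = "const_fun (of_real (renorm_const m eps))"
  have "ball_supp (R + R) s' (mXi m xi eps)" unfolding ball_supp_def
  proof (intro conjI allI impI)
   fix k
   have "cmod (mXi m xi eps k) \<le> cmod (?r k) + cmod (?c k)" unfolding mXi_def fun_diff_def by (rule norm_triangle_ineq4)
   moreover have "cmod (?c k) \<le> \<bar>renorm_const m eps\<bar>" by (simp add: const_fun_def)
   ultimately show "cmod (mXi m xi eps k) \<le> s'" using hb0_coeff[OF B[OF h i], of k] cst[OF e] by (simp add: s'_def)
   assume "mXi m xi eps k \<noteq> 0"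
   then have "?r k \<noteq> 0 \<or> k = 0" by (auto simp: mXi_def const_fun_def split: if_splits)
   then show "nf k \<le> R + R"
    using resonant_supp[of "mollify m eps xi" R "?I eps" R k] supp[OF e] Isupp[OF e] R by (auto simp: ball_supp_def)
  qed
  then show "bb a' (mXi m xi eps) (K3 * s')" using K3 by blast
 qed
 then have "\<forall>eps\<ge>eps0. bb a (mollify m eps xi) (max (K1 * s) (K3 * s')) \<and> bb a' (mXi m xi eps) (max (K1 * s) (K3 * s'))"
  by (meson bb_mono max.cobounded1 max.cobounded2)
 then show ?thesis by blast
qed

lemma besov_small:
 assumes "((\<lambda>eps. besov_norm chi rho a (f eps)) \<longlongrightarrow> 0) F" "a \<le> 0" "0 < e"
 shows "\<forall>\<^sub>F eps in F. bb a (f eps) e"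
proof -
 have "\<forall>\<^sub>F eps in F. besov_norm chi rho a (f eps) < ennreal e"
  using assms(3) by (intro order_tendstoD(2)[OF assms(1)]) simp
 then show ?thesis
 proof eventually_elim
  case (elim eps)
  then have "bb a (f eps) (2 powr a * e)" using assms(3) by (intro besov_normD) auto
  moreover have "2 powr a \<le> 2 powr 0" using assms(2) by (intro powr_mono) auto
  then have "2 powr a * e \<le> 1 * e" using assms(3) by (intro mult_right_mono) auto
  ultimately show ?case by (auto elim: bb_mono)
 qed
qed

lemma fs_mollify: assumes "mollifier m" "0 < eps" shows "fs (mollify m eps xi)"
proof -
 from assms(1) obtain b where b: "\<And>x. m x \<noteq> 0 ==> norm x \<le> b" unfolding mollifier_def by blast
 show ?thesis by (rule fs_freq[OF mollify_supp[OF b assms(2)]])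
qed

lemma fs_mXi: assumes "mollifier m" "0 < eps" shows "fs (mXi m xi eps)"
 unfolding mXi_def fun_diff_def
 by (intro fs_diff fs_resonant fs_const_fun inv_lap_fs fs_mollify assms)

lemma enhanced_small: assumes "enhanced_noise chi rho m xi Xi2" "a < -1" "0 < e"
 shows "\<forall>\<^sub>F eps in at_right 0. bb a (mollify m eps xi - xi) e \<and> bb (2 * a + 2) (mXi m xi eps - Xi2) e"
 using assms unfolding enhanced_noise_def mXi_def by (intro eventually_conj besov_small) auto

lemma enhanced_small_ex: assumes "enhanced_noise chi rho m xi Xi2" "a < -1" "0 < e"
 shows "\<exists>eps>0. bb a (mollify m eps xi - xi) e \<and> bb (2 * a + 2) (mXi m xi eps - Xi2) e"
proof -
 have "\<forall>\<^sub>F eps in at_right (0::real). 0 < eps \<and> bb a (mollify m eps xi - xi) e \<and> bb (2 * a + 2) (mXi m xi eps - Xi2) e"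
  by (intro eventually_conj eventually_at_right_less enhanced_small[OF assms])
 then show ?thesis using eventually_happens' trivial_limit_at_right_real by (metis (no_types, lifting))
qed

lemma enhanced_bb: assumes "mollifier m" "enhanced_noise chi rho m xi Xi2" "a < -1"
 shows "\<exists>D. bb a xi D" "\<exists>D. bb (2 * a + 2) Xi2 D"
proof -
 from enhanced_small_ex[OF assms(2,3), of 1] obtain eps where e: "0 < eps" "bb a (mollify m eps xi - xi) 1" "bb (2 * a + 2) (mXi m xi eps - Xi2) 1" by auto
 from bb_fs'[OF fs_mollify[OF assms(1) e(1)]] obtain D where "bb a (mollify m eps xi) D" by blast
 from bb_diff[OF this e(2)] show "\<exists>D. bb a xi D" by auto
 from bb_fs'[OF fs_mXi[OF assms(1) e(1)]] obtain D' where "bb (2 * a + 2) (mXi m xi eps) D'" by blast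
 from bb_diff[OF this e(3)] show "\<exists>D. bb (2 * a + 2) Xi2 D" by auto
qed

text \<open>Small \<open>eps\<close> are covered by convergence to the limit, the others by
  \<open>mollified_bounds\<close>. A common \<open>D\<close> for the limit and for all
  mollifications is what makes a single contraction threshold possible.\<close>

lemma enhanced_uniform: assumes m: "mollifier m" and E: "enhanced_noise chi rho m xi Xi2"
 obtains D where "1 \<le> D" "bb (-33/32) xi D" "bb (-1/16) Xi2 D"
  "\<And>eps. 0 < eps ==> bb (-33/32) (mollify m eps xi) D \<and> bb (-1/16) (mXi m xi eps) D"
proof -
 have a: "-33/32 < (-1::real)" by simp
 have e: "2 * (-33/32) + 2 = (-1/16 :: real)" by simp
 from enhanced_bb[OF m E a, unfolded e] obtain D1 D2 where D12: "bb (-33/32) xi D1" "bb (-1/16) Xi2 D2" by blast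
 from enhanced_small[OF E a zero_less_one, unfolded e] obtain eps0 where e0: "0 < eps0"
  "\<And>eps. 0 < eps ==> eps < eps0 ==> bb (-33/32) (mollify m eps xi - xi) 1 \<and> bb (-1/16) (mXi m xi eps - Xi2) 1"
  unfolding eventually_at_right_field by auto
 from mollified_bounds[OF m e0(1), of "-33/32" xi "-1/16"] obtain D3 where
  D3: "\<And>eps. eps0 \<le> eps ==> bb (-33/32) (mollify m eps xi) D3 \<and> bb (-1/16) (mXi m xi eps) D3" by blast
 let ?D = "max (max (D1 + 1) (D2 + 1)) (max D3 1)"
 show thesis
 proof (rule that[of ?D])
  show "bb (-33/32) xi ?D" "bb (-1/16) Xi2 ?D" by (rule bb_mono[OF D12(1)] bb_mono[OF D12(2)]; simp)+
  fix eps :: real assume e: "0 < eps"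
  show "bb (-33/32) (mollify m eps xi) ?D \<and> bb (-1/16) (mXi m xi eps) ?D"
  proof (cases "eps < eps0")
   case True
   from e0(2)[OF e True] have "bb (-33/32) (mollify m eps xi - xi + xi) (1 + D1)" "bb (-1/16) (mXi m xi eps - Xi2 + Xi2) (1 + D2)"
    using bb_add D12 by blast+
   then show ?thesis by (auto elim!: bb_mono)
  next
   case False
   then show ?thesis using D3[of eps] by (auto elim!: bb_mono)
  qed
 qed simp
qed

end

section \<open>Convergence of the inverses\<close>

context lp begin

lemma approx_resolvent:
 assumes m: "mollifier m" and r: "\<And>k. xi (- k) = cnj (xi k)" and e: "0 < eps"
  and A: "ansatz (N1 (mollify m eps xi) (mXi m xi eps)) (N2 (mollify m eps xi) (mXi m xi eps)) (N3 (mollify m eps xi)) (N4 (mollify m eps xi)) M"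
  and K: "(6 * M) ^ 16 \<le> K"
 defines "T \<equiv> shift_op (anderson_approx m xi eps) (cor K)"
 shows "resolvent_pair (fst T) (snd T) (ansatz.Sol (N1 (mollify m eps xi) (mXi m xi eps)) (N3 (mollify m eps xi)) (N4 (mollify m eps xi)) K)"
proof -
 let ?xi = "mollify m eps xi" and ?Xi = "mXi m xi eps" and ?c = "renorm_const m eps"
 interpret ansatz "N1 ?xi ?Xi" "N2 ?xi ?Xi" "N3 ?xi" "N4 ?xi" M by (rule A)
 have fsx: "fs ?xi" by (rule fs_mollify[OF m e])
 have real: "?xi (- k) = cnj (?xi k)" for k
  by (rule mollify_real) (use m r in \<open>simp_all add: mollifier_def\<close>)
 note eq = approx_eq[OF fsx mXi_def A]
 have L: "u \<in> L2" "laplacian u \<in> L2" "tprod ?xi u \<in> L2" if "u \<in> Dom" for u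
  using Dom_L2(1)[OF that] laplacian_L2[of u] that tprod_L2[OF fsx] by (auto simp: eq(1))
 have O: "Opr u = laplacian u + tprod ?xi u - scale (cor ?c) u" if "u \<in> Dom" for u
  using eq(2)[of u] that by (simp add: eq(1))
 let ?s = "\<Sum>l | ?xi l \<noteq> 0. cmod (?xi l)"
 have "resolvent_pair Dom (snd T) (Sol K)"
 proof (rule resolvent_pair_sym[OF _ _ K])
  fix u v assume u: "u \<in> Dom" and v: "v \<in> Dom"
  show "L2_inner (Opr u) v = L2_inner u (Opr v)"
   unfolding O[OF u] O[OF v] using L[OF u] L[OF v] tprod_sym[OF fsx real L(1)[OF u] L(1)[OF v]]
   by (simp add: L2_inner_add_left L2_inner_add_right L2_inner_diff_left L2_inner_diff_right L2_inner_scale_left L2_inner_scale_right laplacian_sym)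
 next
  fix u assume u: "u \<in> Dom"
  have "Re (L2_inner (Opr u) u) = Re (L2_inner (laplacian u) u) + Re (L2_inner (tprod ?xi u) u) - ?c * (L2_norm u)^2"
   unfolding O[OF u] using L[OF u] by (simp add: L2_inner_add_left L2_inner_diff_left L2_inner_scale_left L2_inner_self del: of_real_power)
  moreover have "Re (L2_inner (laplacian u) u) \<le> 0" using laplacian_nonpos u by (simp add: eq(1))
  moreover have "Re (L2_inner (tprod ?xi u) u) \<le> ?s * (L2_norm u)^2"
   using complex_Re_le_cmod order_trans tprod_form_bound[OF fsx L(1)[OF u]] by blast
  moreover have "- ?c * (L2_norm u)^2 \<le> \<bar>?c\<bar> * (L2_norm u)^2" by (intro mult_right_mono) auto
  \<comment> \<open>This bound may blow up as \<open>eps\<close> tends to 0; it only provides a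
    starting point for the descent in \<open>coercive\<close>.\<close>
  ultimately show "Re (L2_inner (Opr u) u) \<le> (?s + \<bar>?c\<bar>) * (L2_norm u)^2" by (simp add: distrib_right)
 next
  fix u assume u: "u \<in> Dom"
  show "snd T u = Opr u - scale (cor K) u"
   unfolding O[OF u] by (simp add: T_def shift_op_def anderson_approx_def)
 qed
 moreover have "fst T = Dom" by (simp add: T_def shift_op_def anderson_approx_def eq(1))
 ultimately show ?thesis by simp
qed

lemma resolvent_pair_conclusions: assumes "resolvent_pair (fst T) (snd T) S"
 shows "neg_coercive T" "self_adjoint T" "boundedly_invertible T" "f \<in> L2 ==> op_inverse T f = S (- f)"
 using resolvent_pair.neg_coercive[OF assms] resolvent_pair.self_adjoint[OF assms] resolvent_pair.boundedly_invertible[OF assms]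
  resolvent_pair.op_inverse_eq[OF assms] by simp_all

lemma anderson_convergence:
 assumes m: "mollifier m" and r: "\<And>k. xi (- k) = cnj (xi k)" and E: "enhanced_noise chi rho m xi Xi2"
 shows "\<exists>K0>0. \<forall>K\<ge>K0. \<forall>\<alpha> ga :: real. -4/3 < \<alpha> --> \<alpha> < -1 --> 2/3 < ga --> ga \<le> \<alpha> + 2 -->
  (let H = shift_op (anderson chi rho xi Xi2 ga) (cor K);
     Heps = (\<lambda>eps. shift_op (anderson_approx m xi eps) (cor K))
   in neg_coercive H \<and> self_adjoint H \<and> boundedly_invertible H \<and>
    (\<forall>eps>0. neg_coercive (Heps eps) \<and> self_adjoint (Heps eps) \<and> boundedly_invertible (Heps eps)) \<and>
    ((\<lambda>eps. op_norm ga (\<lambda>f. op_inverse H f - op_inverse (Heps eps) f)) \<longlongrightarrow> 0) (at_right 0) \<and>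
    norm_resolvent_tendsto Heps H (at_right 0))"
proof -
 from enhanced_uniform[OF m E] obtain D where D: "1 \<le> D" "bb (-33/32) xi D" "bb (-1/16) Xi2 D"
  "\<And>eps. 0 < eps ==> bb (-33/32) (mollify m eps xi) D \<and> bb (-1/16) (mXi m xi eps) D" by blast
 from noise_ansatz obtain B where B: "1 \<le> B"
  "\<And>xi Xi D. bb (-33/32) xi D ==> bb (-1/16) Xi D ==> 1 \<le> D ==> ansatz (N1 xi Xi) (N2 xi Xi) (N3 xi) (N4 xi) (B * D^2)"
  "\<And>xi Xi xi' Xi' D eta u C. bb (-33/32) xi D ==> bb (-1/16) Xi D ==> bb (-33/32) xi' D ==> bb (-1/16) Xi' D ==> 1 \<le> D ==>
    bb (-33/32) (xi' - xi) eta ==> bb (-1/16) (Xi' - Xi) eta ==>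
    (hb (3/4) u C --> hb (-17/16) (N1 xi' Xi' u - N1 xi Xi u) (B * D * eta * C) \<and>
     hb (-5/16) (N2 xi' Xi' u - N2 xi Xi u) (B * D * eta * C) \<and> hb (15/16) (N3 xi' u - N3 xi u) (B * D * eta * C)) \<and>
    (hb (17/16) u C --> hb 0 (N4 xi' u - N4 xi u) (B * D * eta * C))" by metis
 define M where "M = B * D^2"
 have BD: "0 \<le> B * D" using B(1) D(1) by simp
 define xie where "xie eps = mollify m eps xi" for eps
 define Xie where "Xie eps = mXi m xi eps" for eps
 have A: "ansatz (N1 xi Xi2) (N2 xi Xi2) (N3 xi) (N4 xi) M" unfolding M_def by (rule B(2)[OF D(2,3,1)])
 have Ae: "ansatz (N1 (xie eps) (Xie eps)) (N2 (xie eps) (Xie eps)) (N3 (xie eps)) (N4 (xie eps)) M" if "0 < eps" for eps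
  unfolding M_def xie_def Xie_def using D(4)[OF that] D(1) by (intro B(2)) auto
 interpret A: ansatz "N1 xi Xi2" "N2 xi Xi2" "N3 xi" "N4 xi" M by (rule A)
 have M1: "1 \<le> M" by (rule A.M)
 show ?thesis
 \<comment> \<open>The contraction threshold: it involves the noise through \<open>D\<close> only,
   the same for all \<open>eps\<close>, and neither \<alpha> nor \<gamma>.\<close>
 proof (intro exI[of _ "(6 * M) ^ 16"] conjI allI impI, goal_cases)
  case 1
  show ?case using M1 by simp
 next
  case (2 K \<alpha> ga)
  then have K: "(6 * M) ^ 16 \<le> K" and \<alpha>: "-4/3 < \<alpha>" "\<alpha> < -1" and ga: "2/3 < ga" "ga \<le> \<alpha> + 2" by auto
  have ga1: "ga < 1" using \<alpha> ga by simp
  define H where "H = shift_op (anderson chi rho xi Xi2 ga) (cor K)"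
  define Heps where "Heps eps = shift_op (anderson_approx m xi eps) (cor K)" for eps
  define S where "S = A.Sol K"
  define Seps where "Seps eps = ansatz.Sol (N1 (xie eps) (Xie eps)) (N3 (xie eps)) (N4 (xie eps)) K" for eps
  have Re: "resolvent_pair (fst (Heps eps)) (snd (Heps eps)) (Seps eps)" if "0 < eps" for eps
   unfolding Heps_def Seps_def xie_def Xie_def by (rule approx_resolvent[OF m r that Ae[OF that, unfolded xie_def Xie_def] K])
  have cmp: "pbl K (Seps eps f - S f, (Seps eps f - N3 (xie eps) (Seps eps f)) - (S f - N3 xi (S f))) (12 * (B * D * eta) * L2_norm f)"
   if e: "0 < eps" and d: "bb (-33/32) (xie eps - xi) eta" "bb (-1/16) (Xie eps - Xi2) eta" and f: "f \<in> L2" for eps eta f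
  proof -
   have b: "bb (-33/32) (xie eps) D" "bb (-1/16) (Xie eps) D" using D(4)[OF e] by (auto simp: xie_def Xie_def)
   note diff = B(3)[OF D(2,3) b D(1) d]
   show ?thesis unfolding S_def Seps_def
   proof (rule ansatz_compare[OF A Ae[OF e] K L2_norm_hb[OF f] A.Sol[OF K f] ansatz.Sol[OF Ae[OF e] K f]])
    show "0 \<le> B * D * eta" using BD bb_nonneg[OF d(1)] by simp
   qed (use diff in blast)+
  qed
  have diffL2: "L2_norm (Seps eps f - S f) \<le> 12 * (B * D * eta) * L2_norm f"
   if e: "0 < eps" and d: "bb (-33/32) (xie eps - xi) eta" "bb (-1/16) (Xie eps - Xi2) eta" and f: "f \<in> L2" for eps eta f
  proof -
   have "hb (3/4) (Seps eps f - S f) (12 * (B * D * eta) * L2_norm f)" using cmp[OF that] by (simp add: pb_def)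
   then show ?thesis by (intro L2_norm_le, elim hb_weaken) simp
  qed
  have small: "\<forall>\<^sub>F eps in at_right 0. 0 < eps \<and> bb a (xie eps - xi) e \<and> bb (2 * a + 2) (Xie eps - Xi2) e" if "a < -1" "0 < e" for a e
   unfolding xie_def Xie_def by (intro eventually_conj eventually_at_right_less enhanced_small[OF E that])
  have small0: "\<forall>\<^sub>F eps in at_right 0. 0 < eps \<and> bb (-33/32) (xie eps - xi) e \<and> bb (-1/16) (Xie eps - Xi2) e" if "0 < e" for e
   using small[of "-33/32" e] that by simp
  define c where "c = 12 * (B * D) + 1"
  have c: "1 \<le> c" using BD by (simp add: c_def)
  have diffe: "\<forall>\<^sub>F eps in at_right 0. 0 < eps \<and> (\<forall>f\<in>L2. L2_norm (Seps eps f - S f) \<le> e * L2_norm f)" if e: "0 < e" for e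
  proof -
   have "0 < e / c" using e c by simp
   from small0[OF this] show ?thesis
   proof eventually_elim
    case (elim eps)
    have "12 * (B * D * (e / c)) = e * ((12 * (B * D)) / c)" by simp
    also have "\<dots> \<le> e * 1" using e c by (intro mult_left_mono) (auto simp: c_def)
    finally have le: "12 * (B * D * (e / c)) \<le> e" by simp
    show ?case
    proof (intro conjI ballI)
     fix f assume f: "f \<in> L2"
     have "L2_norm (Seps eps f - S f) \<le> 12 * (B * D * (e / c)) * L2_norm f" using elim f by (intro diffL2) auto
     also have "\<dots> \<le> e * L2_norm f" by (intro mult_right_mono le L2_norm_nonneg)
     finally show "L2_norm (Seps eps f - S f) \<le> e * L2_norm f" .
    qed (use elim in simp)
   qed
  qed
  have dom: "fst H = A.Dom"
   unfolding H_def shift_op_def anderson_def fst_conv by (rule anderson_eq(1)[OF enhanced_bb(1)[OF m E] D(3) ga(1) ga1 A])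
  have act: "snd H u = A.Opr u - scale (cor K) u" if "u \<in> A.Dom" for u
   using anderson_eq(2)[OF enhanced_bb(1)[OF m E] D(3) ga(1) ga1 A that] by (simp add: H_def shift_op_def)
  have R: "resolvent_pair (fst H) (snd H) S" unfolding dom S_def
  proof (rule A.resolvent_pair_limit[OF K act])
   fix e :: real assume "0 < e"
   from eventually_happens'[OF trivial_limit_at_right_real diffe[OF this]] obtain eps where
    "0 < eps" "\<forall>f\<in>L2. L2_norm (Seps eps f - S f) \<le> e * L2_norm f" by blast
   then show "\<exists>D' h' S'. resolvent_pair D' h' S' \<and> (\<forall>f\<in>L2. L2_norm (S' f - A.Sol K f) \<le> e * L2_norm f)"
    using Re unfolding S_def by blast
  qed
  have conv: "((\<lambda>eps. op_norm ga (\<lambda>f. op_inverse H f - op_inverse (Heps eps) f)) \<longlongrightarrow> 0) (at_right 0)"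
  proof (rule op_norm_tendsto_zero')
   fix e :: real assume e: "0 < e"
   \<comment> \<open>The midpoint of \<open>ga - 2\<close> and \<open>-1\<close>: the mollified
     noise still converges at this exponent, and u \<prec> X depends on it continuously in
     H^\<gamma>.\<close>
   define a where "a = (ga - 3) / 2"
   have a: "a < -1" "ga < a + 2" using ga1 by (auto simp: a_def field_simps)
   from enhanced_bb(1)[OF m E a(1)] obtain Da where Da: "bb a xi Da" by blast
   have "bil F3 (3/4) a ga" using a by (intro bil_F3) auto
   from this bil_bound[OF this] obtain Ba where F3: "bil F3 (3/4) a ga" and Ba: "0 \<le> Ba"
    "\<And>u g C D. hb (3/4) u C ==> bb a g D ==> hb ga (F3 u g) (Ba * C * D)" by blast
   \<comment> \<open>Collects the coefficients of \<open>eta\<close> in the estimate below: the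
     change of u inside the paraproduct, the change of the noise, and the change of the second
     component.\<close>
   define k where "k = Ba * (12 * (B * D)) * (Da + 1) + Ba + K powr (1/8) * (12 * (B * D))"
   have k: "0 \<le> k" using Ba(1) BD bb_nonneg[OF Da] by (simp add: k_def)
   define eta where "eta = min 1 (e / (k + 1))"
   have eta: "0 < eta" "eta \<le> 1" "k * eta \<le> e"
   proof -
    have "k * eta \<le> k * (e / (k + 1))" using k by (intro mult_left_mono) (auto simp: eta_def)
    also have "\<dots> \<le> e" using k e by (simp add: field_simps)
    finally show "k * eta \<le> e" .
   qed (use e k in \<open>auto simp: eta_def\<close>)
   have "\<forall>\<^sub>F eps in at_right 0. (0 < eps \<and> bb (-33/32) (xie eps - xi) eta \<and> bb (-1/16) (Xie eps - Xi2) eta) \<and> (0 < eps \<and> bb a (xie eps - xi) eta \<and> bb (2 * a + 2) (Xie eps - Xi2) eta)"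
    by (rule eventually_conj[OF small0[OF eta(1)] small[OF a(1) eta(1)]])
   then show "\<forall>\<^sub>F eps in at_right 0. \<forall>f\<in>L2. L2_norm f \<le> 1 --> hb ga (op_inverse H f - op_inverse (Heps eps) f) e"
   proof eventually_elim
    case (elim eps)
    then have ep: "0 < eps" and d: "bb (-33/32) (xie eps - xi) eta" "bb (-1/16) (Xie eps - Xi2) eta" "bb a (xie eps - xi) eta" by auto
    show ?case
    proof (intro ballI impI)
     fix f assume f: "f \<in> L2" "L2_norm f \<le> 1"
     define g where "g = - f"
     have g: "g \<in> L2" "L2_norm g \<le> 1" using f L2_norm_uminus[of f] by (auto simp: g_def)
     define u u' where "u = S g" and "u' = Seps eps g"
     let ?c = "12 * (B * D * eta)"
     have c0: "0 \<le> ?c" using BD eta(1) by simp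
     have "pbl K (u' - u, (u' - N3 (xie eps) u') - (u - N3 xi u)) ?c" unfolding u_def u'_def
      by (rule pb_mono[OF cmp[OF ep d(1,2) g(1)]]) (use mult_left_mono[OF g(2) c0] in simp_all)
     then have 1: "hb (3/4) (u' - u) ?c" and 2: "hb (17/16) ((u' - N3 (xie eps) u') - (u - N3 xi u)) (K powr (1/8) * ?c)"
      by (auto simp: pb_def)
     have uD: "u \<in> A.Dom" "scale (cor K) u - A.Opr u = g" unfolding u_def S_def by (rule A.Sol[OF K g(1)])+
     have u1: "hb (3/4) u 1" using A.Dom_norm_le[OF K uD(1)] g(2) unfolding uD(2) by (rule hb_mono)
     have xb: "bb a (xie eps) (Da + 1)" using bb_add[OF Da d(3)] eta(2) by (auto elim!: bb_mono)
     have u'1: "hb (3/4) u' (1 + ?c)" using hb_add'[OF u1 1] by simp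
     have l: "F3 u' (xie eps) = F3 (u' - u) (xie eps) + F3 u (xie eps)" using bil_left[OF F3 1 u1 xb, of 1] by simp
     have r: "F3 u (xie eps - xi) = F3 u (xie eps) - F3 u xi" by (rule bil_diff_right[OF F3 u1 Da xb])
     \<comment> \<open>The first component of the pair controls the difference in H^(3/4) only, and
       \<gamma> may be larger. The decomposition u = u \<prec> X + v is used instead: the
       paraproduct needs no more than H^(3/4) of its first factor, and the second component is
       bounded in H^(17/16).\<close>
     have "u' - u = F3 (u' - u) (xie eps) + F3 u (xie eps - xi) + ((u' - N3 (xie eps) u') - (u - N3 xi u))"
      unfolding N3_def r l by (simp add: algebra_simps)
     moreover have "hb ga (F3 (u' - u) (xie eps) + F3 u (xie eps - xi) + ((u' - N3 (xie eps) u') - (u - N3 xi u)))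
       (Ba * ?c * (Da + 1) + Ba * 1 * eta + K powr (1/8) * ?c)"
      by (intro hb_add' Ba(2) 1 u1 xb d(3) hb_weaken[OF 2]) (use ga1 in simp)
     moreover have "Ba * ?c * (Da + 1) + Ba * 1 * eta + K powr (1/8) * ?c = k * eta" by (simp add: k_def algebra_simps)
     ultimately have "hb ga (u' - u) (k * eta)" by (simp only:)
     then have "hb ga (\<lambda>k. - (u' - u) k) e" using hb_mono[OF hb_minus eta(3)] by blast
     moreover have "(\<lambda>k. - (u' - u) k) = u - u'" by (simp add: fun_eq_iff)
     ultimately show "hb ga (op_inverse H f - op_inverse (Heps eps) f) e"
      using resolvent_pair_conclusions(4)[OF R f(1)] resolvent_pair_conclusions(4)[OF Re[OF ep] f(1)]
      by (simp add: u_def u'_def g_def)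
    qed
   qed
  qed
  have res: "norm_resolvent_tendsto Heps H (at_right 0)" unfolding norm_resolvent_tendsto_def
  proof (intro conjI allI impI)
   show "self_adjoint H" by (rule resolvent_pair_conclusions(2)[OF R])
   show "\<forall>\<^sub>F eps in at_right 0. self_adjoint (Heps eps)"
    using eventually_at_right_less[of 0] by eventually_elim (rule resolvent_pair_conclusions(2)[OF Re])
   fix z assume z: "Im z \<noteq> 0"
   let ?q = "(cmod (1 / z) / \<bar>Im (1 / z)\<bar>) * (1 + cmod z / \<bar>Im z\<bar>)"
   have q: "0 \<le> ?q" by simp
   show "((\<lambda>eps. op_norm 0 (\<lambda>f. op_inverse (shift_op (Heps eps) z) f - op_inverse (shift_op H z) f)) \<longlongrightarrow> 0) (at_right 0)"
   proof (rule op_norm_tendsto_zero')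
    fix e :: real assume e: "0 < e"
    then have "0 < e / (?q + 1)" using q by (intro divide_pos_pos add_nonneg_pos) auto
    from diffe[OF this] show "\<forall>\<^sub>F eps in at_right 0. \<forall>f\<in>L2. L2_norm f \<le> 1 -->
      hb 0 (op_inverse (shift_op (Heps eps) z) f - op_inverse (shift_op H z) f) e"
    proof eventually_elim
     case (elim eps)
     then have ep: "0 < eps" and d: "\<And>f. f \<in> L2 ==> L2_norm (Seps eps f - S f) \<le> e / (?q + 1) * L2_norm f" by auto
     have eta: "0 \<le> e / (?q + 1)" using e q by simp
     show ?case
     proof (intro ballI impI)
      fix f assume f: "f \<in> L2" "L2_norm f \<le> 1"
      have bd: "hb 0 (op_inverse (shift_op (Heps eps) z) f - op_inverse (shift_op H z) f)
        ((cmod (1 / z) / \<bar>Im (1 / z)\<bar>) * (e / (?q + 1) * (1 + cmod z / \<bar>Im z\<bar>)))"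
       using resolvent_compare[OF R Re[OF ep] z eta d f] by simp
      have eq: "(cmod (1 / z) / \<bar>Im (1 / z)\<bar>) * (e / (?q + 1) * (1 + cmod z / \<bar>Im z\<bar>)) = ?q * (e / (?q + 1))" by simp
      have "x * (e / (x + 1)) \<le> e" if "0 \<le> x" for x :: real using that e by (simp add: field_simps)
      from this[OF q] have "?q * (e / (?q + 1)) \<le> e" .
      then show "hb 0 (op_inverse (shift_op (Heps eps) z) f - op_inverse (shift_op H z) f) e"
       by (rule hb_mono[OF bd[unfolded eq]])
     qed
    qed
   qed
  qed
  from resolvent_pair_conclusions(1-3)[OF R] resolvent_pair_conclusions(1-3)[OF Re] conv res show ?case
   unfolding H_def Heps_def[abs_def] Let_def by blast
 qed
qed

end

theorem theorem2p31:
  fixes chi \<rho> m :: "real \<times> real \<Rightarrow> real"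
    and M :: "'w measure" and \<xi> :: "'w \<Rightarrow> tdist" and w :: 'w and \<Xi>2 :: tdist
  assumes "littlewood_paley chi \<rho>"
    and "mollifier m"
    and "white_noise M \<xi>"
    and "w \<in> space M"
    and "enhanced_noise chi \<rho> m (\<xi> w) \<Xi>2"
  shows "\<exists>K0>0. \<forall>K\<ge>K0. \<forall>\<alpha> \<gamma> :: real. -4/3 < \<alpha> \<longrightarrow> \<alpha> < -1 \<longrightarrow> 2/3 < \<gamma> \<longrightarrow> \<gamma> \<le> \<alpha> + 2 \<longrightarrow>
    (let H = shift_op (anderson chi \<rho> (\<xi> w) \<Xi>2 \<gamma>) (complex_of_real K);
         H\<epsilon> = (\<lambda>\<epsilon>. shift_op (anderson_approx m (\<xi> w) \<epsilon>) (complex_of_real K))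
     in neg_coercive H \<and> self_adjoint H \<and> boundedly_invertible H \<and>
        (\<forall>\<epsilon>>0. neg_coercive (H\<epsilon> \<epsilon>) \<and> self_adjoint (H\<epsilon> \<epsilon>) \<and> boundedly_invertible (H\<epsilon> \<epsilon>)) \<and>
        ((\<lambda>\<epsilon>. op_norm \<gamma> (\<lambda>f. op_inverse H f - op_inverse (H\<epsilon> \<epsilon>) f)) \<longlongrightarrow> 0) (at_right 0) \<and>
        norm_resolvent_tendsto H\<epsilon> H (at_right 0))"
proof -
 from assms(1) obtain b where b: "\<And>x. chi x \<noteq> 0 \<Longrightarrow> norm x \<le> b" unfolding littlewood_paley_def by blast
 from assms(1) obtain a b' where ab: "0 < a" "\<And>x. \<rho> x \<noteq> 0 \<Longrightarrow> a \<le> norm x \<and> norm x \<le> b'" unfolding littlewood_paley_def by blast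
 \<comment> \<open>The radii are rescaled to the normalisation of the locale: halved for the
   annulus, and truncated at 1 from either side.\<close>
 interpret lp chi \<rho> "min 1 (a / 2)" "max 1 (max b (b' / 2))"
 proof
  show "norm x \<le> max 1 (max b (b' / 2))" if "chi x \<noteq> 0" for x using b[OF that] by simp
  show "2 * min 1 (a / 2) \<le> norm x \<and> norm x \<le> 2 * max 1 (max b (b' / 2))" if "\<rho> x \<noteq> 0" for x
  proof
   show "2 * min 1 (a / 2) \<le> norm x" using ab(2)[OF that] min.cobounded2[of 1 "a / 2"] by linarith
   have "b' / 2 \<le> max 1 (max b (b' / 2))" by simp
   then show "norm x \<le> 2 * max 1 (max b (b' / 2))" using ab(2)[OF that] by linarith
  qed
 qed (use assms(1) ab(1) in auto)
 \<comment> \<open>Reality of the noise makes multiplication by it symmetric.\<close>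
 have "\<xi> w (- k) = cnj (\<xi> w k)" for k using assms(3,4) unfolding white_noise_def by blast
 from anderson_convergence[OF assms(2) this assms(5)] show ?thesis .
qed

end
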